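(* Over $\mathsf{ACA}_0^\omega+\mathsf{QF\text{-}AC}^{0,1}+\mathsf{FIN}$, the principle $\mathsf{NIN}_{\mathsf{alt}}$ is equivalent to each of the following: (ii) For every regulated and Baire 2 function $f:[0,1]\to\mathbb{R}$ there is $x\in[0,1]$ where $f$ is continuous. (iii) For every regulated and Baire 1$^*$ function $f:[0,1]\to\mathbb{R}$ there is $x\in[0,1]$ where $f$ is continuous. (iv) For every regulated and upper semi-continuous (variant: lower semi-continuous) function $f:[0,1]\to\mathbb{R}$ there is $x\in[0,1]$ where $f$ is continuous.
   Context: Framework: Kohlenbach's higher-order Reverse Mathematics. $\mathsf{ACA}_0^\omega$ is the base theory $\mathsf{RCA}_0^\omega$ plus Kleene's $(\exists^2)$: $(\exists\varphi^2\le_21)(\forall f^1)[(\exists n)(f(n)=0)\leftrightarrow\varphi(f)=0]$. $\mathsf{QF\text{-}AC}^{0,1}$: for quantifier-free $A$, $(\forall n^0)(\exists f^1)A(n,f)\to(\exists g)(\forall n)A(n,g(n))$. Sets of reals are given by characteristic functions. $X\subset\mathbb{R}$ is finite if there is $N$ such that among any distinct reals $x_0,\dots,x_N$ some $x_i\notin X$. $\mathsf{FIN}$: (1) $\bigcup_{n\le k}X_n$ is finite for any sequence of finite sets $(X_n)$ and $k$; (2) every finite set of reals is contained in the range of a finite sequence of reals; (3) for $Y^2,k^0$ with $(\forall n\le k)(\exists f\in2^{\mathbb{N}})(Y(f,n)=0)$ there are $f_0,\dots,f_k$ with $Y(f_n,n)=0$ for $n\le k$. $A\subset\mathbb{R}$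 is height countable if some $H:\mathbb{R}\to\mathbb{N}$ makes every $\{x\in A:H(x)<n\}$ finite; $\mathsf{NIN}_{\mathsf{alt}}$: $[0,1]$ is not height countable. $f$ is regulated if all one-sided limits exist. A set $O$ is open if each $x\in O$ has some ball $B(x,2^{-k})\subset O$; closed if its complement is open. Baire 1: pointwise limit of a sequence of continuous functions; Baire 2: pointwise limit of a sequence of Baire 1 functions; Baire 1$^*$: there is a sequence of closed sets $(C_n)$ with $[0,1]=\bigcup_nC_n$ and $f_{\upharpoonright C_m}$ continuous for every $m$. Upper (lower) semi-continuous: at every $x_0$, $f(x_0)\ge\limsup_{x\to x_0}f(x)$ (resp. $f(x_0)\le\liminf_{x\to x_0}f(x)$). *)

theory Defs
  imports Main
begin

section \<open>The language of finite types\<close>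

text \<open>All principles below are true in ordinary mathematics, so "equivalent over a base theory" has
  content only as derivability in that theory. Hence the language of higher-order arithmetic, a
  calculus for classical logic, and the base theory are formalised as syntactic objects.\<close>

datatype ty = T0 | Fn ty ty  (infixr \<open>\<rightarrow>\<close> 80)

abbreviation T1 :: ty where "T1 \<equiv> T0 \<rightarrow> T0"
abbreviation T2 :: ty where "T2 \<equiv> T1 \<rightarrow> T0"

datatype cst = CZero | COne | CPlus | CTimes | CRec | CPi ty ty | CSigma ty ty ty

primrec cst_ty :: "cst \<Rightarrow> ty" where
  "cst_ty CZero = T0"
| "cst_ty COne = T0"
| "cst_ty CPlus = T0 \<rightarrow> T0 \<rightarrow> T0"
| "cst_ty CTimes = T0 \<rightarrow> T0 \<rightarrow> T0"
| "cst_ty CRec = (T0 \<rightarrow> T0 \<rightarrow> T0) \<rightarrow> T0 \<rightarrow> T0 \<rightarrow> T0"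
| "cst_ty (CPi \<rho> \<tau>) = \<rho> \<rightarrow> \<tau> \<rightarrow> \<rho>"
| "cst_ty (CSigma \<rho> \<sigma> \<tau>) = (\<rho> \<rightarrow> \<sigma> \<rightarrow> \<tau>) \<rightarrow> (\<rho> \<rightarrow> \<sigma>) \<rightarrow> \<rho> \<rightarrow> \<tau>"

text \<open>A variable is a name together with its type; \<open>Var 0 T0\<close> and \<open>Var 0 T1\<close> are different
  variables.\<close>

datatype tm = Var nat ty | Cst cst | App tm tm  (infixl \<open>\<cdot>\<close> 90)

primrec typed :: "tm \<Rightarrow> ty \<Rightarrow> bool" where
  "typed (Var i \<sigma>) \<tau> \<longleftrightarrow> \<sigma> = \<tau>"
| "typed (Cst c) \<tau> \<longleftrightarrow> cst_ty c = \<tau>"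
| "typed (t \<cdot> u) \<tau> \<longleftrightarrow> (\<exists>\<sigma>. typed t (\<sigma> \<rightarrow> \<tau>) \<and> typed u \<sigma>)"

text \<open>Equality is primitive only at type 0. The other connectives and the existential quantifier are
  the usual classical abbreviations.\<close>

datatype fm = FEq tm tm | FLess tm tm | FBot | FImp fm fm | FAll nat ty fm

primrec wf_fm :: "fm \<Rightarrow> bool" where
  "wf_fm (FEq t u) \<longleftrightarrow> typed t T0 \<and> typed u T0"
| "wf_fm (FLess t u) \<longleftrightarrow> typed t T0 \<and> typed u T0"
| "wf_fm FBot \<longleftrightarrow> True"
| "wf_fm (FImp A B) \<longleftrightarrow> wf_fm A \<and> wf_fm B"
| "wf_fm (FAll i \<sigma> A) \<longleftrightarrow> wf_fm A"

primrec qf :: "fm \<Rightarrow> bool" where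
  "qf (FEq t u) \<longleftrightarrow> True"
| "qf (FLess t u) \<longleftrightarrow> True"
| "qf FBot \<longleftrightarrow> True"
| "qf (FImp A B) \<longleftrightarrow> qf A \<and> qf B"
| "qf (FAll i \<sigma> A) \<longleftrightarrow> False"

definition FNot :: "fm \<Rightarrow> fm" where "FNot A = FImp A FBot"
definition FEx :: "nat \<Rightarrow> ty \<Rightarrow> fm \<Rightarrow> fm" where "FEx i \<sigma> A = FNot (FAll i \<sigma> (FNot A))"

primrec fv_tm :: "tm \<Rightarrow> (nat \<times> ty) set" where
  "fv_tm (Var i \<sigma>) = {(i, \<sigma>)}"
| "fv_tm (Cst c) = {}"
| "fv_tm (t \<cdot> u) = fv_tm t \<union> fv_tm u"

primrec fv :: "fm \<Rightarrow> (nat \<times> ty) set" where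
  "fv (FEq t u) = fv_tm t \<union> fv_tm u"
| "fv (FLess t u) = fv_tm t \<union> fv_tm u"
| "fv FBot = {}"
| "fv (FImp A B) = fv A \<union> fv B"
| "fv (FAll i \<sigma> A) = fv A - {(i, \<sigma>)}"

primrec subst_tm :: "tm \<Rightarrow> nat \<times> ty \<Rightarrow> tm \<Rightarrow> tm" where
  "subst_tm s x (Var i \<sigma>) = (if x = (i, \<sigma>) then s else Var i \<sigma>)"
| "subst_tm s x (Cst c) = Cst c"
| "subst_tm s x (t \<cdot> u) = subst_tm s x t \<cdot> subst_tm s x u"

primrec subst :: "tm \<Rightarrow> nat \<times> ty \<Rightarrow> fm \<Rightarrow> fm" where
  "subst s x (FEq t u) = FEq (subst_tm s x t) (subst_tm s x u)"
| "subst s x (FLess t u) = FLess (subst_tm s x t) (subst_tm s x u)"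
| "subst s x FBot = FBot"
| "subst s x (FImp A B) = FImp (subst s x A) (subst s x B)"
| "subst s x (FAll i \<sigma> A) = (if x = (i, \<sigma>) then FAll i \<sigma> A else FAll i \<sigma> (subst s x A))"

text \<open>\<open>free_for s x A\<close>: no variable of \<open>s\<close> is captured when \<open>s\<close> replaces the free
  occurrences of \<open>x\<close> in \<open>A\<close>.\<close>

primrec free_for :: "tm \<Rightarrow> nat \<times> ty \<Rightarrow> fm \<Rightarrow> bool" where
  "free_for s x (FEq t u) \<longleftrightarrow> True"
| "free_for s x (FLess t u) \<longleftrightarrow> True"
| "free_for s x FBot \<longleftrightarrow> True"
| "free_for s x (FImp A B) \<longleftrightarrow> free_for s x A \<and> free_for s x B"
| "free_for s x (FAll i \<sigma> A) \<longleftrightarrow>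
     x \<notin> fv (FAll i \<sigma> A) \<or> ((i, \<sigma>) \<notin> fv_tm s \<and> free_for s x A)"


section \<open>Natural deduction for classical many-sorted logic\<close>

text \<open>\<open>T\<close> is the set of non-logical axioms and \<open>\<Gamma>\<close> the local assumptions. The variable condition of
  \<open>AllI\<close> concerns \<open>\<Gamma>\<close> only, so an open formula in \<open>T\<close> acts as its universal closure. There are no
  equality rules: the equality axioms belong to the theories.\<close>

inductive deriv :: "fm set \<Rightarrow> fm set \<Rightarrow> fm \<Rightarrow> bool" for T where
  Axiom: "A \<in> T \<Longrightarrow> wf_fm A \<Longrightarrow> deriv T \<Gamma> A"
| Assum: "A \<in> \<Gamma> \<Longrightarrow> wf_fm A \<Longrightarrow> deriv T \<Gamma> A"
| ImpI: "wf_fm A \<Longrightarrow> deriv T (insert A \<Gamma>) B \<Longrightarrow> deriv T \<Gamma> (FImp A B)"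
| ImpE: "deriv T \<Gamma> (FImp A B) \<Longrightarrow> deriv T \<Gamma> A \<Longrightarrow> deriv T \<Gamma> B"
| Raa: "wf_fm A \<Longrightarrow> deriv T (insert (FNot A) \<Gamma>) FBot \<Longrightarrow> deriv T \<Gamma> A"
| AllI: "deriv T \<Gamma> A \<Longrightarrow> \<forall>B\<in>\<Gamma>. (i, \<sigma>) \<notin> fv B \<Longrightarrow> deriv T \<Gamma> (FAll i \<sigma> A)"
| AllE: "deriv T \<Gamma> (FAll i \<sigma> A) \<Longrightarrow> typed t \<sigma> \<Longrightarrow> free_for t (i, \<sigma>) A \<Longrightarrow>
    deriv T \<Gamma> (subst t (i, \<sigma>) A)"


section \<open>Writing formulas\<close>

text \<open>A \<open>form\<close> is a formula that still waits for the number of variable names already in use; a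
  quantifier at depth \<open>d\<close> binds the name \<open>d\<close>. This lets the object-level quantifiers be written with
  HOL binders, and no defined notion can capture a variable of its arguments. A complete sentence is
  read off at depth 0.\<close>

type_synonym form = "nat \<Rightarrow> fm"

definition sentence :: "form \<Rightarrow> fm" where "sentence F = F 0"

definition All_f :: "ty \<Rightarrow> (tm \<Rightarrow> form) \<Rightarrow> form" where
  "All_f \<sigma> P = (\<lambda>d. FAll d \<sigma> (P (Var d \<sigma>) (Suc d)))"
definition Imp_f :: "form \<Rightarrow> form \<Rightarrow> form"  (infixr \<open>\<^bold>\<longrightarrow>\<close> 25) where
  "(F \<^bold>\<longrightarrow> G) = (\<lambda>d. FImp (F d) (G d))"
definition Not_f :: "form \<Rightarrow> form"  (\<open>\<^bold>\<not> _\<close> [40] 40) where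
  "(\<^bold>\<not> F) = (\<lambda>d. FNot (F d))"
definition Eq_f :: "tm \<Rightarrow> tm \<Rightarrow> form"  (infix \<open>\<^bold>=\<close> 50) where
  "(t \<^bold>= u) = (\<lambda>d. FEq t u)"
definition Less_f :: "tm \<Rightarrow> tm \<Rightarrow> form"  (infix \<open>\<^bold><\<close> 50) where
  "(t \<^bold>< u) = (\<lambda>d. FLess t u)"

definition Ex_f :: "ty \<Rightarrow> (tm \<Rightarrow> form) \<Rightarrow> form" where
  "Ex_f \<sigma> P = (\<^bold>\<not> All_f \<sigma> (\<lambda>x. \<^bold>\<not> P x))"

syntax
  "_All_f" :: "pttrn \<Rightarrow> ty \<Rightarrow> form \<Rightarrow> form"  (\<open>(3\<^bold>\<forall>_\<^bold>:_./ _)\<close> [0, 0, 10] 10)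
  "_Ex_f" :: "pttrn \<Rightarrow> ty \<Rightarrow> form \<Rightarrow> form"  (\<open>(3\<^bold>\<exists>_\<^bold>:_./ _)\<close> [0, 0, 10] 10)
translations
  "\<^bold>\<forall>x\<^bold>:s. P" \<rightleftharpoons> "CONST All_f s (\<lambda>x. P)"
  "\<^bold>\<exists>x\<^bold>:s. P" \<rightleftharpoons> "CONST Ex_f s (\<lambda>x. P)"

definition Or_f :: "form \<Rightarrow> form \<Rightarrow> form"  (infixr \<open>\<^bold>\<or>\<close> 30) where
  "(F \<^bold>\<or> G) = (\<^bold>\<not> F \<^bold>\<longrightarrow> G)"
definition And_f :: "form \<Rightarrow> form \<Rightarrow> form"  (infixr \<open>\<^bold>\<and>\<close> 35) where
  "(F \<^bold>\<and> G) = (\<^bold>\<not> (F \<^bold>\<longrightarrow> \<^bold>\<not> G))"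
definition Iff_f :: "form \<Rightarrow> form \<Rightarrow> form"  (infixr \<open>\<^bold>\<longleftrightarrow>\<close> 25) where
  "(F \<^bold>\<longleftrightarrow> G) = ((F \<^bold>\<longrightarrow> G) \<^bold>\<and> (G \<^bold>\<longrightarrow> F))"
definition Le_f :: "tm \<Rightarrow> tm \<Rightarrow> form"  (infix \<open>\<^bold>\<le>\<close> 50) where
  "(t \<^bold>\<le> u) = (t \<^bold>< u \<^bold>\<or> t \<^bold>= u)"

abbreviation zero_t :: tm  (\<open>\<^bold>0\<close>) where "\<^bold>0 \<equiv> Cst CZero"
abbreviation one_t :: tm  (\<open>\<^bold>1\<close>) where "\<^bold>1 \<equiv> Cst COne"
abbreviation plus_t :: "tm \<Rightarrow> tm \<Rightarrow> tm"  (infixl \<open>\<^bold>+\<close> 65) where "t \<^bold>+ u \<equiv> Cst CPlus \<cdot> t \<cdot> u"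
abbreviation times_t :: "tm \<Rightarrow> tm \<Rightarrow> tm"  (infixl \<open>\<^bold>*\<close> 70) where "t \<^bold>* u \<equiv> Cst CTimes \<cdot> t \<cdot> u"

primrec eq_ty :: "ty \<Rightarrow> tm \<Rightarrow> tm \<Rightarrow> form" where
  "eq_ty T0 t u = (t \<^bold>= u)"
| "eq_ty (\<rho> \<rightarrow> \<tau>) t u = (\<^bold>\<forall>z\<^bold>:\<rho>. eq_ty \<tau> (t \<cdot> z) (u \<cdot> z))"


section \<open>The base theory\<close>

definition arith_ax :: "fm set" where
  "arith_ax = sentence `
    {\<^bold>\<forall>x\<^bold>:T0. x \<^bold>= x,
     \<^bold>\<forall>x\<^bold>:T0. \<^bold>\<forall>y\<^bold>:T0. x \<^bold>= y \<^bold>\<longrightarrow> y \<^bold>= x,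
     \<^bold>\<forall>x\<^bold>:T0. \<^bold>\<forall>y\<^bold>:T0. \<^bold>\<forall>z\<^bold>:T0. x \<^bold>= y \<^bold>\<longrightarrow> y \<^bold>= z \<^bold>\<longrightarrow> x \<^bold>= z,
     \<^bold>\<forall>x\<^bold>:T0. \<^bold>\<forall>y\<^bold>:T0. \<^bold>\<forall>u\<^bold>:T0. \<^bold>\<forall>v\<^bold>:T0. x \<^bold>= y \<^bold>\<longrightarrow> u \<^bold>= v \<^bold>\<longrightarrow> x \<^bold>< u \<^bold>\<longrightarrow> y \<^bold>< v,
     \<^bold>\<forall>x\<^bold>:T0. \<^bold>\<not> x \<^bold>+ \<^bold>1 \<^bold>= \<^bold>0,
     \<^bold>\<forall>x\<^bold>:T0. \<^bold>\<forall>y\<^bold>:T0. x \<^bold>+ \<^bold>1 \<^bold>= y \<^bold>+ \<^bold>1 \<^bold>\<longrightarrow> x \<^bold>= y,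
     \<^bold>\<forall>x\<^bold>:T0. x \<^bold>+ \<^bold>0 \<^bold>= x,
     \<^bold>\<forall>x\<^bold>:T0. \<^bold>\<forall>y\<^bold>:T0. x \<^bold>+ (y \<^bold>+ \<^bold>1) \<^bold>= (x \<^bold>+ y) \<^bold>+ \<^bold>1,
     \<^bold>\<forall>x\<^bold>:T0. x \<^bold>* \<^bold>0 \<^bold>= \<^bold>0,
     \<^bold>\<forall>x\<^bold>:T0. \<^bold>\<forall>y\<^bold>:T0. x \<^bold>* (y \<^bold>+ \<^bold>1) \<^bold>= x \<^bold>* y \<^bold>+ x,
     \<^bold>\<forall>x\<^bold>:T0. \<^bold>\<not> x \<^bold>< \<^bold>0,
     \<^bold>\<forall>x\<^bold>:T0. \<^bold>\<forall>y\<^bold>:T0. x \<^bold>< y \<^bold>+ \<^bold>1 \<^bold>\<longleftrightarrow> (x \<^bold>< y \<^bold>\<or> x \<^bold>= y)}"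

definition rec_ax :: "fm set" where
  "rec_ax = sentence `
    {\<^bold>\<forall>f\<^bold>:T0 \<rightarrow> T0 \<rightarrow> T0. \<^bold>\<forall>m\<^bold>:T0. Cst CRec \<cdot> f \<cdot> m \<cdot> \<^bold>0 \<^bold>= m,
     \<^bold>\<forall>f\<^bold>:T0 \<rightarrow> T0 \<rightarrow> T0. \<^bold>\<forall>m\<^bold>:T0. \<^bold>\<forall>n\<^bold>:T0.
       Cst CRec \<cdot> f \<cdot> m \<cdot> (n \<^bold>+ \<^bold>1) \<^bold>= f \<cdot> n \<cdot> (Cst CRec \<cdot> f \<cdot> m \<cdot> n)}"

definition comb_ax :: "fm set" where
  "comb_ax =
    {sentence (\<^bold>\<forall>x\<^bold>:\<rho>. \<^bold>\<forall>y\<^bold>:\<tau>. eq_ty \<rho> (Cst (CPi \<rho> \<tau>) \<cdot> x \<cdot> y) x) |\<rho> \<tau>. True} \<union>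
    {sentence (\<^bold>\<forall>x\<^bold>:\<rho> \<rightarrow> \<sigma> \<rightarrow> \<tau>. \<^bold>\<forall>y\<^bold>:\<rho> \<rightarrow> \<sigma>. \<^bold>\<forall>z\<^bold>:\<rho>.
       eq_ty \<tau> (Cst (CSigma \<rho> \<sigma> \<tau>) \<cdot> x \<cdot> y \<cdot> z) (x \<cdot> z \<cdot> (y \<cdot> z))) |\<rho> \<sigma> \<tau>. True}"

definition ext_ax :: "fm set" where
  "ext_ax = {sentence (\<^bold>\<forall>x\<^bold>:\<rho>. \<^bold>\<forall>y\<^bold>:\<rho>. \<^bold>\<forall>f\<^bold>:\<rho> \<rightarrow> \<tau>.
     eq_ty \<rho> x y \<^bold>\<longrightarrow> eq_ty \<tau> (f \<cdot> x) (f \<cdot> y)) |\<rho> \<tau>. True}"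

text \<open>The quantifier-free formulas in the two schemata may contain further free variables (parameters)
  of arbitrary types.\<close>

definition QF_IND :: "fm set" where
  "QF_IND = {FImp (subst \<^bold>0 (i, T0) A)
      (FImp (FAll i T0 (FImp A (subst (Var i T0 \<^bold>+ \<^bold>1) (i, T0) A))) (FAll i T0 A)) |A i.
      qf A \<and> wf_fm A}"

text \<open>\<open>QF_AC \<rho> \<tau>\<close> is \<open>QF-AC\<close> with superscript \<open>\<rho>,\<tau>\<close>: from
  \<open>(\<forall>x\<^sup>\<rho>)(\<exists>y\<^sup>\<tau>)A(x,y)\<close> infer the existence of a choice functional \<open>Y\<close> of type \<open>\<rho> \<rightarrow> \<tau>\<close>.\<close>

definition QF_AC :: "ty \<Rightarrow> ty \<Rightarrow> fm set" where
  "QF_AC \<rho> \<tau> = {FImp (FAll i \<rho> (FEx j \<tau> A))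
      (FEx k (\<rho> \<rightarrow> \<tau>) (FAll i \<rho> (subst (Var k (\<rho> \<rightarrow> \<tau>) \<cdot> Var i \<rho>) (j, \<tau>) A))) |A i j k.
      qf A \<and> wf_fm A \<and> (i, \<rho>) \<noteq> (j, \<tau>) \<and> (k, \<rho> \<rightarrow> \<tau>) \<notin> fv A}"

definition RCA0\<omega> :: "fm set" where
  "RCA0\<omega> = arith_ax \<union> rec_ax \<union> comb_ax \<union> ext_ax \<union> QF_IND \<union> QF_AC T1 T0"

text \<open>Kleene's functional; the first conjunct is \<open>\<phi> \<le> 1\<close> at type 2.\<close>

definition Kleene_E2 :: form where
  "Kleene_E2 = (\<^bold>\<exists>\<phi>\<^bold>:T2. (\<^bold>\<forall>f\<^bold>:T1. \<phi> \<cdot> f \<^bold>\<le> \<^bold>1) \<^bold>\<and>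
     (\<^bold>\<forall>f\<^bold>:T1. (\<^bold>\<exists>n\<^bold>:T0. f \<cdot> n \<^bold>= \<^bold>0) \<^bold>\<longleftrightarrow> \<phi> \<cdot> f \<^bold>= \<^bold>0))"

definition ACA0\<omega> :: "fm set" where
  "ACA0\<omega> = RCA0\<omega> \<union> {sentence Kleene_E2}"


section \<open>Rational and real numbers\<close>

text \<open>Inside formulas a rational is handled as a triple \<open>(a, b, d)\<close> of terms of type 0 with
  \<open>d > 0\<close>, standing for \<open>(a - b) / d\<close>.\<close>

type_synonym rat_t = "tm \<times> tm \<times> tm"

fun rat_less :: "rat_t \<Rightarrow> rat_t \<Rightarrow> form"  (infix \<open>\<^bold><\<^sub>Q\<close> 50) where
  "((a, b, d) \<^bold><\<^sub>Q (a', b', d')) = (a \<^bold>* d' \<^bold>+ b' \<^bold>* d \<^bold>< a' \<^bold>* d \<^bold>+ b \<^bold>* d')"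

fun rat_add :: "rat_t \<Rightarrow> rat_t \<Rightarrow> rat_t"  (infixl \<open>\<^bold>+\<^sub>Q\<close> 65) where
  "((a, b, d) \<^bold>+\<^sub>Q (a', b', d')) = (a \<^bold>* d' \<^bold>+ a' \<^bold>* d, b \<^bold>* d' \<^bold>+ b' \<^bold>* d, d \<^bold>* d')"

fun rat_neg :: "rat_t \<Rightarrow> rat_t"  (\<open>\<^bold>-\<^sub>Q _\<close> [81] 80) where
  "\<^bold>-\<^sub>Q (a, b, d) = (b, a, d)"

definition rat_abs_less :: "rat_t \<Rightarrow> rat_t \<Rightarrow> form" where
  "rat_abs_less q r = (q \<^bold><\<^sub>Q r \<^bold>\<and> \<^bold>-\<^sub>Q q \<^bold><\<^sub>Q r)"

definition rat_abs_le :: "rat_t \<Rightarrow> rat_t \<Rightarrow> form" where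
  "rat_abs_le q r = (\<^bold>\<not> r \<^bold><\<^sub>Q q \<^bold>\<and> \<^bold>\<not> r \<^bold><\<^sub>Q \<^bold>-\<^sub>Q q)"

text \<open>\<open>pow2 n\<close> is \<open>2\<^sup>n\<close>: it iterates \<open>r \<mapsto> r + r\<close>, which is \<open>\<Sigma> (+) I\<close> with \<open>I = \<Sigma> \<Pi> \<Pi>\<close>.\<close>

definition pow2 :: "tm \<Rightarrow> tm" where
  "pow2 n = Cst CRec \<cdot>
     (Cst (CPi T1 T0) \<cdot> (Cst (CSigma T0 T0 T0) \<cdot> Cst CPlus \<cdot>
        (Cst (CSigma T0 T1 T0) \<cdot> Cst (CPi T0 T1) \<cdot> Cst (CPi T0 T0)))) \<cdot> \<^bold>1 \<cdot> n"

text \<open>\<open>2\<^sup>-\<^sup>n\<close> and \<open>2\<^sup>-\<^sup>n\<^sup>+\<^sup>1\<close>\<close>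

definition eps :: "tm \<Rightarrow> rat_t" where "eps n = (\<^bold>1, \<^bold>0, pow2 n)"
definition eps2 :: "tm \<Rightarrow> rat_t" where "eps2 n = (\<^bold>1 \<^bold>+ \<^bold>1, \<^bold>0, pow2 n)"

text \<open>Cantor's pairing \<open>p = (a + b)(a + b + 1) / 2 + b\<close> is a bijection, so every number \<open>n\<close> is the
  code \<open>\<langle>\<langle>a, b\<rangle>, c\<rangle>\<close> of exactly one rational \<open>(a - b) / (c + 1)\<close>. The formula
  \<open>with_rat n P\<close> says that this rational satisfies \<open>P\<close>.\<close>

definition pair_code :: "tm \<Rightarrow> tm \<Rightarrow> tm \<Rightarrow> form" where
  "pair_code a b p = (p \<^bold>+ p \<^bold>= (a \<^bold>+ b) \<^bold>* (a \<^bold>+ b \<^bold>+ \<^bold>1) \<^bold>+ (b \<^bold>+ b))"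

definition with_rat :: "tm \<Rightarrow> (rat_t \<Rightarrow> form) \<Rightarrow> form" where
  "with_rat n P = (\<^bold>\<exists>a\<^bold>:T0. \<^bold>\<exists>b\<^bold>:T0. \<^bold>\<exists>c\<^bold>:T0. \<^bold>\<exists>p\<^bold>:T0.
     pair_code a b p \<^bold>\<and> pair_code p c n \<^bold>\<and> P (a, b, c \<^bold>+ \<^bold>1))"

text \<open>A real is an \<open>x\<close> of type 1 coding a sequence \<open>q\<close> of rationals with
  \<open>\<bar>q\<^sub>n - q\<^sub>n\<^sub>+\<^sub>i\<bar> < 2\<^sup>-\<^sup>n\<close>; then \<open>q\<^sub>n\<close> is within \<open>2\<^sup>-\<^sup>n\<close> of the real, which gives the relations
  \<open>=\<close> and \<open><\<close> on reals, and \<open>\<bar>x - y\<bar> < 2\<^sup>-\<^sup>k\<close>.\<close>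

definition is_real :: "tm \<Rightarrow> form" where
  "is_real x = (\<^bold>\<forall>n\<^bold>:T0. \<^bold>\<forall>i\<^bold>:T0. with_rat (x \<cdot> n) (\<lambda>q. with_rat (x \<cdot> (n \<^bold>+ i)) (\<lambda>r.
     rat_abs_less (q \<^bold>+\<^sub>Q \<^bold>-\<^sub>Q r) (eps n))))"

definition real_eq :: "tm \<Rightarrow> tm \<Rightarrow> form"  (infix \<open>\<^bold>=\<^sub>R\<close> 50) where
  "(x \<^bold>=\<^sub>R y) = (\<^bold>\<forall>n\<^bold>:T0. with_rat (x \<cdot> n) (\<lambda>q. with_rat (y \<cdot> n) (\<lambda>r.
     rat_abs_le (q \<^bold>+\<^sub>Q \<^bold>-\<^sub>Q r) (eps2 n))))"

definition real_less :: "tm \<Rightarrow> tm \<Rightarrow> form"  (infix \<open>\<^bold><\<^sub>R\<close> 50) where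
  "(x \<^bold><\<^sub>R y) = (\<^bold>\<exists>n\<^bold>:T0. with_rat (x \<cdot> n) (\<lambda>q. with_rat (y \<cdot> n) (\<lambda>r.
     q \<^bold>+\<^sub>Q eps2 n \<^bold><\<^sub>Q r)))"

definition real_le :: "tm \<Rightarrow> tm \<Rightarrow> form"  (infix \<open>\<^bold>\<le>\<^sub>R\<close> 50) where
  "(x \<^bold>\<le>\<^sub>R y) = (\<^bold>\<not> y \<^bold><\<^sub>R x)"

definition near :: "tm \<Rightarrow> tm \<Rightarrow> tm \<Rightarrow> form" where
  "near k x y = (\<^bold>\<exists>n\<^bold>:T0. with_rat (x \<cdot> n) (\<lambda>q. with_rat (y \<cdot> n) (\<lambda>r.
     rat_abs_less (q \<^bold>+\<^sub>Q \<^bold>-\<^sub>Q r) (eps k \<^bold>+\<^sub>Q \<^bold>-\<^sub>Q eps2 n))))"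

text \<open>The reals 0 and 1 are constant sequences: the rationals 0 and 1 have the codes 0 and 1.\<close>

definition zero_R :: tm  (\<open>\<^bold>0\<^sub>R\<close>) where "\<^bold>0\<^sub>R = Cst (CPi T0 T0) \<cdot> \<^bold>0"
definition one_R :: tm  (\<open>\<^bold>1\<^sub>R\<close>) where "\<^bold>1\<^sub>R = Cst (CPi T0 T0) \<cdot> \<^bold>1"

definition unit_I :: "tm \<Rightarrow> form" where
  "unit_I x = (is_real x \<^bold>\<and> \<^bold>0\<^sub>R \<^bold>\<le>\<^sub>R x \<^bold>\<and> x \<^bold>\<le>\<^sub>R \<^bold>1\<^sub>R)"


section \<open>Sets of reals\<close>

text \<open>A set of reals is a characteristic function of type 2 that respects equality of reals.
  Membership \<open>x \<^bold>\<in> X\<close> is used only for \<open>x\<close> a real. Notions that apply to definable collections without a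
  given characteristic function take a membership formula \<open>P\<close> instead.\<close>

definition is_set :: "tm \<Rightarrow> form" where
  "is_set X = ((\<^bold>\<forall>x\<^bold>:T1. is_real x \<^bold>\<longrightarrow> X \<cdot> x \<^bold>= \<^bold>0 \<^bold>\<or> X \<cdot> x \<^bold>= \<^bold>1) \<^bold>\<and>
     (\<^bold>\<forall>x\<^bold>:T1. \<^bold>\<forall>y\<^bold>:T1. is_real x \<^bold>\<and> is_real y \<^bold>\<and> x \<^bold>=\<^sub>R y \<^bold>\<longrightarrow> X \<cdot> x \<^bold>= X \<cdot> y))"

definition mem :: "tm \<Rightarrow> tm \<Rightarrow> form"  (infix \<open>\<^bold>\<in>\<close> 50) where
  "(x \<^bold>\<in> X) = (X \<cdot> x \<^bold>= \<^bold>1)"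

definition finite_R :: "(tm \<Rightarrow> form) \<Rightarrow> form" where
  "finite_R P = (\<^bold>\<exists>N\<^bold>:T0. \<^bold>\<forall>w\<^bold>:T0 \<rightarrow> T1.
     (\<^bold>\<forall>i\<^bold>:T0. i \<^bold>\<le> N \<^bold>\<longrightarrow> is_real (w \<cdot> i)) \<^bold>\<and>
     (\<^bold>\<forall>i\<^bold>:T0. \<^bold>\<forall>j\<^bold>:T0. i \<^bold>< j \<^bold>\<and> j \<^bold>\<le> N \<^bold>\<longrightarrow> \<^bold>\<not> w \<cdot> i \<^bold>=\<^sub>R w \<cdot> j) \<^bold>\<longrightarrow>
     (\<^bold>\<exists>i\<^bold>:T0. i \<^bold>\<le> N \<^bold>\<and> \<^bold>\<not> P (w \<cdot> i)))"

definition open_R :: "(tm \<Rightarrow> form) \<Rightarrow> form" where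
  "open_R P = (\<^bold>\<forall>x\<^bold>:T1. is_real x \<^bold>\<and> P x \<^bold>\<longrightarrow>
     (\<^bold>\<exists>k\<^bold>:T0. \<^bold>\<forall>y\<^bold>:T1. is_real y \<^bold>\<and> near k x y \<^bold>\<longrightarrow> P y))"

definition closed_R :: "(tm \<Rightarrow> form) \<Rightarrow> form" where
  "closed_R P = open_R (\<lambda>x. \<^bold>\<not> P x)"


section \<open>The principles FIN and NIN-alt\<close>

definition FIN1 :: form where
  "FIN1 = (\<^bold>\<forall>X\<^bold>:T0 \<rightarrow> T2. \<^bold>\<forall>k\<^bold>:T0.
     (\<^bold>\<forall>n\<^bold>:T0. is_set (X \<cdot> n) \<^bold>\<and> finite_R (\<lambda>x. x \<^bold>\<in> X \<cdot> n)) \<^bold>\<longrightarrow>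
     finite_R (\<lambda>x. \<^bold>\<exists>n\<^bold>:T0. n \<^bold>\<le> k \<^bold>\<and> x \<^bold>\<in> X \<cdot> n))"

text \<open>The finite sequence consists of the reals \<open>w(0), \<dots>, w(k - 1)\<close>.\<close>

definition FIN2 :: form where
  "FIN2 = (\<^bold>\<forall>X\<^bold>:T2. is_set X \<^bold>\<and> finite_R (\<lambda>x. x \<^bold>\<in> X) \<^bold>\<longrightarrow>
     (\<^bold>\<exists>k\<^bold>:T0. \<^bold>\<exists>w\<^bold>:T0 \<rightarrow> T1. (\<^bold>\<forall>i\<^bold>:T0. i \<^bold>< k \<^bold>\<longrightarrow> is_real (w \<cdot> i)) \<^bold>\<and>
       (\<^bold>\<forall>x\<^bold>:T1. is_real x \<^bold>\<and> x \<^bold>\<in> X \<^bold>\<longrightarrow> (\<^bold>\<exists>i\<^bold>:T0. i \<^bold>< k \<^bold>\<and> x \<^bold>=\<^sub>R w \<cdot> i))))"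

text \<open>\<open>Y(f, n)\<close> is curried.\<close>

definition binary :: "tm \<Rightarrow> form" where
  "binary f = (\<^bold>\<forall>m\<^bold>:T0. f \<cdot> m \<^bold>\<le> \<^bold>1)"

definition FIN3 :: form where
  "FIN3 = (\<^bold>\<forall>Y\<^bold>:T1 \<rightarrow> T0 \<rightarrow> T0. \<^bold>\<forall>k\<^bold>:T0.
     (\<^bold>\<forall>n\<^bold>:T0. n \<^bold>\<le> k \<^bold>\<longrightarrow> (\<^bold>\<exists>f\<^bold>:T1. binary f \<^bold>\<and> Y \<cdot> f \<cdot> n \<^bold>= \<^bold>0)) \<^bold>\<longrightarrow>
     (\<^bold>\<exists>g\<^bold>:T0 \<rightarrow> T1. \<^bold>\<forall>n\<^bold>:T0. n \<^bold>\<le> k \<^bold>\<longrightarrow> binary (g \<cdot> n) \<^bold>\<and> Y \<cdot> (g \<cdot> n) \<cdot> n \<^bold>= \<^bold>0))"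

definition FIN :: "fm set" where
  "FIN = {sentence FIN1, sentence FIN2, sentence FIN3}"

text \<open>\<open>H\<close> is a function from the reals to the natural numbers, hence respects equality of reals.\<close>

definition height_countable :: "(tm \<Rightarrow> form) \<Rightarrow> form" where
  "height_countable P = (\<^bold>\<exists>H\<^bold>:T2.
     (\<^bold>\<forall>x\<^bold>:T1. \<^bold>\<forall>y\<^bold>:T1. is_real x \<^bold>\<and> is_real y \<^bold>\<and> x \<^bold>=\<^sub>R y \<^bold>\<longrightarrow> H \<cdot> x \<^bold>= H \<cdot> y) \<^bold>\<and>
     (\<^bold>\<forall>n\<^bold>:T0. finite_R (\<lambda>x. P x \<^bold>\<and> H \<cdot> x \<^bold>< n)))"

definition NIN_alt :: form where
  "NIN_alt = (\<^bold>\<not> height_countable unit_I)"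


section \<open>Functions on the unit interval\<close>

text \<open>A function \<open>f:[0,1] \<rightarrow> \<real>\<close> is an object of type \<open>1 \<rightarrow> 1\<close>; its values outside \<open>[0,1]\<close> are
  irrelevant.\<close>

definition is_fun :: "tm \<Rightarrow> form" where
  "is_fun f = ((\<^bold>\<forall>x\<^bold>:T1. unit_I x \<^bold>\<longrightarrow> is_real (f \<cdot> x)) \<^bold>\<and>
     (\<^bold>\<forall>x\<^bold>:T1. \<^bold>\<forall>y\<^bold>:T1. unit_I x \<^bold>\<and> unit_I y \<^bold>\<and> x \<^bold>=\<^sub>R y \<^bold>\<longrightarrow> f \<cdot> x \<^bold>=\<^sub>R f \<cdot> y))"

text \<open>Continuity at \<open>x\<close> of the restriction of \<open>f\<close> to the collection \<open>P\<close> of reals\<close>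

definition cont_within :: "(tm \<Rightarrow> form) \<Rightarrow> tm \<Rightarrow> tm \<Rightarrow> form" where
  "cont_within P f x = (\<^bold>\<forall>k\<^bold>:T0. \<^bold>\<exists>N\<^bold>:T0. \<^bold>\<forall>y\<^bold>:T1.
     is_real y \<^bold>\<and> P y \<^bold>\<and> near N x y \<^bold>\<longrightarrow> near k (f \<cdot> x) (f \<cdot> y))"

definition cont_on :: "(tm \<Rightarrow> form) \<Rightarrow> tm \<Rightarrow> form" where
  "cont_on P f = (\<^bold>\<forall>x\<^bold>:T1. is_real x \<^bold>\<and> P x \<^bold>\<longrightarrow> cont_within P f x)"

definition left_lim :: "tm \<Rightarrow> tm \<Rightarrow> tm \<Rightarrow> form" where
  "left_lim f x l = (\<^bold>\<forall>k\<^bold>:T0. \<^bold>\<exists>N\<^bold>:T0. \<^bold>\<forall>y\<^bold>:T1.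
     unit_I y \<^bold>\<and> y \<^bold><\<^sub>R x \<^bold>\<and> near N x y \<^bold>\<longrightarrow> near k (f \<cdot> y) l)"

definition right_lim :: "tm \<Rightarrow> tm \<Rightarrow> tm \<Rightarrow> form" where
  "right_lim f x l = (\<^bold>\<forall>k\<^bold>:T0. \<^bold>\<exists>N\<^bold>:T0. \<^bold>\<forall>y\<^bold>:T1.
     unit_I y \<^bold>\<and> x \<^bold><\<^sub>R y \<^bold>\<and> near N x y \<^bold>\<longrightarrow> near k (f \<cdot> y) l)"

definition regulated :: "tm \<Rightarrow> form" where
  "regulated f = (\<^bold>\<forall>x\<^bold>:T1. unit_I x \<^bold>\<longrightarrow>
     (\<^bold>0\<^sub>R \<^bold><\<^sub>R x \<^bold>\<longrightarrow> (\<^bold>\<exists>l\<^bold>:T1. is_real l \<^bold>\<and> left_lim f x l)) \<^bold>\<and>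
     (x \<^bold><\<^sub>R \<^bold>1\<^sub>R \<^bold>\<longrightarrow> (\<^bold>\<exists>l\<^bold>:T1. is_real l \<^bold>\<and> right_lim f x l)))"

definition pointwise_lim :: "tm \<Rightarrow> tm \<Rightarrow> form" where
  "pointwise_lim F f = (\<^bold>\<forall>x\<^bold>:T1. unit_I x \<^bold>\<longrightarrow>
     (\<^bold>\<forall>k\<^bold>:T0. \<^bold>\<exists>N\<^bold>:T0. \<^bold>\<forall>n\<^bold>:T0. N \<^bold>\<le> n \<^bold>\<longrightarrow> near k (F \<cdot> n \<cdot> x) (f \<cdot> x)))"

definition Baire1 :: "tm \<Rightarrow> form" where
  "Baire1 f = (\<^bold>\<exists>F\<^bold>:T0 \<rightarrow> T1 \<rightarrow> T1.
     (\<^bold>\<forall>n\<^bold>:T0. is_fun (F \<cdot> n) \<^bold>\<and> cont_on unit_I (F \<cdot> n)) \<^bold>\<and> pointwise_lim F f)"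

definition Baire2 :: "tm \<Rightarrow> form" where
  "Baire2 f = (\<^bold>\<exists>F\<^bold>:T0 \<rightarrow> T1 \<rightarrow> T1.
     (\<^bold>\<forall>n\<^bold>:T0. is_fun (F \<cdot> n) \<^bold>\<and> Baire1 (F \<cdot> n)) \<^bold>\<and> pointwise_lim F f)"

definition Baire1_star :: "tm \<Rightarrow> form" where
  "Baire1_star f = (\<^bold>\<exists>C\<^bold>:T0 \<rightarrow> T2.
     (\<^bold>\<forall>n\<^bold>:T0. is_set (C \<cdot> n) \<^bold>\<and> closed_R (\<lambda>x. x \<^bold>\<in> C \<cdot> n)) \<^bold>\<and>
     (\<^bold>\<forall>x\<^bold>:T1. is_real x \<^bold>\<longrightarrow> (unit_I x \<^bold>\<longleftrightarrow> (\<^bold>\<exists>n\<^bold>:T0. x \<^bold>\<in> C \<cdot> n))) \<^bold>\<and>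
     (\<^bold>\<forall>m\<^bold>:T0. cont_on (\<lambda>x. x \<^bold>\<in> C \<cdot> m) f))"

text \<open>The limit superior need not exist as an object of the theory, so inequalities about it are
  spelled out: \<open>limsup\<close> of \<open>f\<close> at \<open>x\<close> is \<open>\<le> c\<close> iff for every real \<open>z > c\<close>, eventually
  \<open>f < z\<close> on punctured neighbourhoods of \<open>x\<close>; dually for the limit inferior.\<close>

definition limsup_le :: "tm \<Rightarrow> tm \<Rightarrow> tm \<Rightarrow> form" where
  "limsup_le f x c = (\<^bold>\<forall>z\<^bold>:T1. is_real z \<^bold>\<and> c \<^bold><\<^sub>R z \<^bold>\<longrightarrow>
     (\<^bold>\<exists>N\<^bold>:T0. \<^bold>\<forall>y\<^bold>:T1. unit_I y \<^bold>\<and> \<^bold>\<not> y \<^bold>=\<^sub>R x \<^bold>\<and> near N x y \<^bold>\<longrightarrow> f \<cdot> y \<^bold><\<^sub>R z))"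

definition liminf_ge :: "tm \<Rightarrow> tm \<Rightarrow> tm \<Rightarrow> form" where
  "liminf_ge f x c = (\<^bold>\<forall>z\<^bold>:T1. is_real z \<^bold>\<and> z \<^bold><\<^sub>R c \<^bold>\<longrightarrow>
     (\<^bold>\<exists>N\<^bold>:T0. \<^bold>\<forall>y\<^bold>:T1. unit_I y \<^bold>\<and> \<^bold>\<not> y \<^bold>=\<^sub>R x \<^bold>\<and> near N x y \<^bold>\<longrightarrow> z \<^bold><\<^sub>R f \<cdot> y))"

definition usc :: "tm \<Rightarrow> form" where
  "usc f = (\<^bold>\<forall>x\<^bold>:T1. unit_I x \<^bold>\<longrightarrow> limsup_le f x (f \<cdot> x))"

definition lsc :: "tm \<Rightarrow> form" where
  "lsc f = (\<^bold>\<forall>x\<^bold>:T1. unit_I x \<^bold>\<longrightarrow> liminf_ge f x (f \<cdot> x))"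

text \<open>Every regulated \<open>f:[0,1] \<rightarrow> \<real>\<close> with property \<open>Q\<close> has a point of continuity.\<close>

definition cont_point_principle :: "(tm \<Rightarrow> form) \<Rightarrow> form" where
  "cont_point_principle Q = (\<^bold>\<forall>f\<^bold>:T1 \<rightarrow> T1. is_fun f \<^bold>\<and> regulated f \<^bold>\<and> Q f \<^bold>\<longrightarrow>
     (\<^bold>\<exists>x\<^bold>:T1. unit_I x \<^bold>\<and> cont_within unit_I f x))"

definition equivalent_over :: "fm set \<Rightarrow> form \<Rightarrow> form \<Rightarrow> bool" where
  "equivalent_over T F G \<longleftrightarrow> deriv T {} (sentence (F \<^bold>\<longleftrightarrow> G))"

end

theory Submission
  imports Defs "HOL-Library.Countable" "HOL-Computational_Algebra.Fraction_Field"
begin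

text \<open>By Henkin completeness it is enough to verify the equivalences in every Henkin model. There, Kleene's
  quantifier decides quantifiers over type 0, so that arithmetical predicates have characteristic functions.
  The type 0 objects form an ordered semidomain, its fractions of differences an ordered field, and the real
  numbers of the model lie in the Cauchy completion of that field.

  If \<open>f\<close> is regulated and nowhere continuous, let \<open>H x\<close> be the least \<open>n\<close> such that \<open>f\<close> oscillates by
  \<open>2\<^sup>-\<^sup>n\<close> at \<open>x\<close>. Then \<open>H\<close> is a height: if the points with \<open>H x < n\<close> were not finite, then by \<open>FIN\<close> and a
  finite grid there would be arbitrarily close pairs of them, \<open>QF_AC T0 T1\<close> would select a sequence
  of such pairs, and at its upper limit a one-sided limit of \<open>f\<close> would not exist.

  Conversely, let \<open>H\<close> be a height. By \<open>FIN\<close> each set \<open>{x. H x < n}\<close> is listed by a finite sequence, so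
  \<open>f x = 2\<^sup>-\<^sup>H\<^sup>x\<close> tends to 0 at every point; hence it is regulated, upper semi-continuous and
  nowhere continuous, and \<open>- f\<close> is lower semi-continuous. It is constant near each point of the closed set
  \<open>{x. H x \<le> n}\<close> relative to that set, and it is the limit of its restrictions to these sets, which are Baire 1
  because they have finite support.\<close>

section \<open>Renaming of variables\<close>

text \<open>A Henkin model may have nonstandard type 0 objects and lack most functionals, so
  induction over \<open>nat\<close> and choices made outside the model say nothing about it. Every
  induction, least number and choice is therefore run inside, for predicates satisfying
  \<open>ar\<close>. These are closed under quantifiers over type 0 only, which dictates the form of
  the analysis: quantifiers over reals are traded for quantifiers over codes of rationals, and upper
  limits and finite maxima appear as cuts defined by an arithmetical condition
  (\<open>cut_real\<close>). A least distance to finitely many points is no \<open>Min\<close> but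
  an induction (\<open>finite_distance\<close>), because their number may be nonstandard. The
  completion \<open>rr\<close> plays the opposite role. It lives outside, and \<open>val\<close>
  maps the reals of the model into it without any claim to be onto; equality, order and distance of
  reals become those of an ordered field, where \<open>linarith\<close> applies. A sequence of
  single jump points would not do, as it might repeat its limit; of two distinct jump points at
  least one differs from the limit.\<close>

primrec ren_tm :: "(nat \<Rightarrow> nat) \<Rightarrow> tm \<Rightarrow> tm" where
  "ren_tm g (Var i \<sigma>) = Var (g i) \<sigma>"
| "ren_tm g (Cst c) = Cst c"
| "ren_tm g (t \<cdot> u) = ren_tm g t \<cdot> ren_tm g u"

primrec ren :: "(nat \<Rightarrow> nat) \<Rightarrow> fm \<Rightarrow> fm" where
  "ren g (FEq t u) = FEq (ren_tm g t) (ren_tm g u)"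
| "ren g (FLess t u) = FLess (ren_tm g t) (ren_tm g u)"
| "ren g FBot = FBot"
| "ren g (FImp A B) = FImp (ren g A) (ren g B)"
| "ren g (FAll i \<sigma> A) = FAll (g i) \<sigma> (ren g A)"

primrec names_tm :: "tm \<Rightarrow> nat set" where
  "names_tm (Var i \<sigma>) = {i}"
| "names_tm (Cst c) = {}"
| "names_tm (t \<cdot> u) = names_tm t \<union> names_tm u"

primrec names :: "fm \<Rightarrow> nat set" where
  "names (FEq t u) = names_tm t \<union> names_tm u"
| "names (FLess t u) = names_tm t \<union> names_tm u"
| "names FBot = {}"
| "names (FImp A B) = names A \<union> names B"
| "names (FAll i \<sigma> A) = insert i (names A)"

lemma finite_names: "finite (names A)"
proof -
  have "finite (names_tm t)" for t by (induction t) auto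
  then show ?thesis by (induction A) auto
qed

lemma ren_id:
  assumes "\<And>i. i \<in> names A \<Longrightarrow> g (h i) = i"
  shows "ren g (ren h A) = A"
proof -
  have "(\<And>i. i \<in> names_tm t \<Longrightarrow> g (h i) = i) \<Longrightarrow> ren_tm g (ren_tm h t) = t" for t
    by (induction t) auto
  with assms show ?thesis by (induction A) auto
qed

lemma typed_ren: "typed (ren_tm g t) \<sigma> = typed t \<sigma>"
  by (induction t arbitrary: \<sigma>) auto

lemma wf_ren: "wf_fm (ren g A) = wf_fm A"
  by (induction A) (auto simp: typed_ren)

lemma fv_tm_ren: "fv_tm (ren_tm g t) = (\<lambda>(i, \<sigma>). (g i, \<sigma>)) ` fv_tm t"
  by (induction t) auto

lemma fv_ren: "inj g \<Longrightarrow> fv (ren g A) = (\<lambda>(i, \<sigma>). (g i, \<sigma>)) ` fv A"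
  by (induction A) (auto simp: fv_tm_ren dest: injD)

lemma mem_fv_ren: "inj g \<Longrightarrow> (g i, \<sigma>) \<in> fv (ren g A) \<longleftrightarrow> (i, \<sigma>) \<in> fv A"
  by (auto simp: fv_ren dest: injD)

lemma mem_fv_tm_ren: "inj g \<Longrightarrow> (g i, \<sigma>) \<in> fv_tm (ren_tm g t) \<longleftrightarrow> (i, \<sigma>) \<in> fv_tm t"
  by (auto simp: fv_tm_ren dest: injD)

lemma subst_tm_ren:
  "inj g \<Longrightarrow> ren_tm g (subst_tm s (i, \<sigma>) t) = subst_tm (ren_tm g s) (g i, \<sigma>) (ren_tm g t)"
  by (induction t) (auto simp: inj_eq)

lemma subst_ren:
  "inj g \<Longrightarrow> ren g (subst s (i, \<sigma>) A) = subst (ren_tm g s) (g i, \<sigma>) (ren g A)"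
  by (induction A) (auto simp: subst_tm_ren inj_eq)

lemma free_for_ren:
  "inj g \<Longrightarrow> free_for (ren_tm g s) (g i, \<sigma>) (ren g A) \<longleftrightarrow> free_for s (i, \<sigma>) A"
  by (induction A) (auto simp: mem_fv_ren mem_fv_tm_ren inj_eq)

text \<open>An injective renaming neither creates nor destroys coincidences of variables, so the
  variable condition of \<open>AllI\<close> and the condition \<open>free_for\<close> of
  \<open>AllE\<close> carry over, and the derivation is renamed rule by rule.\<close>

lemma deriv_ren:
  assumes "inj g" "deriv T \<Gamma> A"
  shows "deriv (ren g ` T) (ren g ` \<Gamma>) (ren g A)"
  using assms(2)
proof induction
  case (Axiom A \<Gamma>)
  then show ?case by (auto intro!: deriv.Axiom simp: wf_ren)
next
  case (Assum A \<Gamma>)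
  then show ?case by (auto intro!: deriv.Assum simp: wf_ren)
next
  case (ImpI A \<Gamma> B)
  then show ?case by (simp add: deriv.ImpI wf_ren)
next
  case (ImpE \<Gamma> A B)
  then show ?case by (simp add: deriv.ImpE[of _ _ "ren g A"])
next
  case (Raa A \<Gamma>)
  then show ?case by (intro deriv.Raa[of "ren g A"]) (auto simp: wf_ren FNot_def)
next
  case (AllI \<Gamma> A i \<sigma>)
  then show ?case using assms(1) by (auto intro!: deriv.AllI simp: mem_fv_ren)
next
  case (AllE \<Gamma> i \<sigma> A t)
  then have "deriv (ren g ` T) (ren g ` \<Gamma>) (FAll (g i) \<sigma> (ren g A))" by simp
  then have "deriv (ren g ` T) (ren g ` \<Gamma>) (subst (ren_tm g t) (g i, \<sigma>) (ren g A))"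
    using AllE assms(1) by (intro deriv.AllE) (auto simp: typed_ren free_for_ren)
  then show ?case using assms(1) by (simp add: subst_ren)
qed

text \<open>Enlarging \<open>T\<close> is harmless, unlike enlarging the local assumptions, because
  the variable condition of \<open>AllI\<close> does not look at \<open>T\<close>.\<close>

lemma deriv_mono_axioms: "deriv T \<Gamma> A \<Longrightarrow> T \<subseteq> T' \<Longrightarrow> deriv T' \<Gamma> A"
  by (induction rule: deriv.induct) (auto intro: deriv.intros)

lemma deriv_finite_axioms: "deriv T \<Gamma> A \<Longrightarrow> \<exists>T0\<subseteq>T. finite T0 \<and> deriv T0 \<Gamma> A"
proof (induction rule: deriv.induct)
  case (Axiom A \<Gamma>)
  then show ?case by (intro exI[of _ "{A}"]) (auto intro: deriv.Axiom)
next
  case (Assum A \<Gamma>)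
  then show ?case by (intro exI[of _ "{}"]) (auto intro: deriv.Assum)
next
  case (ImpE \<Gamma> A B)
  then obtain T1 T2 where "T1 \<subseteq> T" "finite T1" "deriv T1 \<Gamma> (FImp A B)" "T2 \<subseteq> T" "finite T2"
    "deriv T2 \<Gamma> A" by blast
  then show ?case
    by (intro exI[of _ "T1 \<union> T2"]) (auto intro: deriv.ImpE deriv_mono_axioms)
qed (meson deriv.intros)+

text \<open>A derivation uses finitely many axioms, so doubling can be undone by an injection.\<close>

lemma deriv_double:
  assumes "deriv (ren (\<lambda>i. 2 * i) ` T) {} (ren (\<lambda>i. 2 * i) A)"
  shows "deriv T {} A"
proof -
  let ?h = "\<lambda>i::nat. 2 * i"
  obtain U where U: "U \<subseteq> ren ?h ` T" "finite U" "deriv U {} (ren ?h A)"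
    using deriv_finite_axioms[OF assms] by blast
  then obtain T0 where T0: "T0 \<subseteq> T" "finite T0" "U = ren ?h ` T0"
    using finite_subset_image by metis
  have "finite (names A \<union> \<Union> (names ` T0))" using T0 by (simp add: finite_names)
  then obtain M where M: "\<And>i. i \<in> names A \<union> \<Union> (names ` T0) \<Longrightarrow> i \<le> M"
    by (metis finite_nat_set_iff_bounded_le)
  \<comment> \<open>Even names up to \<open>2 * M\<close> are halved and land in
    \<open>0..M\<close>; all others are moved beyond \<open>M\<close>. So \<open>g\<close> is
    injective everywhere and undoes the doubling on the finitely many names that occur.\<close>
  define g where "g i = (if even i \<and> i \<le> 2 * M then i div 2 else i + M + 1)" for i
  have "inj g" by (rule injI) (auto simp: g_def split: if_splits)
  have g: "g (2 * i) = i" if "i \<le> M" for i using that by (simp add: g_def)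
  have "ren g (ren ?h A) = A" by (rule ren_id) (use M g in auto)
  moreover have "ren g (ren ?h B) = B" if "B \<in> T0" for B by (rule ren_id) (use M g that in auto)
  ultimately have "deriv T0 {} A"
    using deriv_ren[OF \<open>inj g\<close> U(3)] T0(3) by (simp add: image_image)
  then show ?thesis using T0 deriv_mono_axioms by blast
qed

section \<open>Hilbert-style consequence\<close>

lemma typed_unique: "typed t \<sigma> \<Longrightarrow> typed t \<tau> \<Longrightarrow> \<sigma> = \<tau>"
proof (induction t arbitrary: \<sigma> \<tau>)
  case (App t u)
  then obtain \<rho> \<rho>' where "typed t (\<rho> \<rightarrow> \<sigma>)" "typed t (\<rho>' \<rightarrow> \<tau>)" by auto
  then have "(\<rho> \<rightarrow> \<sigma>) = (\<rho>' \<rightarrow> \<tau>)" by (rule App.IH(1))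
  then show ?case by simp
qed auto

lemma typed_subst_tm: "typed s \<sigma> \<Longrightarrow> typed (subst_tm s (i, \<sigma>) t) \<tau> = typed t \<tau>"
  by (induction t arbitrary: \<tau>) (auto dest: typed_unique)

lemma wf_subst: "typed s \<sigma> \<Longrightarrow> wf_fm (subst s (i, \<sigma>) A) = wf_fm A"
  by (induction A) (auto simp: typed_subst_tm)

lemma wf_FNot [simp]: "wf_fm (FNot A) = wf_fm A"
  by (simp add: FNot_def)

lemma deriv_wf: "deriv T \<Gamma> A \<Longrightarrow> wf_fm A"
  by (induction rule: deriv.induct) (auto simp: wf_subst)

lemma subst_tm_fresh: "x \<notin> fv_tm t \<Longrightarrow> subst_tm s x t = t"
  by (induction t) auto

lemma subst_fresh: "x \<notin> fv A \<Longrightarrow> subst s x A = A"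
  by (induction A) (auto simp: subst_tm_fresh)

lemma subst_tm_same: "subst_tm (Var i \<sigma>) (i, \<sigma>) t = t"
  by (induction t) auto

lemma subst_same: "subst (Var i \<sigma>) (i, \<sigma>) A = A"
  by (induction A) (auto simp: subst_tm_same)

lemma free_for_same: "free_for (Var i \<sigma>) (i, \<sigma>) A"
  by (induction A) auto

lemma deriv_K: "wf_fm A \<Longrightarrow> wf_fm B \<Longrightarrow> deriv T {} (FImp A (FImp B A))"
  by (intro deriv.ImpI) (auto intro: deriv.Assum)

lemma deriv_S:
  assumes "wf_fm A" "wf_fm B" "wf_fm C"
  shows "deriv T {} (FImp (FImp A (FImp B C)) (FImp (FImp A B) (FImp A C)))"
proof -
  let ?\<Gamma> = "{A, FImp A B, FImp A (FImp B C)}"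
  have a: "deriv T ?\<Gamma> A" and ab: "deriv T ?\<Gamma> (FImp A B)" and abc: "deriv T ?\<Gamma> (FImp A (FImp B C))"
    using assms by (auto intro!: deriv.Assum)
  have "deriv T ?\<Gamma> C" using deriv.ImpE[OF deriv.ImpE[OF abc a] deriv.ImpE[OF ab a]] .
  then show ?thesis using assms by (intro deriv.ImpI) auto
qed

lemma deriv_DN:
  assumes "wf_fm A"
  shows "deriv T {} (FImp (FNot (FNot A)) A)"
proof -
  let ?\<Gamma> = "{FNot A, FNot (FNot A)}"
  have "deriv T ?\<Gamma> (FImp (FNot A) FBot)" "deriv T ?\<Gamma> (FNot A)"
    using assms by (auto intro!: deriv.Assum simp: FNot_def)
  then have "deriv T ?\<Gamma> FBot" by (rule deriv.ImpE)
  then show ?thesis using assms by (intro deriv.ImpI deriv.Raa[of A]) auto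
qed

lemma deriv_inst:
  "wf_fm A \<Longrightarrow> typed t \<sigma> \<Longrightarrow> free_for t (i, \<sigma>) A \<Longrightarrow>
    deriv T {} (FImp (FAll i \<sigma> A) (subst t (i, \<sigma>) A))"
  by (intro deriv.ImpI deriv.AllE deriv.Assum) auto

lemma deriv_vacuous: "wf_fm A \<Longrightarrow> (i, \<sigma>) \<notin> fv A \<Longrightarrow> deriv T {} (FImp A (FAll i \<sigma> A))"
  by (intro deriv.ImpI deriv.AllI deriv.Assum) auto

text \<open>Both quantified assumptions are instantiated with the bound variable itself; it is free
  in neither of them, so it can be generalised again.\<close>

lemma deriv_distrib:
  assumes "wf_fm A" "wf_fm B"
  shows "deriv T {} (FImp (FAll i \<sigma> (FImp A B)) (FImp (FAll i \<sigma> A) (FAll i \<sigma> B)))"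
proof -
  let ?\<Gamma> = "{FAll i \<sigma> A, FAll i \<sigma> (FImp A B)}"
  have "deriv T ?\<Gamma> (FAll i \<sigma> (FImp A B))" "deriv T ?\<Gamma> (FAll i \<sigma> A)"
    using assms by (auto intro!: deriv.Assum)
  from this[THEN deriv.AllE, of "Var i \<sigma>"]
  have "deriv T ?\<Gamma> (FImp A B)" "deriv T ?\<Gamma> A"
    by (auto simp: free_for_same subst_same subst_tm_same)
  then have "deriv T ?\<Gamma> B" by (rule deriv.ImpE)
  then have "deriv T ?\<Gamma> (FAll i \<sigma> B)" by (rule deriv.AllI) auto
  then show ?thesis using assms by (intro deriv.ImpI) auto
qed

text \<open>Weakening of \<open>deriv\<close> fails to be an immediate induction because of the variable condition, so
  consequences of a set of formulas are generated from theorems by modus ponens alone.\<close>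

inductive conseq :: "fm set \<Rightarrow> fm set \<Rightarrow> fm \<Rightarrow> bool" for T S where
  hyp: "A \<in> S \<Longrightarrow> conseq T S A"
| prov: "deriv T {} A \<Longrightarrow> conseq T S A"
| modus_ponens: "conseq T S (FImp A B) \<Longrightarrow> conseq T S A \<Longrightarrow> conseq T S B"

lemma conseq_wf: "conseq T S A \<Longrightarrow> \<forall>B\<in>S. wf_fm B \<Longrightarrow> wf_fm A"
  by (induction rule: conseq.induct) (auto simp: deriv_wf)

lemma conseq_mono: "conseq T S A \<Longrightarrow> S \<subseteq> S' \<Longrightarrow> conseq T S' A"
  by (induction rule: conseq.induct) (auto intro: conseq.intros)

lemma conseq_finite: "conseq T S A \<Longrightarrow> \<exists>F\<subseteq>S. finite F \<and> conseq T F A"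
proof (induction rule: conseq.induct)
  case (hyp A)
  then show ?case by (intro exI[of _ "{A}"]) (auto intro: conseq.hyp)
next
  case (prov A)
  then show ?case by (intro exI[of _ "{}"]) (auto intro: conseq.prov)
next
  case (modus_ponens A B)
  then obtain F G where "F \<subseteq> S" "finite F" "conseq T F (FImp A B)" "G \<subseteq> S" "finite G" "conseq T G A"
    by blast
  then show ?case
    by (intro exI[of _ "F \<union> G"])
      (auto intro!: conseq.modus_ponens[of T _ A B] intro: conseq_mono)
qed

text \<open>Modus ponens is the only rule of \<open>conseq\<close>, so K and S suffice for the
  deduction theorem and no variable condition comes up.\<close>

lemma conseq_deduct:
  assumes "conseq T (insert A S) B" "wf_fm A" "\<forall>C\<in>S. wf_fm C"
  shows "conseq T S (FImp A B)"
  using assms(1)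
proof induction
  case (hyp B)
  show ?case
  proof (cases "B = A")
    case True
    have "deriv T {} (FImp A A)" using assms by (intro deriv.ImpI deriv.Assum) auto
    then show ?thesis using True conseq.prov by blast
  next
    case False
    then have "B \<in> S" "wf_fm B" using hyp assms by auto
    then show ?thesis using deriv_K assms by (meson conseq.intros)
  qed
next
  case (prov B)
  then show ?case using deriv_K[of B A] assms deriv_wf by (meson conseq.intros)
next
  case (modus_ponens B C)
  have "wf_fm (FImp B C)" using modus_ponens(1) conseq_wf assms by (metis insert_iff)
  then show ?case using deriv_S[of A B C] assms modus_ponens by (meson conseq.intros wf_fm.simps(4))
qed

text \<open>Generalisation is pushed to the leaves: theorems are generalised by \<open>AllI\<close>
  without assumptions, members of \<open>S\<close> by a vacuous quantifier, and the quantifier is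
  distributed over modus ponens.\<close>

lemma conseq_gen:
  assumes "conseq T S A" "\<forall>B\<in>S. wf_fm B \<and> (i, \<sigma>) \<notin> fv B"
  shows "conseq T S (FAll i \<sigma> A)"
  using assms(1)
proof induction
  case (hyp A)
  then show ?case using deriv_vacuous assms by (meson conseq.intros)
next
  case (prov A)
  then show ?case by (auto intro!: conseq.prov deriv.AllI)
next
  case (modus_ponens A B)
  have "wf_fm (FImp A B)" using modus_ponens(1) conseq_wf assms by blast
  then show ?case using deriv_distrib[of A B] modus_ponens by (meson conseq.intros wf_fm.simps(4))
qed

lemma conseq_raa:
  assumes "conseq T (insert (FNot A) S) FBot" "wf_fm A" "\<forall>C\<in>S. wf_fm C"
  shows "conseq T S A"
proof -
  have "conseq T S (FImp (FNot A) FBot)" by (rule conseq_deduct) (use assms in auto)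
  then have "conseq T S (FNot (FNot A))" by (simp add: FNot_def)
  then show ?thesis using conseq.modus_ponens conseq.prov deriv_DN[OF assms(2)] by blast
qed

section \<open>Henkin models\<close>

text \<open>Bound variables have even and parameters odd names, so substituting a term built from
  parameters never captures a variable.\<close>

primrec even_bound :: "fm \<Rightarrow> bool" where
  "even_bound (FEq t u) \<longleftrightarrow> True"
| "even_bound (FLess t u) \<longleftrightarrow> True"
| "even_bound FBot \<longleftrightarrow> True"
| "even_bound (FImp A B) \<longleftrightarrow> even_bound A \<and> even_bound B"
| "even_bound (FAll i \<sigma> A) \<longleftrightarrow> even i \<and> even_bound A"

text \<open>Sentences of the language with new constants: the odd-named variables act as the
  constants, since no quantifier of such a formula binds them.\<close>

definition param_fm :: "fm \<Rightarrow> bool" where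
  "param_fm A \<longleftrightarrow> wf_fm A \<and> even_bound A \<and> (\<forall>x\<in>fv A. odd (fst x))"

definition elts :: "ty \<Rightarrow> tm set" where
  "elts \<sigma> = {t. typed t \<sigma> \<and> (\<forall>x\<in>fv_tm t. odd (fst x))}"

lemma param_fm_simps [simp]:
  "param_fm FBot" "param_fm (FImp A B) \<longleftrightarrow> param_fm A \<and> param_fm B"
  "param_fm (FNot A) \<longleftrightarrow> param_fm A"
  by (auto simp: param_fm_def FNot_def)

lemma even_bound_subst: "even_bound (subst s x A) = even_bound A"
  by (induction A) auto

lemma fv_subst_tm: "fv_tm (subst_tm s x t) \<subseteq> (fv_tm t - {x}) \<union> fv_tm s"
  by (induction t) auto

lemma fv_subst: "fv (subst s x A) \<subseteq> (fv A - {x}) \<union> fv_tm s"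
proof (induction A)
  case (FEq t u)
  then show ?case using fv_subst_tm[of s x t] fv_subst_tm[of s x u] by auto
next
  case (FLess t u)
  then show ?case using fv_subst_tm[of s x t] fv_subst_tm[of s x u] by auto
qed auto

lemma param_fm_subst: "param_fm (FAll i \<sigma> A) \<Longrightarrow> t \<in> elts \<sigma> \<Longrightarrow> param_fm (subst t (i, \<sigma>) A)"
  using fv_subst[of t "(i, \<sigma>)" A] by (auto simp: param_fm_def elts_def wf_subst even_bound_subst)

lemma free_for_odd: "even_bound A \<Longrightarrow> \<forall>x\<in>fv_tm t. odd (fst x) \<Longrightarrow> free_for t x A"
  by (induction A) auto

lemma subst_tm_back:
  "(y, \<sigma>) \<notin> fv_tm t \<Longrightarrow> subst_tm (Var i \<sigma>) (y, \<sigma>) (subst_tm (Var y \<sigma>) (i, \<sigma>) t) = t"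
  by (induction t) auto

text \<open>The variable \<open>y\<close> does not occur in \<open>A\<close> at all, being neither
  free nor, as an odd name, bound; so the second substitution hits exactly the places filled by the
  first.\<close>

lemma subst_back:
  "(y, \<sigma>) \<notin> fv A \<Longrightarrow> even_bound A \<Longrightarrow> odd y \<Longrightarrow>
    subst (Var i \<sigma>) (y, \<sigma>) (subst (Var y \<sigma>) (i, \<sigma>) A) = A"
proof (induction A)
  case (FAll j \<tau> A)
  then have "y \<noteq> j" by auto
  with FAll show ?case by (auto simp: subst_fresh)
qed (simp_all add: subst_tm_back)

text \<open>After the substitution \<open>y\<close> stands only where \<open>i\<close> was free in
  \<open>A\<close>, hence never in the scope of a quantifier over \<open>i\<close>.\<close>

lemma free_for_back:
  "(y, \<sigma>) \<notin> fv A \<Longrightarrow> even_bound A \<Longrightarrow> odd y \<Longrightarrow>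
    free_for (Var i \<sigma>) (y, \<sigma>) (subst (Var y \<sigma>) (i, \<sigma>) A)"
proof (induction A)
  case (FAll j \<tau> A)
  then have y: "y \<noteq> j" "(y, \<sigma>) \<notin> fv A" by auto
  with FAll show ?case by (cases "(i, \<sigma>) = (j, \<tau>)") auto
qed simp_all

section \<open>Maximal consistent sets with witnesses\<close>

instance ty :: countable by countable_datatype
instance cst :: countable by countable_datatype
instance tm :: countable by countable_datatype
instance fm :: countable by countable_datatype

definition consistent :: "fm set \<Rightarrow> fm set \<Rightarrow> bool" where
  "consistent T S \<longleftrightarrow> \<not> conseq T S FBot"

text \<open>The Henkin witness enters together with the negated universal formula that asks for it.
  \<open>FNot\<close> is no constructor, hence the match on an implication into
  \<open>FBot\<close>.\<close>

definition witness :: "fm set \<Rightarrow> fm \<Rightarrow> fm set" where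
  "witness S B = (case B of
     FImp (FAll i \<sigma> C) FBot \<Rightarrow>
       {FNot (subst (Var (SOME y. odd y \<and> (\<forall>B\<in>S. (y, \<sigma>) \<notin> fv B)) \<sigma>) (i, \<sigma>) C)}
   | _ \<Rightarrow> {})"

lemma witness_cases:
  "witness S B = {} \<or> (\<exists>i \<sigma> C. B = FNot (FAll i \<sigma> C) \<and>
    witness S B = {FNot (subst (Var (SOME y. odd y \<and> (\<forall>B\<in>S. (y, \<sigma>) \<notin> fv B)) \<sigma>) (i, \<sigma>) C)})"
  by (auto simp: witness_def FNot_def split: fm.splits)

lemma finite_fv: "finite (fv A)"
proof -
  have "finite (fv_tm t)" for t by (induction t) auto
  then show ?thesis by (induction A) auto
qed

lemma fresh_param:
  assumes "finite S" and y: "y = (SOME y. odd y \<and> (\<forall>B\<in>S. (y, \<sigma>) \<notin> fv B))"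
  shows "odd y \<and> (\<forall>B\<in>S. (y, \<sigma>) \<notin> fv B)"
proof -
  have "finite (fst ` (\<Union>B\<in>S. fv B))" using assms by (auto simp: finite_fv)
  then obtain M where "\<forall>k \<in> fst ` (\<Union>B\<in>S. fv B). k \<le> M" by (metis finite_nat_set_iff_bounded_le)
  then have "odd (2 * M + 1) \<and> (\<forall>B\<in>S. (2 * M + 1, \<sigma>) \<notin> fv B)" by force
  then show ?thesis unfolding y by (rule someI)
qed

text \<open>If the counterexample at the fresh \<open>y\<close> were inconsistent with
  \<open>S\<close>, then \<open>S\<close> would prove the instance at \<open>y\<close>, hence its
  generalisation over \<open>y\<close>, hence after renaming back the universal formula whose
  negation is \<open>B\<close>, a member of \<open>S\<close>.\<close>

lemma consistent_witness:
  assumes "finite S" "consistent T S" "\<forall>A\<in>S. param_fm A" "B \<in> S"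
  shows "consistent T (S \<union> witness S B) \<and> (\<forall>A\<in>witness S B. param_fm A)"
proof (cases "witness S B = {}")
  case False
  then obtain i \<sigma> C where B: "B = FNot (FAll i \<sigma> C)"
    and W: "witness S B = {FNot (subst (Var (SOME y. odd y \<and> (\<forall>B\<in>S. (y, \<sigma>) \<notin> fv B)) \<sigma>) (i, \<sigma>) C)}"
    using witness_cases by blast
  define y where "y = (SOME y. odd y \<and> (\<forall>B\<in>S. (y, \<sigma>) \<notin> fv B))"
  have y: "odd y" "\<forall>B\<in>S. (y, \<sigma>) \<notin> fv B" using fresh_param[OF assms(1) y_def] by auto
  have wfS: "\<forall>A\<in>S. wf_fm A" using assms by (auto simp: param_fm_def)
  have pB: "param_fm (FAll i \<sigma> C)" using B assms by auto
  then have ev: "even i" "even_bound C" "wf_fm C" by (auto simp: param_fm_def)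
  have yC: "(y, \<sigma>) \<notin> fv C" using y B assms(4) ev by (auto simp: FNot_def)
  have "Var y \<sigma> \<in> elts \<sigma>" using y by (auto simp: elts_def)
  then have p: "param_fm (subst (Var y \<sigma>) (i, \<sigma>) C)" using pB param_fm_subst by blast
  have "consistent T (insert (FNot (subst (Var y \<sigma>) (i, \<sigma>) C)) S)"
    unfolding consistent_def
  proof
    assume "conseq T (insert (FNot (subst (Var y \<sigma>) (i, \<sigma>) C)) S) FBot"
    then have "conseq T S (subst (Var y \<sigma>) (i, \<sigma>) C)"
      by (rule conseq_raa) (use p wfS in \<open>auto simp: param_fm_def\<close>)
    then have *: "conseq T S (FAll y \<sigma> (subst (Var y \<sigma>) (i, \<sigma>) C))"
      by (rule conseq_gen) (use y wfS in auto)
    have "deriv T {} (FImp (FAll y \<sigma> (subst (Var y \<sigma>) (i, \<sigma>) C))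
        (subst (Var i \<sigma>) (y, \<sigma>) (subst (Var y \<sigma>) (i, \<sigma>) C)))"
      by (rule deriv_inst) (use p y ev yC free_for_back in \<open>auto simp: param_fm_def\<close>)
    then have "deriv T {} (FImp (FAll y \<sigma> (subst (Var y \<sigma>) (i, \<sigma>) C)) C)"
      using subst_back[OF yC ev(2) y(1)] by simp
    then have "conseq T S C" using * by (rule conseq.modus_ponens[OF conseq.prov])
    \<comment> \<open>Generalising is allowed here: \<open>i\<close> is a bound name and therefore
      even, while the free names in \<open>S\<close> are odd.\<close>
    then have "conseq T S (FAll i \<sigma> C)"
      by (rule conseq_gen) (use wfS assms(3) ev(1) in \<open>fastforce simp: param_fm_def\<close>)
    moreover have "conseq T S (FImp (FAll i \<sigma> C) FBot)" using B assms(4) by (intro conseq.hyp) (simp add: FNot_def)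
    ultimately have "conseq T S FBot" using conseq.modus_ponens by blast
    then show False using assms by (simp add: consistent_def)
  qed
  then show ?thesis using W p by (simp add: y_def)
qed (use assms in auto)

text \<open>Stage \<open>n\<close> decides the formula with number \<open>n\<close>. Every stage is
  finite, so that a fresh parameter for the witness always exists.\<close>

primrec henkin_seq :: "fm set \<Rightarrow> fm \<Rightarrow> nat \<Rightarrow> fm set" where
  "henkin_seq T A 0 = {A}"
| "henkin_seq T A (Suc n) = (let S = henkin_seq T A n; B = from_nat n in
     if param_fm B \<and> consistent T (insert B S) then insert B S \<union> witness (insert B S) B else S)"

definition henkin :: "fm set \<Rightarrow> fm \<Rightarrow> fm set" where
  "henkin T A = (\<Union>n. henkin_seq T A n)"

context
  fixes T :: "fm set" and A :: fm
  assumes A: "param_fm A" "consistent T {A}"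
begin

lemma henkin_seq_consistent:
  "finite (henkin_seq T A n) \<and> consistent T (henkin_seq T A n) \<and> (\<forall>B\<in>henkin_seq T A n. param_fm B)"
proof (induction n)
  case (Suc n)
  have "finite (witness S B)" for S B using witness_cases[of S B] by auto
  then show ?case using Suc consistent_witness[of "insert (from_nat n) (henkin_seq T A n)" T "from_nat n"]
    by (auto simp: Let_def)
qed (use A in auto)

lemma henkin_seq_mono: "m \<le> n \<Longrightarrow> henkin_seq T A m \<subseteq> henkin_seq T A n"
  by (rule lift_Suc_mono_le) (auto simp: Let_def)

lemma param_henkin: "B \<in> henkin T A \<Longrightarrow> param_fm B"
  using henkin_seq_consistent by (auto simp: henkin_def)

text \<open>A proof of \<open>FBot\<close> uses finitely many members of the union, and these
  already lie in one stage.\<close>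

lemma consistent_henkin: "consistent T (henkin T A)"
  unfolding consistent_def
proof
  assume "conseq T (henkin T A) FBot"
  from conseq_finite[OF this] obtain F where F: "F \<subseteq> henkin T A" "finite F" "conseq T F FBot" by auto
  have "\<exists>n. F \<subseteq> henkin_seq T A n"
  proof -
    from F(2,1) show ?thesis
    proof (induction F rule: finite_induct)
      case (insert B F)
      then obtain m n where "B \<in> henkin_seq T A m" "F \<subseteq> henkin_seq T A n" unfolding henkin_def by blast
      then have "insert B F \<subseteq> henkin_seq T A (max m n)"
        using henkin_seq_mono[of m "max m n"] henkin_seq_mono[of n "max m n"] by auto
      then show ?case ..
    qed simp
  qed
  then obtain n where "F \<subseteq> henkin_seq T A n" ..
  then have "conseq T (henkin_seq T A n) FBot" using F(3) conseq_mono by simp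
  then show False using henkin_seq_consistent[of n] by (simp add: consistent_def)
qed

text \<open>\<open>B\<close> was offered at stage \<open>to_nat B\<close>, and consistency with the
  whole union passes to the part built by then.\<close>

lemma mem_henkin:
  assumes "param_fm B" "consistent T (insert B (henkin T A))"
  shows "B \<in> henkin T A"
proof -
  have "consistent T (insert B (henkin_seq T A n))" for n
    using assms(2) conseq_mono[of T "insert B (henkin_seq T A n)" FBot "insert B (henkin T A)"]
    by (auto simp: consistent_def henkin_def)
  then have "B \<in> henkin_seq T A (Suc (to_nat B))" using assms by (simp add: Let_def)
  then show ?thesis unfolding henkin_def by blast
qed

lemma henkin_conseq:
  assumes "param_fm B" "conseq T (henkin T A) B"
  shows "B \<in> henkin T A"
proof (rule mem_henkin[OF assms(1)], unfold consistent_def, rule notI)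
  assume "conseq T (insert B (henkin T A)) FBot"
  then have "conseq T (henkin T A) (FImp B FBot)"
    by (rule conseq_deduct) (use assms param_henkin in \<open>auto simp: param_fm_def\<close>)
  then show False using assms(2) consistent_henkin conseq.modus_ponens unfolding consistent_def by blast
qed

lemma henkin_deriv: "param_fm B \<Longrightarrow> deriv T {} B \<Longrightarrow> B \<in> henkin T A"
  by (simp add: henkin_conseq conseq.prov)

lemma henkin_mp_deriv:
  "deriv T {} (FImp B C) \<Longrightarrow> B \<in> henkin T A \<Longrightarrow> param_fm C \<Longrightarrow> C \<in> henkin T A"
  by (rule henkin_conseq) (auto intro: conseq.modus_ponens[OF conseq.prov conseq.hyp])

lemma henkin_FBot: "FBot \<notin> henkin T A"
  using consistent_henkin conseq.hyp unfolding consistent_def by blast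

lemma henkin_FNot:
  assumes "param_fm B"
  shows "FNot B \<in> henkin T A \<longleftrightarrow> B \<notin> henkin T A"
proof
  assume "FNot B \<in> henkin T A"
  then show "B \<notin> henkin T A"
    using consistent_henkin conseq.modus_ponens[OF conseq.hyp conseq.hyp] unfolding consistent_def FNot_def by blast
next
  assume B: "B \<notin> henkin T A"
  then have "conseq T (insert B (henkin T A)) FBot"
    using mem_henkin assms consistent_def by blast
  then have "conseq T (henkin T A) (FNot B)"
    unfolding FNot_def
    by (rule conseq_deduct) (use assms param_henkin in \<open>auto simp: param_fm_def\<close>)
  then show "FNot B \<in> henkin T A" using assms by (intro henkin_conseq) auto
qed

lemma henkin_FImp:
  assumes "param_fm B" "param_fm C"
  shows "FImp B C \<in> henkin T A \<longleftrightarrow> (B \<in> henkin T A \<longrightarrow> C \<in> henkin T A)"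
proof
  assume "FImp B C \<in> henkin T A"
  then show "B \<in> henkin T A \<longrightarrow> C \<in> henkin T A"
    using henkin_conseq[OF assms(2)] conseq.modus_ponens[OF conseq.hyp conseq.hyp] by blast
next
  have wf: "wf_fm B" "wf_fm C" using assms by (auto simp: param_fm_def)
  assume BC: "B \<in> henkin T A \<longrightarrow> C \<in> henkin T A"
  show "FImp B C \<in> henkin T A"
  proof (cases "C \<in> henkin T A")
    case True
    then show ?thesis using henkin_mp_deriv[OF deriv_K[OF wf(2,1)]] assms by simp
  next
    case False
    then have "FNot B \<in> henkin T A" using BC assms by (simp add: henkin_FNot)
    moreover have "deriv T {} (FImp (FNot B) (FImp B C))"
    proof -
      let ?\<Gamma> = "{FNot C, B, FNot B}"
      have "deriv T ?\<Gamma> (FImp B FBot)" "deriv T ?\<Gamma> B"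
        using wf by (auto intro!: deriv.Assum simp: FNot_def)
      then have "deriv T ?\<Gamma> FBot" by (rule deriv.ImpE)
      then show ?thesis using wf by (intro deriv.ImpI deriv.Raa[of C]) auto
    qed
    ultimately show ?thesis using henkin_mp_deriv assms by simp
  qed
qed

lemma henkin_FAll:
  assumes "param_fm (FAll i \<sigma> B)"
  shows "FAll i \<sigma> B \<in> henkin T A \<longleftrightarrow> (\<forall>t\<in>elts \<sigma>. subst t (i, \<sigma>) B \<in> henkin T A)"
proof
  assume "FAll i \<sigma> B \<in> henkin T A"
  moreover have "deriv T {} (FImp (FAll i \<sigma> B) (subst t (i, \<sigma>) B))" if "t \<in> elts \<sigma>" for t
    using assms that by (intro deriv_inst free_for_odd) (auto simp: param_fm_def elts_def)
  ultimately show "\<forall>t\<in>elts \<sigma>. subst t (i, \<sigma>) B \<in> henkin T A"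
    using henkin_mp_deriv param_fm_subst[OF assms] by blast
next
  assume *: "\<forall>t\<in>elts \<sigma>. subst t (i, \<sigma>) B \<in> henkin T A"
  show "FAll i \<sigma> B \<in> henkin T A"
  proof (rule ccontr)
    assume "FAll i \<sigma> B \<notin> henkin T A"
    then have N: "FNot (FAll i \<sigma> B) \<in> henkin T A" using assms henkin_FNot by blast
    let ?n = "to_nat (FNot (FAll i \<sigma> B))"
    let ?S = "insert (FNot (FAll i \<sigma> B)) (henkin_seq T A ?n)"
    have "?S \<subseteq> henkin T A" using N by (auto simp: henkin_def)
    then have con: "consistent T ?S"
      using consistent_henkin conseq_mono unfolding consistent_def by blast
    then have "henkin_seq T A (Suc ?n) = ?S \<union> witness ?S (FNot (FAll i \<sigma> B))"
      using assms by (simp add: Let_def)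
    define y where "y = (SOME y. odd y \<and> (\<forall>B\<in>?S. (y, \<sigma>) \<notin> fv B))"
    have "witness ?S (FNot (FAll i \<sigma> B)) = {FNot (subst (Var y \<sigma>) (i, \<sigma>) B)}"
      unfolding y_def by (simp add: witness_def FNot_def)
    with \<open>henkin_seq T A (Suc ?n) = _\<close>
    have "FNot (subst (Var y \<sigma>) (i, \<sigma>) B) \<in> henkin_seq T A (Suc ?n)" by simp
    then have y: "FNot (subst (Var y \<sigma>) (i, \<sigma>) B) \<in> henkin T A" unfolding henkin_def by blast
    have "finite ?S" using henkin_seq_consistent by simp
    then have "odd y" using fresh_param[OF _ y_def] by simp
    then have "Var y \<sigma> \<in> elts \<sigma>" by (simp add: elts_def)
    moreover from this have "param_fm (subst (Var y \<sigma>) (i, \<sigma>) B)" by (rule param_fm_subst[OF assms])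
    ultimately show False using * henkin_FNot[of "subst (Var y \<sigma>) (i, \<sigma>) B"] y by simp
  qed
qed

end

section \<open>The term model and the truth lemma\<close>

primrec eval :: "(nat \<times> ty \<Rightarrow> tm) \<Rightarrow> tm \<Rightarrow> tm" where
  "eval e (Var i \<sigma>) = e (i, \<sigma>)"
| "eval e (Cst c) = Cst c"
| "eval e (t \<cdot> u) = eval e t \<cdot> eval e u"

text \<open>Turns a formula and an environment into a sentence with parameters. Bound names are
  doubled, hence even, and the values of an environment have odd names, so nothing is
  captured.\<close>

primrec rename_subst :: "(nat \<times> ty \<Rightarrow> tm) \<Rightarrow> fm \<Rightarrow> fm" where
  "rename_subst e (FEq t u) = FEq (eval e t) (eval e u)"
| "rename_subst e (FLess t u) = FLess (eval e t) (eval e u)"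
| "rename_subst e FBot = FBot"
| "rename_subst e (FImp A B) = FImp (rename_subst e A) (rename_subst e B)"
| "rename_subst e (FAll i \<sigma> A) = FAll (2 * i) \<sigma> (rename_subst (e((i, \<sigma>) := Var (2 * i) \<sigma>)) A)"

text \<open>The elements of a model are the terms built from parameters; the set \<open>S\<close> decides the atomic
  formulas.\<close>

primrec sat :: "fm set \<Rightarrow> (nat \<times> ty \<Rightarrow> tm) \<Rightarrow> fm \<Rightarrow> bool" where
  "sat S e (FEq t u) \<longleftrightarrow> FEq (eval e t) (eval e u) \<in> S"
| "sat S e (FLess t u) \<longleftrightarrow> FLess (eval e t) (eval e u) \<in> S"
| "sat S e FBot \<longleftrightarrow> False"
| "sat S e (FImp A B) \<longleftrightarrow> (sat S e A \<longrightarrow> sat S e B)"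
| "sat S e (FAll i \<sigma> A) \<longleftrightarrow> (\<forall>a\<in>elts \<sigma>. sat S (e((i, \<sigma>) := a)) A)"

definition env :: "(nat \<times> ty \<Rightarrow> tm) \<Rightarrow> bool" where
  "env e \<longleftrightarrow> (\<forall>i \<sigma>. e (i, \<sigma>) \<in> elts \<sigma>)"

lemma env_upd [simp]: "env e \<Longrightarrow> a \<in> elts \<sigma> \<Longrightarrow> env (e((i, \<sigma>) := a))"
  by (auto simp: env_def)

lemma eval_cong: "(\<And>x. x \<in> fv_tm t \<Longrightarrow> e x = e' x) \<Longrightarrow> eval e t = eval e' t"
  by (induction t) auto

lemma rename_subst_cong: "(\<And>x. x \<in> fv A \<Longrightarrow> e x = e' x) \<Longrightarrow> rename_subst e A = rename_subst e' A"
proof (induction A arbitrary: e e')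
  case (FEq t u)
  then show ?case using eval_cong[of t e e'] eval_cong[of u e e'] by simp
next
  case (FLess t u)
  then show ?case using eval_cong[of t e e'] eval_cong[of u e e'] by simp
next
  case (FAll i \<sigma> A)
  then have "rename_subst (e((i, \<sigma>) := Var (2 * i) \<sigma>)) A = rename_subst (e'((i, \<sigma>) := Var (2 * i) \<sigma>)) A"
    by (intro FAll.IH) auto
  then show ?case by simp
next
  case (FImp A B)
  show ?case using FImp.IH[of e e'] FImp.prems by simp
qed simp

lemma typed_eval:
  "(\<And>i \<sigma>. typed (e (i, \<sigma>)) \<sigma>) \<Longrightarrow> typed (eval e t) \<tau> = typed t \<tau>"
proof (induction t arbitrary: \<tau>)
  case (Var j \<rho>)
  then have "typed (e (j, \<rho>)) \<rho>" by simp
  then show ?case using typed_unique by auto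
qed simp_all

lemma wf_rename_subst:
  "(\<And>i \<sigma>. typed (e (i, \<sigma>)) \<sigma>) \<Longrightarrow> wf_fm (rename_subst e A) = wf_fm A"
  by (induction A arbitrary: e) (simp_all add: typed_eval)

lemma even_bound_rename_subst: "even_bound (rename_subst e A)"
  by (induction A arbitrary: e) simp_all

lemma fv_eval: "fv_tm (eval e t) = (\<Union>x\<in>fv_tm t. fv_tm (e x))"
  by (induction t) auto

lemma fv_rename_subst: "fv (rename_subst e A) \<subseteq> (\<Union>x\<in>fv A. fv_tm (e x))"
proof (induction A arbitrary: e)
  case (FAll i \<sigma> A)
  show ?case using FAll[of "e((i, \<sigma>) := Var (2 * i) \<sigma>)"] by (fastforce split: if_splits)
next
  case (FImp A B)
  show ?case using FImp[of e] by auto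
qed (simp_all add: fv_eval)

lemma env_odd: "env e \<Longrightarrow> x \<in> fv_tm (e y) \<Longrightarrow> odd (fst x)"
  by (cases y) (auto simp: env_def elts_def)

lemma param_rename_subst:
  assumes "env e" "wf_fm A"
  shows "param_fm (rename_subst e A)"
proof -
  have "typed (e (i, \<sigma>)) \<sigma>" for i \<sigma> using assms(1) by (auto simp: env_def elts_def)
  then have "wf_fm (rename_subst e A)" using assms(2) by (simp add: wf_rename_subst)
  moreover have "odd (fst x)" if "x \<in> fv (rename_subst e A)" for x
    using that fv_rename_subst[of e A] env_odd[OF assms(1), of x] by blast
  ultimately show ?thesis by (simp add: param_fm_def even_bound_rename_subst)
qed

lemma subst_tm_eval:
  assumes "\<And>x. x \<noteq> (i, \<sigma>) \<Longrightarrow> y \<notin> fv_tm (e x)" "e (i, \<sigma>) = Var (fst y) (snd y)"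
  shows "subst_tm s y (eval e t) = eval (e((i, \<sigma>) := s)) t"
  using assms by (induction t) (auto simp: subst_tm_fresh)

text \<open>An instance of a quantified formula is the body in the updated environment: this is the
  quantifier step of the truth lemma. The first premise says that the doubled name comes from no
  other variable.\<close>

lemma subst_rename_subst:
  assumes "\<And>x. x \<noteq> (i, \<sigma>) \<Longrightarrow> (2 * i, \<sigma>) \<notin> fv_tm (e x)" "e (i, \<sigma>) = Var (2 * i) \<sigma>"
  shows "subst s (2 * i, \<sigma>) (rename_subst e A) = rename_subst (e((i, \<sigma>) := s)) A"
  using assms
proof (induction A arbitrary: e)
  case (FAll j \<tau> A)
  show ?case
  proof (cases "(i, \<sigma>) = (j, \<tau>)")
    case False
    then have "subst s (2 * i, \<sigma>) (rename_subst (e((j, \<tau>) := Var (2 * j) \<tau>)) A)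
        = rename_subst (e((j, \<tau>) := Var (2 * j) \<tau>, (i, \<sigma>) := s)) A"
      using FAll.prems by (intro FAll.IH) auto
    moreover have "e((j, \<tau>) := Var (2 * j) \<tau>, (i, \<sigma>) := s) = e((i, \<sigma>) := s, (j, \<tau>) := Var (2 * j) \<tau>)"
      using False by (metis fun_upd_twist)
    moreover have "(2 * i, \<sigma>) \<noteq> (2 * j, \<tau>)" using False by simp
    ultimately show ?thesis by (simp del: fun_upd_apply)
  next
    case True
    then have "e((i, \<sigma>) := s, (j, \<tau>) := Var (2 * j) \<tau>) = e((j, \<tau>) := Var (2 * j) \<tau>)"
      by (metis fun_upd_upd)
    then show ?thesis using True by (simp del: fun_upd_apply)
  qed
qed (simp_all add: subst_tm_eval[of i \<sigma> "(2 * i, \<sigma>)"])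

lemma ren_eq_rename_subst: "ren (\<lambda>i. 2 * i) A = rename_subst (\<lambda>(i, \<sigma>). Var (2 * i) \<sigma>) A"
proof -
  have t: "ren_tm (\<lambda>i. 2 * i) t = eval (\<lambda>(i, \<sigma>). Var (2 * i) \<sigma>) t" for t by (induction t) auto
  have "(\<lambda>(i, \<sigma>). Var (2 * i) \<sigma>)((j, \<tau>) := Var (2 * j) \<tau>) = (\<lambda>(i, \<sigma>). Var (2 * i) \<sigma>)" for j \<tau>
    by (rule ext) auto
  then show ?thesis by (induction A) (simp_all add: t)
qed

text \<open>An open axiom acts as its universal closure: its free variables are generalised and
  instantiated one after the other. \<open>X\<close> collects those already replaced by their
  values; the others still carry doubled names, which do not occur in the values.\<close>

lemma deriv_rename_subst:
  assumes "deriv T {} (ren (\<lambda>i. 2 * i) A)" "env e"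
  shows "deriv T {} (rename_subst e A)"
proof -
  have "deriv T {} (rename_subst (\<lambda>x. if x \<in> X then e x else Var (2 * fst x) (snd x)) A)" if "finite X" for X
    using that
  proof (induction X)
    case empty
    have "(\<lambda>x. Var (2 * fst x) (snd x)) = (\<lambda>(i, \<sigma>). Var (2 * i) \<sigma>)" by auto
    then show ?case using assms by (simp add: ren_eq_rename_subst)
  next
    case (insert x X)
    obtain i \<sigma> where x: "x = (i, \<sigma>)" by force
    let ?e = "\<lambda>x. if x \<in> X then e x else Var (2 * fst x) (snd x)"
    have ex: "e x \<in> elts \<sigma>" using assms(2) x by (auto simp: env_def)
    have "deriv T {} (FAll (2 * i) \<sigma> (rename_subst ?e A))"
      using insert by (intro deriv.AllI) auto
    then have "deriv T {} (subst (e x) (2 * i, \<sigma>) (rename_subst ?e A))"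
      by (rule deriv.AllE)
        (use ex free_for_odd[OF even_bound_rename_subst] in \<open>auto simp: elts_def\<close>)
    moreover have "(2 * i, \<sigma>) \<notin> fv_tm (e y)" for y using env_odd[OF assms(2)] by fastforce
    then have "subst (e x) (2 * i, \<sigma>) (rename_subst ?e A) = rename_subst (?e((i, \<sigma>) := e x)) A"
      using insert x by (intro subst_rename_subst) auto
    moreover have "?e((i, \<sigma>) := e x) = (\<lambda>y. if y \<in> insert x X then e y else Var (2 * fst y) (snd y))"
      using x by auto
    ultimately show ?case by simp
  qed
  from this[OF finite_fv, of A] show ?thesis
    by (simp cong: rename_subst_cong)
qed

text \<open>The truth lemma. It needs no change of universe, as \<open>henkin_FAll\<close> ranges
  over the same terms as the quantifiers of \<open>sat\<close>.\<close>

lemma sat_henkin: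
  assumes "param_fm A" "consistent T {A}"
  shows "env e \<Longrightarrow> wf_fm B \<Longrightarrow> sat (henkin T A) e B \<longleftrightarrow> rename_subst e B \<in> henkin T A"
proof (induction B arbitrary: e)
  case FBot
  then show ?case using henkin_FBot[OF assms] by simp
next
  case (FImp B C)
  then show ?case by (simp add: henkin_FImp[OF assms] param_rename_subst)
next
  case (FAll i \<sigma> B)
  have odd: "(2 * i, \<sigma>) \<notin> fv_tm (e y)" for y using env_odd[OF FAll.prems(1)] by fastforce
  have "subst a (2 * i, \<sigma>) (rename_subst (e((i, \<sigma>) := Var (2 * i) \<sigma>)) B) = rename_subst (e((i, \<sigma>) := a)) B" for a
    using subst_rename_subst[of i \<sigma> "e((i, \<sigma>) := Var (2 * i) \<sigma>)" a B] odd by auto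
  moreover have "param_fm (FAll (2 * i) \<sigma> (rename_subst (e((i, \<sigma>) := Var (2 * i) \<sigma>)) B))"
    using param_rename_subst[OF FAll.prems] by simp
  moreover have "sat (henkin T A) (e((i, \<sigma>) := a)) B \<longleftrightarrow> rename_subst (e((i, \<sigma>) := a)) B \<in> henkin T A"
    if "a \<in> elts \<sigma>" for a
    using FAll.prems that by (intro FAll.IH env_upd) auto
  ultimately show ?case by (simp add: henkin_FAll[OF assms])
qed simp_all

lemma conseq_empty: "conseq T {} A \<Longrightarrow> deriv T {} A"
  by (induction rule: conseq.induct) (auto intro: deriv.ImpE)

text \<open>Completeness. Doubling all names of the theory and of \<open>A\<close> sets the odd
  names free for parameters; nothing is lost, since \<open>deriv_double\<close> takes a derivation
  of the doubled formula back.\<close>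

theorem henkin_model:
  assumes A: "wf_fm A" "fv A = {}" "\<not> deriv T {} A"
  shows "\<exists>S. (\<forall>B\<in>T. wf_fm B \<longrightarrow> (\<forall>e. env e \<longrightarrow> sat S e B)) \<and> (\<forall>e. env e \<longrightarrow> \<not> sat S e A)"
proof -
  let ?r = "ren (\<lambda>i. 2 * i)"
  let ?A = "FNot (?r A)"
  have rA: "rename_subst e A = ?r A" for e
    unfolding ren_eq_rename_subst using A(2) by (intro rename_subst_cong) auto
  have "env (\<lambda>(i, \<sigma>). Var 1 \<sigma>)" by (auto simp: env_def elts_def)
  then have pA: "param_fm ?A" using param_rename_subst A(1) rA by (metis param_fm_simps(3))
  have con: "consistent (?r ` T) {?A}"
    unfolding consistent_def
  proof
    assume "conseq (?r ` T) {?A} FBot"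
    then have "conseq (?r ` T) {} (?r A)"
      by (rule conseq_raa) (use A(1) in \<open>auto simp: wf_ren\<close>)
    then show False using A(3) deriv_double conseq_empty by blast
  qed
  let ?S = "henkin (?r ` T) ?A"
  have "?A \<in> henkin_seq (?r ` T) ?A 0" by simp
  then have "?A \<in> ?S" unfolding henkin_def by blast
  then have "?r A \<notin> ?S" using henkin_FNot[OF pA con] pA by simp
  then have "\<not> sat ?S e A" if "env e" for e using sat_henkin[OF pA con that A(1)] rA by simp
  moreover have "sat ?S e B" if "B \<in> T" "wf_fm B" "env e" for B e
  proof -
    have "deriv (?r ` T) {} (?r B)" using that by (intro deriv.Axiom) (auto simp: wf_ren)
    then have "rename_subst e B \<in> ?S"
      using that by (intro henkin_deriv[OF pA con]) (auto intro: deriv_rename_subst param_rename_subst)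
    then show ?thesis using sat_henkin[OF pA con] that by simp
  qed
  ultimately show ?thesis by blast
qed

section \<open>The ordered ring of differences of an ordered semidomain\<close>

lemma less_iff_add_pos: "(a::'a::linordered_semidom) < b \<longleftrightarrow> (\<exists>c>0. b = a + c)"
proof
  assume "a < b"
  then have b: "a + (b - a) = b" by (simp add: le_add_diff_inverse)
  with \<open>a < b\<close> have "a + 0 < a + (b - a)" by simp
  then have "0 < b - a" by (rule add_less_imp_less_left)
  with b show "\<exists>c>0. b = a + c" by metis
qed auto

quotient_type (overloaded) 'a diff = "'a::linordered_semidom \<times> 'a" / "\<lambda>(x, y) (u, v). x + v = u + y"
  morphisms Rep_diff Abs_diff
proof (rule equivpI)
  show "reflp (\<lambda>(x, y) (u, v). x + v = u + (y::'a))" by (auto simp: reflp_def)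
  show "symp (\<lambda>(x, y) (u, v). x + v = u + (y::'a))" by (auto simp: symp_def)
  show "transp (\<lambda>(x, y) (u, v). x + v = u + (y::'a))"
  proof (rule transpI; clarify)
    fix a b c d e f :: 'a
    assume "a + d = c + b" "c + f = e + d"
    then have "(a + f) + (c + d) = (e + b) + (c + d)" by (simp add: algebra_simps) (metis add.assoc add.commute)
    then show "a + f = e + b" by simp
  qed
qed

text \<open>One factor is exchanged at a time, passing through the product of the new first with the
  old second factor. In the absence of subtraction the terms \<open>?p\<close> of this intermediate
  product are added on both sides and cancelled.\<close>

lemma diff_mult_cong:
  fixes s t u v w x y z :: "'a::linordered_semidom"
  assumes "s + v = u + t" "w + z = y + x"
  shows "(s * w + t * x) + (u * z + v * y) = (u * y + v * z) + (s * x + t * w)"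
proof -
  have "(s + v) * w + (u + t) * x = (u + t) * w + (s + v) * x" using assms by simp
  then have 1: "(s * w + t * x) + (u * x + v * w) = (u * w + v * x) + (s * x + t * w)"
    by (simp add: algebra_simps)
  have "u * (w + z) + v * (y + x) = u * (y + x) + v * (w + z)" using assms by simp
  then have 2: "(u * w + v * x) + (u * z + v * y) = (u * y + v * z) + (u * x + v * w)"
    by (simp add: algebra_simps)
  let ?p = "u * w + v * x + (u * x + v * w)"
  have "((s * w + t * x) + (u * z + v * y)) + ?p
      = ((s * w + t * x) + (u * x + v * w)) + ((u * w + v * x) + (u * z + v * y))"
    by (simp add: algebra_simps)
  also have "\<dots> = ((u * w + v * x) + (s * x + t * w)) + ((u * y + v * z) + (u * x + v * w))"
    by (simp only: 1 2)
  also have "\<dots> = ((u * y + v * z) + (s * x + t * w)) + ?p" by (simp add: algebra_simps)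
  finally show ?thesis by simp
qed

lemma diff_order_cong:
  fixes a b c d :: "'a::linordered_semidom"
  assumes "a + b' = a' + b" "c + d' = c' + d"
  shows "a + d \<le> c + b \<longleftrightarrow> a' + d' \<le> c' + b'" "a + d < c + b \<longleftrightarrow> a' + d' < c' + b'"
proof -
  have l: "(a + d) + (b' + c') = (a' + d') + (b + c)"
  proof -
    have "(a + d) + (b' + c') = (a + b') + (c' + d)" by (simp add: algebra_simps)
    also have "\<dots> = (a' + b) + (c + d')" by (simp only: assms)
    finally show ?thesis by (simp add: algebra_simps)
  qed
  have r: "(c + b) + (b' + c') = (c' + b') + (b + c)" by (simp add: algebra_simps)
  have "a + d \<le> c + b \<longleftrightarrow> (a + d) + (b' + c') \<le> (c + b) + (b' + c')" by simp
  also have "\<dots> \<longleftrightarrow> a' + d' \<le> c' + b'" unfolding l r by simp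
  finally show "a + d \<le> c + b \<longleftrightarrow> a' + d' \<le> c' + b'" .
  have "a + d < c + b \<longleftrightarrow> (a + d) + (b' + c') < (c + b) + (b' + c')" by simp
  also have "\<dots> \<longleftrightarrow> a' + d' < c' + b'" unfolding l r by simp
  finally show "a + d < c + b \<longleftrightarrow> a' + d' < c' + b'" .
qed

instantiation diff :: (linordered_semidom) linordered_idom
begin

lift_definition zero_diff :: "'a diff" is "(0, 0)" .
lift_definition one_diff :: "'a diff" is "(1, 0)" .
lift_definition plus_diff :: "'a diff \<Rightarrow> 'a diff \<Rightarrow> 'a diff" is "\<lambda>(x, y) (u, v). (x + u, y + v)"
  by clarify (metis (no_types, opaque_lifting) add.assoc add.commute)
lift_definition uminus_diff :: "'a diff \<Rightarrow> 'a diff" is "\<lambda>(x, y). (y, x)"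
  by clarify (simp add: add.commute)
lift_definition minus_diff :: "'a diff \<Rightarrow> 'a diff \<Rightarrow> 'a diff" is "\<lambda>(x, y) (u, v). (x + v, y + u)"
  by clarify (metis (no_types, opaque_lifting) add.assoc add.commute)
lift_definition times_diff :: "'a diff \<Rightarrow> 'a diff \<Rightarrow> 'a diff"
  is "\<lambda>(x, y) (u, v). (x * u + y * v, x * v + y * u)"
  by clarify (rule diff_mult_cong)
lift_definition less_eq_diff :: "'a diff \<Rightarrow> 'a diff \<Rightarrow> bool" is "\<lambda>(x, y) (u, v). x + v \<le> u + y"
  by clarify (rule diff_order_cong)
lift_definition less_diff :: "'a diff \<Rightarrow> 'a diff \<Rightarrow> bool" is "\<lambda>(x, y) (u, v). x + v < u + y"
  by clarify (rule diff_order_cong)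
definition abs_diff_def: "\<bar>x :: 'a diff\<bar> = (if x < 0 then - x else x)"
definition sgn_diff_def: "sgn (x :: 'a diff) = (if x = 0 then 0 else if 0 < x then 1 else - 1)"

instance
proof
  fix x y z :: "'a diff"
  show "x + y + z = x + (y + z)" by transfer (auto simp: algebra_simps)
  show "x + y = y + x" by transfer (auto simp: algebra_simps)
  show "0 + x = x" by transfer auto
  show "- x + x = 0" by transfer (auto simp: algebra_simps)
  show "x - y = x + - y" by transfer auto
  show "x + y - x = y" by transfer (auto simp: algebra_simps)
  show "x - y - z = x - (y + z)" by transfer (auto simp: algebra_simps)
  show "0 * x = 0" "x * 0 = 0" by (transfer; auto)+
  show "x * y * z = x * (y * z)" by transfer (auto simp: algebra_simps)
  show "x * y = y * x" by transfer (auto simp: algebra_simps)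
  show "1 * x = x" by transfer auto
  show "(x + y) * z = x * z + y * z" by transfer (auto simp: algebra_simps)
  show "(0::'a diff) \<noteq> 1" by transfer auto
  show "x < y \<longleftrightarrow> x \<le> y \<and> \<not> y \<le> x" by transfer auto
  show "x \<le> x" by transfer auto
  show "x \<le> y \<or> y \<le> x" by transfer auto
  show "x = y" if "x \<le> y" "y \<le> x" using that by transfer auto
  show "x \<le> z" if "x \<le> y" "y \<le> z"
    using that
  proof (transfer, clarify)
    fix a b c d e f :: 'a
    assume "a + d \<le> c + b" "c + f \<le> e + d"
    from add_mono[OF this] have "(a + f) + (c + d) \<le> (e + b) + (c + d)" by (simp add: algebra_simps)
    then show "a + f \<le> e + b" by simp
  qed
  show "z + x \<le> z + y" if "x \<le> y"
    using that
  proof (transfer, clarify)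
    fix a b c d e f :: 'a
    assume "a + d \<le> c + b"
    from add_right_mono[OF this, of "e + f"] show "e + a + (f + d) \<le> e + c + (f + b)"
      by (simp add: algebra_simps)
  qed
  show "z * x < z * y" if "x < y" "0 < z"
    using that
  proof (transfer, clarify)
    fix a b c d e f :: 'a
    assume 1: "a + d < c + b" and "0 + f < e + 0"
    then have "f < e" by simp
    then obtain g where g: "e = f + g" "0 < g" using less_iff_add_pos[THEN iffD1] by blast
    have "g * (a + d) < g * (c + b)" using 1 g(2) by (rule mult_strict_left_mono)
    then have "g * (a + d) + f * (a + b + c + d) < g * (c + b) + f * (a + b + c + d)" by simp
    moreover have "e * a + f * b + (e * d + f * c) = g * (a + d) + f * (a + b + c + d)"
      "e * c + f * d + (e * b + f * a) = g * (c + b) + f * (a + b + c + d)"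
      unfolding g(1) by (simp_all add: algebra_simps)
    ultimately show "e * a + f * b + (e * d + f * c) < e * c + f * d + (e * b + f * a)" by simp
  qed
qed (simp_all add: abs_diff_def sgn_diff_def)

end

lift_definition of_semi :: "'a::linordered_semidom \<Rightarrow> 'a diff" is "\<lambda>x. (x, 0)" .

lemma of_semi_simps [simp]:
  "of_semi 0 = 0" "of_semi 1 = 1" "of_semi (x + y) = of_semi x + of_semi y"
  "of_semi (x * y) = of_semi x * of_semi y"
  "of_semi x = of_semi y \<longleftrightarrow> x = y" "of_semi x < of_semi y \<longleftrightarrow> x < y" "of_semi x \<le> of_semi y \<longleftrightarrow> x \<le> y"
  by (transfer; simp)+

lemma diff_cases: obtains x y where "z = of_semi x - of_semi y"
proof -
  have "\<exists>x y. z = of_semi x - of_semi y" by transfer auto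
  then show thesis using that by blast
qed

definition of_semi_fract :: "'a::linordered_semidom \<Rightarrow> 'a diff fract" where
  "of_semi_fract x = Fract (of_semi x) 1"

lemma of_semi_fract_simps [simp]:
  "of_semi_fract 0 = 0" "of_semi_fract 1 = 1" "of_semi_fract (x + y) = of_semi_fract x + of_semi_fract y"
  "of_semi_fract (x * y) = of_semi_fract x * of_semi_fract y"
  "of_semi_fract x = of_semi_fract y \<longleftrightarrow> x = y" "of_semi_fract x < of_semi_fract y \<longleftrightarrow> x < y"
  "of_semi_fract x \<le> of_semi_fract y \<longleftrightarrow> x \<le> y"
  by (simp_all add: of_semi_fract_def Zero_fract_def One_fract_def eq_fract)

text \<open>A denominator can be made positive, and a positive difference of elements of the
  semidomain is itself such an element. This puts every fraction in the shape of the triples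
  \<open>(a, b, d)\<close> of \<open>rat_t\<close>.\<close>

lemma fract_cases_semi:
  fixes q :: "'a::linordered_semidom diff fract"
  obtains a b d where "d > 0" "q = (of_semi_fract a - of_semi_fract b) / of_semi_fract d"
proof -
  obtain z w where q: "q = Fract z w" "w > 0"
  proof (cases q rule: Fract_cases)
    case (Fract a b)
    then have "q = Fract (- a) (- b)" by (simp add: eq_fract)
    with Fract show thesis using that[of a b] that[of "- a" "- b"] by (cases "b > 0") auto
  qed
  obtain a b where z: "z = of_semi a - of_semi b" by (rule diff_cases)
  obtain c d where w: "w = of_semi c - of_semi d" by (rule diff_cases)
  then have "d < c" using q by simp
  then obtain g where g: "c = d + g" "0 < g" using less_iff_add_pos[THEN iffD1] by blast
  then have "w = of_semi g" using w by simp
  then have "q = (of_semi_fract a - of_semi_fract b) / of_semi_fract g"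
    using q z g by (simp add: of_semi_fract_def)
  then show thesis using that g by blast
qed

section \<open>The Cauchy completion of an ordered field\<close>

text \<open>The index type of the sequences is an arbitrary linear order: the model's natural numbers, along
  which the reals of the model converge, may be nonstandard.\<close>

definition vanishes :: "('i::linorder \<Rightarrow> 'a::linordered_field) \<Rightarrow> bool" where
  "vanishes X \<longleftrightarrow> (\<forall>r>0. \<forall>\<^sub>F n in at_top. \<bar>X n\<bar> < r)"

definition cauchy :: "('i::linorder \<Rightarrow> 'a::linordered_field) \<Rightarrow> bool" where
  "cauchy X \<longleftrightarrow> (\<forall>r>0. \<exists>k. \<forall>m\<ge>k. \<forall>n\<ge>k. \<bar>X m - X n\<bar> < r)"

lemma vanishes_0: "vanishes (\<lambda>n. 0)"
  by (simp add: vanishes_def)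

lemma vanishes_minus: "vanishes (\<lambda>n. - X n) = vanishes X"
  by (simp add: vanishes_def)

lemma vanishes_add:
  assumes "vanishes X" "vanishes Y" shows "vanishes (\<lambda>n. X n + Y n)"
  unfolding vanishes_def
proof (intro allI impI)
  fix r :: 'b assume "0 < r"
  then have "0 < r / 2" by simp
  with assms have "\<forall>\<^sub>F n in at_top. \<bar>X n\<bar> < r / 2" "\<forall>\<^sub>F n in at_top. \<bar>Y n\<bar> < r / 2"
    unfolding vanishes_def by blast+
  then show "\<forall>\<^sub>F n in at_top. \<bar>X n + Y n\<bar> < r"
  proof eventually_elim
    case (elim n)
    then show ?case using abs_triangle_ineq[of "X n" "Y n"] by linarith
  qed
qed

lemma vanishes_diff: "vanishes X \<Longrightarrow> vanishes Y \<Longrightarrow> vanishes (\<lambda>n. X n - Y n)"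
  using vanishes_add[of X "\<lambda>n. - Y n"] by (simp add: vanishes_minus)

lemma vanishes_mult:
  assumes "\<forall>\<^sub>F n in at_top. \<bar>X n\<bar> < b" "vanishes Y" shows "vanishes (\<lambda>n. X n * Y n)"
  unfolding vanishes_def
proof (intro allI impI)
  fix r :: 'b assume r: "0 < r"
  obtain n where "\<bar>X n\<bar> < b" using eventually_happens'[OF trivial_limit_at_top_linorder assms(1)] by blast
  then have b: "0 < b" using abs_ge_zero order.strict_trans1 by blast
  then have "0 < r / b" using r by simp
  then have "\<forall>\<^sub>F n in at_top. \<bar>Y n\<bar> < r / b" using assms(2) unfolding vanishes_def by blast
  with assms(1) show "\<forall>\<^sub>F n in at_top. \<bar>X n * Y n\<bar> < r"
  proof eventually_elim
    case (elim n)
    have "\<bar>X n\<bar> * \<bar>Y n\<bar> < b * (r / b)" using elim b by (intro mult_strict_mono) auto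
    then show ?case using b by (simp add: abs_mult)
  qed
qed

lemma cauchy_const: "cauchy (\<lambda>n. c)"
  by (simp add: cauchy_def)

lemma cauchyD: "cauchy X \<Longrightarrow> 0 < r \<Longrightarrow> \<exists>k. \<forall>m\<ge>k. \<forall>n\<ge>k. \<bar>X m - X n\<bar> < r"
  by (simp add: cauchy_def)

lemma cauchy_add:
  assumes "cauchy X" "cauchy Y" shows "cauchy (\<lambda>n. X n + Y n)"
  unfolding cauchy_def
proof (intro allI impI)
  fix r :: 'b assume "0 < r"
  then have r: "0 < r / 2" by simp
  obtain i where i: "\<forall>m\<ge>i. \<forall>n\<ge>i. \<bar>X m - X n\<bar> < r / 2" using cauchyD[OF assms(1) r] by blast
  obtain j where j: "\<forall>m\<ge>j. \<forall>n\<ge>j. \<bar>Y m - Y n\<bar> < r / 2" using cauchyD[OF assms(2) r] by blast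
  have "\<bar>X m + Y m - (X n + Y n)\<bar> < r" if "m \<ge> max i j" "n \<ge> max i j" for m n
  proof -
    have "\<bar>X m - X n\<bar> < r / 2" "\<bar>Y m - Y n\<bar> < r / 2" using that i j by auto
    moreover have "X m + Y m - (X n + Y n) = (X m - X n) + (Y m - Y n)" by simp
    ultimately show ?thesis using abs_triangle_ineq[of "X m - X n" "Y m - Y n"] by linarith
  qed
  then show "\<exists>k. \<forall>m\<ge>k. \<forall>n\<ge>k. \<bar>X m + Y m - (X n + Y n)\<bar> < r" by blast
qed

lemma cauchy_minus: "cauchy X \<Longrightarrow> cauchy (\<lambda>n. - X n)"
  unfolding cauchy_def by (simp add: abs_minus_commute)

lemma cauchy_bounded:
  assumes "cauchy X" obtains b where "b > 0" "\<forall>\<^sub>F n in at_top. \<bar>X n\<bar> < b"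
proof -
  obtain k where k: "\<forall>m\<ge>k. \<forall>n\<ge>k. \<bar>X m - X n\<bar> < 1" using cauchyD[OF assms, of 1] by auto
  have "\<bar>X n\<bar> < \<bar>X k\<bar> + 1" if "n \<ge> k" for n
    using k that abs_triangle_ineq[of "X n - X k" "X k"] by fastforce
  then have "\<forall>\<^sub>F n in at_top. \<bar>X n\<bar> < \<bar>X k\<bar> + 1" by (auto simp: eventually_at_top_linorder)
  moreover have "\<bar>X k\<bar> + 1 > 0" by (simp add: add_nonneg_pos)
  ultimately show thesis using that by blast
qed

lemma cauchy_mult:
  assumes "cauchy X" "cauchy Y" shows "cauchy (\<lambda>n. X n * Y n)"
  unfolding cauchy_def
proof (intro allI impI)
  fix r :: 'b assume r: "0 < r"
  obtain a where a: "a > 0" "\<forall>\<^sub>F n in at_top. \<bar>X n\<bar> < a" by (rule cauchy_bounded[OF assms(1)])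
  obtain b where b: "b > 0" "\<forall>\<^sub>F n in at_top. \<bar>Y n\<bar> < b" by (rule cauchy_bounded[OF assms(2)])
  obtain i1 where i1: "\<forall>n\<ge>i1. \<bar>X n\<bar> < a" using a by (auto simp: eventually_at_top_linorder)
  obtain i2 where i2: "\<forall>n\<ge>i2. \<bar>Y n\<bar> < b" using b by (auto simp: eventually_at_top_linorder)
  have "0 < r / 2 / b" "0 < r / 2 / a" using r a b by simp_all
  then obtain j1 j2 where j1: "\<forall>m\<ge>j1. \<forall>n\<ge>j1. \<bar>X m - X n\<bar> < r / 2 / b"
    and j2: "\<forall>m\<ge>j2. \<forall>n\<ge>j2. \<bar>Y m - Y n\<bar> < r / 2 / a"
    using cauchyD[OF assms(1)] cauchyD[OF assms(2)] by metis
  let ?k = "max (max i1 i2) (max j1 j2)"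
  have "\<bar>X m * Y m - X n * Y n\<bar> < r" if "m \<ge> ?k" "n \<ge> ?k" for m n
  proof -
    have "X m * Y m - X n * Y n = X m * (Y m - Y n) + (X m - X n) * Y n" by (simp add: algebra_simps)
    then have "\<bar>X m * Y m - X n * Y n\<bar> \<le> \<bar>X m\<bar> * \<bar>Y m - Y n\<bar> + \<bar>X m - X n\<bar> * \<bar>Y n\<bar>"
      using abs_triangle_ineq[of "X m * (Y m - Y n)" "(X m - X n) * Y n"] by (simp add: abs_mult)
    also have "\<dots> < a * (r / 2 / a) + (r / 2 / b) * b"
      using that i1 i2 j1 j2 a b r by (intro add_strict_mono mult_strict_mono) auto
    also have "\<dots> = r" using a b by simp
    finally show ?thesis .
  qed
  then show "\<exists>k. \<forall>m\<ge>k. \<forall>n\<ge>k. \<bar>X m * Y m - X n * Y n\<bar> < r" by blast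
qed

text \<open>Beyond an index from which the terms vary by less than \<open>r / 2\<close>, some term
  has absolute value at least \<open>r\<close>; all the others there share its sign and exceed
  \<open>r / 2\<close> in size.\<close>

lemma cauchy_not_vanishes:
  assumes "cauchy X" "\<not> vanishes X"
  obtains b where "b > 0" "(\<forall>\<^sub>F n in at_top. b < X n) \<or> (\<forall>\<^sub>F n in at_top. b < - X n)"
proof -
  obtain r where r: "r > 0" "\<not> (\<forall>\<^sub>F n in at_top. \<bar>X n\<bar> < r)" using assms(2) vanishes_def by blast
  then have "0 < r / 2" by simp
  then obtain k where k: "\<forall>m\<ge>k. \<forall>n\<ge>k. \<bar>X m - X n\<bar> < r / 2" using cauchyD[OF assms(1)] by blast
  obtain n where n: "n \<ge> k" "\<not> \<bar>X n\<bar> < r" using r(2) by (auto simp: eventually_at_top_linorder)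
  have near: "\<bar>X m - X n\<bar> < r / 2" if "m \<ge> k" for m using k n that by blast
  have "(\<forall>m\<ge>k. r / 2 < X m) \<or> (\<forall>m\<ge>k. r / 2 < - X m)"
  proof (cases "X n \<ge> 0")
    case True
    then have "r \<le> X n" using n by simp
    then have "r / 2 < X m" if "m \<ge> k" for m
      using near[OF that] unfolding abs_less_iff by (simp add: field_simps)
    then show ?thesis by blast
  next
    case False
    then have "r \<le> - X n" using n by simp
    then have "r / 2 < - X m" if "m \<ge> k" for m
      using near[OF that] unfolding abs_less_iff by (simp add: field_simps)
    then show ?thesis by blast
  qed
  then show thesis using that[of "r / 2"] \<open>0 < r / 2\<close> by (auto simp: eventually_at_top_linorder)
qed

lemma cauchy_away:
  assumes "cauchy X" "\<not> vanishes X"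
  obtains b where "b > 0" "\<forall>\<^sub>F n in at_top. b < \<bar>X n\<bar>"
proof -
  obtain b where b: "b > 0" "(\<forall>\<^sub>F n in at_top. b < X n) \<or> (\<forall>\<^sub>F n in at_top. b < - X n)"
    by (rule cauchy_not_vanishes[OF assms])
  then have "\<forall>\<^sub>F n in at_top. b < \<bar>X n\<bar>"
    by (auto elim!: eventually_mono)
  with b show thesis using that by blast
qed

lemma cauchy_inverse:
  assumes "cauchy X" "\<not> vanishes X" shows "cauchy (\<lambda>n. inverse (X n))"
  unfolding cauchy_def
proof (intro allI impI)
  fix r :: 'b assume r: "0 < r"
  obtain b where b: "b > 0" "\<forall>\<^sub>F n in at_top. b < \<bar>X n\<bar>" by (rule cauchy_away[OF assms])
  then obtain i where i: "\<forall>n\<ge>i. b < \<bar>X n\<bar>" by (auto simp: eventually_at_top_linorder)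
  have "0 < r * (b * b)" using r b by simp
  then obtain j where j: "\<forall>m\<ge>j. \<forall>n\<ge>j. \<bar>X m - X n\<bar> < r * (b * b)" using cauchyD[OF assms(1)] by blast
  have "\<bar>inverse (X m) - inverse (X n)\<bar> < r" if "m \<ge> max i j" "n \<ge> max i j" for m n
  proof -
    have mn: "b < \<bar>X m\<bar>" "b < \<bar>X n\<bar>" "\<bar>X m - X n\<bar> < r * (b * b)" using that i j by auto
    then have nz: "X m \<noteq> 0" "X n \<noteq> 0" using b by auto
    have bb: "b * b < \<bar>X m\<bar> * \<bar>X n\<bar>" using mn b by (intro mult_strict_mono) auto
    have "inverse (X m) - inverse (X n) = (X n - X m) / (X m * X n)" using nz by (simp add: field_simps)
    then have "\<bar>inverse (X m) - inverse (X n)\<bar> = \<bar>X m - X n\<bar> / (\<bar>X m\<bar> * \<bar>X n\<bar>)"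
      by (simp add: abs_mult abs_minus_commute)
    also have "\<dots> < r"
    proof -
      have "\<bar>X m - X n\<bar> < r * (\<bar>X m\<bar> * \<bar>X n\<bar>)"
        using mn(3) mult_strict_left_mono[OF bb r] by (rule order.strict_trans)
      moreover have "0 < \<bar>X m\<bar> * \<bar>X n\<bar>" using nz by simp
      ultimately show ?thesis by (simp add: divide_less_eq)
    qed
    finally show ?thesis .
  qed
  then show "\<exists>k. \<forall>m\<ge>k. \<forall>n\<ge>k. \<bar>inverse (X m) - inverse (X n)\<bar> < r" by blast
qed

text \<open>The difference of the inverses is a bounded sequence times the null sequence
  \<open>X n - Y n\<close>, but only where neither term is zero; hence the passage to a sequence
  that is eventually equal.\<close>

lemma vanishes_inverse_diff:
  assumes "cauchy X" "\<not> vanishes X" "cauchy Y" "\<not> vanishes Y" "vanishes (\<lambda>n. X n - Y n)"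
  shows "vanishes (\<lambda>n. inverse (X n) - inverse (Y n))"
proof -
  obtain a where a: "a > 0" "\<forall>\<^sub>F n in at_top. a < \<bar>X n\<bar>" by (rule cauchy_away[OF assms(1,2)])
  obtain b where b: "b > 0" "\<forall>\<^sub>F n in at_top. b < \<bar>Y n\<bar>" by (rule cauchy_away[OF assms(3,4)])
  have "cauchy (\<lambda>n. - (inverse (X n) * inverse (Y n)))"
    by (intro cauchy_minus cauchy_mult cauchy_inverse assms)
  then obtain c where "\<forall>\<^sub>F n in at_top. \<bar>- (inverse (X n) * inverse (Y n))\<bar> < c" by (rule cauchy_bounded)
  then have *: "vanishes (\<lambda>n. - (inverse (X n) * inverse (Y n)) * (X n - Y n))"
    using assms(5) by (rule vanishes_mult)
  have "\<forall>\<^sub>F n in at_top. - (inverse (X n) * inverse (Y n)) * (X n - Y n) = inverse (X n) - inverse (Y n)"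
    using a(2) b(2)
  proof eventually_elim
    case (elim n)
    then have "X n \<noteq> 0" "Y n \<noteq> 0" using a b by auto
    then show ?case by (simp add: field_simps)
  qed
  then have ev: "\<forall>\<^sub>F n in at_top. (\<bar>- (inverse (X n) * inverse (Y n)) * (X n - Y n)\<bar> < r)
      = (\<bar>inverse (X n) - inverse (Y n)\<bar> < r)" for r
    by eventually_elim simp
  have "(\<forall>\<^sub>F n in at_top. \<bar>- (inverse (X n) * inverse (Y n)) * (X n - Y n)\<bar> < r)
      = (\<forall>\<^sub>F n in at_top. \<bar>inverse (X n) - inverse (Y n)\<bar> < r)" for r
    using eventually_subst[OF ev] .
  with * show ?thesis unfolding vanishes_def by blast
qed

quotient_type (overloaded) ('i, 'a) completion = "'i::linorder \<Rightarrow> 'a::linordered_field" /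
  partial: "\<lambda>X Y. cauchy X \<and> cauchy Y \<and> vanishes (\<lambda>n. X n - Y n)"
  morphisms rep_completion lim_seq
proof (rule part_equivpI)
  show "\<exists>X::'i \<Rightarrow> 'a. cauchy X \<and> cauchy X \<and> vanishes (\<lambda>n. X n - X n)"
    by (rule exI[of _ "\<lambda>n. 0"]) (simp add: vanishes_0 cauchy_const)
  show "symp (\<lambda>(X::'i \<Rightarrow> 'a) Y. cauchy X \<and> cauchy Y \<and> vanishes (\<lambda>n. X n - Y n))"
    by (rule sympI) (use vanishes_minus in fastforce)
  show "transp (\<lambda>(X::'i \<Rightarrow> 'a) Y. cauchy X \<and> cauchy Y \<and> vanishes (\<lambda>n. X n - Y n))"
    by (rule transpI) (use vanishes_add in fastforce)
qed

instantiation completion :: (linorder, linordered_field) field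
begin

lift_definition zero_completion :: "('a, 'b) completion" is "\<lambda>n. 0"
  by (simp add: vanishes_0 cauchy_const)
lift_definition one_completion :: "('a, 'b) completion" is "\<lambda>n. 1"
  by (simp add: vanishes_0 cauchy_const)
lift_definition plus_completion :: "('a, 'b) completion \<Rightarrow> ('a, 'b) completion \<Rightarrow> ('a, 'b) completion"
  is "\<lambda>X Y n. X n + Y n"
proof -
  fix X X' Y Y' :: "'a \<Rightarrow> 'b"
  assume "cauchy X \<and> cauchy X' \<and> vanishes (\<lambda>n. X n - X' n)" "cauchy Y \<and> cauchy Y' \<and> vanishes (\<lambda>n. Y n - Y' n)"
  moreover from this have "vanishes (\<lambda>n. (X n - X' n) + (Y n - Y' n))" using vanishes_add by blast
  moreover have "(\<lambda>n. (X n - X' n) + (Y n - Y' n)) = (\<lambda>n. X n + Y n - (X' n + Y' n))" by auto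
  ultimately show "cauchy (\<lambda>n. X n + Y n) \<and> cauchy (\<lambda>n. X' n + Y' n) \<and> vanishes (\<lambda>n. X n + Y n - (X' n + Y' n))"
    by (auto simp: cauchy_add)
qed
lift_definition uminus_completion :: "('a, 'b) completion \<Rightarrow> ('a, 'b) completion" is "\<lambda>X n. - X n"
  using vanishes_minus by (fastforce simp: cauchy_minus)
lift_definition times_completion :: "('a, 'b) completion \<Rightarrow> ('a, 'b) completion \<Rightarrow> ('a, 'b) completion"
  is "\<lambda>X Y n. X n * Y n"
proof -
  fix X X' Y Y' :: "'a \<Rightarrow> 'b"
  assume *: "cauchy X \<and> cauchy X' \<and> vanishes (\<lambda>n. X n - X' n)" "cauchy Y \<and> cauchy Y' \<and> vanishes (\<lambda>n. Y n - Y' n)"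
  obtain a where "\<forall>\<^sub>F n in at_top. \<bar>X n\<bar> < a" using * cauchy_bounded by blast
  then have 1: "vanishes (\<lambda>n. X n * (Y n - Y' n))" using * vanishes_mult by blast
  obtain b where "\<forall>\<^sub>F n in at_top. \<bar>Y' n\<bar> < b" using * cauchy_bounded by blast
  then have 2: "vanishes (\<lambda>n. Y' n * (X n - X' n))" using * vanishes_mult by blast
  have "(\<lambda>n. X n * (Y n - Y' n) + Y' n * (X n - X' n)) = (\<lambda>n. X n * Y n - X' n * Y' n)"
    by (auto simp: algebra_simps)
  then show "cauchy (\<lambda>n. X n * Y n) \<and> cauchy (\<lambda>n. X' n * Y' n) \<and> vanishes (\<lambda>n. X n * Y n - X' n * Y' n)"
    using * vanishes_add[OF 1 2] by (auto simp: cauchy_mult)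
qed
lift_definition inverse_completion :: "('a, 'b) completion \<Rightarrow> ('a, 'b) completion"
  is "\<lambda>X. if vanishes X then (\<lambda>n. 0) else (\<lambda>n. inverse (X n))"
proof -
  fix X Y :: "'a \<Rightarrow> 'b"
  assume *: "cauchy X \<and> cauchy Y \<and> vanishes (\<lambda>n. X n - Y n)"
  then have "vanishes X = vanishes Y"
    using vanishes_diff[of X "\<lambda>n. X n - Y n"] vanishes_add[of "\<lambda>n. X n - Y n" Y] by auto
  then show "?thesis X Y" using * by (auto simp: vanishes_0 cauchy_const cauchy_inverse vanishes_inverse_diff)
qed
definition "x - y = x + - (y :: ('a, 'b) completion)"
definition "x div y = x * inverse (y :: ('a, 'b) completion)"

instance
proof
  fix x y z :: "('a, 'b) completion"
  show "x + y + z = x + (y + z)"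
    by transfer (auto simp: cauchy_add vanishes_0 algebra_simps)
  show "x + y = y + x" by transfer (auto simp: cauchy_add vanishes_0 algebra_simps)
  show "0 + x = x" by transfer (auto simp: vanishes_0)
  show "- x + x = 0" by transfer (auto simp: cauchy_minus vanishes_0 cauchy_add cauchy_const)
  show "x - y = x + - y" by (rule minus_completion_def)
  show "x * y * z = x * (y * z)" by transfer (auto simp: cauchy_mult vanishes_0 algebra_simps)
  show "x * y = y * x" by transfer (auto simp: cauchy_mult vanishes_0 algebra_simps)
  show "1 * x = x" by transfer (auto simp: vanishes_0)
  show "(x + y) * z = x * z + y * z"
    by transfer (auto simp: cauchy_mult cauchy_add vanishes_0 algebra_simps)
  show "(0::('a, 'b) completion) \<noteq> 1"
  proof transfer
    have "\<not> vanishes (\<lambda>n::'a. 0 - (1::'b))"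
    proof
      assume "vanishes (\<lambda>n::'a. 0 - (1::'b))"
      then have "\<forall>\<^sub>F n::'a in at_top. \<bar>0 - (1::'b)\<bar> < 1" unfolding vanishes_def by (metis zero_less_one)
      then show False by simp
    qed
    then show "\<not> (cauchy (\<lambda>n::'a. 0::'b) \<and> cauchy (\<lambda>n::'a. 1::'b) \<and> vanishes (\<lambda>n::'a. 0 - (1::'b)))" by blast
  qed
  show "inverse x * x = 1" if "x \<noteq> 0"
    using that
  proof transfer
    fix X :: "'a \<Rightarrow> 'b"
    assume X: "cauchy X \<and> cauchy X \<and> vanishes (\<lambda>n. X n - X n)"
      and "\<not> (cauchy X \<and> cauchy (\<lambda>n::'a. 0::'b) \<and> vanishes (\<lambda>n. X n - 0))"
    then have nv: "\<not> vanishes X" by (simp add: cauchy_const)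
    obtain b where b: "b > 0" "\<forall>\<^sub>F n in at_top. b < \<bar>X n\<bar>" using cauchy_away X nv by blast
    have "vanishes (\<lambda>n. inverse (X n) * X n - 1)"
      unfolding vanishes_def
    proof (intro allI impI)
      fix r :: 'b assume "0 < r"
      from b(2) show "\<forall>\<^sub>F n in at_top. \<bar>inverse (X n) * X n - 1\<bar> < r"
      proof eventually_elim
        case (elim n)
        then have "X n \<noteq> 0" using b by auto
        then show ?case using \<open>0 < r\<close> by simp
      qed
    qed
    then show "cauchy (\<lambda>n. (if vanishes X then \<lambda>n. 0 else (\<lambda>n. inverse (X n))) n * X n) \<and>
        cauchy (\<lambda>n::'a. 1::'b) \<and> vanishes (\<lambda>n. (if vanishes X then \<lambda>n. 0 else (\<lambda>n. inverse (X n))) n * X n - 1)"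
      using X nv by (simp add: cauchy_mult cauchy_inverse cauchy_const)
  qed
  show "x div y = x * inverse y" by (rule divide_completion_def)
  show "inverse (0::('a, 'b) completion) = 0" by transfer (simp add: vanishes_0 cauchy_const)
qed

end

text \<open>A positive lower bound is demanded because positive terms alone may converge to
  0.\<close>

lift_definition positive :: "('i::linorder, 'a::linordered_field) completion \<Rightarrow> bool"
  is "\<lambda>X. \<exists>r>0. \<forall>\<^sub>F n in at_top. r < X n"
proof -
  have *: "\<exists>r>0. \<forall>\<^sub>F n in at_top. r < Y n"
    if XY: "vanishes (\<lambda>n. X n - Y n)" "\<exists>r>0. \<forall>\<^sub>F n in at_top. r < X n" for X Y :: "'i \<Rightarrow> 'a"
  proof -
    obtain r where r: "r > 0" "\<forall>\<^sub>F n in at_top. r < X n" using XY(2) by blast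
    then have "0 < r / 2" by simp
    then have "\<forall>\<^sub>F n in at_top. \<bar>X n - Y n\<bar> < r / 2" using XY(1) unfolding vanishes_def by blast
    with r(2) have "\<forall>\<^sub>F n in at_top. r / 2 < Y n"
    proof eventually_elim
      case (elim n)
      then show ?case by linarith
    qed
    then show ?thesis using \<open>0 < r / 2\<close> by blast
  qed
  fix X Y :: "'i \<Rightarrow> 'a"
  assume "cauchy X \<and> cauchy Y \<and> vanishes (\<lambda>n. X n - Y n)"
  moreover from this have "vanishes (\<lambda>n. Y n - X n)" using vanishes_minus[of "\<lambda>n. X n - Y n"] by simp
  ultimately show "(\<exists>r>0. \<forall>\<^sub>F n in at_top. r < X n) = (\<exists>r>0. \<forall>\<^sub>F n in at_top. r < Y n)"
    using * by blast
qed

lemma positive_0: "\<not> positive 0"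
  by transfer auto

lemma positive_add: "positive x \<Longrightarrow> positive y \<Longrightarrow> positive (x + y)"
proof (transfer, clarify)
  fix X Y :: "'a \<Rightarrow> 'b" and r s :: 'b
  assume "0 < r" "0 < s" "\<forall>\<^sub>F n in at_top. r < X n" "\<forall>\<^sub>F n in at_top. s < Y n"
  moreover from this(3,4) have "\<forall>\<^sub>F n in at_top. r + s < X n + Y n"
    by eventually_elim (rule add_strict_mono)
  ultimately show "\<exists>r>0. \<forall>\<^sub>F n in at_top. r < X n + Y n" using add_pos_pos by blast
qed

lemma positive_mult: "positive x \<Longrightarrow> positive y \<Longrightarrow> positive (x * y)"
proof (transfer, clarify)
  fix X Y :: "'a \<Rightarrow> 'b" and r s :: 'b
  assume rs: "0 < r" "0 < s" and "\<forall>\<^sub>F n in at_top. r < X n" "\<forall>\<^sub>F n in at_top. s < Y n"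
  from this(3,4) have "\<forall>\<^sub>F n in at_top. r * s < X n * Y n"
  proof eventually_elim
    case (elim n)
    then show ?case using rs by (intro mult_strict_mono) auto
  qed
  then show "\<exists>r>0. \<forall>\<^sub>F n in at_top. r < X n * Y n" using rs mult_pos_pos by blast
qed

lemma positive_or_minus: "x \<noteq> 0 \<Longrightarrow> positive x \<or> positive (- x)"
proof transfer
  fix X :: "'a \<Rightarrow> 'b"
  assume "cauchy X \<and> cauchy X \<and> vanishes (\<lambda>n. X n - X n)"
    and "\<not> (cauchy X \<and> cauchy (\<lambda>n::'a. 0::'b) \<and> vanishes (\<lambda>n. X n - 0))"
  then have "cauchy X" "\<not> vanishes X" by (simp_all add: cauchy_const)
  then obtain b where "b > 0" "(\<forall>\<^sub>F n in at_top. b < X n) \<or> (\<forall>\<^sub>F n in at_top. b < - X n)"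
    by (rule cauchy_not_vanishes)
  then show "(\<exists>r>0. \<forall>\<^sub>F n in at_top. r < X n) \<or> (\<exists>r>0. \<forall>\<^sub>F n in at_top. r < - X n)" by blast
qed

instantiation completion :: (linorder, linordered_field) linordered_field
begin

definition less_completion_def: "x < (y :: ('a, 'b) completion) \<longleftrightarrow> positive (y - x)"
definition less_eq_completion_def: "x \<le> (y :: ('a, 'b) completion) \<longleftrightarrow> x = y \<or> positive (y - x)"
definition abs_completion_def: "\<bar>x :: ('a, 'b) completion\<bar> = (if x < 0 then - x else x)"
definition sgn_completion_def: "sgn (x :: ('a, 'b) completion) = (if x = 0 then 0 else if 0 < x then 1 else - 1)"

instance
proof
  fix x y z :: "('a, 'b) completion"
  have anti: "\<not> (positive (y - x) \<and> positive (x - y))" for x y :: "('a, 'b) completion"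
    using positive_add[of "y - x" "x - y"] by (auto simp: positive_0)
  show "x < y \<longleftrightarrow> x \<le> y \<and> \<not> y \<le> x"
    using anti[of x y] by (auto simp: less_completion_def less_eq_completion_def positive_0)
  show "x \<le> x" by (simp add: less_eq_completion_def)
  show "x \<le> z" if "x \<le> y" "y \<le> z"
    using that positive_add[of "y - x" "z - y"] by (auto simp: less_eq_completion_def)
  show "x = y" if "x \<le> y" "y \<le> x"
    using that anti[of x y] by (auto simp: less_eq_completion_def)
  show "x \<le> y \<or> y \<le> x"
    using positive_or_minus[of "x - y"] by (auto simp: less_eq_completion_def)
  show "z + x \<le> z + y" if "x \<le> y" using that by (auto simp: less_eq_completion_def)
  show "z * x < z * y" if "x < y" "0 < z"
    using that positive_mult[of z "y - x"] by (simp add: less_completion_def algebra_simps)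
qed (simp_all add: abs_completion_def sgn_completion_def)

end

lift_definition const :: "'a::linordered_field \<Rightarrow> ('i::linorder, 'a) completion" is "\<lambda>c n. c"
  by (simp add: cauchy_const vanishes_0)

lemma const_minus [simp]: "const (- x) = - const x"
  by transfer (simp add: cauchy_const vanishes_0)

lemma const_simps [simp]:
  "const 0 = 0" "const 1 = 1" "const (x + y) = const x + const y" "const (x * y) = const x * const y"
  by (transfer; simp add: cauchy_const vanishes_0)+

lemma const_diff [simp]: "const (x - y) = const x - const y"
  using const_simps(3)[of x "- y"] by simp

lemma positive_const: "positive (const z) \<longleftrightarrow> 0 < z"
  by transfer (use dense in \<open>auto simp: eventually_at_top_linorder\<close>)

lemma const_less [simp]: "const x < const y \<longleftrightarrow> x < y"
  using positive_const[of "y - x"] by (simp add: less_completion_def)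

lemma const_le [simp]: "const x \<le> const y \<longleftrightarrow> x \<le> y"
  by (simp add: linorder_not_less[symmetric])

lemma const_eq [simp]: "const x = const y \<longleftrightarrow> x = y"
  by (simp add: order_eq_iff)

lemma const_inverse [simp]: "const (inverse x) = inverse (const x)"
proof (cases "x = 0")
  case False
  then have "const x * const (inverse x) = 1" by (simp flip: const_simps)
  then show ?thesis using inverse_unique by metis
qed simp

lemma const_divide [simp]: "const (x / y) = const x / const y"
  by (simp add: divide_inverse)

lemma const_abs [simp]: "const \<bar>x\<bar> = \<bar>const x\<bar>"
  by (simp add: abs_if flip: const_simps(1))

lemma const_numeral [simp]: "const (numeral n) = numeral n"
proof -
  have "const (of_nat n) = of_nat n" for n by (induction n) simp_all
  from this[of "numeral n"] show ?thesis by simp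
qed

lemma completion_cases: obtains X where "cauchy X" "x = lim_seq X"
proof -
  have "\<exists>X. cauchy X \<and> x = lim_seq X" by (rule completion.abs_induct) blast
  then show thesis using that by blast
qed

lemma lim_seq_minus: "cauchy X \<Longrightarrow> - lim_seq X = lim_seq (\<lambda>n. - X n)"
  by (simp add: uminus_completion.abs_eq vanishes_0)

lemma lim_seq_le:
  fixes X :: "'i::linorder \<Rightarrow> 'a::linordered_field"
  assumes "cauchy X" "\<forall>\<^sub>F n in at_top. X n \<le> c"
  shows "lim_seq X \<le> const c"
proof (rule ccontr)
  assume "\<not> ?thesis"
  then have "positive (lim_seq X + const (- c))" by (simp add: less_completion_def linorder_not_le)
  moreover have "lim_seq X + const (- c) = lim_seq (\<lambda>n. X n + - c)"
    unfolding const.abs_eq by (rule plus_completion.abs_eq) (simp_all add: assms cauchy_const vanishes_0)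
  moreover have "cauchy (\<lambda>n. X n + - c)" using assms(1) cauchy_const by (rule cauchy_add)
  ultimately have "\<exists>r>0. \<forall>\<^sub>F n in at_top. r < X n + - c"
    by (simp add: positive.abs_eq vanishes_0)
  then obtain r where r: "r > 0" "\<forall>\<^sub>F n in at_top. r < X n + - c" by blast
  from r(2) assms(2) have "\<forall>\<^sub>F n::'i in at_top. False"
  proof eventually_elim
    case (elim n)
    then show ?case using r(1) by simp
  qed
  then show False by simp
qed

lemma lim_seq_ge:
  assumes "cauchy X" "\<forall>\<^sub>F n in at_top. c \<le> X n"
  shows "const c \<le> lim_seq X"
proof -
  have "lim_seq (\<lambda>n. - X n) \<le> const (- c)"
    by (rule lim_seq_le) (use assms cauchy_minus in auto)
  then show ?thesis using lim_seq_minus[OF assms(1)] by simp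
qed

lemma const_below_positive:
  assumes "0 < x" obtains r where "0 < r" "const r \<le> x"
proof -
  obtain X where X: "cauchy X" "x = lim_seq X" by (rule completion_cases)
  have "positive (lim_seq X)" using assms X(2) by (simp add: less_completion_def)
  then have "\<exists>r>0. \<forall>\<^sub>F n in at_top. r < X n" using X(1) by (simp add: positive.abs_eq vanishes_0)
  then obtain r where r: "0 < r" "\<forall>\<^sub>F n in at_top. r < X n" by blast
  then have "const r \<le> lim_seq X"
    using X(1) by (intro lim_seq_ge) (auto elim: eventually_mono)
  then show thesis using that r X(2) by blast
qed

lemma const_dense:
  fixes x y :: "('i::linorder, 'a::linordered_field) completion"
  assumes "x < y" obtains q where "x < const q" "const q < y"
proof -
  obtain r where r: "0 < r" "const r \<le> y - x" using const_below_positive[of "y - x"] assms by auto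
  obtain X where X: "cauchy X" "x = lim_seq X" by (rule completion_cases)
  \<comment> \<open>\<open>X k\<close> misses \<open>x\<close> by at most \<open>r / 4\<close>, so
    \<open>X k + r / 2\<close> lies between \<open>r / 4\<close> and \<open>3 * r / 4\<close> above
    \<open>x\<close>, short of \<open>y\<close>.\<close>
  have r4: "0 < r / 4" using r by simp
  then obtain k where k: "\<forall>m\<ge>k. \<forall>n\<ge>k. \<bar>X m - X n\<bar> < r / 4" using cauchyD[OF X(1)] by blast
  have "X n \<le> X k + r / 4" "X k - r / 4 \<le> X n" if "n \<ge> k" for n
  proof -
    have "\<bar>X n - X k\<bar> < r / 4" using k that by blast
    then show "X n \<le> X k + r / 4" "X k - r / 4 \<le> X n" by linarith+
  qed
  then have "\<forall>\<^sub>F n in at_top. X n \<le> X k + r / 4" "\<forall>\<^sub>F n in at_top. X k - r / 4 \<le> X n"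
    by (auto simp: eventually_at_top_linorder)
  then have "x \<le> const (X k + r / 4)" "const (X k - r / 4) \<le> x"
    unfolding X(2) using X(1) lim_seq_le lim_seq_ge by blast+
  then have le: "x \<le> const (X k) + const (r / 4)" "const (X k) - const (r / 4) \<le> x"
    by simp_all
  define e :: "('i, 'a) completion" where "e = const (r / 4)"
  have c4: "const r = 4 * e" "0 < e" unfolding e_def using r4 const_less[of 0 "r / 4"] by simp_all
  have q: "const (X k + r / 2) = const (X k) + 2 * e" by (simp add: e_def)
  have "x < const (X k + r / 2)" unfolding q using le[folded e_def] c4(2) by linarith
  moreover have "const (X k + r / 2) < y" unfolding q using le[folded e_def] c4 r(2) by linarith
  ultimately show thesis using that by blast
qed

section \<open>Models of the base theory\<close>

abbreviation base_theory :: "fm set" where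
  "base_theory \<equiv> ACA0\<omega> \<union> QF_AC T0 T1 \<union> FIN"

lemma sat_form [simp]:
  "sat S e ((\<^bold>\<forall>x\<^bold>:\<sigma>. P x) d) \<longleftrightarrow> (\<forall>a\<in>elts \<sigma>. sat S (e((d, \<sigma>) := a)) (P (Var d \<sigma>) (Suc d)))"
  "sat S e ((\<^bold>\<exists>x\<^bold>:\<sigma>. P x) d) \<longleftrightarrow> (\<exists>a\<in>elts \<sigma>. sat S (e((d, \<sigma>) := a)) (P (Var d \<sigma>) (Suc d)))"
  "sat S e ((F \<^bold>\<longrightarrow> G) d) \<longleftrightarrow> (sat S e (F d) \<longrightarrow> sat S e (G d))"
  "sat S e ((F \<^bold>\<and> G) d) \<longleftrightarrow> (sat S e (F d) \<and> sat S e (G d))"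
  "sat S e ((F \<^bold>\<or> G) d) \<longleftrightarrow> (sat S e (F d) \<or> sat S e (G d))"
  "sat S e ((F \<^bold>\<longleftrightarrow> G) d) \<longleftrightarrow> (sat S e (F d) \<longleftrightarrow> sat S e (G d))"
  "sat S e ((\<^bold>\<not> F) d) \<longleftrightarrow> \<not> sat S e (F d)"
  "sat S e ((t \<^bold>= u) d) \<longleftrightarrow> FEq (eval e t) (eval e u) \<in> S"
  "sat S e ((t \<^bold>< u) d) \<longleftrightarrow> FLess (eval e t) (eval e u) \<in> S"
  "sat S e ((t \<^bold>\<le> u) d) \<longleftrightarrow> FLess (eval e t) (eval e u) \<in> S \<or> FEq (eval e t) (eval e u) \<in> S"
  by (auto simp: All_f_def Ex_f_def Imp_f_def And_f_def Or_f_def Iff_f_def Not_f_def Eq_f_def Less_f_def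
      Le_f_def FNot_def)

lemma sat_FNot [simp]: "sat S e (FNot A) \<longleftrightarrow> \<not> sat S e A"
  by (simp add: FNot_def)

lemma sat_FEx [simp]: "sat S e (FEx i \<sigma> A) \<longleftrightarrow> (\<exists>a\<in>elts \<sigma>. sat S (e((i, \<sigma>) := a)) A)"
  by (simp add: FEx_def)

lemma wf_form [simp]:
  "wf_fm ((\<^bold>\<forall>x\<^bold>:\<sigma>. P x) d) \<longleftrightarrow> wf_fm (P (Var d \<sigma>) (Suc d))"
  "wf_fm ((\<^bold>\<exists>x\<^bold>:\<sigma>. P x) d) \<longleftrightarrow> wf_fm (P (Var d \<sigma>) (Suc d))"
  "wf_fm ((F \<^bold>\<longrightarrow> G) d) \<longleftrightarrow> wf_fm (F d) \<and> wf_fm (G d)"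
  "wf_fm ((F \<^bold>\<and> G) d) \<longleftrightarrow> wf_fm (F d) \<and> wf_fm (G d)"
  "wf_fm ((F \<^bold>\<or> G) d) \<longleftrightarrow> wf_fm (F d) \<and> wf_fm (G d)"
  "wf_fm ((F \<^bold>\<longleftrightarrow> G) d) \<longleftrightarrow> wf_fm (F d) \<and> wf_fm (G d)"
  "wf_fm ((\<^bold>\<not> F) d) \<longleftrightarrow> wf_fm (F d)"
  "wf_fm ((t \<^bold>= u) d) \<longleftrightarrow> typed t T0 \<and> typed u T0"
  "wf_fm ((t \<^bold>< u) d) \<longleftrightarrow> typed t T0 \<and> typed u T0"
  "wf_fm ((t \<^bold>\<le> u) d) \<longleftrightarrow> typed t T0 \<and> typed u T0"
  by (auto simp: All_f_def Ex_f_def Imp_f_def And_f_def Or_f_def Iff_f_def Not_f_def Eq_f_def Less_f_def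
      Le_f_def FNot_def)

lemma wf_FEx [simp]: "wf_fm (FEx i \<sigma> A) = wf_fm A"
  by (simp add: FEx_def)

text \<open>A formula written at depth \<open>d\<close> has used only names below \<open>d\<close>.
  By \<open>eval_below\<close> the variable bound next leaves the values of its terms alone, which
  lets simplification compute the meaning of a \<open>form\<close>.\<close>

definition below :: "nat \<Rightarrow> tm \<Rightarrow> bool" where
  "below d t \<longleftrightarrow> (\<forall>x\<in>fv_tm t. fst x < d)"

lemma below_simps [simp]:
  "below d (Var i \<sigma>) \<longleftrightarrow> i < d" "below d (Cst c)" "below d (t \<cdot> u) \<longleftrightarrow> below d t \<and> below d u"
  by (auto simp: below_def)

lemma below_Suc [simp]: "below d t \<Longrightarrow> below (Suc d) t"
  by (auto simp: below_def)

lemma eval_below [simp]: "below d t \<Longrightarrow> eval (e((d, \<sigma>) := a)) t = eval e t"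
  by (induction t) auto

lemma wf_eq_ty: "typed t \<sigma> \<Longrightarrow> typed u \<sigma> \<Longrightarrow> wf_fm (eq_ty \<sigma> t u d)"
  by (induction \<sigma> arbitrary: t u d) auto

lemma eval_subst_tm: "eval e (subst_tm s x t) = eval (e(x := eval e s)) t"
  by (induction t) auto

text \<open>Without quantifiers there is nothing to capture a variable, and the schemata substitute
  only into quantifier-free formulas.\<close>

lemma sat_subst_qf: "qf A \<Longrightarrow> sat S e (subst s x A) = sat S (e(x := eval e s)) A"
  by (induction A) (simp_all add: eval_subst_tm)

lemma elts_App [intro]: "f \<in> elts (\<sigma> \<rightarrow> \<tau>) \<Longrightarrow> a \<in> elts \<sigma> \<Longrightarrow> f \<cdot> a \<in> elts \<tau>"
  by (auto simp: elts_def)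

lemma elts_Cst: "Cst c \<in> elts (cst_ty c)"
  by (simp add: elts_def)

lemma elts_consts [simp, intro]:
  "\<^bold>0 \<in> elts T0" "\<^bold>1 \<in> elts T0" "Cst CPlus \<in> elts (T0 \<rightarrow> T0 \<rightarrow> T0)" "Cst CTimes \<in> elts (T0 \<rightarrow> T0 \<rightarrow> T0)"
  "Cst CRec \<in> elts ((T0 \<rightarrow> T0 \<rightarrow> T0) \<rightarrow> T0 \<rightarrow> T0 \<rightarrow> T0)"
  "Cst (CPi \<rho> \<sigma>) \<in> elts (\<rho> \<rightarrow> \<sigma> \<rightarrow> \<rho>)"
  "Cst (CSigma \<rho> \<sigma> \<tau>) \<in> elts ((\<rho> \<rightarrow> \<sigma> \<rightarrow> \<tau>) \<rightarrow> (\<rho> \<rightarrow> \<sigma>) \<rightarrow> \<rho> \<rightarrow> \<tau>)"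
  by (simp_all add: elts_def)

lemma elts_plus [simp, intro]: "a \<in> elts T0 \<Longrightarrow> b \<in> elts T0 \<Longrightarrow> a \<^bold>+ b \<in> elts T0"
  by (meson elts_App elts_consts)

lemma elts_times [simp, intro]: "a \<in> elts T0 \<Longrightarrow> b \<in> elts T0 \<Longrightarrow> a \<^bold>* b \<in> elts T0"
  by (meson elts_App elts_consts)

lemma elts_T1 [simp, intro]: "f \<in> elts T1 \<Longrightarrow> a \<in> elts T0 \<Longrightarrow> f \<cdot> a \<in> elts T0"
  by (rule elts_App)

lemma elts_T2 [simp, intro]: "f \<in> elts T2 \<Longrightarrow> a \<in> elts T1 \<Longrightarrow> f \<cdot> a \<in> elts T0"
  by (rule elts_App)

lemma elts_eval: "env e \<Longrightarrow> typed t \<sigma> \<Longrightarrow> eval e t \<in> elts \<sigma>"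
proof (induction t arbitrary: \<sigma>)
  case (Var i \<tau>)
  then show ?case by (auto simp: env_def)
next
  case (Cst c)
  then show ?case using elts_Cst by auto
next
  case (App t u)
  then show ?case by (auto intro!: elts_App)
qed

definition is_model :: "fm set \<Rightarrow> bool" where
  "is_model S \<longleftrightarrow> (\<forall>B\<in>base_theory. wf_fm B \<longrightarrow> (\<forall>e. env e \<longrightarrow> sat S e B))"

text \<open>Applicative terms over the model, the variables being read from the environment. They
  are functions of environments because the elements of the model are themselves terms with free
  variables, their parameters.\<close>

inductive definable :: "ty \<Rightarrow> ((nat \<times> ty \<Rightarrow> tm) \<Rightarrow> tm) \<Rightarrow> bool" where
  definable_var: "definable \<sigma> (\<lambda>e. e (i, \<sigma>))"
| definable_const: "a \<in> elts \<sigma> \<Longrightarrow> definable \<sigma> (\<lambda>e. a)"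
| definable_app: "definable (\<sigma> \<rightarrow> \<tau>) G \<Longrightarrow> definable \<sigma> F \<Longrightarrow> definable \<tau> (\<lambda>e. G e \<cdot> F e)"

lemma definable_elts: "definable \<sigma> G \<Longrightarrow> env e \<Longrightarrow> G e \<in> elts \<sigma>"
  by (induction rule: definable.induct) (auto simp: env_def)

lemma definable_eval: "typed t \<sigma> \<Longrightarrow> definable \<sigma> (\<lambda>e. eval e t)"
proof (induction t arbitrary: \<sigma>)
  case (Cst c)
  then show ?case using elts_Cst by (auto intro: definable_const)
next
  case (Var i \<tau>)
  then show ?case using definable_var[of \<sigma> i] by simp
next
  case (App t u)
  then obtain \<rho> where "typed t (\<rho> \<rightarrow> \<sigma>)" "typed u \<rho>" by auto
  then show ?case using definable_app[OF App.IH] by simp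
qed

locale model =
  fixes S :: "fm set"
  assumes is_model: "is_model S"
begin

definition E :: "tm \<Rightarrow> tm \<Rightarrow> bool" where "E a b \<longleftrightarrow> FEq a b \<in> S"
definition L :: "tm \<Rightarrow> tm \<Rightarrow> bool" where "L a b \<longleftrightarrow> FLess a b \<in> S"

lemma FEq_mem [simp]: "FEq a b \<in> S \<longleftrightarrow> E a b" by (simp add: E_def)
lemma FLess_mem [simp]: "FLess a b \<in> S \<longleftrightarrow> L a b" by (simp add: L_def)

primrec eqv :: "ty \<Rightarrow> tm \<Rightarrow> tm \<Rightarrow> bool" where
  "eqv T0 a b \<longleftrightarrow> E a b"
| "eqv (\<sigma> \<rightarrow> \<tau>) a b \<longleftrightarrow> (\<forall>x\<in>elts \<sigma>. eqv \<tau> (a \<cdot> x) (b \<cdot> x))"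

lemma sat_eq_ty: "below d t \<Longrightarrow> below d u \<Longrightarrow> sat S e (eq_ty \<sigma> t u d) \<longleftrightarrow> eqv \<sigma> (eval e t) (eval e u)"
  by (induction \<sigma> arbitrary: t u d e) simp_all

lemma axiom_sat: "B \<in> base_theory \<Longrightarrow> wf_fm B \<Longrightarrow> env e \<Longrightarrow> sat S e B"
  using is_model by (auto simp: is_model_def)

text \<open>An arbitrary environment: 1 is odd, so \<open>Var 1 \<sigma>\<close> is a parameter of
  type \<open>\<sigma>\<close>.\<close>

definition e0 :: "nat \<times> ty \<Rightarrow> tm" where "e0 = (\<lambda>(i, \<sigma>). Var 1 \<sigma>)"

lemma env_e0 [simp]: "env e0"
  by (auto simp: env_def e0_def elts_def)

text \<open>The interleaving of quantifiers and implications is the one that simplification leaves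
  when it unfolds the truth of the axioms, so that each fact is literally a conjunct of the
  result.\<close>

lemma arith_facts:
  "\<forall>x\<in>elts T0. E x x" (is ?X1)
  "\<forall>x\<in>elts T0. \<forall>y\<in>elts T0. E x y \<longrightarrow> E y x" (is ?X2)
  "\<forall>x\<in>elts T0. \<forall>y\<in>elts T0. E x y \<longrightarrow> (\<forall>z\<in>elts T0. E y z \<longrightarrow> E x z)" (is ?X3)
  "\<forall>x\<in>elts T0. \<forall>y\<in>elts T0. E x y \<longrightarrow> (\<forall>u\<in>elts T0. \<forall>v\<in>elts T0. E u v \<longrightarrow> L x u \<longrightarrow> L y v)" (is ?X4)
  "\<forall>x\<in>elts T0. \<not> E (x \<^bold>+ \<^bold>1) \<^bold>0" (is ?X5)
  "\<forall>x\<in>elts T0. \<forall>y\<in>elts T0. E (x \<^bold>+ \<^bold>1) (y \<^bold>+ \<^bold>1) \<longrightarrow> E x y" (is ?X6)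
  "\<forall>x\<in>elts T0. E (x \<^bold>+ \<^bold>0) x" (is ?X7)
  "\<forall>x\<in>elts T0. \<forall>y\<in>elts T0. E (x \<^bold>+ (y \<^bold>+ \<^bold>1)) ((x \<^bold>+ y) \<^bold>+ \<^bold>1)" (is ?X8)
  "\<forall>x\<in>elts T0. E (x \<^bold>* \<^bold>0) \<^bold>0" (is ?X9)
  "\<forall>x\<in>elts T0. \<forall>y\<in>elts T0. E (x \<^bold>* (y \<^bold>+ \<^bold>1)) (x \<^bold>* y \<^bold>+ x)" (is ?X10)
  "\<forall>x\<in>elts T0. \<not> L x \<^bold>0" (is ?X11)
  "\<forall>x\<in>elts T0. \<forall>y\<in>elts T0. L x (y \<^bold>+ \<^bold>1) \<longleftrightarrow> L x y \<or> E x y" (is ?X12)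
proof -
  have "\<forall>B\<in>arith_ax. wf_fm B \<longrightarrow> sat S e0 B"
    using axiom_sat env_e0 unfolding ACA0\<omega>_def RCA0\<omega>_def by blast
  then have *: "\<forall>F\<in>F. wf_fm (F 0) \<longrightarrow> sat S e0 (F 0)" if "arith_ax = sentence ` F" for F
    unfolding that by (simp only: ball_simps sentence_def)
  show ?X1 ?X2 ?X3 ?X4 ?X5 ?X6 ?X7 ?X8 ?X9 ?X10 ?X11 ?X12
    by (insert *[OF arith_ax_def, simplified], elim conjE, assumption)+
qed

lemma E_refl: "a \<in> elts T0 \<Longrightarrow> E a a"
  using arith_facts(1) by blast

lemma E_sym: "E a b \<Longrightarrow> a \<in> elts T0 \<Longrightarrow> b \<in> elts T0 \<Longrightarrow> E b a"
  using arith_facts(2) by blast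

lemma E_trans: "E a b \<Longrightarrow> E b c \<Longrightarrow> a \<in> elts T0 \<Longrightarrow> b \<in> elts T0 \<Longrightarrow> c \<in> elts T0 \<Longrightarrow> E a c"
  using arith_facts(3) by blast

lemma L_cong:
  "L a b \<Longrightarrow> E a a' \<Longrightarrow> E b b' \<Longrightarrow> a \<in> elts T0 \<Longrightarrow> b \<in> elts T0 \<Longrightarrow> a' \<in> elts T0 \<Longrightarrow> b' \<in> elts T0 \<Longrightarrow> L a' b'"
  using arith_facts(4) by blast

lemma rec_facts:
  "\<forall>f\<in>elts (T0 \<rightarrow> T0 \<rightarrow> T0). \<forall>a\<in>elts T0. E (Cst CRec \<cdot> f \<cdot> a \<cdot> \<^bold>0) a"
  "\<forall>f\<in>elts (T0 \<rightarrow> T0 \<rightarrow> T0). \<forall>a\<in>elts T0. \<forall>n\<in>elts T0.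
    E (Cst CRec \<cdot> f \<cdot> a \<cdot> (n \<^bold>+ \<^bold>1)) (f \<cdot> n \<cdot> (Cst CRec \<cdot> f \<cdot> a \<cdot> n))"
proof -
  have "\<forall>B\<in>rec_ax. wf_fm B \<longrightarrow> sat S e0 B"
    using axiom_sat env_e0 unfolding ACA0\<omega>_def RCA0\<omega>_def by blast
  then have *: "\<forall>F\<in>F. wf_fm (F 0) \<longrightarrow> sat S e0 (F 0)" if "rec_ax = sentence ` F" for F
    unfolding that by (simp only: ball_simps sentence_def)
  show "\<forall>f\<in>elts (T0 \<rightarrow> T0 \<rightarrow> T0). \<forall>a\<in>elts T0. E (Cst CRec \<cdot> f \<cdot> a \<cdot> \<^bold>0) a"
    "\<forall>f\<in>elts (T0 \<rightarrow> T0 \<rightarrow> T0). \<forall>a\<in>elts T0. \<forall>n\<in>elts T0.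
      E (Cst CRec \<cdot> f \<cdot> a \<cdot> (n \<^bold>+ \<^bold>1)) (f \<cdot> n \<cdot> (Cst CRec \<cdot> f \<cdot> a \<cdot> n))"
    by (insert *[OF rec_ax_def, simplified], elim conjE, assumption)+
qed

lemma eqv_trans: "eqv \<sigma> a b \<Longrightarrow> eqv \<sigma> b c \<Longrightarrow> a \<in> elts \<sigma> \<Longrightarrow> b \<in> elts \<sigma> \<Longrightarrow> c \<in> elts \<sigma> \<Longrightarrow> eqv \<sigma> a c"
proof (induction \<sigma> arbitrary: a b c)
  case T0
  show ?case using T0.prems(1,2) by (simp, intro E_trans[OF _ _ T0.prems(3-5)])
next
  case (Fn \<sigma> \<tau>)
  show ?case unfolding eqv.simps
  proof
    fix x assume x: "x \<in> elts \<sigma>"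
    then have "eqv \<tau> (a \<cdot> x) (b \<cdot> x)" "eqv \<tau> (b \<cdot> x) (c \<cdot> x)" using Fn.prems(1,2) by simp_all
    then show "eqv \<tau> (a \<cdot> x) (c \<cdot> x)"
      by (rule Fn.IH(2)[OF _ _ elts_App[OF Fn.prems(3) x] elts_App[OF Fn.prems(4) x] elts_App[OF Fn.prems(5) x]])
  qed
qed

lemma base_subsets: "ext_ax \<subseteq> base_theory" "comb_ax \<subseteq> base_theory" "QF_IND \<subseteq> base_theory"
  "QF_AC T1 T0 \<subseteq> base_theory" "QF_AC T0 T1 \<subseteq> base_theory" "sentence Kleene_E2 \<in> base_theory"
  by (auto simp: ACA0\<omega>_def RCA0\<omega>_def)

lemma eqv_arg:
  assumes "f \<in> elts (\<rho> \<rightarrow> \<tau>)" "eqv \<rho> x y" "x \<in> elts \<rho>" "y \<in> elts \<rho>"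
  shows "eqv \<tau> (f \<cdot> x) (f \<cdot> y)"
proof -
  let ?F = "\<^bold>\<forall>x\<^bold>:\<rho>. \<^bold>\<forall>y\<^bold>:\<rho>. \<^bold>\<forall>f\<^bold>:\<rho> \<rightarrow> \<tau>. eq_ty \<rho> x y \<^bold>\<longrightarrow> eq_ty \<tau> (f \<cdot> x) (f \<cdot> y)"
  have "sentence ?F \<in> base_theory"
    by (rule subsetD[OF base_subsets(1)]) (unfold ext_ax_def, rule CollectI, rule exI[of _ \<rho>], rule exI[of _ \<tau>], simp)
  then have "sat S e0 (sentence ?F)" by (rule axiom_sat) (auto simp: sentence_def intro!: wf_eq_ty)
  then show ?thesis using assms by (simp add: sentence_def sat_eq_ty)
qed

lemma eqv_app:
  assumes "eqv (\<rho> \<rightarrow> \<tau>) f g" "eqv \<rho> x y" "f \<in> elts (\<rho> \<rightarrow> \<tau>)" "g \<in> elts (\<rho> \<rightarrow> \<tau>)" "x \<in> elts \<rho>" "y \<in> elts \<rho>"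
  shows "eqv \<tau> (f \<cdot> x) (g \<cdot> y)"
proof (rule eqv_trans[of _ _ "f \<cdot> y"])
  show "eqv \<tau> (f \<cdot> x) (f \<cdot> y)" using assms by (intro eqv_arg)
  show "eqv \<tau> (f \<cdot> y) (g \<cdot> y)" using assms by simp
qed (rule elts_App[OF assms(3,5)] elts_App[OF assms(3,6)] elts_App[OF assms(4,6)])+

lemma Pi_eqv:
  assumes "x \<in> elts \<rho>" "y \<in> elts \<tau>"
  shows "eqv \<rho> (Cst (CPi \<rho> \<tau>) \<cdot> x \<cdot> y) x"
proof -
  let ?F = "\<^bold>\<forall>x\<^bold>:\<rho>. \<^bold>\<forall>y\<^bold>:\<tau>. eq_ty \<rho> (Cst (CPi \<rho> \<tau>) \<cdot> x \<cdot> y) x"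
  have "sentence ?F \<in> base_theory"
    by (rule subsetD[OF base_subsets(2)]) (unfold comb_ax_def, rule UnI1, rule CollectI, rule exI[of _ \<rho>], rule exI[of _ \<tau>], simp)
  then have "sat S e0 (sentence ?F)" by (rule axiom_sat) (auto simp: sentence_def intro!: wf_eq_ty)
  then show ?thesis using assms by (simp add: sentence_def sat_eq_ty)
qed

lemma Sigma_eqv:
  assumes "x \<in> elts (\<rho> \<rightarrow> \<sigma> \<rightarrow> \<tau>)" "y \<in> elts (\<rho> \<rightarrow> \<sigma>)" "z \<in> elts \<rho>"
  shows "eqv \<tau> (Cst (CSigma \<rho> \<sigma> \<tau>) \<cdot> x \<cdot> y \<cdot> z) (x \<cdot> z \<cdot> (y \<cdot> z))"
proof -
  let ?F = "\<^bold>\<forall>x\<^bold>:\<rho> \<rightarrow> \<sigma> \<rightarrow> \<tau>. \<^bold>\<forall>y\<^bold>:\<rho> \<rightarrow> \<sigma>. \<^bold>\<forall>z\<^bold>:\<rho>.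
       eq_ty \<tau> (Cst (CSigma \<rho> \<sigma> \<tau>) \<cdot> x \<cdot> y \<cdot> z) (x \<cdot> z \<cdot> (y \<cdot> z))"
  have "sentence ?F \<in> base_theory"
    by (rule subsetD[OF base_subsets(2)]) (unfold comb_ax_def, rule UnI2, rule CollectI, rule exI[of _ \<rho>], rule exI[of _ \<sigma>], rule exI[of _ \<tau>], simp)
  then have "sat S e0 (sentence ?F)" by (rule axiom_sat) (auto simp: sentence_def intro!: wf_eq_ty)
  then show ?thesis using assms by (simp add: sentence_def sat_eq_ty)
qed

text \<open>Bracket abstraction: the abstracted variable becomes \<Sigma> \<Pi> \<Pi>, other
  variables and constants are put under \<Pi>, and an application becomes a \<Sigma>. The combinator
  axioms hold for \<open>eq_ty\<close>, hence the agreement is only up to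
  \<open>eqv\<close>.\<close>

lemma definable_lam:
  assumes "definable \<tau> G"
  obtains G' where "definable (\<sigma> \<rightarrow> \<tau>) G'"
    "\<And>e a. env e \<Longrightarrow> a \<in> elts \<sigma> \<Longrightarrow> eqv \<tau> (G' e \<cdot> a) (G (e((i, \<sigma>) := a)))"
proof -
  have "\<exists>G'. definable (\<sigma> \<rightarrow> \<tau>) G' \<and>
    (\<forall>e a. env e \<longrightarrow> a \<in> elts \<sigma> \<longrightarrow> eqv \<tau> (G' e \<cdot> a) (G (e((i, \<sigma>) := a))))"
    using assms
  proof induction
    case (definable_var \<tau> j)
    show ?case
    proof (cases "(j, \<tau>) = (i, \<sigma>)")
      case True
      let ?I = "Cst (CSigma \<sigma> (\<sigma> \<rightarrow> \<sigma>) \<sigma>) \<cdot> Cst (CPi \<sigma> (\<sigma> \<rightarrow> \<sigma>)) \<cdot> Cst (CPi \<sigma> \<sigma>)"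
      have I: "?I \<in> elts (\<sigma> \<rightarrow> \<sigma>)"
        by (rule elts_App[OF elts_App[OF elts_consts(7) elts_consts(6)] elts_consts(6)])
      have "eqv \<sigma> (?I \<cdot> a) a" if "a \<in> elts \<sigma>" for a
      proof (rule eqv_trans[of _ _ "Cst (CPi \<sigma> (\<sigma> \<rightarrow> \<sigma>)) \<cdot> a \<cdot> (Cst (CPi \<sigma> \<sigma>) \<cdot> a)"])
        show "eqv \<sigma> (?I \<cdot> a) (Cst (CPi \<sigma> (\<sigma> \<rightarrow> \<sigma>)) \<cdot> a \<cdot> (Cst (CPi \<sigma> \<sigma>) \<cdot> a))"
          using that by (intro Sigma_eqv elts_consts)
        show "eqv \<sigma> (Cst (CPi \<sigma> (\<sigma> \<rightarrow> \<sigma>)) \<cdot> a \<cdot> (Cst (CPi \<sigma> \<sigma>) \<cdot> a)) a"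
          using that by (intro Pi_eqv elts_App[OF elts_consts(6)])
      qed (use that I in \<open>auto intro!: elts_App[OF I] elts_App[OF elts_App[OF elts_consts(6)]] elts_App[OF elts_consts(6)]\<close>)
      then show ?thesis using True I by (intro exI[of _ "\<lambda>e. ?I"]) (auto intro: definable.definable_const)
    next
      case False
      have "definable (\<sigma> \<rightarrow> \<tau>) (\<lambda>e. Cst (CPi \<tau> \<sigma>) \<cdot> e (j, \<tau>))"
        by (rule definable_app[OF definable.definable_const[OF elts_consts(6)] definable.definable_var])
      moreover have "eqv \<tau> (Cst (CPi \<tau> \<sigma>) \<cdot> e (j, \<tau>) \<cdot> a) ((e((i, \<sigma>) := a)) (j, \<tau>))"
        if "env e" "a \<in> elts \<sigma>" for e a
        using that False Pi_eqv by (auto simp: env_def)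
      ultimately show ?thesis by blast
    qed
  next
    case (definable_const b \<tau>)
    then have "definable (\<sigma> \<rightarrow> \<tau>) (\<lambda>e. Cst (CPi \<tau> \<sigma>) \<cdot> b)"
      by (intro definable.definable_const elts_App[OF elts_consts(6)])
    moreover have "eqv \<tau> (Cst (CPi \<tau> \<sigma>) \<cdot> b \<cdot> a) b" if "a \<in> elts \<sigma>" for a
      using that definable_const by (intro Pi_eqv)
    ultimately show ?case by blast
  next
    case (definable_app \<rho> \<tau> G F)
    then obtain G' F' where
      G: "definable (\<sigma> \<rightarrow> \<rho> \<rightarrow> \<tau>) G'" "\<And>e a. env e \<Longrightarrow> a \<in> elts \<sigma> \<Longrightarrow> eqv (\<rho> \<rightarrow> \<tau>) (G' e \<cdot> a) (G (e((i, \<sigma>) := a)))"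
      and F: "definable (\<sigma> \<rightarrow> \<rho>) F'" "\<And>e a. env e \<Longrightarrow> a \<in> elts \<sigma> \<Longrightarrow> eqv \<rho> (F' e \<cdot> a) (F (e((i, \<sigma>) := a)))"
      by blast
    let ?H = "\<lambda>e. Cst (CSigma \<sigma> \<rho> \<tau>) \<cdot> G' e \<cdot> F' e"
    have H: "definable (\<sigma> \<rightarrow> \<tau>) ?H"
      by (rule definable.definable_app[OF definable.definable_app[OF definable.definable_const[OF elts_consts(7)] G(1)] F(1)])
    have "eqv \<tau> (?H e \<cdot> a) (G (e((i, \<sigma>) := a)) \<cdot> F (e((i, \<sigma>) := a)))" if e: "env e" and a: "a \<in> elts \<sigma>" for e a
    proof -
      have el: "G' e \<in> elts (\<sigma> \<rightarrow> \<rho> \<rightarrow> \<tau>)" "F' e \<in> elts (\<sigma> \<rightarrow> \<rho>)" "?H e \<in> elts (\<sigma> \<rightarrow> \<tau>)"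
        using definable_elts e G F H by blast+
      have ga: "G' e \<cdot> a \<in> elts (\<rho> \<rightarrow> \<tau>)" "F' e \<cdot> a \<in> elts \<rho>" using el a by auto
      have gg: "G (e((i, \<sigma>) := a)) \<in> elts (\<rho> \<rightarrow> \<tau>)" "F (e((i, \<sigma>) := a)) \<in> elts \<rho>"
        using definable_elts[OF definable_app.hyps(1)] definable_elts[OF definable_app.hyps(2)] env_upd[OF e a] by blast+
      show ?thesis
        by (rule eqv_trans[OF Sigma_eqv[OF el(1,2) a] eqv_app[OF G(2)[OF e a] F(2)[OF e a] ga(1) gg(1) ga(2) gg(2)]])
          (use el ga gg a in auto)
    qed
    with H show ?case by blast
  qed
  then show thesis using that by blast
qed

lemma QF_IND_sat:
  assumes "qf A" "wf_fm A" "env e" "sat S (e((i, T0) := \<^bold>0)) A"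
    "\<And>b. b \<in> elts T0 \<Longrightarrow> sat S (e((i, T0) := b)) A \<Longrightarrow> sat S (e((i, T0) := b \<^bold>+ \<^bold>1)) A"
    "a \<in> elts T0"
  shows "sat S (e((i, T0) := a)) A"
proof -
  let ?F = "FImp (subst \<^bold>0 (i, T0) A)
      (FImp (FAll i T0 (FImp A (subst (Var i T0 \<^bold>+ \<^bold>1) (i, T0) A))) (FAll i T0 A))"
  have "?F \<in> base_theory"
    by (rule subsetD[OF base_subsets(3)]) (unfold QF_IND_def, use assms(1,2) in blast)
  moreover have "wf_fm ?F" using assms(2) by (auto simp: wf_subst)
  ultimately have "sat S e ?F" using axiom_sat assms(3) by blast
  then show ?thesis using assms by (simp add: sat_subst_qf)
qed

text \<open>Addition recurses on its second argument, so identifying the constant 1 with the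
  successor of 0 takes an induction. \<open>CRec\<close> and the order are governed by successors,
  and what happens at 1 depends on this.\<close>

lemma zero_plus_one: "E (\<^bold>0 \<^bold>+ \<^bold>1) \<^bold>1"
proof -
  let ?A = "FEq (\<^bold>0 \<^bold>+ Var 0 T0) (Var 0 T0)"
  have "sat S (e0((0, T0) := \<^bold>1)) ?A"
  proof (rule QF_IND_sat)
    fix b assume b: "b \<in> elts T0" "sat S (e0((0, T0) := b)) ?A"
    then have "E (\<^bold>0 \<^bold>+ b) b" by simp
    then have "E (\<^bold>0 \<^bold>+ b \<^bold>+ \<^bold>1) (b \<^bold>+ \<^bold>1)"
      using b eqv_app[of T0 T0 "Cst CPlus \<cdot> (\<^bold>0 \<^bold>+ b)" "Cst CPlus \<cdot> b" "\<^bold>1" "\<^bold>1"]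
        eqv_arg[of "Cst CPlus" T0 "T0 \<rightarrow> T0" "\<^bold>0 \<^bold>+ b" b] elts_App[of "Cst CPlus" T0 "T0 \<rightarrow> T0"]
      by (simp add: E_refl)
    then have "E (\<^bold>0 \<^bold>+ (b \<^bold>+ \<^bold>1)) (b \<^bold>+ \<^bold>1)"
      using b by (intro E_trans[OF bspec[OF bspec[OF arith_facts(8)]]]) auto
    then show "sat S (e0((0, T0) := b \<^bold>+ \<^bold>1)) ?A" by simp
  qed (auto simp: arith_facts(7))
  then show ?thesis by simp
qed

lemma one_nonzero: "\<not> E \<^bold>1 \<^bold>0"
  using bspec[OF arith_facts(5), of "\<^bold>0"] E_trans[OF zero_plus_one] by auto

lemma QF_AC_sat:
  assumes "QF_AC \<rho> \<tau> \<subseteq> base_theory" "qf A" "wf_fm A" "(i, \<rho>) \<noteq> (j, \<tau>)" "(k, \<rho> \<rightarrow> \<tau>) \<notin> fv A" "env e"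
    "\<And>x. x \<in> elts \<rho> \<Longrightarrow> \<exists>y\<in>elts \<tau>. sat S (e((i, \<rho>) := x, (j, \<tau>) := y)) A"
  obtains Z where "Z \<in> elts (\<rho> \<rightarrow> \<tau>)"
    "\<And>x. x \<in> elts \<rho> \<Longrightarrow> sat S (e((k, \<rho> \<rightarrow> \<tau>) := Z, (i, \<rho>) := x, (j, \<tau>) := Z \<cdot> x)) A"
proof -
  let ?F = "FImp (FAll i \<rho> (FEx j \<tau> A))
      (FEx k (\<rho> \<rightarrow> \<tau>) (FAll i \<rho> (subst (Var k (\<rho> \<rightarrow> \<tau>) \<cdot> Var i \<rho>) (j, \<tau>) A)))"
  have "?F \<in> QF_AC \<rho> \<tau>" using assms(2-5) unfolding QF_AC_def by blast
  moreover have "wf_fm ?F" using assms(3) by (auto simp: wf_subst)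
  ultimately have "sat S e ?F" using axiom_sat assms(1,6) by blast
  \<comment> \<open>The choice functional and its argument are different variables even if their
    names coincide, since no type is its own function type.\<close>
  moreover have "\<rho> \<noteq> (\<rho> \<rightarrow> \<tau>)"
    by (rule size_neq_size_imp_neq) simp
  ultimately show thesis using assms(2,7) that by (auto simp: sat_subst_qf)
qed

lemma choice_basic:
  assumes AC: "QF_AC \<rho> \<tau> \<subseteq> base_theory" and Y: "Y \<in> elts (\<rho> \<rightarrow> \<tau> \<rightarrow> T0)"
    and ex: "\<And>x. x \<in> elts \<rho> \<Longrightarrow> \<exists>y\<in>elts \<tau>. E (Y \<cdot> x \<cdot> y) \<^bold>0"
  obtains Z where "Z \<in> elts (\<rho> \<rightarrow> \<tau>)" "\<And>x. x \<in> elts \<rho> \<Longrightarrow> E (Y \<cdot> x \<cdot> (Z \<cdot> x)) \<^bold>0"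
proof -
  let ?A = "FEq (Var 3 (\<rho> \<rightarrow> \<tau> \<rightarrow> T0) \<cdot> Var 0 \<rho> \<cdot> Var 1 \<tau>) \<^bold>0"
  let ?e = "e0((3, \<rho> \<rightarrow> \<tau> \<rightarrow> T0) := Y)"
  have "env ?e" using Y by simp
  moreover have "\<exists>y\<in>elts \<tau>. sat S (?e((0, \<rho>) := x, (1, \<tau>) := y)) ?A" if "x \<in> elts \<rho>" for x
    using ex[OF that] by simp
  ultimately obtain Z where Z: "Z \<in> elts (\<rho> \<rightarrow> \<tau>)"
    "\<And>x. x \<in> elts \<rho> \<Longrightarrow> sat S (?e((2, \<rho> \<rightarrow> \<tau>) := Z, (0, \<rho>) := x, (1, \<tau>) := Z \<cdot> x)) ?A"
    using QF_AC_sat[OF AC, of ?A 0 1 2 ?e] by (auto simp: numeral_eq_Suc)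
  from Z(2) have "\<And>x. x \<in> elts \<rho> \<Longrightarrow> E (Y \<cdot> x \<cdot> (Z \<cdot> x)) \<^bold>0" by simp
  with Z(1) show thesis using that by blast
qed

end

section \<open>Arithmetical comprehension\<close>

context model
begin

text \<open>Definition by cases: \<open>q\<close> if \<open>p\<close> is 0 and \<open>b\<close> if \<open>p\<close> is 1.\<close>

abbreviation cond :: "tm \<Rightarrow> tm \<Rightarrow> tm \<Rightarrow> tm" where
  "cond b q p \<equiv> Cst CRec \<cdot> (Cst (CPi T1 T0) \<cdot> (Cst (CPi T0 T0) \<cdot> b)) \<cdot> q \<cdot> p"

lemma elts_cond_fun: "b \<in> elts T0 \<Longrightarrow> Cst (CPi T1 T0) \<cdot> (Cst (CPi T0 T0) \<cdot> b) \<in> elts (T0 \<rightarrow> T0 \<rightarrow> T0)"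
  by (rule elts_App[OF elts_consts(6) elts_App[OF elts_consts(6)]])

text \<open>Left without its last argument, \<open>cond\<close> is a sequence with the values
  \<open>q\<close> at 0 and \<open>b\<close> at 1: a pair coded as an object of type 1.\<close>

lemma elts_pair: "b \<in> elts T0 \<Longrightarrow> q \<in> elts T0 \<Longrightarrow>
    Cst CRec \<cdot> (Cst (CPi T1 T0) \<cdot> (Cst (CPi T0 T0) \<cdot> b)) \<cdot> q \<in> elts T1"
  by (rule elts_App[OF elts_App[OF elts_consts(5) elts_cond_fun]])

lemma elts_cond: "b \<in> elts T0 \<Longrightarrow> q \<in> elts T0 \<Longrightarrow> p \<in> elts T0 \<Longrightarrow> cond b q p \<in> elts T0"
  by (rule elts_T1[OF elts_pair])

lemma E_arg: "f \<in> elts T1 \<Longrightarrow> E a b \<Longrightarrow> a \<in> elts T0 \<Longrightarrow> b \<in> elts T0 \<Longrightarrow> E (f \<cdot> a) (f \<cdot> b)"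
  using eqv_arg[of f T0 T0 a b] by simp

lemma cond_0:
  assumes "b \<in> elts T0" "q \<in> elts T0" "p \<in> elts T0" "E p \<^bold>0"
  shows "E (cond b q p) q"
  by (rule E_trans[OF E_arg[OF elts_pair] bspec[OF bspec[OF rec_facts(1) elts_cond_fun]]])
    (use assms in \<open>auto intro: elts_cond\<close>)

lemma cond_1:
  assumes "b \<in> elts T0" "q \<in> elts T0" "p \<in> elts T0" "E p \<^bold>1"
  shows "E (cond b q p) b"
proof -
  let ?f = "Cst (CPi T1 T0) \<cdot> (Cst (CPi T0 T0) \<cdot> b)"
  have f: "?f \<in> elts (T0 \<rightarrow> T0 \<rightarrow> T0)" using assms elts_cond_fun by blast
  have fm: "?f \<cdot> n \<cdot> m \<in> elts T0" if "n \<in> elts T0" "m \<in> elts T0" for n m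
    using f that by (metis elts_App)
  have p: "E p (\<^bold>0 \<^bold>+ \<^bold>1)"
    using E_trans[OF assms(4) E_sym[OF zero_plus_one]] assms by auto
  have 1: "E (cond b q p) (cond b q (\<^bold>0 \<^bold>+ \<^bold>1))"
    by (rule E_arg[OF elts_pair]) (use assms p in auto)
  have 2: "E (cond b q (\<^bold>0 \<^bold>+ \<^bold>1)) (?f \<cdot> \<^bold>0 \<cdot> cond b q \<^bold>0)"
    using rec_facts(2) f assms(2) elts_consts(1) by blast
  have "eqv T1 (?f \<cdot> \<^bold>0) (Cst (CPi T0 T0) \<cdot> b)"
    by (rule Pi_eqv) (use assms elts_App[OF elts_consts(6)] in auto)
  then have "E (?f \<cdot> \<^bold>0 \<cdot> cond b q \<^bold>0) (Cst (CPi T0 T0) \<cdot> b \<cdot> cond b q \<^bold>0)"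
    using elts_cond[OF assms(1,2), of "\<^bold>0"] by simp
  moreover have "E (Cst (CPi T0 T0) \<cdot> b \<cdot> cond b q \<^bold>0) b"
    using Pi_eqv[of b T0 "cond b q \<^bold>0" T0] elts_cond[OF assms(1,2), of "\<^bold>0"] assms by simp
  moreover have "Cst (CPi T0 T0) \<cdot> b \<cdot> cond b q \<^bold>0 \<in> elts T0"
    by (rule elts_T1[OF elts_App[OF elts_consts(6)]]) (use assms elts_cond in auto)
  ultimately have 3: "E (?f \<cdot> \<^bold>0 \<cdot> cond b q \<^bold>0) b"
    using E_trans fm elts_cond assms elts_consts(1) by meson
  have el: "cond b q (\<^bold>0 \<^bold>+ \<^bold>1) \<in> elts T0" "cond b q p \<in> elts T0" "?f \<cdot> \<^bold>0 \<cdot> cond b q \<^bold>0 \<in> elts T0"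
    using elts_cond assms fm by auto
  show ?thesis by (rule E_trans[OF 1 E_trans[OF 2 3]]) (use el assms in auto)
qed

text \<open>Stands for arithmetical. Truth is 0, as in \<open>Kleene_E2\<close>, and a quantified
  variable is an entry of the environment, so that closure under a quantifier is abstraction
  followed by Kleene's functional.\<close>

definition ar :: "((nat \<times> ty \<Rightarrow> tm) \<Rightarrow> bool) \<Rightarrow> bool" where
  "ar P \<longleftrightarrow> (\<exists>G. definable T0 G \<and> (\<forall>e. env e \<longrightarrow> E (G e) (if P e then \<^bold>0 else \<^bold>1)))"

lemma ar_decides: "E a (if P then \<^bold>0 else \<^bold>1) \<Longrightarrow> a \<in> elts T0 \<Longrightarrow> E a \<^bold>0 \<longleftrightarrow> P"
  using one_nonzero E_trans[of "\<^bold>1" a "\<^bold>0"] E_sym[of a "\<^bold>1"] by (auto split: if_splits)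

lemma arE:
  assumes "ar P"
  obtains G where "definable T0 G" "\<And>e. env e \<Longrightarrow> E (G e) (if P e then \<^bold>0 else \<^bold>1)"
    "\<And>e. env e \<Longrightarrow> E (G e) \<^bold>0 \<longleftrightarrow> P e"
proof -
  obtain G where G: "definable T0 G" "\<And>e. env e \<Longrightarrow> E (G e) (if P e then \<^bold>0 else \<^bold>1)"
    using assms unfolding ar_def by blast
  with ar_decides definable_elts have "\<And>e. env e \<Longrightarrow> E (G e) \<^bold>0 \<longleftrightarrow> P e" by blast
  with G show thesis using that by blast
qed

lemma ar_ext: "ar P \<Longrightarrow> (\<And>e. env e \<Longrightarrow> P e = Q e) \<Longrightarrow> ar Q"
  unfolding ar_def by metis

lemma ar_const [intro]: "ar (\<lambda>e. P)"
  unfolding ar_def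
  by (rule exI[of _ "\<lambda>e. if P then \<^bold>0 else \<^bold>1"]) (auto intro: definable_const E_refl)

lemma definable_cond:
  assumes "definable T0 B" "definable T0 Q" "definable T0 P"
  shows "definable T0 (\<lambda>e. cond (B e) (Q e) (P e))"
  by (rule definable_app[OF definable_app[OF definable_app[OF definable_const[OF elts_consts(5)]
      definable_app[OF definable_const[OF elts_consts(6)]
        definable_app[OF definable_const[OF elts_consts(6)] assms(1)]]] assms(2)] assms(3)])

lemma ar_imp:
  assumes "ar P" "ar Q" shows "ar (\<lambda>e. P e \<longrightarrow> Q e)"
proof -
  obtain F where F: "definable T0 F" "\<And>e. env e \<Longrightarrow> E (F e) (if P e then \<^bold>0 else \<^bold>1)" using assms(1) by (rule arE) blast
  obtain G where G: "definable T0 G" "\<And>e. env e \<Longrightarrow> E (G e) (if Q e then \<^bold>0 else \<^bold>1)" using assms(2) by (rule arE) blast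
  \<comment> \<open>The value is that of \<open>Q\<close> if \<open>P\<close> holds, and 0, meaning
    true, otherwise.\<close>
  have "E (cond \<^bold>0 (G e) (F e)) (if P e \<longrightarrow> Q e then \<^bold>0 else \<^bold>1)" if e: "env e" for e
  proof (cases "P e")
    case True
    have "E (cond \<^bold>0 (G e) (F e)) (G e)"
      by (rule cond_0) (use F[of] G True e definable_elts in fastforce)+
    then have "E (cond \<^bold>0 (G e) (F e)) (if Q e then \<^bold>0 else \<^bold>1)"
      by (rule E_trans[OF _ G(2)[OF e]]) (use elts_cond definable_elts F(1) G(1) e in auto)
    then show ?thesis using True by simp
  next
    case False
    have "E (cond \<^bold>0 (G e) (F e)) \<^bold>0"
      by (rule cond_1) (use F[of] G False e definable_elts in fastforce)+
    then show ?thesis using False by simp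
  qed
  moreover have "definable T0 (\<lambda>e. cond \<^bold>0 (G e) (F e))"
    by (rule definable_cond[OF definable_const[OF elts_consts(1)] G(1) F(1)])
  ultimately show ?thesis unfolding ar_def by blast
qed

lemma ar_not: "ar P \<Longrightarrow> ar (\<lambda>e. \<not> P e)"
  using ar_imp[OF _ ar_const[of False]] by simp

lemma ar_conj: assumes "ar P" "ar Q" shows "ar (\<lambda>e. P e \<and> Q e)"
  using ar_not[OF ar_imp[OF assms(1) ar_not[OF assms(2)]]] by simp

lemma ar_disj: assumes "ar P" "ar Q" shows "ar (\<lambda>e. P e \<or> Q e)"
  using ar_imp[OF ar_not[OF assms(1)] assms(2)] by (simp add: disj_imp)

lemma ar_iff: assumes "ar P" "ar Q" shows "ar (\<lambda>e. P e \<longleftrightarrow> Q e)"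
  using ar_conj[OF ar_imp[OF assms] ar_imp[OF assms(2,1)]] by (simp add: iff_conv_conj_imp)

text \<open>Characteristic functions of equality and order come from \<open>QF_AC T1 T0\<close>.\<close>

lemma characteristic:
  assumes R: "R = (FEq :: tm \<Rightarrow> tm \<Rightarrow> fm) \<or> R = FLess"
  obtains Z where "Z \<in> elts T2"
    "\<And>x. x \<in> elts T1 \<Longrightarrow> E (Z \<cdot> x) (if R (x \<cdot> \<^bold>0) (x \<cdot> \<^bold>1) \<in> S then \<^bold>0 else \<^bold>1)"
proof -
  let ?R = "R (Var 0 T1 \<cdot> \<^bold>0) (Var 0 T1 \<cdot> \<^bold>1)"
  \<comment> \<open>Read: \<open>?R\<close> implies that the number is 0, and its negation implies
    that it is 1. The conjunction is spelled out through implication and negation.\<close>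
  let ?A = "FNot (FImp (FImp ?R (FEq (Var 1 T0) \<^bold>0)) (FNot (FImp (FNot ?R) (FEq (Var 1 T0) \<^bold>1))))"
  have sat: "sat S e ?R \<longleftrightarrow> R (e (0, T1) \<cdot> \<^bold>0) (e (0, T1) \<cdot> \<^bold>1) \<in> S" for e using R by auto
  have qf: "qf ?A" "wf_fm ?A" "(2, T2) \<notin> fv ?A" using R by (auto simp: FNot_def)
  have "\<exists>y\<in>elts T0. sat S (e0((0, T1) := x, (1, T0) := y)) ?A" if "x \<in> elts T1" for x
  proof (cases "R (x \<cdot> \<^bold>0) (x \<cdot> \<^bold>1) \<in> S")
    case True
    then show ?thesis by (intro bexI[of _ "\<^bold>0"]) (auto simp: sat E_refl)
  next
    case False
    then show ?thesis by (intro bexI[of _ "\<^bold>1"]) (auto simp: sat E_refl)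
  qed
  then obtain Z where Z: "Z \<in> elts T2"
    "\<And>x. x \<in> elts T1 \<Longrightarrow> sat S (e0((2, T2) := Z, (0, T1) := x, (1, T0) := Z \<cdot> x)) ?A"
    using QF_AC_sat[OF base_subsets(4) qf(1,2) _ qf(3) env_e0] by (metis ty.distinct(1) Pair_inject)
  have "E (Z \<cdot> x) (if R (x \<cdot> \<^bold>0) (x \<cdot> \<^bold>1) \<in> S then \<^bold>0 else \<^bold>1)" if "x \<in> elts T1" for x
    using Z(2)[OF that] by (auto simp: sat)
  with Z(1) show thesis using that by blast
qed

text \<open>The characteristic functional takes one argument of type 1; the pair of
  \<open>elts_pair\<close> carries both sides of the atom in its values at 0 and 1.\<close>

lemma ar_atom:
  assumes R: "R = (FEq :: tm \<Rightarrow> tm \<Rightarrow> fm) \<or> R = FLess" and FG: "definable T0 F" "definable T0 G"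
  shows "ar (\<lambda>e. R (F e) (G e) \<in> S)"
proof -
  obtain Z where Z: "Z \<in> elts T2"
    "\<And>x. x \<in> elts T1 \<Longrightarrow> E (Z \<cdot> x) (if R (x \<cdot> \<^bold>0) (x \<cdot> \<^bold>1) \<in> S then \<^bold>0 else \<^bold>1)"
    by (rule characteristic[OF R]) blast
  let ?p = "\<lambda>e. Cst CRec \<cdot> (Cst (CPi T1 T0) \<cdot> (Cst (CPi T0 T0) \<cdot> G e)) \<cdot> F e"
  have "definable T0 (\<lambda>e. Z \<cdot> ?p e)"
    by (rule definable_app[OF definable_const[OF Z(1)]
      definable_app[OF definable_app[OF definable_const[OF elts_consts(5)]
        definable_app[OF definable_const[OF elts_consts(6)]
          definable_app[OF definable_const[OF elts_consts(6)] FG(2)]]] FG(1)]])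
  moreover have "E (Z \<cdot> ?p e) (if R (F e) (G e) \<in> S then \<^bold>0 else \<^bold>1)" if e: "env e" for e
  proof -
    have el: "F e \<in> elts T0" "G e \<in> elts T0" using FG e definable_elts by auto
    have p: "?p e \<in> elts T1" using el elts_pair by blast
    have 0: "E (?p e \<cdot> \<^bold>0) (F e)" using cond_0 el E_refl by auto
    have 1: "E (?p e \<cdot> \<^bold>1) (G e)" using cond_1 el E_refl by auto
    have el2: "?p e \<cdot> \<^bold>0 \<in> elts T0" "?p e \<cdot> \<^bold>1 \<in> elts T0" using p by auto
    have "R (?p e \<cdot> \<^bold>0) (?p e \<cdot> \<^bold>1) \<in> S \<longleftrightarrow> R (F e) (G e) \<in> S"
      using R
    proof
      assume R: "R = FEq"
      show ?thesis unfolding R FEq_mem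
        using E_trans[OF E_sym[OF 0 el2(1) el(1)] E_trans[OF _ 1]] E_trans[OF 0 E_trans[OF _ E_sym[OF 1 el2(2) el(2)]]] el el2
        by blast
    next
      assume R: "R = FLess"
      show ?thesis unfolding R FLess_mem
        using L_cong[OF _ 0 1] L_cong[OF _ E_sym[OF 0] E_sym[OF 1]] el el2 by blast
    qed
    then show ?thesis using Z(2)[OF p] by simp
  qed
  ultimately show ?thesis unfolding ar_def by blast
qed

lemma ar_E: "definable T0 F \<Longrightarrow> definable T0 G \<Longrightarrow> ar (\<lambda>e. E (F e) (G e))"
  using ar_atom[of FEq] by simp

lemma ar_L: "definable T0 F \<Longrightarrow> definable T0 G \<Longrightarrow> ar (\<lambda>e. L (F e) (G e))"
  using ar_atom[of FLess] by simp

text \<open>The first conjunct of \<open>Kleene_E2\<close> fixes the value 1 where there is no zero,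
  as \<open>ar\<close> requires.\<close>

lemma E2:
  obtains \<phi> where "\<phi> \<in> elts T2" "\<And>f. f \<in> elts T1 \<Longrightarrow> E (\<phi> \<cdot> f) (if \<exists>n\<in>elts T0. E (f \<cdot> n) \<^bold>0 then \<^bold>0 else \<^bold>1)"
proof -
  have "sat S e0 (sentence Kleene_E2)"
    by (rule axiom_sat[OF base_subsets(6)]) (auto simp: sentence_def Kleene_E2_def)
  then obtain \<phi> where \<phi>: "\<phi> \<in> elts T2" "\<And>f. f \<in> elts T1 \<Longrightarrow> L (\<phi> \<cdot> f) \<^bold>1 \<or> E (\<phi> \<cdot> f) \<^bold>1"
    "\<And>f. f \<in> elts T1 \<Longrightarrow> (\<exists>n\<in>elts T0. E (f \<cdot> n) \<^bold>0) \<longleftrightarrow> E (\<phi> \<cdot> f) \<^bold>0"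
    by (auto simp: sentence_def Kleene_E2_def)
  have "E (\<phi> \<cdot> f) (if \<exists>n\<in>elts T0. E (f \<cdot> n) \<^bold>0 then \<^bold>0 else \<^bold>1)" if f: "f \<in> elts T1" for f
  proof -
    have el: "\<phi> \<cdot> f \<in> elts T0" using \<phi>(1) f by auto
    have "E (\<phi> \<cdot> f) \<^bold>0" if "L (\<phi> \<cdot> f) \<^bold>1"
    proof -
      have "L (\<phi> \<cdot> f) (\<^bold>0 \<^bold>+ \<^bold>1)"
        using L_cong[OF that E_refl[OF el] E_sym[OF zero_plus_one]] el by auto
      then have "L (\<phi> \<cdot> f) \<^bold>0 \<or> E (\<phi> \<cdot> f) \<^bold>0" using arith_facts(12) el elts_consts(1) by blast
      then show ?thesis using arith_facts(11) el by blast
    qed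
    then show ?thesis using \<phi>(2)[OF f] \<phi>(3)[OF f] by auto
  qed
  with \<phi>(1) show thesis using that by blast
qed

lemma definable_lam0:
  assumes "definable T0 G"
  obtains G' where "definable (\<sigma> \<rightarrow> T0) G'"
    "\<And>e a. env e \<Longrightarrow> a \<in> elts \<sigma> \<Longrightarrow> E (G' e \<cdot> a) (G (e((i, \<sigma>) := a)))"
proof -
  obtain G' where "definable (\<sigma> \<rightarrow> T0) G'"
    "\<And>e a. env e \<Longrightarrow> a \<in> elts \<sigma> \<Longrightarrow> eqv T0 (G' e \<cdot> a) (G (e((i, \<sigma>) := a)))"
    by (rule definable_lam[OF assms, of \<sigma> i]) blast
  then show thesis using that[of G'] by simp
qed

lemma ar_ex_upd:
  assumes "ar P" shows "ar (\<lambda>e. \<exists>a\<in>elts T0. P (e((i, T0) := a)))"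
proof -
  obtain G where G: "definable T0 G" "\<And>e. env e \<Longrightarrow> E (G e) \<^bold>0 \<longleftrightarrow> P e" using assms by (rule arE) blast
  obtain G' where G': "definable T1 G'" "\<And>e a. env e \<Longrightarrow> a \<in> elts T0 \<Longrightarrow> E (G' e \<cdot> a) (G (e((i, T0) := a)))"
    by (rule definable_lam0[OF G(1)]) blast
  obtain \<phi> where \<phi>: "\<phi> \<in> elts T2"
    "\<And>f. f \<in> elts T1 \<Longrightarrow> E (\<phi> \<cdot> f) (if \<exists>n\<in>elts T0. E (f \<cdot> n) \<^bold>0 then \<^bold>0 else \<^bold>1)" by (rule E2) blast
  have "definable T0 (\<lambda>e. \<phi> \<cdot> G' e)" by (rule definable_app[OF definable_const[OF \<phi>(1)] G'(1)])
  moreover have "E (\<phi> \<cdot> G' e) (if \<exists>a\<in>elts T0. P (e((i, T0) := a)) then \<^bold>0 else \<^bold>1)" if e: "env e" for e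
  proof -
    have g: "G' e \<in> elts T1" using G'(1) e definable_elts by blast
    have "E (G' e \<cdot> a) \<^bold>0 \<longleftrightarrow> P (e((i, T0) := a))" if a: "a \<in> elts T0" for a
    proof -
      have el: "G' e \<cdot> a \<in> elts T0" "G (e((i, T0) := a)) \<in> elts T0"
        using g a definable_elts[OF G(1)] env_upd[OF e a] by auto
      have "E (G' e \<cdot> a) \<^bold>0 \<longleftrightarrow> E (G (e((i, T0) := a))) \<^bold>0"
        using E_trans[OF G'(2)[OF e a]] E_trans[OF E_sym[OF G'(2)[OF e a] el]] el by blast
      then show ?thesis using G(2)[OF env_upd[OF e a]] by simp
    qed
    then show ?thesis using \<phi>(2)[OF g] by auto
  qed
  ultimately show ?thesis unfolding ar_def by blast
qed

text \<open>Here \<open>Q\<close> takes the quantified object as a separate argument. The second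
  premise makes \<open>i\<close> a name reserved for it, so that updates of the environment
  disappear from the conclusion.\<close>

lemma ar_ex:
  assumes "ar (\<lambda>e. Q e (e (i, T0)))" "\<And>e a b. Q (e((i, T0) := a)) b = Q e b"
  shows "ar (\<lambda>e. \<exists>a\<in>elts T0. Q e a)"
  using ar_ex_upd[OF assms(1), of i] by (simp add: assms(2))

lemma ar_all:
  assumes "ar (\<lambda>e. Q e (e (i, T0)))" "\<And>e a b. Q (e((i, T0) := a)) b = Q e b"
  shows "ar (\<lambda>e. \<forall>a\<in>elts T0. Q e a)"
  using ar_not[OF ar_ex[of "\<lambda>e a. \<not> Q e a", OF ar_not[OF assms(1)]]] assms(2) by simp

lemma ar_subst:
  assumes "ar P" "definable \<sigma> F" shows "ar (\<lambda>e. P (e((i, \<sigma>) := F e)))"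
proof -
  obtain G where G: "definable T0 G" "\<And>e. env e \<Longrightarrow> E (G e) (if P e then \<^bold>0 else \<^bold>1)" using assms(1) by (rule arE) blast
  obtain G' where G': "definable (\<sigma> \<rightarrow> T0) G'" "\<And>e a. env e \<Longrightarrow> a \<in> elts \<sigma> \<Longrightarrow> E (G' e \<cdot> a) (G (e((i, \<sigma>) := a)))"
    by (rule definable_lam0[OF G(1)]) blast
  have "E (G' e \<cdot> F e) (if P (e((i, \<sigma>) := F e)) then \<^bold>0 else \<^bold>1)" if e: "env e" for e
  proof -
    have F: "F e \<in> elts \<sigma>" using assms(2) e definable_elts by blast
    have g: "G' e \<cdot> F e \<in> elts T0" using definable_elts[OF G'(1) e] F by (rule elts_App)
    have "G (e((i, \<sigma>) := F e)) \<in> elts T0" using definable_elts[OF G(1) env_upd[OF e F]] .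
    then show ?thesis using E_trans[OF G'(2)[OF e F] G(2)[OF env_upd[OF e F]]] g by auto
  qed
  moreover have "definable T0 (\<lambda>e. G' e \<cdot> F e)" by (rule definable_app[OF G'(1) assms(2)])
  ultimately show ?thesis unfolding ar_def by blast
qed

primrec arith :: "fm \<Rightarrow> bool" where
  "arith (FEq t u) \<longleftrightarrow> True"
| "arith (FLess t u) \<longleftrightarrow> True"
| "arith FBot \<longleftrightarrow> True"
| "arith (FImp A B) \<longleftrightarrow> arith A \<and> arith B"
| "arith (FAll i \<sigma> A) \<longleftrightarrow> \<sigma> = T0 \<and> arith A"

text \<open>Abstraction with all other variables fixed by \<open>e0\<close> turns a definable
  function into an element of the model.\<close>

lemma lam1:
  assumes "definable \<tau> G"
  obtains g where "g \<in> elts (\<sigma> \<rightarrow> \<tau>)" "\<And>a. a \<in> elts \<sigma> \<Longrightarrow> eqv \<tau> (g \<cdot> a) (G (e0((0, \<sigma>) := a)))"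
proof -
  obtain G' where "definable (\<sigma> \<rightarrow> \<tau>) G'"
    "\<And>e a. env e \<Longrightarrow> a \<in> elts \<sigma> \<Longrightarrow> eqv \<tau> (G' e \<cdot> a) (G (e((0, \<sigma>) := a)))"
    using definable_lam[OF assms, of \<sigma> 0] by blast
  then show thesis using that[of "G' e0"] definable_elts env_e0 by blast
qed

lemma lam2:
  assumes "definable \<tau> G"
  obtains g where "g \<in> elts (\<rho> \<rightarrow> \<sigma> \<rightarrow> \<tau>)"
    "\<And>a b. a \<in> elts \<rho> \<Longrightarrow> b \<in> elts \<sigma> \<Longrightarrow> eqv \<tau> (g \<cdot> a \<cdot> b) (G (e0((0, \<rho>) := a, (1, \<sigma>) := b)))"
proof -
  obtain G' where G': "definable (\<sigma> \<rightarrow> \<tau>) G'"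
    "\<And>e a. env e \<Longrightarrow> a \<in> elts \<sigma> \<Longrightarrow> eqv \<tau> (G' e \<cdot> a) (G (e((1, \<sigma>) := a)))"
    using definable_lam[OF assms, of \<sigma> 1] by blast
  obtain g where g: "g \<in> elts (\<rho> \<rightarrow> \<sigma> \<rightarrow> \<tau>)" "\<And>a. a \<in> elts \<rho> \<Longrightarrow> eqv (\<sigma> \<rightarrow> \<tau>) (g \<cdot> a) (G' (e0((0, \<rho>) := a)))"
    by (rule lam1[OF G'(1)]) blast
  have "eqv \<tau> (g \<cdot> a \<cdot> b) (G (e0((0, \<rho>) := a, (1, \<sigma>) := b)))" if ab: "a \<in> elts \<rho>" "b \<in> elts \<sigma>" for a b
  proof (rule eqv_trans)
    have e: "env (e0((0, \<rho>) := a))" using ab by simp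
    show "eqv \<tau> (g \<cdot> a \<cdot> b) (G' (e0((0, \<rho>) := a)) \<cdot> b)" using g(2) ab by simp
    show "eqv \<tau> (G' (e0((0, \<rho>) := a)) \<cdot> b) (G (e0((0, \<rho>) := a, (1, \<sigma>) := b)))" by (rule G'(2)[OF e ab(2)])
    show "g \<cdot> a \<cdot> b \<in> elts \<tau>" by (rule elts_App[OF elts_App[OF g(1) ab(1)] ab(2)])
    show "G' (e0((0, \<rho>) := a)) \<cdot> b \<in> elts \<tau>" by (rule elts_App[OF definable_elts[OF G'(1) e] ab(2)])
    show "G (e0((0, \<rho>) := a, (1, \<sigma>) := b)) \<in> elts \<tau>" by (rule definable_elts[OF assms env_upd[OF e ab(2)]])
  qed
  with g(1) show thesis using that by blast
qed

lemma lam3: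
  assumes "definable \<tau> G"
  obtains g where "g \<in> elts (\<pi> \<rightarrow> \<rho> \<rightarrow> \<sigma> \<rightarrow> \<tau>)"
    "\<And>a b c. a \<in> elts \<pi> \<Longrightarrow> b \<in> elts \<rho> \<Longrightarrow> c \<in> elts \<sigma> \<Longrightarrow>
      eqv \<tau> (g \<cdot> a \<cdot> b \<cdot> c) (G (e0((0, \<pi>) := a, (1, \<rho>) := b, (2, \<sigma>) := c)))"
proof -
  obtain G' where G': "definable (\<sigma> \<rightarrow> \<tau>) G'"
    "\<And>e a. env e \<Longrightarrow> a \<in> elts \<sigma> \<Longrightarrow> eqv \<tau> (G' e \<cdot> a) (G (e((2, \<sigma>) := a)))"
    using definable_lam[OF assms, of \<sigma> 2] by blast
  obtain g where g: "g \<in> elts (\<pi> \<rightarrow> \<rho> \<rightarrow> \<sigma> \<rightarrow> \<tau>)"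
    "\<And>a b. a \<in> elts \<pi> \<Longrightarrow> b \<in> elts \<rho> \<Longrightarrow> eqv (\<sigma> \<rightarrow> \<tau>) (g \<cdot> a \<cdot> b) (G' (e0((0, \<pi>) := a, (1, \<rho>) := b)))"
    by (rule lam2[OF G'(1)]) blast
  have "eqv \<tau> (g \<cdot> a \<cdot> b \<cdot> c) (G (e0((0, \<pi>) := a, (1, \<rho>) := b, (2, \<sigma>) := c)))"
    if abc: "a \<in> elts \<pi>" "b \<in> elts \<rho>" "c \<in> elts \<sigma>" for a b c
  proof (rule eqv_trans)
    let ?e = "e0((0, \<pi>) := a, (1, \<rho>) := b)"
    have e: "env ?e" using abc by simp
    show "eqv \<tau> (g \<cdot> a \<cdot> b \<cdot> c) (G' ?e \<cdot> c)" using g(2)[OF abc(1,2)] abc(3) by simp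
    show "eqv \<tau> (G' ?e \<cdot> c) (G (?e((2, \<sigma>) := c)))" by (rule G'(2)[OF e abc(3)])
    show "g \<cdot> a \<cdot> b \<cdot> c \<in> elts \<tau>" by (rule elts_App[OF elts_App[OF elts_App[OF g(1) abc(1)] abc(2)] abc(3)])
    show "G' ?e \<cdot> c \<in> elts \<tau>" by (rule elts_App[OF definable_elts[OF G'(1) e] abc(3)])
    show "G (?e((2, \<sigma>) := c)) \<in> elts \<tau>" by (rule definable_elts[OF assms env_upd[OF e abc(3)]])
  qed
  with g(1) show thesis using that by blast
qed

text \<open>With its characteristic function as a parameter of type 1 the predicate is an equation,
  to which \<open>QF_IND\<close> applies.\<close>

lemma ar_induct:
  assumes P: "ar (\<lambda>e. P (e (0, T0)))" and base: "P \<^bold>0"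
    and step: "\<And>b. b \<in> elts T0 \<Longrightarrow> P b \<Longrightarrow> P (b \<^bold>+ \<^bold>1)" and a: "a \<in> elts T0"
  shows "P a"
proof -
  obtain G where G: "definable T0 G" "\<And>e. env e \<Longrightarrow> E (G e) \<^bold>0 \<longleftrightarrow> P (e (0, T0))" using P by (rule arE) blast
  obtain Y where Y: "Y \<in> elts T1" "\<And>b. b \<in> elts T0 \<Longrightarrow> eqv T0 (Y \<cdot> b) (G (e0((0, T0) := b)))"
    by (rule lam1[OF G(1)]) blast
  have iff: "E (Y \<cdot> b) \<^bold>0 \<longleftrightarrow> P b" if b: "b \<in> elts T0" for b
  proof -
    have e: "env (e0((0, T0) := b))" using b by simp
    have el: "Y \<cdot> b \<in> elts T0" "G (e0((0, T0) := b)) \<in> elts T0" using Y(1) b definable_elts[OF G(1) e] by auto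
    have Yb: "E (Y \<cdot> b) (G (e0((0, T0) := b)))" using Y(2)[OF b] by simp
    have "E (Y \<cdot> b) \<^bold>0 \<longleftrightarrow> E (G (e0((0, T0) := b))) \<^bold>0"
      using E_trans[OF Yb] E_trans[OF E_sym[OF Yb el]] el by blast
    then show ?thesis using G(2)[OF e] by simp
  qed
  let ?A = "FEq (Var 1 T1 \<cdot> Var 0 T0) \<^bold>0"
  let ?e = "e0((1, T1) := Y)"
  have "sat S (?e((0, T0) := a)) ?A"
    by (rule QF_IND_sat) (use Y(1) iff base step a in auto)
  then show ?thesis using iff a by simp
qed

text \<open>A search functional \<open>\<mu>\<close> for zeros comes from
  \<open>QF_AC T1 T0\<close>, applied to the statement that \<open>n\<close> is a zero of
  \<open>f\<close> if \<open>f\<close> has one. In this form a value always exists, and Kleene's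
  functional makes the statement quantifier-free. The condition \<open>Q\<close> enters through its
  characteristic function.\<close>

lemma definable_choice:
  assumes Q: "ar (\<lambda>e. Q e (e (i, T0)))" and indep: "\<And>e a b. Q (e((i, T0) := a)) b = Q e b"
  obtains G where "definable T0 G" "\<And>e. env e \<Longrightarrow> \<exists>n\<in>elts T0. Q e n \<Longrightarrow> Q e (G e)"
proof -
  let ?P = "\<lambda>f n. (\<exists>m\<in>elts T0. E (f \<cdot> m) \<^bold>0) \<longrightarrow> E (f \<cdot> n) \<^bold>0"
  have "ar (\<lambda>e. ?P (e (0, T1)) (e (1, T0)))"
    by (rule ar_imp ar_ex[of _ 2] ar_E definable_app[of T0] definable_var definable_const elts_consts | simp)+
  then obtain F where F: "definable T0 F" "\<And>e. env e \<Longrightarrow> E (F e) \<^bold>0 \<longleftrightarrow> ?P (e (0, T1)) (e (1, T0))" by (rule arE) blast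
  obtain Y where Y: "Y \<in> elts (T1 \<rightarrow> T0 \<rightarrow> T0)"
    "\<And>f n. f \<in> elts T1 \<Longrightarrow> n \<in> elts T0 \<Longrightarrow> eqv T0 (Y \<cdot> f \<cdot> n) (F (e0((0, T1) := f, (1, T0) := n)))"
    by (rule lam2[OF F(1)]) blast
  have iff: "E (Y \<cdot> f \<cdot> n) \<^bold>0 \<longleftrightarrow> ?P f n" if fn: "f \<in> elts T1" "n \<in> elts T0" for f n
  proof -
    have e: "env (e0((0, T1) := f, (1, T0) := n))" using fn by simp
    have el: "Y \<cdot> f \<cdot> n \<in> elts T0" "F (e0((0, T1) := f, (1, T0) := n)) \<in> elts T0"
      using elts_App[OF elts_App[OF Y(1) fn(1)] fn(2)] definable_elts[OF F(1) e] by auto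
    have Yb: "E (Y \<cdot> f \<cdot> n) (F (e0((0, T1) := f, (1, T0) := n)))" using Y(2)[OF fn] by simp
    have "E (Y \<cdot> f \<cdot> n) \<^bold>0 \<longleftrightarrow> E (F (e0((0, T1) := f, (1, T0) := n))) \<^bold>0"
      using E_trans[OF Yb] E_trans[OF E_sym[OF Yb el]] el by blast
    then show ?thesis using F(2)[OF e] by simp
  qed
  have "\<exists>n\<in>elts T0. E (Y \<cdot> f \<cdot> n) \<^bold>0" if "f \<in> elts T1" for f
    using iff[OF that] elts_consts(1) by blast
  then obtain \<mu> where \<mu>: "\<mu> \<in> elts T2" "\<And>f. f \<in> elts T1 \<Longrightarrow> E (Y \<cdot> f \<cdot> (\<mu> \<cdot> f)) \<^bold>0"
    using choice_basic[OF base_subsets(4) Y(1)] by blast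
  obtain G where G: "definable T0 G" "\<And>e. env e \<Longrightarrow> E (G e) \<^bold>0 \<longleftrightarrow> Q e (e (i, T0))" using Q by (rule arE) blast
  obtain G' where G': "definable T1 G'" "\<And>e a. env e \<Longrightarrow> a \<in> elts T0 \<Longrightarrow> E (G' e \<cdot> a) (G (e((i, T0) := a)))"
    by (rule definable_lam0[OF G(1)]) blast
  have "Q e (\<mu> \<cdot> G' e)" if e: "env e" and ex: "\<exists>n\<in>elts T0. Q e n" for e
  proof -
    have g: "G' e \<in> elts T1" using definable_elts[OF G'(1) e] .
    have *: "E (G' e \<cdot> a) \<^bold>0 \<longleftrightarrow> Q e a" if a: "a \<in> elts T0" for a
    proof -
      have el: "G' e \<cdot> a \<in> elts T0" "G (e((i, T0) := a)) \<in> elts T0"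
        using g a definable_elts[OF G(1)] env_upd[OF e a] by auto
      have "E (G' e \<cdot> a) \<^bold>0 \<longleftrightarrow> E (G (e((i, T0) := a))) \<^bold>0"
        using E_trans[OF G'(2)[OF e a]] E_trans[OF E_sym[OF G'(2)[OF e a] el]] el by blast
      then show ?thesis using G(2)[OF env_upd[OF e a]] by (simp add: indep)
    qed
    have "\<mu> \<cdot> G' e \<in> elts T0" using \<mu>(1) g by auto
    then show ?thesis using \<mu>(2)[OF g] iff[OF g] * ex by blast
  qed
  moreover have "definable T0 (\<lambda>e. \<mu> \<cdot> G' e)" by (rule definable_app[OF definable_const[OF \<mu>(1)] G'(1)])
  ultimately show thesis using that by blast
qed

end

section \<open>The natural numbers of a model\<close>

text \<open>The axioms of the nonnegative part of a discretely ordered commutative ring, with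
  comparability through addition in place of an order. It is a predicate on carriers since the type
  of numbers is cut out of either of two structures.\<close>

definition arith_structure :: "'u set \<Rightarrow> 'u \<Rightarrow> 'u \<Rightarrow> ('u \<Rightarrow> 'u \<Rightarrow> 'u) \<Rightarrow> ('u \<Rightarrow> 'u \<Rightarrow> 'u) \<Rightarrow> bool" where
  "arith_structure N z i p m \<longleftrightarrow> z \<in> N \<and> i \<in> N \<and> (\<forall>x\<in>N. \<forall>y\<in>N. p x y \<in> N \<and> m x y \<in> N) \<and>
     (\<forall>x\<in>N. \<forall>y\<in>N. p x y = p y x \<and> m x y = m y x) \<and>
     (\<forall>x\<in>N. p x z = x \<and> m x z = z \<and> m x i = x \<and> p x i \<noteq> z \<and> (x = z \<or> (\<exists>y\<in>N. x = p y i))) \<and>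
     (\<forall>x\<in>N. \<forall>y\<in>N. \<forall>w\<in>N. p (p x y) w = p x (p y w) \<and> m (m x y) w = m x (m y w) \<and>
        m (p x y) w = p (m x w) (m y w) \<and> (p x w = p y w \<longrightarrow> x = y)) \<and>
     (\<forall>x\<in>N. \<forall>y\<in>N. (\<exists>w\<in>N. y = p x w) \<or> (\<exists>w\<in>N. x = p y w))"

context model
begin

text \<open>Equality of type 0 is only a relation \<open>E\<close> between terms; the numbers are
  its classes.\<close>

definition cls :: "tm \<Rightarrow> tm set" where "cls a = {b \<in> elts T0. E a b}"
definition reps :: "tm set \<Rightarrow> tm" where "reps x = (SOME a. a \<in> elts T0 \<and> x = cls a)"
definition nats :: "tm set set" where "nats = cls ` elts T0"
definition padd :: "tm set \<Rightarrow> tm set \<Rightarrow> tm set" where "padd x y = cls (reps x \<^bold>+ reps y)"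
definition pmult :: "tm set \<Rightarrow> tm set \<Rightarrow> tm set" where "pmult x y = cls (reps x \<^bold>* reps y)"

lemma cls_eq: "a \<in> elts T0 \<Longrightarrow> b \<in> elts T0 \<Longrightarrow> cls a = cls b \<longleftrightarrow> E a b"
  unfolding cls_def using E_refl E_sym E_trans by blast

lemma reps:
  assumes "x \<in> nats" shows "reps x \<in> elts T0" "cls (reps x) = x"
proof -
  obtain a where "a \<in> elts T0 \<and> x = cls a" using assms by (auto simp: nats_def)
  then have "reps x \<in> elts T0 \<and> x = cls (reps x)" unfolding reps_def by (rule someI)
  then show "reps x \<in> elts T0" "cls (reps x) = x" by auto
qed

lemma cls_nats [simp]: "a \<in> elts T0 \<Longrightarrow> cls a \<in> nats"
  by (simp add: nats_def)

lemma reps_cls: "a \<in> elts T0 \<Longrightarrow> E (reps (cls a)) a"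
  using reps[of "cls a"] cls_eq by simp

lemma E_binop:
  assumes c: "Cst c \<in> elts (T0 \<rightarrow> T0 \<rightarrow> T0)" and E: "E a a'" "E b b'"
    and el: "a \<in> elts T0" "a' \<in> elts T0" "b \<in> elts T0" "b' \<in> elts T0"
  shows "E (Cst c \<cdot> a \<cdot> b) (Cst c \<cdot> a' \<cdot> b')"
proof -
  have "eqv T1 (Cst c \<cdot> a) (Cst c \<cdot> a')" using c E el by (intro eqv_arg[of _ T0]) auto
  then have "eqv T0 (Cst c \<cdot> a \<cdot> b) (Cst c \<cdot> a' \<cdot> b')"
    by (rule eqv_app) (use E el elts_App[OF c] in auto)
  then show ?thesis by simp
qed

lemma cls_plus [simp]: "a \<in> elts T0 \<Longrightarrow> b \<in> elts T0 \<Longrightarrow> cls (a \<^bold>+ b) = padd (cls a) (cls b)"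
  unfolding padd_def by (subst cls_eq) (auto intro!: E_binop E_sym[OF reps_cls] reps)

lemma cls_times [simp]: "a \<in> elts T0 \<Longrightarrow> b \<in> elts T0 \<Longrightarrow> cls (a \<^bold>* b) = pmult (cls a) (cls b)"
  unfolding pmult_def by (subst cls_eq) (auto intro!: E_binop E_sym[OF reps_cls] reps)

lemma nats_closed [simp]: "x \<in> nats \<Longrightarrow> y \<in> nats \<Longrightarrow> padd x y \<in> nats" "x \<in> nats \<Longrightarrow> y \<in> nats \<Longrightarrow> pmult x y \<in> nats"
  unfolding padd_def pmult_def by (intro cls_nats elts_plus elts_times reps; assumption)+

lemma nats_basic:
  "x \<in> nats \<Longrightarrow> padd x (cls \<^bold>0) = x"
  "x \<in> nats \<Longrightarrow> y \<in> nats \<Longrightarrow> padd x (padd y (cls \<^bold>1)) = padd (padd x y) (cls \<^bold>1)"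
  "x \<in> nats \<Longrightarrow> pmult x (cls \<^bold>0) = cls \<^bold>0"
  "x \<in> nats \<Longrightarrow> y \<in> nats \<Longrightarrow> pmult x (padd y (cls \<^bold>1)) = padd (pmult x y) x"
  "x \<in> nats \<Longrightarrow> padd x (cls \<^bold>1) \<noteq> cls \<^bold>0"
  and nats_suc_inject: "x \<in> nats \<Longrightarrow> y \<in> nats \<Longrightarrow> padd x (cls \<^bold>1) = padd y (cls \<^bold>1) \<Longrightarrow> x = y"
proof -
  have *: "\<exists>a. a \<in> elts T0 \<and> x = cls a" if "x \<in> nats" for x using that by (auto simp: nats_def)
  have f: "cls (a \<^bold>+ \<^bold>0) = cls a" "cls (a \<^bold>+ (b \<^bold>+ \<^bold>1)) = cls ((a \<^bold>+ b) \<^bold>+ \<^bold>1)" "cls (a \<^bold>* \<^bold>0) = cls \<^bold>0"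
    "cls (a \<^bold>* (b \<^bold>+ \<^bold>1)) = cls (a \<^bold>* b \<^bold>+ a)" "cls (a \<^bold>+ \<^bold>1) \<noteq> cls \<^bold>0"
    if "a \<in> elts T0" "b \<in> elts T0" for a b
    using that by (simp_all add: cls_eq arith_facts(5,7-10)[rule_format] del: cls_plus cls_times)
  have f6: "cls a = cls b" if "a \<in> elts T0" "b \<in> elts T0" "cls (a \<^bold>+ \<^bold>1) = cls (b \<^bold>+ \<^bold>1)" for a b
    using that arith_facts(6)[rule_format, of a b] by (simp add: cls_eq del: cls_plus)
  show "x \<in> nats \<Longrightarrow> padd x (cls \<^bold>0) = x" using * f(1) by fastforce
  show "x \<in> nats \<Longrightarrow> y \<in> nats \<Longrightarrow> padd x (padd y (cls \<^bold>1)) = padd (padd x y) (cls \<^bold>1)"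
    using *[of x] *[of y] f(2) by auto
  show "x \<in> nats \<Longrightarrow> pmult x (cls \<^bold>0) = cls \<^bold>0" using * f(3) by fastforce
  show "x \<in> nats \<Longrightarrow> y \<in> nats \<Longrightarrow> pmult x (padd y (cls \<^bold>1)) = padd (pmult x y) x"
    using *[of x] *[of y] f(4) by auto
  show "x \<in> nats \<Longrightarrow> padd x (cls \<^bold>1) \<noteq> cls \<^bold>0" using *[of x] f(5) by auto
  show "x \<in> nats \<Longrightarrow> y \<in> nats \<Longrightarrow> padd x (cls \<^bold>1) = padd y (cls \<^bold>1) \<Longrightarrow> x = y"
    using *[of x] *[of y] f6 by auto
qed

lemma definable_plus: "definable T0 F \<Longrightarrow> definable T0 G \<Longrightarrow> definable T0 (\<lambda>e. F e \<^bold>+ G e)"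
  by (rule definable_app[OF definable_app[OF definable_const[OF elts_consts(3)]]])

lemma definable_times: "definable T0 F \<Longrightarrow> definable T0 G \<Longrightarrow> definable T0 (\<lambda>e. F e \<^bold>* G e)"
  by (rule definable_app[OF definable_app[OF definable_const[OF elts_consts(4)]]])

lemma ar_cls:
  assumes "definable T0 F" "definable T0 G" shows "ar (\<lambda>e. cls (F e) = cls (G e))"
  by (rule ar_ext[OF ar_E[OF assms]]) (simp add: cls_eq definable_elts[OF assms(1)] definable_elts[OF assms(2)])

lemma nats_induct:
  assumes x: "x \<in> nats" and ar: "ar (\<lambda>e. P (cls (e (0, T0))))" and 0: "P (cls \<^bold>0)"
    and step: "\<And>y. y \<in> nats \<Longrightarrow> P y \<Longrightarrow> P (padd y (cls \<^bold>1))"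
  shows "P x"
proof -
  obtain a where a: "a \<in> elts T0" "x = cls a" using x by (auto simp: nats_def)
  show ?thesis unfolding a(2)
    by (rule ar_induct[of "\<lambda>b. P (cls b)"]) (use ar 0 step a in auto)
qed

text \<open>Equations between classes are arithmetical once both sides are given by terms; fixed
  elements of \<open>nats\<close> enter these terms through representatives.\<close>

lemma ar_nats_eq:
  assumes "\<And>e. env e \<Longrightarrow> x e = cls (F e)" "\<And>e. env e \<Longrightarrow> y e = cls (G e)" "definable T0 F" "definable T0 G"
  shows "ar (\<lambda>e. x e = y e)"
  by (rule ar_ext[OF ar_cls[OF assms(3,4)]]) (simp add: assms(1,2))

lemma env_elts: "env e \<Longrightarrow> e (i, \<sigma>) \<in> elts \<sigma>"
  by (simp add: env_def)

lemmas definable_intros = definable_plus definable_times definable_var definable_const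

section \<open>Semiring laws by arithmetical induction\<close>

lemma nats_assoc:
  assumes "x \<in> nats" "y \<in> nats" "w \<in> nats" shows "padd (padd x y) w = padd x (padd y w)"
proof (rule nats_induct[OF assms(3)])
  show "ar (\<lambda>e. padd (padd x y) (cls (e (0, T0))) = padd x (padd y (cls (e (0, T0)))))"
    by (rule ar_nats_eq[of _ "\<lambda>e. reps x \<^bold>+ reps y \<^bold>+ e (0, T0)" _ "\<lambda>e. reps x \<^bold>+ (reps y \<^bold>+ e (0, T0))"])
      (simp_all add: assms reps env_elts definable_intros)
qed (simp_all add: nats_basic assms)

lemma nats_zero_left:
  assumes "x \<in> nats" shows "padd (cls \<^bold>0) x = x"
proof (rule nats_induct[OF assms])
  show "ar (\<lambda>e. padd (cls \<^bold>0) (cls (e (0, T0))) = cls (e (0, T0)))"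
    by (rule ar_nats_eq[of _ "\<lambda>e. \<^bold>0 \<^bold>+ e (0, T0)" _ "\<lambda>e. e (0, T0)"])
      (simp_all add: env_elts definable_intros)
qed (simp_all add: nats_basic)

lemma nats_one_left:
  assumes "x \<in> nats" shows "padd (cls \<^bold>1) x = padd x (cls \<^bold>1)"
proof (rule nats_induct[OF assms])
  show "ar (\<lambda>e. padd (cls \<^bold>1) (cls (e (0, T0))) = padd (cls (e (0, T0))) (cls \<^bold>1))"
    by (rule ar_nats_eq[of _ "\<lambda>e. \<^bold>1 \<^bold>+ e (0, T0)" _ "\<lambda>e. e (0, T0) \<^bold>+ \<^bold>1"])
      (simp_all add: env_elts definable_intros)
qed (simp_all add: nats_basic nats_zero_left)

lemma nats_add_comm:
  assumes "x \<in> nats" "y \<in> nats" shows "padd x y = padd y x"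
proof (rule nats_induct[OF assms(2)])
  show "ar (\<lambda>e. padd x (cls (e (0, T0))) = padd (cls (e (0, T0))) x)"
    by (rule ar_nats_eq[of _ "\<lambda>e. reps x \<^bold>+ e (0, T0)" _ "\<lambda>e. e (0, T0) \<^bold>+ reps x"])
      (simp_all add: assms reps env_elts definable_intros)
  show "padd x (padd y (cls \<^bold>1)) = padd (padd y (cls \<^bold>1)) x" if "y \<in> nats" "padd x y = padd y x" for y
  proof -
    have "padd x (padd y (cls \<^bold>1)) = padd (padd y x) (cls \<^bold>1)" using that assms by (simp add: nats_basic)
    also have "\<dots> = padd y (padd (cls \<^bold>1) x)" using that assms by (simp add: nats_assoc nats_one_left)
    also have "\<dots> = padd (padd y (cls \<^bold>1)) x" using that assms by (simp add: nats_assoc)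
    finally show ?thesis .
  qed
qed (simp_all add: nats_basic nats_zero_left assms)

lemma nats_left_comm:
  "x \<in> nats \<Longrightarrow> y \<in> nats \<Longrightarrow> w \<in> nats \<Longrightarrow> padd x (padd y w) = padd y (padd x w)"
  by (metis nats_add_comm nats_assoc)

lemma nats_times_zero_left:
  assumes "x \<in> nats" shows "pmult (cls \<^bold>0) x = cls \<^bold>0"
proof (rule nats_induct[OF assms])
  show "ar (\<lambda>e. pmult (cls \<^bold>0) (cls (e (0, T0))) = cls \<^bold>0)"
    by (rule ar_nats_eq[of _ "\<lambda>e. \<^bold>0 \<^bold>* e (0, T0)" _ "\<lambda>e. \<^bold>0"])
      (simp_all add: env_elts definable_intros)
qed (simp_all add: nats_basic)

lemma nats_distrib:
  assumes "x \<in> nats" "y \<in> nats" "w \<in> nats" shows "pmult (padd x y) w = padd (pmult x w) (pmult y w)"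
proof (rule nats_induct[OF assms(3)])
  show "ar (\<lambda>e. pmult (padd x y) (cls (e (0, T0))) = padd (pmult x (cls (e (0, T0)))) (pmult y (cls (e (0, T0)))))"
    by (rule ar_nats_eq[of _ "\<lambda>e. (reps x \<^bold>+ reps y) \<^bold>* e (0, T0)" _ "\<lambda>e. reps x \<^bold>* e (0, T0) \<^bold>+ reps y \<^bold>* e (0, T0)"])
      (simp_all add: assms reps env_elts definable_intros)
qed (simp_all add: nats_basic(1,3,4) nats_assoc nats_left_comm assms)

lemma nats_distrib_left:
  assumes "x \<in> nats" "y \<in> nats" "w \<in> nats" shows "pmult x (padd y w) = padd (pmult x y) (pmult x w)"
proof (rule nats_induct[OF assms(3)])
  show "ar (\<lambda>e. pmult x (padd y (cls (e (0, T0)))) = padd (pmult x y) (pmult x (cls (e (0, T0)))))"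
    by (rule ar_nats_eq[of _ "\<lambda>e. reps x \<^bold>* (reps y \<^bold>+ e (0, T0))" _ "\<lambda>e. reps x \<^bold>* reps y \<^bold>+ reps x \<^bold>* e (0, T0)"])
      (simp_all add: assms reps env_elts definable_intros)
qed (simp_all add: nats_basic(1,3,4) nats_assoc[symmetric] nats_basic(2) assms)

lemma nats_times_one:
  assumes "x \<in> nats" shows "pmult x (cls \<^bold>1) = x" "pmult (cls \<^bold>1) x = x"
proof -
  show "pmult x (cls \<^bold>1) = x"
    using nats_basic(4)[OF assms, of "cls \<^bold>0"] assms
    by (simp add: nats_zero_left nats_basic)
  show "pmult (cls \<^bold>1) x = x"
  proof (rule nats_induct[OF assms])
    show "ar (\<lambda>e. pmult (cls \<^bold>1) (cls (e (0, T0))) = cls (e (0, T0)))"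
      by (rule ar_nats_eq[of _ "\<lambda>e. \<^bold>1 \<^bold>* e (0, T0)" _ "\<lambda>e. e (0, T0)"])
        (simp_all add: env_elts definable_intros)
  qed (simp_all add: nats_basic)
qed

lemma nats_mult_comm:
  assumes "x \<in> nats" "y \<in> nats" shows "pmult x y = pmult y x"
proof (rule nats_induct[OF assms(2)])
  show "ar (\<lambda>e. pmult x (cls (e (0, T0))) = pmult (cls (e (0, T0))) x)"
    by (rule ar_nats_eq[of _ "\<lambda>e. reps x \<^bold>* e (0, T0)" _ "\<lambda>e. e (0, T0) \<^bold>* reps x"])
      (simp_all add: assms reps env_elts definable_intros)
qed (simp_all add: nats_basic nats_times_zero_left nats_distrib nats_times_one assms)

lemma nats_mult_assoc:
  assumes "x \<in> nats" "y \<in> nats" "w \<in> nats" shows "pmult (pmult x y) w = pmult x (pmult y w)"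
proof (rule nats_induct[OF assms(3)])
  show "ar (\<lambda>e. pmult (pmult x y) (cls (e (0, T0))) = pmult x (pmult y (cls (e (0, T0)))))"
    by (rule ar_nats_eq[of _ "\<lambda>e. reps x \<^bold>* reps y \<^bold>* e (0, T0)" _ "\<lambda>e. reps x \<^bold>* (reps y \<^bold>* e (0, T0))"])
      (simp_all add: assms reps env_elts definable_intros)
qed (simp_all add: nats_basic nats_distrib_left nats_times_one assms)

lemma nats_cancel:
  assumes "x \<in> nats" "y \<in> nats" "w \<in> nats" "padd x w = padd y w" shows "x = y"
proof -
  have "padd x w = padd y w \<longrightarrow> x = y"
  proof (rule nats_induct[OF assms(3)])
    show "ar (\<lambda>e. padd x (cls (e (0, T0))) = padd y (cls (e (0, T0))) \<longrightarrow> x = y)"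
      by (rule ar_imp[OF ar_nats_eq[of _ "\<lambda>e. reps x \<^bold>+ e (0, T0)" _ "\<lambda>e. reps y \<^bold>+ e (0, T0)"]])
        (simp_all add: assms reps env_elts definable_intros ar_const)
    show "padd x (padd w (cls \<^bold>1)) = padd y (padd w (cls \<^bold>1)) \<longrightarrow> x = y"
      if "w \<in> nats" "padd x w = padd y w \<longrightarrow> x = y" for w
      using that nats_suc_inject[of "padd x w" "padd y w"] assms by (simp add: nats_basic(2))
  qed (simp add: nats_basic assms)
  then show ?thesis using assms(4) by blast
qed

lemma ar_nats_bex:
  assumes "ar (\<lambda>e. Q e (cls (e (i, T0))))" "\<And>e a b. Q (e((i, T0) := a)) b = Q e b"
  shows "ar (\<lambda>e. \<exists>y\<in>nats. Q e y)"
  using ar_ex[of "\<lambda>e a. Q e (cls a)" i, OF assms(1)] assms(2) by (simp add: nats_def)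

lemma nats_zero_or_suc:
  assumes "x \<in> nats" shows "x = cls \<^bold>0 \<or> (\<exists>y\<in>nats. x = padd y (cls \<^bold>1))"
proof (rule nats_induct[OF assms])
  show "ar (\<lambda>e. cls (e (0, T0)) = cls \<^bold>0 \<or> (\<exists>y\<in>nats. cls (e (0, T0)) = padd y (cls \<^bold>1)))"
  proof (intro ar_disj ar_nats_bex[of _ 1])
    show "ar (\<lambda>e. cls (e (0, T0)) = cls \<^bold>0)" by (intro ar_cls definable_intros elts_consts)
    show "ar (\<lambda>e. cls (e (0, T0)) = padd (cls (e (1, T0))) (cls \<^bold>1))"
      by (rule ar_nats_eq[of _ "\<lambda>e. e (0, T0)" _ "\<lambda>e. e (1, T0) \<^bold>+ \<^bold>1"])
        (simp_all add: env_elts definable_intros)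
  qed simp
qed auto

lemma nats_total:
  assumes "x \<in> nats" "y \<in> nats" shows "(\<exists>w\<in>nats. y = padd x w) \<or> (\<exists>w\<in>nats. x = padd y w)"
proof (rule nats_induct[OF assms(2)])
  show "ar (\<lambda>e. (\<exists>w\<in>nats. cls (e (0, T0)) = padd x w) \<or> (\<exists>w\<in>nats. x = padd (cls (e (0, T0))) w))"
  proof (intro ar_disj ar_nats_bex[of _ 1])
    show "ar (\<lambda>e. cls (e (0, T0)) = padd x (cls (e (1, T0))))"
      by (rule ar_nats_eq[of _ "\<lambda>e. e (0, T0)" _ "\<lambda>e. reps x \<^bold>+ e (1, T0)"])
        (simp_all add: assms reps env_elts definable_intros)
    show "ar (\<lambda>e. x = padd (cls (e (0, T0))) (cls (e (1, T0))))"
      by (rule ar_nats_eq[of _ "\<lambda>e. reps x" _ "\<lambda>e. e (0, T0) \<^bold>+ e (1, T0)"])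
        (simp_all add: assms reps env_elts definable_intros)
  qed simp_all
  show "(\<exists>w\<in>nats. cls \<^bold>0 = padd x w) \<or> (\<exists>w\<in>nats. x = padd (cls \<^bold>0) w)"
    using nats_zero_left[OF assms(1)] assms(1) by metis
  show "(\<exists>w\<in>nats. padd y (cls \<^bold>1) = padd x w) \<or> (\<exists>w\<in>nats. x = padd (padd y (cls \<^bold>1)) w)"
    if y: "y \<in> nats" and IH: "(\<exists>w\<in>nats. y = padd x w) \<or> (\<exists>w\<in>nats. x = padd y w)" for y
    using IH
  proof
    assume "\<exists>w\<in>nats. y = padd x w"
    then obtain w where "w \<in> nats" "y = padd x w" by blast
    then have "padd y (cls \<^bold>1) = padd x (padd w (cls \<^bold>1))" "padd w (cls \<^bold>1) \<in> nats" using assms by (simp_all add: nats_basic)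
    then show ?thesis by blast
  next
    assume "\<exists>w\<in>nats. x = padd y w"
    then obtain w where w: "w \<in> nats" "x = padd y w" by blast
    from nats_zero_or_suc[OF w(1)] show ?thesis
    proof
      assume "w = cls \<^bold>0"
      then have "padd y (cls \<^bold>1) = padd x (cls \<^bold>1)" using w y by (simp add: nats_basic)
      then show ?thesis using cls_nats elts_consts by blast
    next
      assume "\<exists>v\<in>nats. w = padd v (cls \<^bold>1)"
      then obtain v where v: "v \<in> nats" "w = padd v (cls \<^bold>1)" by blast
      then have "x = padd (padd y (cls \<^bold>1)) v" using w y by (simp add: nats_assoc nats_one_left)
      then show ?thesis using v by blast
    qed
  qed
qed

lemma arith_structure_nats: "arith_structure nats (cls \<^bold>0) (cls \<^bold>1) padd pmult"
  unfolding arith_structure_def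
  by (intro conjI ballI impI)
    (rule cls_nats nats_closed nats_basic(1,3,5) nats_times_one(1) nats_zero_or_suc nats_assoc nats_mult_assoc
      nats_distrib nats_add_comm nats_mult_comm nats_total elts_consts | assumption | erule nats_cancel[rotated 3])+

text \<open>The axiom for the primitive order recurses on the right argument, hence the induction on
  \<open>b\<close>. The result makes the order a matter of addition, as it is by definition on
  \<open>nn\<close>.\<close>

lemma L_iff:
  assumes "a \<in> elts T0" "b \<in> elts T0"
  shows "L a b \<longleftrightarrow> (\<exists>w\<in>nats. cls b = padd (padd (cls a) w) (cls \<^bold>1))"
proof (rule ar_induct[OF _ _ _ assms(2)])
  show "ar (\<lambda>e. L a (e (0, T0)) \<longleftrightarrow> (\<exists>w\<in>nats. cls (e (0, T0)) = padd (padd (cls a) w) (cls \<^bold>1)))"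
  proof (intro ar_iff ar_nats_bex[of _ 1] ar_L)
    show "ar (\<lambda>e. cls (e (0, T0)) = padd (padd (cls a) (cls (e (1, T0)))) (cls \<^bold>1))"
      by (rule ar_nats_eq[of _ "\<lambda>e. e (0, T0)" _ "\<lambda>e. a \<^bold>+ e (1, T0) \<^bold>+ \<^bold>1"])
        (simp_all add: assms env_elts definable_intros)
  qed (simp_all add: assms definable_intros)
  show "L a \<^bold>0 \<longleftrightarrow> (\<exists>w\<in>nats. cls \<^bold>0 = padd (padd (cls a) w) (cls \<^bold>1))"
    using arith_facts(11) assms(1) nats_basic(5) nats_closed(1) cls_nats by metis
  show "L a (b \<^bold>+ \<^bold>1) \<longleftrightarrow> (\<exists>w\<in>nats. cls (b \<^bold>+ \<^bold>1) = padd (padd (cls a) w) (cls \<^bold>1))"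
    if b: "b \<in> elts T0" and IH: "L a b \<longleftrightarrow> (\<exists>w\<in>nats. cls b = padd (padd (cls a) w) (cls \<^bold>1))" for b
  proof -
    have "L a (b \<^bold>+ \<^bold>1) \<longleftrightarrow> (\<exists>w\<in>nats. cls b = padd (padd (cls a) w) (cls \<^bold>1)) \<or> cls a = cls b"
      using arith_facts(12) assms(1) b IH by (simp add: cls_eq)
    also have "\<dots> \<longleftrightarrow> (\<exists>w\<in>nats. cls b = padd (cls a) w)"
    proof
      assume "(\<exists>w\<in>nats. cls b = padd (padd (cls a) w) (cls \<^bold>1)) \<or> cls a = cls b"
      then show "\<exists>w\<in>nats. cls b = padd (cls a) w"
      proof
        assume "\<exists>w\<in>nats. cls b = padd (padd (cls a) w) (cls \<^bold>1)"
        then obtain w where "w \<in> nats" "cls b = padd (cls a) (padd w (cls \<^bold>1))"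
          using assms by (auto simp: nats_basic(2))
        then show ?thesis by (intro bexI[of _ "padd w (cls \<^bold>1)"]) simp_all
      next
        assume "cls a = cls b"
        then have "cls b = padd (cls a) (cls \<^bold>0)" using nats_basic(1)[of "cls b"] b by simp
        then show ?thesis by (rule bexI) simp
      qed
    next
      assume "\<exists>w\<in>nats. cls b = padd (cls a) w"
      then obtain w where w: "w \<in> nats" "cls b = padd (cls a) w" by blast
      from nats_zero_or_suc[OF w(1)] show "(\<exists>w\<in>nats. cls b = padd (padd (cls a) w) (cls \<^bold>1)) \<or> cls a = cls b"
        using w assms by (auto simp: nats_basic)
    qed
    also have "\<dots> \<longleftrightarrow> (\<exists>w\<in>nats. cls (b \<^bold>+ \<^bold>1) = padd (padd (cls a) w) (cls \<^bold>1))"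
    proof (rule bex_cong[OF refl])
      fix w assume w: "w \<in> nats"
      have "cls b = padd (cls a) w" if "padd (cls b) (cls \<^bold>1) = padd (padd (cls a) w) (cls \<^bold>1)"
        by (rule nats_suc_inject[OF _ _ that]) (use w b assms(1) in simp_all)
      then show "cls b = padd (cls a) w \<longleftrightarrow> cls (b \<^bold>+ \<^bold>1) = padd (padd (cls a) w) (cls \<^bold>1)"
        using b by auto
    qed
    finally show ?thesis .
  qed
qed

end

text \<open>Everything is derived in one fixed model, chosen to refute one of the equivalences if any model
  does. Its natural numbers can then be made a type, so that the ordered fields built from them are
  types too.\<close>

definition goals :: "fm set" where
  "goals = sentence ` {NIN_alt \<^bold>\<longleftrightarrow> cont_point_principle Baire2, NIN_alt \<^bold>\<longleftrightarrow> cont_point_principle Baire1_star,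
     NIN_alt \<^bold>\<longleftrightarrow> cont_point_principle usc, NIN_alt \<^bold>\<longleftrightarrow> cont_point_principle lsc}"

definition M :: "fm set" where
  "M = (SOME S. is_model S \<and> \<not> (\<forall>e. env e \<longrightarrow> (\<forall>A\<in>goals. sat S e A)))"

text \<open>If there is no such model, a copy of the standard natural numbers keeps the type well-behaved.\<close>

definition num :: "nat \<Rightarrow> tm set" where "num n = {Var n T0}"

lemma inv_num [simp]: "inv num (num n) = n"
  by (rule inv_f_f) (auto simp: inj_def num_def)

lemma arith_structure_num:
  "arith_structure (range num) (num 0) (num 1) (\<lambda>x y. num (inv num x + inv num y)) (\<lambda>x y. num (inv num x * inv num y))"
proof -
  have "x = 0 \<or> (\<exists>y. x = Suc y)" "(\<exists>w. y = x + w) \<or> (\<exists>w. x = y + w)" for x y :: nat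
    by (presburger, metis le_add_diff_inverse linorder_linear)
  moreover have "num x = num y \<longleftrightarrow> x = y" for x y by (simp add: num_def)
  ultimately show ?thesis
    by (simp add: arith_structure_def algebra_simps)
qed

definition nn_set :: "tm set set" where "nn_set = (if is_model M then model.nats M else range num)"
definition nn_zero :: "tm set" where "nn_zero = (if is_model M then model.cls M \<^bold>0 else num 0)"
definition nn_one :: "tm set" where "nn_one = (if is_model M then model.cls M \<^bold>1 else num 1)"
definition nn_plus :: "tm set \<Rightarrow> tm set \<Rightarrow> tm set" where
  "nn_plus = (if is_model M then model.padd M else (\<lambda>x y. num (inv num x + inv num y)))"
definition nn_times :: "tm set \<Rightarrow> tm set \<Rightarrow> tm set" where
  "nn_times = (if is_model M then model.pmult M else (\<lambda>x y. num (inv num x * inv num y)))"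

lemma arith_structure_nn: "arith_structure nn_set nn_zero nn_one nn_plus nn_times"
  using model.arith_structure_nats[of M] arith_structure_num
  by (simp add: nn_set_def nn_zero_def nn_one_def nn_plus_def nn_times_def model_def)

lemma nn_facts:
  "nn_zero \<in> nn_set" "nn_one \<in> nn_set"
  "\<forall>x\<in>nn_set. \<forall>y\<in>nn_set. nn_plus x y \<in> nn_set \<and> nn_times x y \<in> nn_set"
  "\<forall>x\<in>nn_set. \<forall>y\<in>nn_set. nn_plus x y = nn_plus y x \<and> nn_times x y = nn_times y x"
  "\<forall>x\<in>nn_set. nn_plus x nn_zero = x \<and> nn_times x nn_zero = nn_zero \<and> nn_times x nn_one = x \<and>
    nn_plus x nn_one \<noteq> nn_zero \<and> (x = nn_zero \<or> (\<exists>y\<in>nn_set. x = nn_plus y nn_one))"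
  "\<forall>x\<in>nn_set. \<forall>y\<in>nn_set. \<forall>w\<in>nn_set. nn_plus (nn_plus x y) w = nn_plus x (nn_plus y w) \<and>
    nn_times (nn_times x y) w = nn_times x (nn_times y w) \<and>
    nn_times (nn_plus x y) w = nn_plus (nn_times x w) (nn_times y w) \<and> (nn_plus x w = nn_plus y w \<longrightarrow> x = y)"
  "\<forall>x\<in>nn_set. \<forall>y\<in>nn_set. (\<exists>w\<in>nn_set. y = nn_plus x w) \<or> (\<exists>w\<in>nn_set. x = nn_plus y w)"
  by (insert arith_structure_nn[unfolded arith_structure_def], elim conjE, assumption)+

typedef nn = nn_set
  using nn_facts(1) by blast

definition nadd :: "nn \<Rightarrow> nn \<Rightarrow> nn" where "nadd x y = Abs_nn (nn_plus (Rep_nn x) (Rep_nn y))"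
definition nmult :: "nn \<Rightarrow> nn \<Rightarrow> nn" where "nmult x y = Abs_nn (nn_times (Rep_nn x) (Rep_nn y))"
definition nzero :: nn where "nzero = Abs_nn nn_zero"
definition none :: nn where "none = Abs_nn nn_one"

lemma Rep_nn_ops:
  "Rep_nn (nadd x y) = nn_plus (Rep_nn x) (Rep_nn y)" "Rep_nn (nmult x y) = nn_times (Rep_nn x) (Rep_nn y)"
  "Rep_nn nzero = nn_zero" "Rep_nn none = nn_one"
proof -
  have "nn_plus (Rep_nn x) (Rep_nn y) \<in> nn_set \<and> nn_times (Rep_nn x) (Rep_nn y) \<in> nn_set"
    using nn_facts(3)[rule_format, OF Rep_nn Rep_nn] .
  then show "Rep_nn (nadd x y) = nn_plus (Rep_nn x) (Rep_nn y)" "Rep_nn (nmult x y) = nn_times (Rep_nn x) (Rep_nn y)"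
    "Rep_nn nzero = nn_zero" "Rep_nn none = nn_one"
    by (simp_all add: nadd_def nmult_def nzero_def none_def Abs_nn_inverse nn_facts(1,2))
qed

lemma nn_bex: "(\<exists>x\<in>nn_set. P x) \<longleftrightarrow> (\<exists>x. P (Rep_nn x))"
  by (metis Rep_nn Abs_nn_inverse)

lemma nn_laws:
  fixes x y w :: nn
  shows "nadd x y = nadd y x" "nmult x y = nmult y x" "nadd x nzero = x" "nmult x nzero = nzero" "nmult x none = x"
    "nadd x none \<noteq> nzero" "x = nzero \<or> (\<exists>y. x = nadd y none)" "nadd (nadd x y) w = nadd x (nadd y w)"
    "nmult (nmult x y) w = nmult x (nmult y w)" "nmult (nadd x y) w = nadd (nmult x w) (nmult y w)"
    "nadd x w = nadd y w \<Longrightarrow> x = y" "(\<exists>w. y = nadd x w) \<or> (\<exists>w. x = nadd y w)"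
  using nn_facts(4)[rule_format, OF Rep_nn Rep_nn, of x y] nn_facts(5)[rule_format, OF Rep_nn, of x]
    nn_facts(6)[rule_format, OF Rep_nn Rep_nn Rep_nn, of x y w] nn_facts(7)[rule_format, OF Rep_nn Rep_nn, of x y]
  unfolding Rep_nn_inject[symmetric] Rep_nn_ops nn_bex by (simp_all add: disj_commute)

section \<open>The numbers of \<open>M\<close> as an ordered semidomain\<close>

instantiation nn :: linordered_semidom
begin

definition zero_nn_def: "0 = nzero"
definition one_nn_def: "1 = none"
definition plus_nn_def: "x + y = nadd x y"
definition times_nn_def: "x * y = nmult x y"
definition less_eq_nn_def: "x \<le> (y::nn) \<longleftrightarrow> (\<exists>w. y = nadd x w)"
definition less_nn_def: "x < (y::nn) \<longleftrightarrow> x \<le> y \<and> x \<noteq> y"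
text \<open>Truncated at 0, as the laws of cancellative semirings such as
  \<open>x - y - z = x - (y + z)\<close> demand.\<close>

definition minus_nn_def: "x - (y::nn) = (if y \<le> x then THE w. x = nadd y w else 0)"

lemmas nn_laws' = nn_laws[folded zero_nn_def one_nn_def plus_nn_def times_nn_def]

lemma nn_add_eq_0: "x + y = (0::nn) \<Longrightarrow> x = 0 \<and> y = 0"
  using nn_laws'(6,7,8) nn_laws'(1,3) by metis

lemma nn_mult_eq_0: "x * y = (0::nn) \<Longrightarrow> x = 0 \<or> y = 0"
proof (rule ccontr)
  assume xy: "x * y = 0" and "\<not> (x = 0 \<or> y = 0)"
  then obtain a b where "x = a + 1" "y = b + 1" using nn_laws'(7) by metis
  then have "x * y = (x * b + a) + 1" using nn_laws'(1,2,5,8,10) by metis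
  then show False using xy nn_laws'(6) by metis
qed

lemma nn_minus: "y + w - y = (w::nn)"
proof -
  have "(THE v. y + w = y + v) = w"
    by (rule the_equality) (use nn_laws'(1,11) in metis)+
  moreover have "y \<le> y + w" unfolding less_eq_nn_def plus_nn_def by blast
  ultimately show ?thesis by (simp add: minus_nn_def plus_nn_def)
qed

lemma nn_minus_0: "\<not> y \<le> x \<Longrightarrow> x - y = (0::nn)"
  by (simp add: minus_nn_def)

lemma nn_le_iff: "x \<le> (y::nn) \<longleftrightarrow> (\<exists>w. y = x + w)"
  by (simp add: less_eq_nn_def plus_nn_def)

lemma nn_order: "x \<le> (x::nn)" "x \<le> y \<Longrightarrow> y \<le> z \<Longrightarrow> x \<le> z" "x \<le> y \<Longrightarrow> y \<le> x \<Longrightarrow> x = y" "x \<le> y \<or> y \<le> (x::nn)"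
proof -
  show "x \<le> x" unfolding nn_le_iff using nn_laws'(3) by metis
  show "x \<le> y \<Longrightarrow> y \<le> z \<Longrightarrow> x \<le> z" unfolding nn_le_iff using nn_laws'(8) by metis
  show "x \<le> y \<or> y \<le> (x::nn)" unfolding nn_le_iff using nn_laws'(12) by metis
  show "x = y" if "x \<le> y" "y \<le> x"
  proof -
    obtain v w where "y = x + v" "x = y + w" using \<open>x \<le> y\<close> \<open>y \<le> x\<close> nn_le_iff by metis
    then have "0 + x = (v + w) + x" using nn_laws'(1,3,8) by metis
    then have "v + w = 0" using nn_laws'(11) by metis
    then show ?thesis using nn_add_eq_0 \<open>y = x + v\<close> nn_laws'(3) by metis
  qed
qed

instance
proof
  fix x y z :: nn
  show "x + y + z = x + (y + z)" by (rule nn_laws')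
  show "x + y = y + x" by (rule nn_laws')
  show "0 + x = x" using nn_laws'(1,3) by metis
  show "x * y * z = x * (y * z)" by (rule nn_laws')
  show "x * y = y * x" by (rule nn_laws')
  show "1 * x = x" using nn_laws'(2,5) by metis
  show "(x + y) * z = x * z + y * z" by (rule nn_laws')
  show "x * (y + z) = x * y + x * z" using nn_laws'(2,10) by metis
  show "x * (y - z) = x * y - x * z"
  proof (cases "z \<le> y")
    case True
    then obtain w where w: "y = z + w" unfolding nn_le_iff by blast
    then have "x * y = x * z + x * w" using nn_laws'(2,10) by metis
    then show ?thesis using w nn_minus by metis
  next
    case False
    then obtain w where w: "z = y + w" using nn_order(4) unfolding nn_le_iff by metis
    have "w \<noteq> 0" using False w nn_laws'(3) nn_order(1) by metis
    have xz: "x * z = x * y + x * w" using w nn_laws'(2,10) by metis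
    have "x * y - x * z = 0"
    proof (cases "x = 0")
      case True
      then have "x * y = 0" "x * z = 0" using nn_laws'(2,4) by metis+
      then show ?thesis using nn_minus[of 0 0] nn_laws'(3) by metis
    next
      case x: False
      have "\<not> x * z \<le> x * y"
      proof
        assume "x * z \<le> x * y"
        then obtain v where "x * y = x * z + v" unfolding nn_le_iff by blast
        then have "0 + x * y = (x * w + v) + x * y" using xz nn_laws'(1,3,8) by metis
        then have "x * w + v = 0" using nn_laws'(11) by metis
        then show False using nn_add_eq_0 nn_mult_eq_0 x \<open>w \<noteq> 0\<close> by blast
      qed
      then show ?thesis by (rule nn_minus_0)
    qed
    moreover have "x * (y - z) = 0" using nn_minus_0[OF False] nn_laws'(4) by metis
    ultimately show ?thesis by simp
  qed
  show "0 * x = 0" "x * 0 = 0" using nn_laws'(2,4) by metis+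
  show "(0::nn) \<noteq> 1" using nn_laws'(1,3,6) by metis
  show "x + y - x = y" by (rule nn_minus)
  show "x - y - z = x - (y + z)" 
  proof (cases "y + z \<le> x")
    case True
    then obtain w where "x = y + z + w" unfolding nn_le_iff by blast
    then show ?thesis using nn_minus nn_laws'(8) by metis
  next
    case False
    show ?thesis
    proof (cases "y \<le> x")
      case True
      then obtain w where w: "x = y + w" unfolding nn_le_iff by blast
      then have "\<not> z \<le> w" using False unfolding nn_le_iff using nn_laws'(8) by metis
      then show ?thesis using False w nn_minus by (simp add: nn_minus_0)
    next
      case F: False
      have "0 - z = (0::nn)"
      proof (cases "z \<le> 0")
        case True
        then have "z = 0" unfolding nn_le_iff using nn_add_eq_0 by metis
        then show ?thesis using nn_minus[of 0 0] nn_laws'(3) by metis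
      qed (simp add: minus_nn_def)
      then show ?thesis using F False by (simp add: nn_minus_0)
    qed
  qed
  show "x < y \<longleftrightarrow> x \<le> y \<and> \<not> y \<le> x" unfolding less_nn_def using nn_order by blast
  show "x \<le> x" by (rule nn_order)
  show "x \<le> z" if "x \<le> y" "y \<le> z" using that by (rule nn_order)
  show "x = y" if "x \<le> y" "y \<le> x" using that by (rule nn_order)
  show "x \<le> y \<or> y \<le> x" by (rule nn_order)
  show "z + x \<le> z + y" if "x \<le> y" using that unfolding nn_le_iff using nn_laws'(8) by metis
  show "z * x < z * y" if "x < y" "0 < z"
  proof -
    obtain w where w: "y = x + w" using \<open>x < y\<close> unfolding less_nn_def nn_le_iff by blast
    then have "w \<noteq> 0" using \<open>x < y\<close> nn_laws'(3) unfolding less_nn_def by metis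
    moreover have "z \<noteq> 0" using \<open>0 < z\<close> unfolding less_nn_def by auto
    ultimately have "z * w \<noteq> 0" using nn_mult_eq_0 by blast
    moreover have zy: "z * y = z * x + z * w" using w nn_laws'(2,10) by metis
    ultimately have "z * x \<noteq> z * y" using nn_laws'(1,3,11) by metis
    then show ?thesis unfolding less_nn_def nn_le_iff using zy by blast
  qed
  show "x * y \<noteq> 0" if "x \<noteq> 0" "y \<noteq> 0" using that nn_mult_eq_0 by blast
  show "(0::nn) < 1" unfolding less_nn_def nn_le_iff using nn_laws'(1,3,6) by metis
  show "x - y + y = x" if "y \<le> x"
    using that unfolding nn_le_iff using nn_minus nn_laws'(1) by metis
qed

end

lemma nn_zero_or_suc: "x = 0 \<or> (\<exists>y. x = y + (1::nn))"
  by (rule nn_laws'(7))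

lemma nn_less_suc: "x < y + (1::nn) \<longleftrightarrow> x \<le> y"
proof
  assume "x < y + 1"
  then obtain c where c: "c > 0" "y + 1 = x + c" using less_iff_add_pos[of x "y + 1"] by auto
  then obtain d where "c = d + 1" using nn_zero_or_suc[of c] by auto
  then have "y = x + d" using c by (simp flip: add.assoc)
  then show "x \<le> y" unfolding nn_le_iff by blast
next
  assume "x \<le> y"
  then show "x < y + 1" by (rule le_less_trans) simp
qed

lemma nn_nonneg [simp]: "(0::nn) \<le> x"
  unfolding nn_le_iff by (rule exI[of _ x]) simp

section \<open>Numerical values of objects of types 0 and 1\<close>

locale the_model = model M
begin

definition nv :: "tm \<Rightarrow> nn" where "nv a = Abs_nn (cls a)"
definition rp :: "nn \<Rightarrow> tm" where "rp n = reps (Rep_nn n)"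

lemma nn_model:
  "nn_set = nats" "nn_zero = cls \<^bold>0" "nn_one = cls \<^bold>1" "nn_plus = padd" "nn_times = pmult"
  using is_model by (simp_all add: nn_set_def nn_zero_def nn_one_def nn_plus_def nn_times_def)

lemma Rep_nv: "a \<in> elts T0 \<Longrightarrow> Rep_nn (nv a) = cls a"
  by (simp add: nv_def Abs_nn_inverse nn_model)

lemma nv_eq: "a \<in> elts T0 \<Longrightarrow> b \<in> elts T0 \<Longrightarrow> nv a = nv b \<longleftrightarrow> E a b"
  by (metis Rep_nv cls_eq Rep_nn_inject)

lemma rp_elts [simp]: "rp n \<in> elts T0"
  using Rep_nn[of n] by (simp add: rp_def nn_model reps)

lemma nv_rp [simp]: "nv (rp n) = n"
  using Rep_nn[of n] by (simp add: nv_def rp_def nn_model reps Rep_nn_inverse)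

lemma nv_0 [simp]: "nv \<^bold>0 = 0" and nv_1 [simp]: "nv \<^bold>1 = 1"
  by (simp_all add: nv_def zero_nn_def nzero_def one_nn_def none_def nn_model)

lemma nv_plus [simp]: "a \<in> elts T0 \<Longrightarrow> b \<in> elts T0 \<Longrightarrow> nv (a \<^bold>+ b) = nv a + nv b"
  by (simp add: Rep_nn_inject[symmetric] plus_nn_def Rep_nn_ops Rep_nv nn_model)

lemma nv_times [simp]: "a \<in> elts T0 \<Longrightarrow> b \<in> elts T0 \<Longrightarrow> nv (a \<^bold>* b) = nv a * nv b"
  by (simp add: Rep_nn_inject[symmetric] times_nn_def Rep_nn_ops Rep_nv nn_model)

lemma nn_less_iff: "x < (y::nn) \<longleftrightarrow> (\<exists>w. y = x + w + 1)"
proof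
  assume "x < y"
  then obtain c where "c > 0" "y = x + c" using less_iff_add_pos[of x y] by auto
  then show "\<exists>w. y = x + w + 1" using nn_zero_or_suc[of c] by (auto simp: add.assoc)
next
  assume "\<exists>w. y = x + w + 1"
  then obtain w where y: "y = (x + w) + 1" by blast
  have "x \<le> x + w" unfolding nn_le_iff by blast
  then show "x < y" unfolding y nn_less_suc .
qed

lemma nv_less: "a \<in> elts T0 \<Longrightarrow> b \<in> elts T0 \<Longrightarrow> L a b \<longleftrightarrow> nv a < nv b"
proof -
  assume ab: "a \<in> elts T0" "b \<in> elts T0"
  have "nv a < nv b \<longleftrightarrow> (\<exists>w. Rep_nn (nv b) = Rep_nn (nv a + w + 1))"
    unfolding nn_less_iff Rep_nn_inject ..
  also have "\<dots> \<longleftrightarrow> (\<exists>w. cls b = padd (padd (cls a) (Rep_nn w)) (cls \<^bold>1))"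
    using ab by (simp add: plus_nn_def one_nn_def Rep_nn_ops Rep_nv nn_model)
  also have "\<dots> \<longleftrightarrow> L a b" unfolding L_iff[OF ab] using nn_bex by (simp add: nn_model)
  finally show ?thesis ..
qed

lemma nv_all: "(\<forall>a\<in>elts T0. P (nv a)) \<longleftrightarrow> (\<forall>n. P n)"
  by (metis rp_elts nv_rp)

lemma nv_ex: "(\<exists>a\<in>elts T0. P (nv a)) \<longleftrightarrow> (\<exists>n. P n)"
  by (metis rp_elts nv_rp)

definition fn :: "tm \<Rightarrow> nn \<Rightarrow> nn" where "fn f n = nv (f \<cdot> rp n)"

lemma E_rp: "a \<in> elts T0 \<Longrightarrow> E a (rp (nv a))"
  using nv_eq[of a "rp (nv a)"] by simp

lemma nv_app: "f \<in> elts T1 \<Longrightarrow> a \<in> elts T0 \<Longrightarrow> nv (f \<cdot> a) = fn f (nv a)"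
  unfolding fn_def using E_arg[of f a "rp (nv a)"] E_rp[of a] nv_eq[of "f \<cdot> a" "f \<cdot> rp (nv a)"] by simp

lemma nv_arg: "F \<in> elts (T0 \<rightarrow> \<tau>) \<Longrightarrow> a \<in> elts T0 \<Longrightarrow> eqv \<tau> (F \<cdot> a) (F \<cdot> rp (nv a))"
  using eqv_arg[of F T0 \<tau> a "rp (nv a)"] E_rp[of a] by simp

lemma eqv_T1: "f \<in> elts T1 \<Longrightarrow> g \<in> elts T1 \<Longrightarrow> eqv T1 f g \<longleftrightarrow> fn f = fn g"
proof -
  assume fg: "f \<in> elts T1" "g \<in> elts T1"
  have "eqv T1 f g \<longleftrightarrow> (\<forall>a\<in>elts T0. fn f (nv a) = fn g (nv a))"
    using fg by (auto simp: nv_eq[symmetric] nv_app)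
  also have "\<dots> \<longleftrightarrow> (\<forall>n. fn f n = fn g n)" by (rule nv_all)
  also have "\<dots> \<longleftrightarrow> fn f = fn g" by auto
  finally show ?thesis .
qed

text \<open>This is \<open>definable\<close> up to the value in \<open>nn\<close>: arithmetical
  conditions can then be written with the operations of \<open>nn\<close> and recognised by
  introduction rules.\<close>

definition dnn :: "((nat \<times> ty \<Rightarrow> tm) \<Rightarrow> nn) \<Rightarrow> bool" where
  "dnn X \<longleftrightarrow> (\<exists>F. definable T0 F \<and> (\<forall>e. env e \<longrightarrow> X e = nv (F e)))"

lemma dnn_nv: "definable T0 F \<Longrightarrow> dnn (\<lambda>e. nv (F e))"
  unfolding dnn_def by blast

lemma dnn_const: "dnn (\<lambda>e. n)"
  unfolding dnn_def by (intro exI[of _ "\<lambda>e. rp n"]) (auto intro: definable_const)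

lemma dnn_plus: "dnn X \<Longrightarrow> dnn Y \<Longrightarrow> dnn (\<lambda>e. X e + Y e)"
proof -
  assume "dnn X" "dnn Y"
  then obtain F G where F: "definable T0 F" "\<And>e. env e \<Longrightarrow> X e = nv (F e)"
    and G: "definable T0 G" "\<And>e. env e \<Longrightarrow> Y e = nv (G e)" unfolding dnn_def by blast
  show ?thesis unfolding dnn_def
    by (intro exI[of _ "\<lambda>e. F e \<^bold>+ G e"]) (use F G definable_elts in \<open>auto intro: definable_plus\<close>)
qed

lemma dnn_times: "dnn X \<Longrightarrow> dnn Y \<Longrightarrow> dnn (\<lambda>e. X e * Y e)"
proof -
  assume "dnn X" "dnn Y"
  then obtain F G where F: "definable T0 F" "\<And>e. env e \<Longrightarrow> X e = nv (F e)"
    and G: "definable T0 G" "\<And>e. env e \<Longrightarrow> Y e = nv (G e)" unfolding dnn_def by blast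
  show ?thesis unfolding dnn_def
    by (intro exI[of _ "\<lambda>e. F e \<^bold>* G e"]) (use F G definable_elts in \<open>auto intro: definable_times\<close>)
qed

lemma dnn_fn: "definable T1 F \<Longrightarrow> dnn X \<Longrightarrow> dnn (\<lambda>e. fn (F e) (X e))"
proof -
  assume F: "definable T1 F" and "dnn X"
  then obtain G where G: "definable T0 G" "\<And>e. env e \<Longrightarrow> X e = nv (G e)" unfolding dnn_def by blast
  show ?thesis unfolding dnn_def
    by (intro exI[of _ "\<lambda>e. F e \<cdot> G e"]) (use F G definable_elts in \<open>auto intro: definable_app simp: nv_app\<close>)
qed

lemma ar_nn_eq: "dnn X \<Longrightarrow> dnn Y \<Longrightarrow> ar (\<lambda>e. X e = Y e)"
proof -
  assume "dnn X" "dnn Y"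
  then obtain F G where F: "definable T0 F" "\<And>e. env e \<Longrightarrow> X e = nv (F e)"
    and G: "definable T0 G" "\<And>e. env e \<Longrightarrow> Y e = nv (G e)" unfolding dnn_def by blast
  show ?thesis
    by (rule ar_ext[OF ar_E[OF F(1) G(1)]]) (use F G definable_elts in \<open>auto simp: nv_eq\<close>)
qed

lemma ar_nn_less: "dnn X \<Longrightarrow> dnn Y \<Longrightarrow> ar (\<lambda>e. X e < Y e)"
proof -
  assume "dnn X" "dnn Y"
  then obtain F G where F: "definable T0 F" "\<And>e. env e \<Longrightarrow> X e = nv (F e)"
    and G: "definable T0 G" "\<And>e. env e \<Longrightarrow> Y e = nv (G e)" unfolding dnn_def by blast
  show ?thesis
    by (rule ar_ext[OF ar_L[OF F(1) G(1)]]) (use F G definable_elts in \<open>auto simp: nv_less\<close>)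
qed

lemma ar_nn_le: "dnn X \<Longrightarrow> dnn Y \<Longrightarrow> ar (\<lambda>e. X e \<le> Y e)"
  using ar_not[OF ar_nn_less[of Y X]] by (simp add: not_less)

lemma ar_nn_ex:
  assumes "ar (\<lambda>e. Q e (nv (e (i, T0))))" "\<And>e a b. Q (e((i, T0) := a)) b = Q e b"
  shows "ar (\<lambda>e. \<exists>n. Q e n)"
  using ar_ex[of "\<lambda>e a. Q e (nv a)" i, OF assms(1)] assms(2) by (simp add: nv_ex)

lemma ar_nn_all:
  assumes "ar (\<lambda>e. Q e (nv (e (i, T0))))" "\<And>e a b. Q (e((i, T0) := a)) b = Q e b"
  shows "ar (\<lambda>e. \<forall>n. Q e n)"
  using ar_all[of "\<lambda>e a. Q e (nv a)" i, OF assms(1)] assms(2) by (simp add: nv_all)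

lemma nn_induct:
  assumes "ar (\<lambda>e. P (nv (e (0, T0))))" "P 0" "\<And>n. P n \<Longrightarrow> P (n + 1)"
  shows "P n"
  using ar_induct[of "\<lambda>a. P (nv a)" "rp n"] assms by simp

text \<open>The order of \<open>nn\<close> need not be well-founded, so a least element is
  guaranteed for arithmetical sets only. It comes from induction on the statement that no number
  below \<open>n\<close> satisfies \<open>P\<close>.\<close>

lemma nn_least:
  assumes ar: "ar (\<lambda>e. P (nv (e (0, T0))))" and ex: "P m"
  shows "\<exists>n. P n \<and> (\<forall>k<n. \<not> P k)"
proof (rule ccontr)
  assume no: "\<not> ?thesis"
  have "\<forall>k. k < n \<longrightarrow> \<not> P k" for n
  proof (rule nn_induct[of "\<lambda>n. \<forall>k. k < n \<longrightarrow> \<not> P k"])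
    have "ar (\<lambda>e. P (nv (e (1, T0))))"
      using ar_subst[OF ar definable_var[of T0 1], of 0] by simp
    then show "ar (\<lambda>e. \<forall>k. k < nv (e (0, T0)) \<longrightarrow> \<not> P k)"
      by (intro ar_nn_all[of _ 1] ar_imp ar_nn_less dnn_nv definable_var ar_not) auto
    show "\<forall>k. k < n + 1 \<longrightarrow> \<not> P k" if "\<forall>k. k < n \<longrightarrow> \<not> P k" for n
      using that no by (metis nn_less_suc order_le_less)
  qed (metis nn_nonneg not_less)
  then show False using ex nn_less_suc[of m m] by blast
qed

lemma nn_choice:
  assumes Q: "ar (\<lambda>e. Q e (nv (e (i, T0))))" and indep: "\<And>e a b. Q (e((i, T0) := a)) b = Q e b"
  obtains X where "dnn X" "\<And>e. env e \<Longrightarrow> \<exists>n. Q e n \<Longrightarrow> Q e (X e)"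
proof -
  obtain G where G: "definable T0 G" "\<And>e. env e \<Longrightarrow> \<exists>n\<in>elts T0. Q e (nv n) \<Longrightarrow> Q e (nv (G e))"
    using definable_choice[of "\<lambda>e a. Q e (nv a)" i, OF Q] indep by blast
  then show thesis using that[OF dnn_nv[OF G(1)]] nv_ex by blast
qed

section \<open>Powers of two and Cantor pairing\<close>

definition p2 :: "nn \<Rightarrow> nn" where "p2 n = nv (pow2 (rp n))"

lemma eval_pow2 [simp]: "eval e (pow2 t) = pow2 (eval e t)"
  by (simp add: pow2_def)

lemma typed_pow2 [simp]: "typed (pow2 t) T0 \<longleftrightarrow> typed t T0"
  by (auto simp: pow2_def)

lemma pow2_facts:
  shows "a \<in> elts T0 \<Longrightarrow> pow2 a \<in> elts T0" "nv (pow2 \<^bold>0) = 1"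
    "a \<in> elts T0 \<Longrightarrow> nv (pow2 (a \<^bold>+ \<^bold>1)) = nv (pow2 a) + nv (pow2 a)"
    "a \<in> elts T0 \<Longrightarrow> nv (pow2 a) = p2 (nv a)"
proof -
  let ?I = "Cst (CSigma T0 T1 T0) \<cdot> Cst (CPi T0 T1) \<cdot> Cst (CPi T0 T0)"
  let ?D = "Cst (CSigma T0 T0 T0) \<cdot> Cst CPlus \<cdot> ?I"
  let ?f = "Cst (CPi T1 T0) \<cdot> ?D"
  have I: "?I \<in> elts T1" by (rule elts_App[OF elts_App[OF elts_consts(7) elts_consts(6)] elts_consts(6)])
  have D: "?D \<in> elts T1" by (rule elts_App[OF elts_App[OF elts_consts(7) elts_consts(3)] I])
  have f: "?f \<in> elts (T0 \<rightarrow> T1)" by (rule elts_App[OF elts_consts(6) D])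
  have p: "Cst CRec \<cdot> ?f \<cdot> \<^bold>1 \<in> elts T1" by (rule elts_App[OF elts_App[OF elts_consts(5) f] elts_consts(2)])
  show el: "pow2 a \<in> elts T0" if "a \<in> elts T0" for a unfolding pow2_def using p that by (rule elts_T1)
  show "nv (pow2 \<^bold>0) = 1"
    using rec_facts(1)[rule_format, OF f elts_consts(2)] el[of "\<^bold>0"] nv_eq[of "pow2 \<^bold>0" "\<^bold>1"]
    by (simp add: pow2_def)
  have "nv (?I \<cdot> r) = nv r" if r: "r \<in> elts T0" for r
  proof -
    have "E (?I \<cdot> r) (Cst (CPi T0 T1) \<cdot> r \<cdot> (Cst (CPi T0 T0) \<cdot> r))"
      using Sigma_eqv[of "Cst (CPi T0 T1)" T0 T1 T0 "Cst (CPi T0 T0)" r] r by simp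
    moreover have "E (Cst (CPi T0 T1) \<cdot> r \<cdot> (Cst (CPi T0 T0) \<cdot> r)) r"
      using Pi_eqv[of r T0 "Cst (CPi T0 T0) \<cdot> r" T1] r elts_App[OF elts_consts(6) r] by simp
    moreover have "Cst (CPi T0 T1) \<cdot> r \<cdot> (Cst (CPi T0 T0) \<cdot> r) \<in> elts T0"
      by (rule elts_App[OF elts_App[OF elts_consts(6) r] elts_App[OF elts_consts(6) r]])
    ultimately show ?thesis using r elts_T1[OF I r] by (simp add: nv_eq[symmetric])
  qed
  then have D2: "nv (?D \<cdot> r) = nv r + nv r" if r: "r \<in> elts T0" for r
    using Sigma_eqv[OF elts_consts(3) I r] r elts_T1[OF I r] elts_T1[OF D r] by (simp add: nv_eq[symmetric])
  show "nv (pow2 (a \<^bold>+ \<^bold>1)) = nv (pow2 a) + nv (pow2 a)" if a: "a \<in> elts T0" for a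
  proof -
    have "E (pow2 (a \<^bold>+ \<^bold>1)) (?f \<cdot> a \<cdot> pow2 a)"
      using rec_facts(2)[rule_format, OF f elts_consts(2) a] by (simp add: pow2_def)
    moreover have "E (?f \<cdot> a \<cdot> pow2 a) (?D \<cdot> pow2 a)"
      using Pi_eqv[OF D a] el[OF a] by simp
    moreover have "?f \<cdot> a \<cdot> pow2 a \<in> elts T0" by (rule elts_App[OF elts_App[OF f a] el[OF a]])
    ultimately show ?thesis using D2[OF el[OF a]] el[OF a] el[of "a \<^bold>+ \<^bold>1"] a elts_T1[OF D el[OF a]]
      by (simp add: nv_eq[symmetric])
  qed
  show "nv (pow2 a) = p2 (nv a)" if "a \<in> elts T0" for a
    unfolding p2_def pow2_def using nv_app[OF p] that by simp
qed

lemma p2_0 [simp]: "p2 0 = 1"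
  using pow2_facts(2) pow2_facts(4)[of "\<^bold>0"] by simp

lemma p2_suc [simp]: "p2 (n + 1) = p2 n + p2 n"
  using pow2_facts(3)[of "rp n"] pow2_facts(4)[of "rp n"] pow2_facts(4)[of "rp n \<^bold>+ \<^bold>1"] by simp

text \<open>\<open>pow2\<close> is a function on terms; being definable means reading it as the
  application of one closed term.\<close>

lemma definable_pow2: "definable T0 F \<Longrightarrow> definable T0 (\<lambda>e. pow2 (F e))"
proof -
  assume F: "definable T0 F"
  have "definable T0 (\<lambda>e. eval e (pow2 (Var 0 T0)))" by (rule definable_eval) simp
  obtain g where "g \<in> elts T1" "\<And>t. pow2 t = g \<cdot> t"
    by (rule that[of "Cst CRec \<cdot>
     (Cst (CPi T1 T0) \<cdot> (Cst (CSigma T0 T0 T0) \<cdot> Cst CPlus \<cdot>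
        (Cst (CSigma T0 T1 T0) \<cdot> Cst (CPi T0 T1) \<cdot> Cst (CPi T0 T0)))) \<cdot> \<^bold>1"])
      (auto simp: pow2_def elts_def)
  then show ?thesis using definable_app[OF definable_const F] by simp
qed

lemma dnn_p2: "dnn X \<Longrightarrow> dnn (\<lambda>e. p2 (X e))"
proof -
  assume "dnn X"
  then obtain F where F: "definable T0 F" "\<And>e. env e \<Longrightarrow> X e = nv (F e)" unfolding dnn_def by blast
  show ?thesis unfolding dnn_def
    by (intro exI[of _ "\<lambda>e. pow2 (F e)"]) (use F definable_elts in \<open>auto intro: definable_pow2 simp: pow2_facts(4)\<close>)
qed

lemmas dnn_intros = dnn_plus dnn_times dnn_p2 dnn_fn dnn_const dnn_nv definable_var definable_const

text \<open>Makes the powers of two cofinal in \<open>nn\<close>, nonstandard elements included. The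
  Archimedean properties \<open>hp_archimedean\<close> and \<open>HP_archimedean\<close> come from
  here.\<close>

lemma p2_greater: "n < p2 n"
proof (rule nn_induct[of "\<lambda>n. n < p2 n"])
  show "ar (\<lambda>e. nv (e (0, T0)) < p2 (nv (e (0, T0))))" by (intro ar_nn_less dnn_intros)
  show "n + 1 < p2 (n + 1)" if "n < p2 n" for n
  proof -
    have "n + 1 \<le> p2 n" using that by (metis nn_less_suc not_less add_le_cancel_right linorder_not_le)
    moreover have "0 < p2 n" using that nn_nonneg by (rule le_less_trans[rotated])
    ultimately show ?thesis by (metis add_le_less_mono add.right_neutral p2_suc)
  qed
qed simp

lemma p2_pos [simp]: "0 < p2 n"
  using le_less_trans[OF nn_nonneg p2_greater] .

lemma p2_mono: "m \<le> n \<Longrightarrow> p2 m \<le> p2 n"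
proof -
  have "p2 m \<le> p2 (m + k)" for k
  proof (rule nn_induct[of "\<lambda>k. p2 m \<le> p2 (m + k)"])
    show "ar (\<lambda>e. p2 m \<le> p2 (m + nv (e (0, T0))))" by (intro ar_nn_le dnn_intros)
    show "p2 m \<le> p2 (m + (k + 1))" if "p2 m \<le> p2 (m + k)" for k
      using that p2_suc[of "m + k"] add_increasing[of "p2 (m + k)"] by (simp add: add.assoc)
  qed simp
  then show "m \<le> n \<Longrightarrow> p2 m \<le> p2 n" unfolding nn_le_iff by blast
qed

definition pairs :: "nn \<Rightarrow> nn \<Rightarrow> nn \<Rightarrow> bool" where
  "pairs a b p \<longleftrightarrow> p + p = (a + b) * (a + b + 1) + (b + b)"

text \<open>A code exists because \<open>s * (s + 1)\<close> is even, which is shown by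
  induction.\<close>

lemma pairs_total: "\<exists>p. pairs a b p"
proof -
  have "\<exists>t. t + t = s * (s + 1)" for s :: nn
  proof (rule nn_induct[of "\<lambda>s. \<exists>t. t + t = s * (s + 1)"])
    show "ar (\<lambda>e. \<exists>t. t + t = nv (e (0, T0)) * (nv (e (0, T0)) + 1))"
      by (intro ar_nn_ex[of _ 1] ar_nn_eq dnn_intros) simp
    show "\<exists>t. t + t = (s + 1) * (s + 1 + 1)" if ex: "\<exists>t. t + t = s * (s + 1)" for s :: nn
    proof -
      obtain t where "t + t = s * (s + 1)" using ex by blast
      moreover have "(t + (s + 1)) + (t + (s + 1)) = (t + t) + (s + 1) + (s + 1)" by (simp only: add_ac)
      ultimately have "(t + (s + 1)) + (t + (s + 1)) = s * (s + 1) + (s + 1) + (s + 1)" by (simp only:)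
      also have "\<dots> = (s + 1) * (s + 1 + 1)"
        by (simp only: distrib_left distrib_right mult_1_left mult_1_right add_ac mult_ac)
      finally show ?thesis by blast
    qed
  qed (intro exI[of _ 0], simp)
  then obtain t where "t + t = (a + b) * (a + b + 1)" by blast
  then have "pairs a b (t + b)" by (simp add: pairs_def algebra_simps)
  then show ?thesis ..
qed

text \<open>The successor of a code walks along the antidiagonal, from \<open>(c + 1, b)\<close> to
  \<open>(c, b + 1)\<close>, and from its end \<open>(0, b)\<close> to the start
  \<open>(b + 1, 0)\<close> of the next one.\<close>

lemma pairs_surj: "\<exists>a b. pairs a b n"
proof (rule nn_induct[of "\<lambda>n. \<exists>a b. pairs a b n"])
  show "ar (\<lambda>e. \<exists>a b. pairs a b (nv (e (0, T0))))"
    unfolding pairs_def by (intro ar_nn_ex[of _ 1] ar_nn_ex[of _ 2] ar_nn_eq dnn_intros) simp_all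
  show "\<exists>a b. pairs a b 0" by (intro exI[of _ 0]) (simp add: pairs_def)
  show "\<exists>a b. pairs a b (n + 1)" if ex: "\<exists>a b. pairs a b n" for n
  proof -
    obtain a b where ab: "pairs a b n" using ex by blast
    then have e: "(n + 1) + (n + 1) = (a + b) * (a + b + 1) + (b + 1) + (b + 1)"
      unfolding pairs_def by (simp add: algebra_simps)
    from nn_zero_or_suc[of a] show ?thesis
    proof
      assume "a = 0"
      then have "pairs (b + 1) 0 (n + 1)" using e by (simp add: pairs_def algebra_simps)
      then show ?thesis by blast
    next
      assume "\<exists>y. a = y + 1"
      then obtain c where "a = c + 1" by blast
      then have "pairs c (b + 1) (n + 1)" using e by (simp add: pairs_def algebra_simps)
      then show ?thesis by blast
    qed
  qed
qed

text \<open>The codes with sum \<open>s\<close> stop before those with sum \<open>s + 1\<close>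
  begin: doubled, the former are at most \<open>s * (s + 1) + 2 * s\<close>, the latter at least
  \<open>(s + 1) * (s + 2)\<close>, which is larger by 2.\<close>

lemma pairs_less: "pairs a b n \<Longrightarrow> pairs a' b' n' \<Longrightarrow> a + b < a' + b' \<Longrightarrow> n < n'"
proof -
  assume *: "pairs a b n" "pairs a' b' n'" "a + b < a' + b'"
  let ?s = "a + b" and ?s' = "a' + b'"
  have s: "?s + 1 \<le> ?s'" using *(3) by (metis nn_less_suc not_less add_le_cancel_right linorder_not_le)
  have "n + n = ?s * (?s + 1) + (b + b)" using *(1) by (simp add: pairs_def)
  also have "\<dots> \<le> ?s * (?s + 1) + (?s + ?s)" by (intro add_mono) (auto intro: add_increasing)
  also have "\<dots> < ?s * (?s + 1) + (?s + ?s) + (1 + 1)"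
    using add_strict_left_mono[of 0 "1 + 1" "?s * (?s + 1) + (?s + ?s)"] by (simp add: add_pos_pos)
  also have "\<dots> = (?s + 1) * (?s + 1 + 1)"
    by (simp only: distrib_left distrib_right mult_1_left mult_1_right add_ac mult_ac)
  also have "\<dots> \<le> ?s' * (?s' + 1)" by (rule mult_mono[OF s add_right_mono[OF s]]) auto
  also have "\<dots> \<le> n' + n'" using *(2) by (simp add: pairs_def add_increasing2)
  finally show ?thesis by (meson add_mono not_less)
qed

lemma pairs_unique: "pairs a b n \<Longrightarrow> pairs a' b' n \<Longrightarrow> a = a' \<and> b = b'"
proof -
  assume *: "pairs a b n" "pairs a' b' n"
  then have s: "a + b = a' + b'" using pairs_less by (metis less_irrefl linorder_neqE)
  then have "b + b = b' + b'" using * unfolding pairs_def by (metis add_left_cancel)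
  then have "b = b'" by (metis add_strict_mono less_irrefl linorder_neqE)
  then show ?thesis using s by simp
qed

end

section \<open>Rational numbers of the model\<close>

type_synonym qq = "nn diff fract"
type_synonym rr = "(nn, nn diff fract) completion"

abbreviation ofn :: "nn \<Rightarrow> qq" where "ofn \<equiv> of_semi_fract"

context the_model
begin

definition codes :: "nn \<Rightarrow> nn \<Rightarrow> nn \<Rightarrow> nn \<Rightarrow> bool" where
  "codes a b c n \<longleftrightarrow> (\<exists>p. pairs a b p \<and> pairs p c n)"

definition rat :: "nn \<Rightarrow> qq" where
  "rat n = (THE q. \<exists>a b c. codes a b c n \<and> q = (ofn a - ofn b) / ofn (c + 1))"

lemma codes_surj: "\<exists>a b c. codes a b c n"
  unfolding codes_def using pairs_surj by metis

lemma codes_unique: "codes a b c n \<Longrightarrow> codes a' b' c' n \<Longrightarrow> a = a' \<and> b = b' \<and> c = c'"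
  unfolding codes_def using pairs_unique by metis

lemma rat_codes: "codes a b c n \<Longrightarrow> rat n = (ofn a - ofn b) / ofn (c + 1)"
  unfolding rat_def by (rule the_equality) (use codes_unique in blast)+

lemma rat_surj: "\<exists>n. rat n = q"
proof -
  obtain a b d where d: "d > 0" "q = (ofn a - ofn b) / ofn d" by (rule fract_cases_semi)
  then obtain c where "d = c + 1" using nn_zero_or_suc[of d] by auto
  moreover obtain n where "codes a b c n" unfolding codes_def using pairs_total by metis
  ultimately show ?thesis using rat_codes d by metis
qed

lemma rat_0 [simp]: "rat 0 = 0" and rat_1 [simp]: "rat 1 = 1"
proof -
  have "codes 0 0 0 0" unfolding codes_def pairs_def by (rule exI[of _ 0]) simp
  from rat_codes[OF this] show "rat 0 = 0" by simp
  have "codes 1 0 0 1" unfolding codes_def pairs_def by (rule exI[of _ 1]) simp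
  from rat_codes[OF this] show "rat 1 = 1" by simp
qed

definition hp :: "nn \<Rightarrow> qq" where "hp k = 1 / ofn (p2 k)"

lemma ofn_pos [simp]: "0 < ofn n \<longleftrightarrow> 0 < n"
  using of_semi_fract_simps(6)[of 0 n] by simp

lemma ofn_nonneg [simp]: "0 \<le> ofn n"
  using of_semi_fract_simps(7)[of 0 n] by simp

lemma hp_pos [simp]: "0 < hp k"
  by (simp add: hp_def)

lemma hp_0 [simp]: "hp 0 = 1"
  by (simp add: hp_def)

lemma hp_suc: "hp (k + 1) = hp k / 2"
proof -
  have "ofn (p2 (k + 1)) = 2 * ofn (p2 k)" by simp
  then show ?thesis by (simp add: hp_def)
qed

lemma hp_mono: "m \<le> n \<Longrightarrow> hp n \<le> hp m"
  using p2_mono[of m n] by (simp add: hp_def frac_le)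

text \<open>The numerator of a positive rational is at least 1, so \<open>q\<close> is at least
  \<open>1 / d\<close>, which exceeds \<open>2^-d\<close>.\<close>

lemma hp_archimedean:
  assumes "0 < q" obtains k where "hp k < q"
proof -
  obtain a b d where d: "d > 0" "q = (ofn a - ofn b) / ofn d" by (rule fract_cases_semi)
  then have "b < a" using assms ofn_nonneg[of d] by (auto simp: zero_less_divide_iff simp del: ofn_nonneg)
  then obtain w where "a = b + w + 1" unfolding nn_less_iff by blast
  then have "ofn a - ofn b = ofn w + 1" by simp
  then have "1 / ofn d \<le> q" unfolding d(2) using d(1) by (intro divide_right_mono) auto
  moreover have "hp d < 1 / ofn d"
    unfolding hp_def using p2_greater[of d] d(1) by (intro divide_strict_left_mono mult_pos_pos) auto
  ultimately show thesis using that[of d] by (meson less_le_trans)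
qed

end

section \<open>The real numbers of a model\<close>

lemma frac_less:
  fixes a b c a' b' c' :: "'a::linordered_field"
  assumes "0 < c" "0 < c'"
  shows "(a - b) / c < (a' - b') / c' \<longleftrightarrow> a * c' + b' * c < a' * c + b * c'"
proof -
  have "(a - b) / c < (a' - b') / c' \<longleftrightarrow> (a - b) * c' < (a' - b') * c"
    using assms by (simp add: divide_less_eq less_divide_eq mult.commute)
  also have "\<dots> \<longleftrightarrow> a * c' + b' * c < a' * c + b * c'" by (simp add: left_diff_distrib) linarith
  finally show ?thesis .
qed

lemma frac_add:
  fixes a b c a' b' c' :: "'a::field"
  assumes "c \<noteq> 0" "c' \<noteq> 0"
  shows "((a * c' + a' * c) - (b * c' + b' * c)) / (c * c') = (a - b) / c + (a' - b') / c'"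
  using assms by (simp add: add_frac_eq) (simp add: algebra_simps)

lemma ofn_2 [simp]: "of_semi_fract 2 = 2"
  using of_semi_fract_simps(3)[of 1 1] by simp

context the_model
begin

section \<open>Truth of the formulas about reals\<close>

definition isr :: "tm \<Rightarrow> bool" where
  "isr x \<longleftrightarrow> (\<forall>n i. \<bar>rat (fn x n) - rat (fn x (n + i))\<bar> < hp n)"
definition req :: "tm \<Rightarrow> tm \<Rightarrow> bool" where
  "req x y \<longleftrightarrow> (\<forall>n. \<bar>rat (fn x n) - rat (fn y n)\<bar> \<le> 2 * hp n)"
definition rlt :: "tm \<Rightarrow> tm \<Rightarrow> bool" where
  "rlt x y \<longleftrightarrow> (\<exists>n. rat (fn x n) + 2 * hp n < rat (fn y n))"
definition nearr :: "nn \<Rightarrow> tm \<Rightarrow> tm \<Rightarrow> bool" where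
  "nearr k x y \<longleftrightarrow> (\<exists>n. \<bar>rat (fn x n) - rat (fn y n)\<bar> < hp k - 2 * hp n)"

text \<open>Relates the environment in which a term was written to later ones, in which
  \<open>with_rat\<close> has bound its own variables at greater depths.\<close>

definition agree :: "nat \<Rightarrow> (nat \<times> ty \<Rightarrow> tm) \<Rightarrow> (nat \<times> ty \<Rightarrow> tm) \<Rightarrow> bool" where
  "agree d e e' \<longleftrightarrow> (\<forall>t. below d t \<longrightarrow> eval e' t = eval e t)"

fun qv :: "(nat \<times> ty \<Rightarrow> tm) \<Rightarrow> rat_t \<Rightarrow> qq" where
  "qv e (a, b, d) = (ofn (nv (eval e a)) - ofn (nv (eval e b))) / ofn (nv (eval e d))"

text \<open>A positive denominator belongs to the well-formedness of a triple because the cross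
  multiplication in \<open>rat_less\<close> is correct only then.\<close>

fun rat_ok :: "nat \<Rightarrow> (nat \<times> ty \<Rightarrow> tm) \<Rightarrow> rat_t \<Rightarrow> bool" where
  "rat_ok k e (a, b, d) \<longleftrightarrow> below k a \<and> below k b \<and> below k d \<and> typed a T0 \<and> typed b T0 \<and> typed d T0 \<and>
     0 < nv (eval e d)"

lemma agree_refl: "agree d e e"
  by (simp add: agree_def)

lemma below_mono: "below d t \<Longrightarrow> d \<le> d' \<Longrightarrow> below d' t"
  by (auto simp: below_def)

lemma agree_upd: "agree d e e' \<Longrightarrow> d \<le> j \<Longrightarrow> agree d e (e'((j, \<sigma>) := a))"
  unfolding agree_def using below_mono by (metis eval_below)

lemma agree_trans: "agree d e e' \<Longrightarrow> agree d' e' e'' \<Longrightarrow> d \<le> d' \<Longrightarrow> agree d e e''"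
  unfolding agree_def using below_mono by metis

lemma rat_ok_agree: "rat_ok d e q \<Longrightarrow> agree d e e' \<Longrightarrow> d \<le> d' \<Longrightarrow> rat_ok d' e' q \<and> qv e' q = qv e q"
  by (cases q) (auto simp: agree_def intro: below_mono)

lemma below_pow2 [simp]: "below d (pow2 t) = below d t"
  by (simp add: pow2_def)

lemma rat_ok_eps:
  assumes "below d n" "typed n T0" "env e"
  shows "rat_ok d e (eps n)" "qv e (eps n) = hp (nv (eval e n))"
    "rat_ok d e (eps2 n)" "qv e (eps2 n) = 2 * hp (nv (eval e n))"
  using assms elts_eval[OF assms(3,2)] by (simp_all add: eps_def eps2_def pow2_facts(4) hp_def)

lemma rat_ok_neg: "rat_ok d e q \<Longrightarrow> rat_ok d e (\<^bold>-\<^sub>Q q) \<and> qv e (\<^bold>-\<^sub>Q q) = - qv e q"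
  by (cases q) (auto simp: minus_divide_left)

lemma rat_ok_add:
  assumes "rat_ok d e q" "rat_ok d e r" "env e"
  shows "rat_ok d e (q \<^bold>+\<^sub>Q r) \<and> qv e (q \<^bold>+\<^sub>Q r) = qv e q + qv e r"
proof -
  obtain a b c a' b' c' where qr: "q = (a, b, c)" "r = (a', b', c')" by (metis prod_cases3)
  have el: "eval e a \<in> elts T0" "eval e b \<in> elts T0" "eval e c \<in> elts T0"
    "eval e a' \<in> elts T0" "eval e b' \<in> elts T0" "eval e c' \<in> elts T0"
    using assms elts_eval unfolding qr by auto
  have pos: "0 < ofn (nv (eval e c))" "0 < ofn (nv (eval e c'))" using assms unfolding qr by auto
  then have "ofn (nv (eval e c)) \<noteq> 0" "ofn (nv (eval e c')) \<noteq> 0" by (metis less_irrefl)+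
  from frac_add[OF this] show ?thesis using assms el unfolding qr by (auto simp: mult_pos_pos)
qed

lemma sat_rat_less:
  assumes "rat_ok d e q" "rat_ok d e r" "env e"
  shows "sat M e ((q \<^bold><\<^sub>Q r) d) \<longleftrightarrow> qv e q < qv e r"
proof -
  obtain a b c a' b' c' where qr: "q = (a, b, c)" "r = (a', b', c')" by (metis prod_cases3)
  have el: "eval e a \<in> elts T0" "eval e b \<in> elts T0" "eval e c \<in> elts T0"
    "eval e a' \<in> elts T0" "eval e b' \<in> elts T0" "eval e c' \<in> elts T0"
    using assms elts_eval unfolding qr by auto
  have pos: "0 < ofn (nv (eval e c))" "0 < ofn (nv (eval e c'))" using assms unfolding qr by auto
  have "sat M e ((q \<^bold><\<^sub>Q r) d) \<longleftrightarrow>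
    ofn (nv (eval e a) * nv (eval e c') + nv (eval e b') * nv (eval e c))
    < ofn (nv (eval e a') * nv (eval e c) + nv (eval e b) * nv (eval e c'))"
    using el unfolding qr of_semi_fract_simps(6) by (simp add: nv_less del: of_semi_fract_simps)
  also have "\<dots> \<longleftrightarrow> qv e q < qv e r"
    unfolding qr using frac_less[OF pos] by simp
  finally show ?thesis .
qed

lemma sat_rat_abs_less:
  assumes "rat_ok d e q" "rat_ok d e r" "env e"
  shows "sat M e (rat_abs_less q r d) \<longleftrightarrow> \<bar>qv e q\<bar> < qv e r"
  using sat_rat_less[OF assms] sat_rat_less[of d e "\<^bold>-\<^sub>Q q" r] rat_ok_neg[OF assms(1)] assms
  by (auto simp: rat_abs_less_def)

lemma sat_rat_abs_le:
  assumes "rat_ok d e q" "rat_ok d e r" "env e"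
  shows "sat M e (rat_abs_le q r d) \<longleftrightarrow> \<bar>qv e q\<bar> \<le> qv e r"
  using sat_rat_less[OF assms(2,1,3)] sat_rat_less[of d e r "\<^bold>-\<^sub>Q q"] rat_ok_neg[OF assms(1)] assms
  by (auto simp: rat_abs_le_def)

lemma sat_pair_code:
  assumes "typed a T0" "typed b T0" "typed p T0" "env e"
  shows "sat M e (pair_code a b p d) \<longleftrightarrow> pairs (nv (eval e a)) (nv (eval e b)) (nv (eval e p))"
  using assms elts_eval by (simp add: pair_code_def pairs_def nv_eq[symmetric])

text \<open>\<open>with_rat\<close> binds four variables, hence the depth \<open>d + 4\<close>. Its
  existential quantifiers pick out the one rational coded by \<open>n\<close>, since components
  exist and are unique. The body has to mean \<open>Q\<close> only for triples in scope and in
  environments that still agree with \<open>e\<close>.\<close>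

lemma with_rat_sem:
  assumes n: "typed n T0" "below d n" "env e"
    and P: "\<And>e' q. env e' \<Longrightarrow> agree d e e' \<Longrightarrow> rat_ok (d + 4) e' q \<Longrightarrow> sat M e' (P q (d + 4)) \<longleftrightarrow> Q (qv e' q)"
  shows "sat M e (with_rat n P d) \<longleftrightarrow> Q (rat (nv (eval e n)))"
proof -
  have s: "Suc (Suc (Suc (Suc d))) = d + 4" by simp
  let ?e = "\<lambda>a b c p. e((d, T0) := a, (Suc d, T0) := b, (Suc (Suc d), T0) := c, (Suc (Suc (Suc d)), T0) := p)"
  let ?q = "(Var d T0, Var (Suc d) T0, Var (Suc (Suc d)) T0 \<^bold>+ \<^bold>1)"
  have ev: "eval (?e a b c p) n = eval e n" for a b c p
    using n(2) by simp
  have sat: "sat M (?e a b c p) (P ?q (d + 4)) \<longleftrightarrow> Q ((ofn (nv a) - ofn (nv b)) / ofn (nv c + 1))"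
    if el: "a \<in> elts T0" "b \<in> elts T0" "c \<in> elts T0" "p \<in> elts T0" for a b c p
  proof -
    have env: "env (?e a b c p)" using el n(3) by (intro env_upd)
    have "agree d e (?e a b c p)" by (intro agree_upd agree_refl) auto
    moreover have "0 < nv c + 1" by (simp add: add_nonneg_pos)
    ultimately show ?thesis using P[OF env, of ?q] el by simp
  qed
  have "sat M e (with_rat n P d) \<longleftrightarrow> (\<exists>a\<in>elts T0. \<exists>b\<in>elts T0. \<exists>c\<in>elts T0. \<exists>p\<in>elts T0.
      pairs (nv a) (nv b) (nv p) \<and> pairs (nv p) (nv c) (nv (eval e n)) \<and> sat M (?e a b c p) (P ?q (d + 4)))"
    unfolding with_rat_def sat_form s[symmetric] using n
    by (intro bex_cong refl) (simp add: sat_pair_code ev del: fun_upd_apply, simp)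
  also have "\<dots> \<longleftrightarrow> (\<exists>a\<in>elts T0. \<exists>b\<in>elts T0. \<exists>c\<in>elts T0. \<exists>p\<in>elts T0.
      pairs (nv a) (nv b) (nv p) \<and> pairs (nv p) (nv c) (nv (eval e n)) \<and> Q ((ofn (nv a) - ofn (nv b)) / ofn (nv c + 1)))"
    using sat by (intro bex_cong refl) blast
  also have "\<dots> \<longleftrightarrow> (\<exists>a b c p. pairs a b p \<and> pairs p c (nv (eval e n)) \<and> Q ((ofn a - ofn b) / ofn (c + 1)))"
    unfolding nv_ex[symmetric] by blast
  also have "\<dots> \<longleftrightarrow> (\<exists>a b c. codes a b c (nv (eval e n)) \<and> Q ((ofn a - ofn b) / ofn (c + 1)))"
    unfolding codes_def by blast
  also have "\<dots> \<longleftrightarrow> Q (rat (nv (eval e n)))"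
    using codes_surj[of "nv (eval e n)"] rat_codes by metis
  finally show ?thesis .
qed

lemma with_rat2_sem:
  assumes n: "typed n T0" "below d n" and m: "typed m T0" "below d m" and e: "env e"
    and P: "\<And>e' q r. env e' \<Longrightarrow> agree d e e' \<Longrightarrow> rat_ok (d + 8) e' q \<Longrightarrow> rat_ok (d + 8) e' r \<Longrightarrow>
      sat M e' (P q r (d + 8)) \<longleftrightarrow> Q (qv e' q) (qv e' r)"
  shows "sat M e (with_rat n (\<lambda>q. with_rat m (P q)) d) \<longleftrightarrow> Q (rat (nv (eval e n))) (rat (nv (eval e m)))"
proof (rule with_rat_sem[OF n e, of _ "\<lambda>q. Q q (rat (nv (eval e m)))"])
  fix e' q assume e': "env e'" "agree d e e'" "rat_ok (d + 4) e' q"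
  have "eval e' m = eval e m" using e'(2) m(2) by (simp add: agree_def)
  moreover have "sat M e' (with_rat m (P q) (d + 4)) \<longleftrightarrow> Q (qv e' q) (rat (nv (eval e' m)))"
  proof (rule with_rat_sem[OF m(1) below_mono[OF m(2)] e'(1)])
    fix e'' r assume e'': "env e''" "agree (d + 4) e' e''" "rat_ok (d + 4 + 4) e'' r"
    have ok: "rat_ok (d + 8) e'' q" "qv e'' q = qv e' q" using rat_ok_agree[OF e'(3) e''(2)] by auto
    have d: "d + 4 + 4 = d + 8" by simp
    show "sat M e'' (P q r (d + 4 + 4)) \<longleftrightarrow> Q (qv e' q) (qv e'' r)"
      using P[OF e''(1) agree_trans[OF e'(2) e''(2)] ok(1)] ok(2) e''(3) unfolding d by simp
  qed simp
  ultimately show "sat M e' (with_rat m (P q) (d + 4)) \<longleftrightarrow> Q (qv e' q) (rat (nv (eval e m)))" by simp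
qed

lemma agree_eps:
  assumes "agree d e e'" "below d n" "typed n T0" "env e'" "d \<le> d'"
  shows "rat_ok d' e' (eps n)" "qv e' (eps n) = hp (nv (eval e n))"
    "rat_ok d' e' (eps2 n)" "qv e' (eps2 n) = 2 * hp (nv (eval e n))"
  using rat_ok_eps[OF below_mono[OF assms(2,5)] assms(3,4)] assms(1,2) by (simp_all add: agree_def)

lemma rat_ok_diff:
  "rat_ok d e q \<Longrightarrow> rat_ok d e r \<Longrightarrow> env e \<Longrightarrow> rat_ok d e (q \<^bold>+\<^sub>Q \<^bold>-\<^sub>Q r) \<and> qv e (q \<^bold>+\<^sub>Q \<^bold>-\<^sub>Q r) = qv e q - qv e r"
  using rat_ok_add[of d e q "\<^bold>-\<^sub>Q r"] rat_ok_neg[of d e r] by auto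

lemma sat_is_real [simp]:
  assumes x: "typed x T1" "below d x" "env e"
  shows "sat M e (is_real x d) \<longleftrightarrow> isr (eval e x)"
proof -
  have "sat M e (is_real x d) \<longleftrightarrow> (\<forall>a\<in>elts T0. \<forall>b\<in>elts T0.
     \<bar>rat (fn (eval e x) (nv a)) - rat (fn (eval e x) (nv a + nv b))\<bar> < hp (nv a))"
    unfolding is_real_def sat_form
  proof (intro ball_cong refl)
    fix a b assume ab: "a \<in> elts T0" "b \<in> elts T0"
    let ?e = "e((d, T0) := a, (Suc d, T0) := b)"
    let ?n = "Var d T0" and ?d = "Suc (Suc d)"
    have e: "env ?e" using ab x(3) by simp
    have "sat M ?e (with_rat (x \<cdot> ?n) (\<lambda>q. with_rat (x \<cdot> (?n \<^bold>+ Var (Suc d) T0)) (\<lambda>r.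
       rat_abs_less (q \<^bold>+\<^sub>Q \<^bold>-\<^sub>Q r) (eps ?n))) ?d) \<longleftrightarrow>
       \<bar>rat (nv (eval ?e (x \<cdot> ?n))) - rat (nv (eval ?e (x \<cdot> (?n \<^bold>+ Var (Suc d) T0))))\<bar> < hp (nv (eval ?e ?n))"
    proof (rule with_rat2_sem[of _ _ _ _ _ "\<lambda>q r. \<bar>q - r\<bar> < hp (nv (eval ?e ?n))"])
      fix e' q r assume *: "env e'" "agree ?d ?e e'" "rat_ok (?d + 8) e' q" "rat_ok (?d + 8) e' r"
      have "rat_ok (?d + 8) e' (eps ?n)" "qv e' (eps ?n) = hp (nv (eval ?e ?n))"
        using agree_eps[OF *(2) _ _ *(1), of ?n "?d + 8"] by simp_all
      then show "sat M e' (rat_abs_less (q \<^bold>+\<^sub>Q \<^bold>-\<^sub>Q r) (eps ?n) (?d + 8)) \<longleftrightarrow> \<bar>qv e' q - qv e' r\<bar> < hp (nv (eval ?e ?n))"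
        using sat_rat_abs_less[of "?d + 8" e' "q \<^bold>+\<^sub>Q \<^bold>-\<^sub>Q r" "eps ?n"] rat_ok_diff[OF *(3,4,1)] *(1) by simp
    qed (use x e in simp_all)
    then show "sat M ?e (with_rat (x \<cdot> ?n) (\<lambda>q. with_rat (x \<cdot> (?n \<^bold>+ Var (Suc d) T0)) (\<lambda>r.
       rat_abs_less (q \<^bold>+\<^sub>Q \<^bold>-\<^sub>Q r) (eps ?n))) ?d) \<longleftrightarrow>
       \<bar>rat (fn (eval e x) (nv a)) - rat (fn (eval e x) (nv a + nv b))\<bar> < hp (nv a)"
      using x ab by (simp add: nv_app elts_eval)
  qed
  also have "\<dots> \<longleftrightarrow> isr (eval e x)"
    unfolding isr_def nv_all[symmetric] ..
  finally show ?thesis .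
qed

lemma sat_real_eq [simp]:
  assumes x: "typed x T1" "below d x" and y: "typed y T1" "below d y" and e: "env e"
  shows "sat M e ((x \<^bold>=\<^sub>R y) d) \<longleftrightarrow> req (eval e x) (eval e y)"
proof -
  have "sat M e ((x \<^bold>=\<^sub>R y) d) \<longleftrightarrow> (\<forall>a\<in>elts T0. \<bar>rat (fn (eval e x) (nv a)) - rat (fn (eval e y) (nv a))\<bar> \<le> 2 * hp (nv a))"
    unfolding real_eq_def sat_form
  proof (intro ball_cong refl)
    fix a assume a: "a \<in> elts T0"
    let ?e = "e((d, T0) := a)"
    let ?n = "Var d T0" and ?d = "Suc d"
    have e': "env ?e" using a e by simp
    have "sat M ?e (with_rat (x \<cdot> ?n) (\<lambda>q. with_rat (y \<cdot> ?n) (\<lambda>r. rat_abs_le (q \<^bold>+\<^sub>Q \<^bold>-\<^sub>Q r) (eps2 ?n))) ?d) \<longleftrightarrow>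
       \<bar>rat (nv (eval ?e (x \<cdot> ?n))) - rat (nv (eval ?e (y \<cdot> ?n)))\<bar> \<le> 2 * hp (nv (eval ?e ?n))"
    proof (rule with_rat2_sem[of _ _ _ _ _ "\<lambda>q r. \<bar>q - r\<bar> \<le> 2 * hp (nv (eval ?e ?n))"])
      fix e' q r assume *: "env e'" "agree ?d ?e e'" "rat_ok (?d + 8) e' q" "rat_ok (?d + 8) e' r"
      have "rat_ok (?d + 8) e' (eps2 ?n)" "qv e' (eps2 ?n) = 2 * hp (nv (eval ?e ?n))"
        using agree_eps[OF *(2) _ _ *(1), of ?n "?d + 8"] by simp_all
      then show "sat M e' (rat_abs_le (q \<^bold>+\<^sub>Q \<^bold>-\<^sub>Q r) (eps2 ?n) (?d + 8)) \<longleftrightarrow> \<bar>qv e' q - qv e' r\<bar> \<le> 2 * hp (nv (eval ?e ?n))"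
        using sat_rat_abs_le[of "?d + 8" e' "q \<^bold>+\<^sub>Q \<^bold>-\<^sub>Q r" "eps2 ?n"] rat_ok_diff[OF *(3,4,1)] *(1) by simp
    qed (use x y e' in simp_all)
    then show "sat M ?e (with_rat (x \<cdot> ?n) (\<lambda>q. with_rat (y \<cdot> ?n) (\<lambda>r. rat_abs_le (q \<^bold>+\<^sub>Q \<^bold>-\<^sub>Q r) (eps2 ?n))) ?d) \<longleftrightarrow>
       \<bar>rat (fn (eval e x) (nv a)) - rat (fn (eval e y) (nv a))\<bar> \<le> 2 * hp (nv a)"
      using x y e a by (simp add: nv_app elts_eval)
  qed
  also have "\<dots> \<longleftrightarrow> req (eval e x) (eval e y)"
    unfolding req_def nv_all[symmetric] ..
  finally show ?thesis .
qed

lemma sat_real_less [simp]: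
  assumes x: "typed x T1" "below d x" and y: "typed y T1" "below d y" and e: "env e"
  shows "sat M e ((x \<^bold><\<^sub>R y) d) \<longleftrightarrow> rlt (eval e x) (eval e y)"
proof -
  have "sat M e ((x \<^bold><\<^sub>R y) d) \<longleftrightarrow> (\<exists>a\<in>elts T0. rat (fn (eval e x) (nv a)) + 2 * hp (nv a) < rat (fn (eval e y) (nv a)))"
    unfolding real_less_def sat_form
  proof (intro bex_cong refl)
    fix a assume a: "a \<in> elts T0"
    let ?e = "e((d, T0) := a)"
    let ?n = "Var d T0" and ?d = "Suc d"
    have e': "env ?e" using a e by simp
    have "sat M ?e (with_rat (x \<cdot> ?n) (\<lambda>q. with_rat (y \<cdot> ?n) (\<lambda>r. q \<^bold>+\<^sub>Q eps2 ?n \<^bold><\<^sub>Q r)) ?d) \<longleftrightarrow>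
       rat (nv (eval ?e (x \<cdot> ?n))) + 2 * hp (nv (eval ?e ?n)) < rat (nv (eval ?e (y \<cdot> ?n)))"
    proof (rule with_rat2_sem[of _ _ _ _ _ "\<lambda>q r. q + 2 * hp (nv (eval ?e ?n)) < r"])
      fix e' q r assume *: "env e'" "agree ?d ?e e'" "rat_ok (?d + 8) e' q" "rat_ok (?d + 8) e' r"
      have "rat_ok (?d + 8) e' (eps2 ?n)" "qv e' (eps2 ?n) = 2 * hp (nv (eval ?e ?n))"
        using agree_eps[OF *(2) _ _ *(1), of ?n "?d + 8"] by simp_all
      then show "sat M e' ((q \<^bold>+\<^sub>Q eps2 ?n \<^bold><\<^sub>Q r) (?d + 8)) \<longleftrightarrow> qv e' q + 2 * hp (nv (eval ?e ?n)) < qv e' r"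
        using sat_rat_less[of "?d + 8" e' "q \<^bold>+\<^sub>Q eps2 ?n" r] rat_ok_add[OF *(3) _ *(1), of "eps2 ?n"] * by simp
    qed (use x y e' in simp_all)
    then show "sat M ?e (with_rat (x \<cdot> ?n) (\<lambda>q. with_rat (y \<cdot> ?n) (\<lambda>r. q \<^bold>+\<^sub>Q eps2 ?n \<^bold><\<^sub>Q r)) ?d) \<longleftrightarrow>
       rat (fn (eval e x) (nv a)) + 2 * hp (nv a) < rat (fn (eval e y) (nv a))"
      using x y e a by (simp add: nv_app elts_eval)
  qed
  also have "\<dots> \<longleftrightarrow> rlt (eval e x) (eval e y)"
    unfolding rlt_def nv_ex[symmetric] ..
  finally show ?thesis .
qed

lemma sat_near [simp]:
  assumes k: "typed k T0" "below d k" and x: "typed x T1" "below d x" and y: "typed y T1" "below d y" and e: "env e"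
  shows "sat M e (near k x y d) \<longleftrightarrow> nearr (nv (eval e k)) (eval e x) (eval e y)"
proof -
  have "sat M e (near k x y d) \<longleftrightarrow> (\<exists>a\<in>elts T0. \<bar>rat (fn (eval e x) (nv a)) - rat (fn (eval e y) (nv a))\<bar>
      < hp (nv (eval e k)) - 2 * hp (nv a))"
    unfolding near_def sat_form
  proof (intro bex_cong refl)
    fix a assume a: "a \<in> elts T0"
    let ?e = "e((d, T0) := a)"
    let ?n = "Var d T0" and ?d = "Suc d"
    have e': "env ?e" using a e by simp
    have "sat M ?e (with_rat (x \<cdot> ?n) (\<lambda>q. with_rat (y \<cdot> ?n) (\<lambda>r. rat_abs_less (q \<^bold>+\<^sub>Q \<^bold>-\<^sub>Q r) (eps k \<^bold>+\<^sub>Q \<^bold>-\<^sub>Q eps2 ?n))) ?d) \<longleftrightarrow>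
       \<bar>rat (nv (eval ?e (x \<cdot> ?n))) - rat (nv (eval ?e (y \<cdot> ?n)))\<bar> < hp (nv (eval ?e k)) - 2 * hp (nv (eval ?e ?n))"
    proof (rule with_rat2_sem[of _ _ _ _ _ "\<lambda>q r. \<bar>q - r\<bar> < hp (nv (eval ?e k)) - 2 * hp (nv (eval ?e ?n))"])
      fix e' q r assume *: "env e'" "agree ?d ?e e'" "rat_ok (?d + 8) e' q" "rat_ok (?d + 8) e' r"
      have 1: "rat_ok (?d + 8) e' (eps2 ?n)" "qv e' (eps2 ?n) = 2 * hp (nv (eval ?e ?n))"
        using agree_eps[OF *(2) _ _ *(1), of ?n "?d + 8"] by simp_all
      have 2: "rat_ok (?d + 8) e' (eps k)" "qv e' (eps k) = hp (nv (eval ?e k))"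
        using agree_eps[OF *(2) _ _ *(1), of k "?d + 8"] k by simp_all
      show "sat M e' (rat_abs_less (q \<^bold>+\<^sub>Q \<^bold>-\<^sub>Q r) (eps k \<^bold>+\<^sub>Q \<^bold>-\<^sub>Q eps2 ?n) (?d + 8)) \<longleftrightarrow>
          \<bar>qv e' q - qv e' r\<bar> < hp (nv (eval ?e k)) - 2 * hp (nv (eval ?e ?n))"
        using sat_rat_abs_less[of "?d + 8" e' "q \<^bold>+\<^sub>Q \<^bold>-\<^sub>Q r" "eps k \<^bold>+\<^sub>Q \<^bold>-\<^sub>Q eps2 ?n"]
          rat_ok_diff[OF *(3,4,1)] rat_ok_diff[OF 2(1) 1(1) *(1)] 1 2 *(1) by simp
    qed (use x y k e' in simp_all)
    then show "sat M ?e (with_rat (x \<cdot> ?n) (\<lambda>q. with_rat (y \<cdot> ?n) (\<lambda>r. rat_abs_less (q \<^bold>+\<^sub>Q \<^bold>-\<^sub>Q r) (eps k \<^bold>+\<^sub>Q \<^bold>-\<^sub>Q eps2 ?n))) ?d) \<longleftrightarrow>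
       \<bar>rat (fn (eval e x) (nv a)) - rat (fn (eval e y) (nv a))\<bar> < hp (nv (eval e k)) - 2 * hp (nv a)"
      using x y k e a by (simp add: nv_app elts_eval)
  qed
  also have "\<dots> \<longleftrightarrow> nearr (nv (eval e k)) (eval e x) (eval e y)"
    unfolding nearr_def nv_ex[symmetric] ..
  finally show ?thesis .
qed

section \<open>Arithmetical predicates of rationals and reals\<close>

definition dqq :: "((nat \<times> ty \<Rightarrow> tm) \<Rightarrow> qq) \<Rightarrow> bool" where
  "dqq X \<longleftrightarrow> (\<exists>A B C. dnn A \<and> dnn B \<and> dnn C \<and>
     (\<forall>e. env e \<longrightarrow> 0 < C e \<and> X e = (ofn (A e) - ofn (B e)) / ofn (C e)))"

lemma dqqI:
  "dnn A \<Longrightarrow> dnn B \<Longrightarrow> dnn C \<Longrightarrow> (\<And>e. env e \<Longrightarrow> 0 < C e) \<Longrightarrow>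
    (\<And>e. env e \<Longrightarrow> X e = (ofn (A e) - ofn (B e)) / ofn (C e)) \<Longrightarrow> dqq X"
  unfolding dqq_def by blast

lemma dqqE:
  assumes "dqq X"
  obtains A B C where "dnn A" "dnn B" "dnn C" "\<And>e. env e \<Longrightarrow> 0 < C e"
    "\<And>e. env e \<Longrightarrow> X e = (ofn (A e) - ofn (B e)) / ofn (C e)"
  using assms unfolding dqq_def by blast

lemma dqq_const: "dqq (\<lambda>e. q)"
proof -
  obtain a b d where "d > 0" "q = (ofn a - ofn b) / ofn d" by (rule fract_cases_semi)
  then show ?thesis by (intro dqqI[of "\<lambda>e. a" "\<lambda>e. b" "\<lambda>e. d"] dnn_const)
qed

lemma dqq_ofn: "dnn X \<Longrightarrow> dqq (\<lambda>e. ofn (X e))"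
  by (rule dqqI[of X "\<lambda>e. 0" "\<lambda>e. 1"]) (simp_all add: dnn_const)

lemma dqq_hp: "dnn X \<Longrightarrow> dqq (\<lambda>e. hp (X e))"
  by (rule dqqI[of "\<lambda>e. 1" "\<lambda>e. 0" "\<lambda>e. p2 (X e)"]) (simp_all add: dnn_const dnn_p2 hp_def)

lemma dqq_minus: "dqq X \<Longrightarrow> dqq (\<lambda>e. - X e)"
  by (erule dqqE) (rule dqqI[of "B" "A" "C" for A B C], simp_all add: minus_divide_left)

lemma dqq_add:
  assumes "dqq X" "dqq Y" shows "dqq (\<lambda>e. X e + Y e)"
proof -
  obtain A B C where X: "dnn A" "dnn B" "dnn C" "\<And>e. env e \<Longrightarrow> 0 < C e"
    "\<And>e. env e \<Longrightarrow> X e = (ofn (A e) - ofn (B e)) / ofn (C e)" using assms(1) by (rule dqqE) blast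
  obtain A' B' C' where Y: "dnn A'" "dnn B'" "dnn C'" "\<And>e. env e \<Longrightarrow> 0 < C' e"
    "\<And>e. env e \<Longrightarrow> Y e = (ofn (A' e) - ofn (B' e)) / ofn (C' e)" using assms(2) by (rule dqqE) blast
  show ?thesis
  proof (rule dqqI[of "\<lambda>e. A e * C' e + A' e * C e" "\<lambda>e. B e * C' e + B' e * C e" "\<lambda>e. C e * C' e"])
    fix e assume e: "env e"
    then show "0 < C e * C' e" using X(4) Y(4) by simp
    have "ofn (C e) \<noteq> 0" "ofn (C' e) \<noteq> 0" using X(4)[OF e] Y(4)[OF e] by (metis less_irrefl ofn_pos)+
    from frac_add[OF this] show "X e + Y e = (ofn (A e * C' e + A' e * C e) - ofn (B e * C' e + B' e * C e)) / ofn (C e * C' e)"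
      using X(5)[OF e] Y(5)[OF e] by simp
  qed (intro dnn_plus dnn_times X Y)+
qed

lemma dqq_diff: "dqq X \<Longrightarrow> dqq Y \<Longrightarrow> dqq (\<lambda>e. X e - Y e)"
  using dqq_add[OF _ dqq_minus] by fastforce

lemma dqq_mult:
  assumes "dqq X" "dqq Y" shows "dqq (\<lambda>e. X e * Y e)"
proof -
  obtain A B C where X: "dnn A" "dnn B" "dnn C" "\<And>e. env e \<Longrightarrow> 0 < C e"
    "\<And>e. env e \<Longrightarrow> X e = (ofn (A e) - ofn (B e)) / ofn (C e)" using assms(1) by (rule dqqE) blast
  obtain A' B' C' where Y: "dnn A'" "dnn B'" "dnn C'" "\<And>e. env e \<Longrightarrow> 0 < C' e"
    "\<And>e. env e \<Longrightarrow> Y e = (ofn (A' e) - ofn (B' e)) / ofn (C' e)" using assms(2) by (rule dqqE) blast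
  show ?thesis
  proof (rule dqqI[of "\<lambda>e. A e * A' e + B e * B' e" "\<lambda>e. A e * B' e + B e * A' e" "\<lambda>e. C e * C' e"])
    fix e assume e: "env e"
    then show "0 < C e * C' e" using X(4) Y(4) by simp
    show "X e * Y e = (ofn (A e * A' e + B e * B' e) - ofn (A e * B' e + B e * A' e)) / ofn (C e * C' e)"
      using X(5)[OF e] Y(5)[OF e] by (simp add: algebra_simps)
  qed (intro dnn_plus dnn_times X Y)+
qed

lemma ar_qq_less: "dqq X \<Longrightarrow> dqq Y \<Longrightarrow> ar (\<lambda>e. X e < Y e)"
proof -
  assume XY: "dqq X" "dqq Y"
  obtain A B C where X: "dnn A" "dnn B" "dnn C" "\<And>e. env e \<Longrightarrow> 0 < C e"
    "\<And>e. env e \<Longrightarrow> X e = (ofn (A e) - ofn (B e)) / ofn (C e)" using XY(1) by (rule dqqE) blast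
  obtain A' B' C' where Y: "dnn A'" "dnn B'" "dnn C'" "\<And>e. env e \<Longrightarrow> 0 < C' e"
    "\<And>e. env e \<Longrightarrow> Y e = (ofn (A' e) - ofn (B' e)) / ofn (C' e)" using XY(2) by (rule dqqE) blast
  have "ar (\<lambda>e. A e * C' e + B' e * C e < A' e * C e + B e * C' e)"
    by (intro ar_nn_less dnn_plus dnn_times X Y)
  then show ?thesis
  proof (rule ar_ext)
    fix e assume e: "env e"
    have "A e * C' e + B' e * C e < A' e * C e + B e * C' e \<longleftrightarrow>
      ofn (A e * C' e + B' e * C e) < ofn (A' e * C e + B e * C' e)" unfolding of_semi_fract_simps(6) ..
    then show "A e * C' e + B' e * C e < A' e * C e + B e * C' e \<longleftrightarrow> X e < Y e"
      using X(5)[OF e] Y(5)[OF e] frac_less[of "ofn (C e)" "ofn (C' e)"] X(4)[OF e] Y(4)[OF e]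
      by (simp del: of_semi_fract_simps(6) add: of_semi_fract_simps(3,4))
  qed
qed

lemma ar_qq_le: "dqq X \<Longrightarrow> dqq Y \<Longrightarrow> ar (\<lambda>e. X e \<le> Y e)"
  using ar_not[OF ar_qq_less[of Y X]] by (simp add: not_less)

lemma ar_qq_eq: "dqq X \<Longrightarrow> dqq Y \<Longrightarrow> ar (\<lambda>e. X e = Y e)"
  using ar_conj[OF ar_qq_le[of X Y] ar_qq_le[of Y X]] by (simp add: order_eq_iff)

lemma ar_abs_less: "dqq X \<Longrightarrow> dqq Y \<Longrightarrow> ar (\<lambda>e. \<bar>X e\<bar> < Y e)"
  using ar_conj[OF ar_qq_less[of X Y] ar_qq_less[OF dqq_minus, of X Y]] by (simp add: abs_less_iff)

lemma ar_abs_le: "dqq X \<Longrightarrow> dqq Y \<Longrightarrow> ar (\<lambda>e. \<bar>X e\<bar> \<le> Y e)"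
  using ar_conj[OF ar_qq_le[of X Y] ar_qq_le[OF dqq_minus, of X Y]] by (simp add: abs_le_iff)

lemma choice_T1:
  assumes "ar (\<lambda>e. P (nv (e (0, T0))) (nv (e (1, T0))))" "\<And>m. \<exists>n. P m n"
  obtains f where "f \<in> elts T1" "\<And>m. P m (fn f m)"
proof -
  obtain X where X: "dnn X" "\<And>e. env e \<Longrightarrow> P (nv (e (0, T0))) (X e)"
    using nn_choice[of "\<lambda>e. P (nv (e (0, T0)))" 1, OF assms(1)] assms(2) by auto
  then obtain F where F: "definable T0 F" "\<And>e. env e \<Longrightarrow> X e = nv (F e)" unfolding dnn_def by blast
  obtain f where f: "f \<in> elts T1" "\<And>a. a \<in> elts T0 \<Longrightarrow> eqv T0 (f \<cdot> a) (F (e0((0, T0) := a)))"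
    by (rule lam1[OF F(1)]) blast
  have "P m (fn f m)" for m
  proof -
    have e: "env (e0((0, T0) := rp m))" by simp
    have "f \<cdot> rp m \<in> elts T0" "F (e0((0, T0) := rp m)) \<in> elts T0" using f(1) definable_elts[OF F(1) e] by auto
    then have "fn f m = X (e0((0, T0) := rp m))" using f(2)[OF rp_elts, of m] F(2)[OF e] nv_eq by (simp add: fn_def)
    then show ?thesis using X(2)[OF e] by simp
  qed
  with f(1) show thesis using that by blast
qed

text \<open>\<open>rat\<close> is a definite description and no term. Decoders for the three
  components of a code are therefore chosen inside the model, after which the value is a fraction of
  \<open>dnn\<close> terms.\<close>

lemma dqq_rat:
  assumes N: "dnn N" shows "dqq (\<lambda>e. rat (N e))"
proof -
  have ar: "ar (\<lambda>e. codes (nv (e (i, T0))) (nv (e (j, T0))) (nv (e (k, T0))) (nv (e (0, T0))))"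
    if "i < 7" "j < 7" "k < 7" for i j k
    unfolding codes_def pairs_def
    by (intro ar_nn_ex[of _ 7] ar_conj ar_nn_eq dnn_intros) (use that in auto)
  have "ar (\<lambda>e. \<exists>b c. codes (nv (e (1, T0))) b c (nv (e (0, T0))))"
    by (intro ar_nn_ex[of _ 2] ar_nn_ex[of _ 3] ar) auto
  then obtain f where f: "f \<in> elts T1" "\<And>m. \<exists>b c. codes (fn f m) b c m"
    by (rule choice_T1[of "\<lambda>m n. \<exists>b c. codes n b c m"]) (use codes_surj in meson)+
  have "ar (\<lambda>e. \<exists>a c. codes a (nv (e (1, T0))) c (nv (e (0, T0))))"
    by (intro ar_nn_ex[of _ 2] ar_nn_ex[of _ 3] ar) auto
  then obtain g where g: "g \<in> elts T1" "\<And>m. \<exists>a c. codes a (fn g m) c m"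
    by (rule choice_T1[of "\<lambda>m n. \<exists>a c. codes a n c m"]) (use codes_surj in meson)+
  have "ar (\<lambda>e. \<exists>a b. codes a b (nv (e (1, T0))) (nv (e (0, T0))))"
    by (intro ar_nn_ex[of _ 2] ar_nn_ex[of _ 3] ar) auto
  then obtain h where h: "h \<in> elts T1" "\<And>m. \<exists>a b. codes a b (fn h m) m"
    by (rule choice_T1[of "\<lambda>m n. \<exists>a b. codes a b n m"]) (use codes_surj in meson)+
  \<comment> \<open>Each decoder was chosen without regard to the others; uniqueness of the
    components makes them fit together.\<close>
  have "codes (fn f m) (fn g m) (fn h m) m" for m
    using f(2)[of m] g(2)[of m] h(2)[of m] codes_unique by metis
  then have "rat m = (ofn (fn f m) - ofn (fn g m)) / ofn (fn h m + 1)" for m using rat_codes by blast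
  then show ?thesis
    by (intro dqqI[of "\<lambda>e. fn f (N e)" "\<lambda>e. fn g (N e)" "\<lambda>e. fn h (N e) + 1"] dnn_intros N f(1) g(1) h(1))
      (simp_all add: add_nonneg_pos)
qed

lemmas dqq_intros = dqq_const dqq_ofn dqq_hp dqq_minus dqq_add dqq_diff dqq_mult dqq_rat

lemma ar_rel1: "ar (\<lambda>e. R (e (0, \<sigma>))) \<Longrightarrow> definable \<sigma> F \<Longrightarrow> ar (\<lambda>e. R (F e))"
  using ar_subst[of "\<lambda>e. R (e (0, \<sigma>))" \<sigma> F 0] by simp

lemma E_0_cong: "E a b \<Longrightarrow> a \<in> elts T0 \<Longrightarrow> b \<in> elts T0 \<Longrightarrow> E a \<^bold>0 \<longleftrightarrow> E b \<^bold>0"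
  using E_trans[of a b "\<^bold>0"] E_trans[of b a "\<^bold>0"] E_sym[of a b] by auto

lemma rel_fun2:
  assumes "ar (\<lambda>e. R (e (0, \<rho>)) (e (1, \<sigma>)))"
  obtains Y where "Y \<in> elts (\<rho> \<rightarrow> \<sigma> \<rightarrow> T0)" "\<And>x y. x \<in> elts \<rho> \<Longrightarrow> y \<in> elts \<sigma> \<Longrightarrow> E (Y \<cdot> x \<cdot> y) \<^bold>0 \<longleftrightarrow> R x y"
proof -
  obtain G where G: "definable T0 G" "\<And>e. env e \<Longrightarrow> E (G e) \<^bold>0 \<longleftrightarrow> R (e (0, \<rho>)) (e (1, \<sigma>))"
    using assms by (rule arE) blast
  obtain Y where Y: "Y \<in> elts (\<rho> \<rightarrow> \<sigma> \<rightarrow> T0)"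
    "\<And>x y. x \<in> elts \<rho> \<Longrightarrow> y \<in> elts \<sigma> \<Longrightarrow> eqv T0 (Y \<cdot> x \<cdot> y) (G (e0((0, \<rho>) := x, (1, \<sigma>) := y)))"
    by (rule lam2[OF G(1)]) blast
  have "E (Y \<cdot> x \<cdot> y) \<^bold>0 \<longleftrightarrow> R x y" if xy: "x \<in> elts \<rho>" "y \<in> elts \<sigma>" for x y
  proof -
    let ?e = "e0((0, \<rho>) := x, (1, \<sigma>) := y)"
    have e: "env ?e" using xy by simp
    have "E (Y \<cdot> x \<cdot> y) \<^bold>0 \<longleftrightarrow> E (G ?e) \<^bold>0"
      using Y(2)[OF xy] elts_App[OF elts_App[OF Y(1) xy(1)] xy(2)] definable_elts[OF G(1) e]
      by (intro E_0_cong) simp_all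
    then show ?thesis using G(2)[OF e] by simp
  qed
  with Y(1) show thesis using that by blast
qed

lemma rel_fun3:
  assumes "ar (\<lambda>e. R (e (0, \<pi>)) (e (1, \<rho>)) (e (2, \<sigma>)))"
  obtains Y where "Y \<in> elts (\<pi> \<rightarrow> \<rho> \<rightarrow> \<sigma> \<rightarrow> T0)"
    "\<And>x y z. x \<in> elts \<pi> \<Longrightarrow> y \<in> elts \<rho> \<Longrightarrow> z \<in> elts \<sigma> \<Longrightarrow> E (Y \<cdot> x \<cdot> y \<cdot> z) \<^bold>0 \<longleftrightarrow> R x y z"
proof -
  obtain G where G: "definable T0 G" "\<And>e. env e \<Longrightarrow> E (G e) \<^bold>0 \<longleftrightarrow> R (e (0, \<pi>)) (e (1, \<rho>)) (e (2, \<sigma>))"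
    using assms by (rule arE) blast
  obtain Y where Y: "Y \<in> elts (\<pi> \<rightarrow> \<rho> \<rightarrow> \<sigma> \<rightarrow> T0)"
    "\<And>x y z. x \<in> elts \<pi> \<Longrightarrow> y \<in> elts \<rho> \<Longrightarrow> z \<in> elts \<sigma> \<Longrightarrow>
      eqv T0 (Y \<cdot> x \<cdot> y \<cdot> z) (G (e0((0, \<pi>) := x, (1, \<rho>) := y, (2, \<sigma>) := z)))"
    by (rule lam3[OF G(1)]) blast
  have "E (Y \<cdot> x \<cdot> y \<cdot> z) \<^bold>0 \<longleftrightarrow> R x y z" if xyz: "x \<in> elts \<pi>" "y \<in> elts \<rho>" "z \<in> elts \<sigma>" for x y z
  proof -
    let ?e = "e0((0, \<pi>) := x, (1, \<rho>) := y, (2, \<sigma>) := z)"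
    have e: "env ?e" using xyz by simp
    have "E (Y \<cdot> x \<cdot> y \<cdot> z) \<^bold>0 \<longleftrightarrow> E (G ?e) \<^bold>0"
      using Y(2)[OF xyz] elts_App[OF elts_App[OF elts_App[OF Y(1) xyz(1)] xyz(2)] xyz(3)] definable_elts[OF G(1) e]
      by (intro E_0_cong) simp_all
    then show ?thesis using G(2)[OF e] by simp
  qed
  with Y(1) show thesis using that by blast
qed

text \<open>Going through a closed functional substitutes both terms at once. Two successive uses of
  \<open>ar_subst\<close> would evaluate one term in an environment already changed by the
  other.\<close>

lemma ar_rel2:
  assumes "ar (\<lambda>e. R (e (0, \<rho>)) (e (1, \<sigma>)))" "definable \<rho> F" "definable \<sigma> G"
  shows "ar (\<lambda>e. R (F e) (G e))"
proof -
  obtain Y where Y: "Y \<in> elts (\<rho> \<rightarrow> \<sigma> \<rightarrow> T0)" "\<And>x y. x \<in> elts \<rho> \<Longrightarrow> y \<in> elts \<sigma> \<Longrightarrow> E (Y \<cdot> x \<cdot> y) \<^bold>0 \<longleftrightarrow> R x y"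
    by (rule rel_fun2[OF assms(1)]) blast
  have "ar (\<lambda>e. E (Y \<cdot> F e \<cdot> G e) \<^bold>0)"
    by (intro ar_E definable_app[OF definable_app[OF definable_const[OF Y(1)] assms(2)] assms(3)] definable_const elts_consts)
  then show ?thesis
    by (rule ar_ext) (use Y(2) definable_elts assms in blast)
qed

lemma ar_rel3:
  assumes "ar (\<lambda>e. R (e (0, \<pi>)) (e (1, \<rho>)) (e (2, \<sigma>)))" "definable \<pi> H" "definable \<rho> F" "definable \<sigma> G"
  shows "ar (\<lambda>e. R (H e) (F e) (G e))"
proof -
  obtain Y where Y: "Y \<in> elts (\<pi> \<rightarrow> \<rho> \<rightarrow> \<sigma> \<rightarrow> T0)"
    "\<And>x y z. x \<in> elts \<pi> \<Longrightarrow> y \<in> elts \<rho> \<Longrightarrow> z \<in> elts \<sigma> \<Longrightarrow> E (Y \<cdot> x \<cdot> y \<cdot> z) \<^bold>0 \<longleftrightarrow> R x y z"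
    by (rule rel_fun3[OF assms(1)]) blast
  have "ar (\<lambda>e. E (Y \<cdot> H e \<cdot> F e \<cdot> G e) \<^bold>0)"
    by (intro ar_E definable_app[OF definable_app[OF definable_app[OF definable_const[OF Y(1)] assms(2)] assms(3)] assms(4)]
        definable_const elts_consts)
  then show ?thesis
    by (rule ar_ext) (use Y(2) definable_elts assms in blast)
qed

lemma ar_isr: "definable T1 F \<Longrightarrow> ar (\<lambda>e. isr (F e))"
proof (rule ar_rel1[of isr])
  show "ar (\<lambda>e. isr (e (0, T1)))" unfolding isr_def
    by (intro ar_nn_all[of _ 1] ar_nn_all[of _ 2] ar_abs_less dqq_intros dnn_intros) auto
qed

lemma ar_req: "definable T1 F \<Longrightarrow> definable T1 G \<Longrightarrow> ar (\<lambda>e. req (F e) (G e))"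
proof (rule ar_rel2[of req])
  show "ar (\<lambda>e. req (e (0, T1)) (e (1, T1)))" unfolding req_def
    by (intro ar_nn_all[of _ 2] ar_abs_le dqq_intros dnn_intros) auto
qed

lemma ar_rlt: "definable T1 F \<Longrightarrow> definable T1 G \<Longrightarrow> ar (\<lambda>e. rlt (F e) (G e))"
proof (rule ar_rel2[of rlt])
  show "ar (\<lambda>e. rlt (e (0, T1)) (e (1, T1)))" unfolding rlt_def
    by (intro ar_nn_ex[of _ 2] ar_qq_less dqq_intros dnn_intros) auto
qed

lemma ar_nearr:
  assumes K: "dnn K" and FG: "definable T1 F" "definable T1 G" shows "ar (\<lambda>e. nearr (K e) (F e) (G e))"
proof -
  obtain H where H: "definable T0 H" "\<And>e. env e \<Longrightarrow> K e = nv (H e)" using K unfolding dnn_def by blast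
  have "ar (\<lambda>e. nearr (nv (e (0, T0))) (e (1, T1)) (e (2, T1)))" unfolding nearr_def
    by (intro ar_nn_ex[of _ 3] ar_abs_less dqq_intros dnn_intros) auto
  then have "ar (\<lambda>e. nearr (nv (H e)) (F e) (G e))"
    by (rule ar_rel3[of "\<lambda>k. nearr (nv k)", OF _ H(1) FG])
  then show ?thesis by (rule ar_ext) (simp add: H(2))
qed

section \<open>Reals of the model as elements of the completion\<close>

definition val :: "tm \<Rightarrow> rr" where "val x = lim_seq (\<lambda>n. rat (fn x n))"

definition HP :: "nn \<Rightarrow> rr" where "HP k = const (hp k)"

lemma HP_pos [simp]: "0 < HP k"
  using const_less[of 0 "hp k"] by (simp add: HP_def)

lemma HP_suc: "HP (k + 1) = HP k / 2"
  by (simp add: HP_def hp_suc)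

lemma HP_mono: "m \<le> n \<Longrightarrow> HP n \<le> HP m"
  by (simp add: HP_def hp_mono)

lemma HP_archimedean:
  assumes "0 < r" obtains k where "HP k < r"
proof -
  obtain q where q: "0 < q" "const q \<le> r" using const_below_positive[OF assms] by blast
  obtain k where "hp k < q" using hp_archimedean[OF q(1)] by blast
  then have "HP k < const q" by (simp add: HP_def)
  then show thesis using that q(2) by (meson less_le_trans)
qed

lemma isr_cauchy:
  assumes "isr x" shows "cauchy (\<lambda>n. rat (fn x n))"
  unfolding cauchy_def
proof (intro allI impI)
  fix r :: qq assume "0 < r"
  then have "0 < r / 2" by simp
  then obtain k where k: "hp k < r / 2" using hp_archimedean by blast
  have near: "\<bar>rat (fn x k) - rat (fn x m)\<bar> < hp k" if "k \<le> m" for m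
    using assms that unfolding isr_def nn_le_iff by blast
  have "\<bar>rat (fn x m) - rat (fn x n)\<bar> < r" if "k \<le> m" "k \<le> n" for m n
    using near[OF that(1)] near[OF that(2)] k by linarith
  then show "\<exists>k. \<forall>m\<ge>k. \<forall>n\<ge>k. \<bar>rat (fn x m) - rat (fn x n)\<bar> < r" by blast
qed

lemma val_approx:
  assumes "isr x"
  shows "val x \<le> const (rat (fn x n)) + HP n" "const (rat (fn x n)) - HP n \<le> val x"
proof -
  have "rat (fn x m) \<le> rat (fn x n) + hp n \<and> rat (fn x n) - hp n \<le> rat (fn x m)" if "n \<le> m" for m
  proof -
    have "\<bar>rat (fn x n) - rat (fn x m)\<bar> < hp n" using assms that unfolding isr_def nn_le_iff by blast
    then show ?thesis by linarith
  qed
  then have "\<forall>\<^sub>F m in at_top. rat (fn x m) \<le> rat (fn x n) + hp n" "\<forall>\<^sub>F m in at_top. rat (fn x n) - hp n \<le> rat (fn x m)"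
    by (auto simp: eventually_at_top_linorder)
  from lim_seq_le[OF isr_cauchy[OF assms] this(1)] lim_seq_ge[OF isr_cauchy[OF assms] this(2)]
  show "val x \<le> const (rat (fn x n)) + HP n" "const (rat (fn x n)) - HP n \<le> val x"
    by (simp_all add: val_def HP_def)
qed

text \<open>In the definition of \<open>rlt\<close> the margin \<open>2 * hp n\<close> absorbs the
  errors of both approximations. Conversely, \<open>2^-n\<close> has to fit four times into the gap:
  for two errors and for the margin.\<close>

lemma rlt_iff:
  assumes "isr x" "isr y" shows "rlt x y \<longleftrightarrow> val x < val y"
proof
  assume "rlt x y"
  then obtain n where "rat (fn x n) + 2 * hp n < rat (fn y n)" unfolding rlt_def by blast
  then have "const (rat (fn x n) + 2 * hp n) < (const (rat (fn y n)) :: rr)" by (simp only: const_less)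
  then have "const (rat (fn x n)) + 2 * HP n < const (rat (fn y n))" by (simp add: HP_def)
  then show "val x < val y" using val_approx[OF assms(1), of n] val_approx[OF assms(2), of n] by linarith
next
  assume "val x < val y"
  then obtain n where n: "HP n < (val y - val x) / 4" using HP_archimedean[of "(val y - val x) / 4"] by auto
  then have "const (rat (fn x n)) + 2 * HP n < const (rat (fn y n))"
    using val_approx[OF assms(1), of n] val_approx[OF assms(2), of n] by (simp add: field_simps)
  then have "const (rat (fn x n) + 2 * hp n) < (const (rat (fn y n)) :: rr)" by (simp add: HP_def)
  then show "rlt x y" unfolding rlt_def const_less by blast
qed

lemma nearr_iff:
  assumes "isr x" "isr y" shows "nearr k x y \<longleftrightarrow> \<bar>val x - val y\<bar> < HP k"
proof
  assume "nearr k x y"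
  then obtain n where "\<bar>rat (fn x n) - rat (fn y n)\<bar> < hp k - 2 * hp n" unfolding nearr_def by blast
  then have "const \<bar>rat (fn x n) - rat (fn y n)\<bar> < (const (hp k - 2 * hp n) :: rr)" by (simp only: const_less)
  then have "\<bar>const (rat (fn x n)) - const (rat (fn y n))\<bar> < HP k - 2 * HP n" by (simp add: HP_def)
  then show "\<bar>val x - val y\<bar> < HP k" using val_approx[OF assms(1), of n] val_approx[OF assms(2), of n] by linarith
next
  assume "\<bar>val x - val y\<bar> < HP k"
  then obtain n where n: "HP n < (HP k - \<bar>val x - val y\<bar>) / 4" using HP_archimedean[of "(HP k - \<bar>val x - val y\<bar>) / 4"] by auto
  then have "4 * HP n < HP k - \<bar>val x - val y\<bar>" by (simp add: field_simps)
  then have "\<bar>const (rat (fn x n)) - const (rat (fn y n))\<bar> < HP k - 2 * HP n"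
    using val_approx[OF assms(1), of n] val_approx[OF assms(2), of n] by linarith
  then have "const \<bar>rat (fn x n) - rat (fn y n)\<bar> < (const (hp k - 2 * hp n) :: rr)" by (simp add: HP_def)
  then show "nearr k x y" unfolding nearr_def const_less by blast
qed

lemma req_iff:
  assumes "isr x" "isr y" shows "req x y \<longleftrightarrow> val x = val y"
proof
  assume xy: "req x y"
  show "val x = val y"
  proof (rule ccontr)
    assume "val x \<noteq> val y"
    then obtain n where n: "HP n < \<bar>val x - val y\<bar> / 4" using HP_archimedean[of "\<bar>val x - val y\<bar> / 4"] by auto
    have "\<bar>rat (fn x n) - rat (fn y n)\<bar> \<le> 2 * hp n" using xy unfolding req_def by blast
    then have "const \<bar>rat (fn x n) - rat (fn y n)\<bar> \<le> (const (2 * hp n) :: rr)" by (simp only: const_le)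
    then have "\<bar>const (rat (fn x n)) - const (rat (fn y n))\<bar> \<le> 2 * HP n" by (simp add: HP_def)
    moreover have "4 * HP n < \<bar>val x - val y\<bar>" using n by (simp add: field_simps)
    ultimately show False using val_approx[OF assms(1), of n] val_approx[OF assms(2), of n] by linarith
  qed
next
  assume "val x = val y"
  then have "\<bar>const (rat (fn x n)) - const (rat (fn y n))\<bar> \<le> 2 * HP n" for n
    using val_approx[OF assms(1), of n] val_approx[OF assms(2), of n] by linarith
  then have "const \<bar>rat (fn x n) - rat (fn y n)\<bar> \<le> (const (2 * hp n) :: rr)" for n by (simp add: HP_def)
  then show "req x y" unfolding req_def const_le by blast
qed

definition qc :: "tm \<Rightarrow> tm" where "qc c = Cst (CPi T0 T0) \<cdot> c"

lemma qc:
  assumes "c \<in> elts T0"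
  shows "qc c \<in> elts T1" "fn (qc c) n = nv c" "isr (qc c)" "val (qc c) = const (rat (nv c))"
proof -
  show el: "qc c \<in> elts T1" unfolding qc_def by (rule elts_App[OF elts_consts(6) assms])
  have "E (qc c \<cdot> rp n) c" for n unfolding qc_def using Pi_eqv[OF assms rp_elts, of n] by simp
  then show fn: "fn (qc c) n = nv c" for n unfolding fn_def using nv_eq elts_T1[OF el rp_elts] assms by blast
  then show "isr (qc c)" by (simp add: isr_def)
  show "val (qc c) = const (rat (nv c))" unfolding val_def fn const.abs_eq ..
qed

lemma definable_qc: "definable T0 F \<Longrightarrow> definable T1 (\<lambda>e. qc (F e))"
  unfolding qc_def by (rule definable_app[OF definable_const[OF elts_consts(6)]])

lemma zero_R_qc: "\<^bold>0\<^sub>R = qc \<^bold>0" and one_R_qc: "\<^bold>1\<^sub>R = qc \<^bold>1"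
  by (simp_all add: zero_R_def one_R_def qc_def)

lemma rational_between:
  assumes "r < s" obtains c where "c \<in> elts T0" "r < val (qc c)" "val (qc c) < s"
proof -
  obtain q where q: "r < const q" "const q < s" using const_dense[OF assms] by blast
  obtain n where "rat n = q" using rat_surj by blast
  then show thesis using that[of "rp n"] q qc(4)[OF rp_elts] by simp
qed

text \<open>Turns an arithmetical upper set of rationals into a real, uniformly in a number and an
  object of type 1; it takes the place of suprema and maxima. The real has to be an object of the
  model, so its approximations are selected there. The bounds \<open>- 1\<close> and
  \<open>2\<close> confine the search for them to a grid.\<close>

lemma cut_real:
  assumes U: "ar (\<lambda>e. U (nv (e (0, T0))) (e (1, T1)) (rat (nv (e (2, T0)))))"
    and low: "\<And>m x. x \<in> elts T1 \<Longrightarrow> \<not> U m x (- 1)" and high: "\<And>m x. x \<in> elts T1 \<Longrightarrow> U m x 2"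
    and up: "\<And>m x q r. x \<in> elts T1 \<Longrightarrow> U m x q \<Longrightarrow> q \<le> r \<Longrightarrow> U m x r"
  obtains G where "G \<in> elts (T0 \<rightarrow> T1 \<rightarrow> T1)" "\<And>a x. a \<in> elts T0 \<Longrightarrow> x \<in> elts T1 \<Longrightarrow> isr (G \<cdot> a \<cdot> x)"
    "\<And>a x q. a \<in> elts T0 \<Longrightarrow> x \<in> elts T1 \<Longrightarrow> const q < val (G \<cdot> a \<cdot> x) \<Longrightarrow> \<not> U (nv a) x q"
    "\<And>a x q. a \<in> elts T0 \<Longrightarrow> x \<in> elts T1 \<Longrightarrow> val (G \<cdot> a \<cdot> x) < const q \<Longrightarrow> U (nv a) x q"
proof -
  \<comment> \<open>The approximation with index \<open>l\<close> is a rational outside the cut that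
    has a member of the cut at most \<open>2^-(l + 1)\<close> above it. Staying on one side of the
    boundary lets any two approximations be compared through a single member of the cut.\<close>
  define Q where "Q m x l c \<longleftrightarrow> \<not> U m x (rat c) \<and> (\<exists>c'. U m x (rat c') \<and> rat c' \<le> rat c + hp (l + 1))" for m x l c
  have U': "ar (\<lambda>e. U (nv (e (0, T0))) (e (1, T1)) (rat (nv (e (j, T0)))))" if "j \<noteq> 0" for j
    using ar_subst[OF U definable_var[of T0 j], of 2] by simp
  have "ar (\<lambda>e. Q (nv (e (0, T0))) (e (1, T1)) (nv (e (2, T0))) (nv (e (3, T0))))"
    unfolding Q_def by (intro ar_conj ar_not U' ar_nn_ex[of _ 4] ar_qq_le dqq_intros dnn_intros) simp_all
  then obtain X where X: "dnn X" "\<And>e. env e \<Longrightarrow> \<exists>n. Q (nv (e (0, T0))) (e (1, T1)) (nv (e (2, T0))) n \<Longrightarrow>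
      Q (nv (e (0, T0))) (e (1, T1)) (nv (e (2, T0))) (X e)"
    using nn_choice[of "\<lambda>e. Q (nv (e (0, T0))) (e (1, T1)) (nv (e (2, T0)))" 3] by auto
  obtain F where F: "definable T0 F" "\<And>e. env e \<Longrightarrow> X e = nv (F e)" using X(1) unfolding dnn_def by blast
  obtain G where G: "G \<in> elts (T0 \<rightarrow> T1 \<rightarrow> T1)"
    "\<And>a x l. a \<in> elts T0 \<Longrightarrow> x \<in> elts T1 \<Longrightarrow> l \<in> elts T0 \<Longrightarrow>
      eqv T0 (G \<cdot> a \<cdot> x \<cdot> l) (F (e0((0, T0) := a, (1, T1) := x, (2, T0) := l)))"
    by (rule lam3[OF F(1)]) blast
  have ex: "\<exists>n. Q m x l n" if x: "x \<in> elts T1" for m x l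
  proof -
    let ?P = "\<lambda>a. \<exists>c. rat c = - 1 + ofn a * hp (l + 1) \<and> U m x (rat c)"
    have "ar (\<lambda>e. U m x (rat (nv (e (3, T0)))))"
      using ar_subst[OF ar_subst[OF U'[of 3] definable_const[OF x], of 1] definable_const[OF rp_elts, of m], of 0] by simp
    then have ar: "ar (\<lambda>e. ?P (nv (e (0, T0))))"
      by (intro ar_nn_ex[of _ 3] ar_conj ar_qq_eq dqq_intros dnn_intros) simp_all
    \<comment> \<open>The grid of mesh \<open>2^-(l + 1)\<close> starting at \<open>- 1\<close>
      reaches \<open>2\<close> after three times \<open>2^(l + 1)\<close> steps; the predecessor of
      its first point in the cut is the approximation.\<close>
    have "ofn (p2 (l + 1)) * hp (l + 1) = 1" unfolding hp_def using p2_pos[of "l + 1"] by (metis ofn_pos less_irrefl nonzero_mult_div_cancel_left mult_1_right times_divide_eq_right)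
    then have "- 1 + ofn (p2 (l + 1) + p2 (l + 1) + p2 (l + 1)) * hp (l + 1) = 2"
      by (simp add: distrib_right del: p2_suc)
    then have "?P (p2 (l + 1) + p2 (l + 1) + p2 (l + 1))" using rat_surj[of 2] high[OF x, of m] by metis
    from nn_least[of ?P, OF ar this] obtain a where a: "?P a" "\<forall>k<a. \<not> ?P k" by blast
    have "a \<noteq> 0"
    proof
      assume "a = 0"
      then show False using a(1) low[OF x, of m] by auto
    qed
    then obtain b where b: "a = b + 1" using nn_zero_or_suc by blast
    obtain c where c: "rat c = - 1 + ofn b * hp (l + 1)" using rat_surj by blast
    have "\<not> U m x (rat c)" using a(2) c unfolding b nn_less_suc by blast
    moreover obtain c' where "rat c' = - 1 + ofn a * hp (l + 1)" "U m x (rat c')" using a(1) by blast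
    moreover have "- 1 + ofn a * hp (l + 1) = rat c + hp (l + 1)" unfolding c b by (simp add: distrib_right)
    ultimately show ?thesis unfolding Q_def by (metis order_refl)
  qed
  have Qn: "Q (nv a) x n (fn (G \<cdot> a \<cdot> x) n)" and el: "G \<cdot> a \<cdot> x \<in> elts T1"
    if ax: "a \<in> elts T0" "x \<in> elts T1" for a x n
  proof -
    let ?e = "e0((0, T0) := a, (1, T1) := x, (2, T0) := rp n)"
    have e: "env ?e" using ax by simp
    show el: "G \<cdot> a \<cdot> x \<in> elts T1" by (rule elts_App[OF elts_App[OF G(1) ax(1)] ax(2)])
    have "fn (G \<cdot> a \<cdot> x) n = X ?e"
      unfolding fn_def F(2)[OF e]
      using G(2)[OF ax rp_elts, of n] nv_eq elts_T1[OF el rp_elts] definable_elts[OF F(1) e] by simp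
    then show "Q (nv a) x n (fn (G \<cdot> a \<cdot> x) n)" using X(2)[OF e] ex[OF ax(2)] by simp
  qed
  have isr: "isr (G \<cdot> a \<cdot> x)" if ax: "a \<in> elts T0" "x \<in> elts T1" for a x
    unfolding isr_def
  proof (intro allI)
    fix n i
    let ?q = "\<lambda>n. rat (fn (G \<cdot> a \<cdot> x) n)"
    \<comment> \<open>A point outside the cut lies below every point inside it.\<close>
    have lt: "?q k < ?q n + hp (n + 1)" for k n
    proof -
      obtain c' where c': "U (nv a) x (rat c')" "rat c' \<le> ?q n + hp (n + 1)" using Qn[OF ax, of n] unfolding Q_def by blast
      have "\<not> rat c' \<le> ?q k" using up[OF ax(2) c'(1)] Qn[OF ax, of k] unfolding Q_def by blast
      then show ?thesis using c'(2) by linarith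
    qed
    have "hp (n + 1) < hp n" using hp_pos[of n] by (simp add: hp_suc)
    moreover have "hp (n + i + 1) \<le> hp (n + 1)" by (rule hp_mono) (simp add: add_mono)
    ultimately show "\<bar>?q n - ?q (n + i)\<bar> < hp n" using lt[of n "n + i"] lt[of "n + i" n] by linarith
  qed
  have below: "\<not> U (nv a) x q" if ax: "a \<in> elts T0" "x \<in> elts T1" and q: "const q < val (G \<cdot> a \<cdot> x)" for a x q
  proof
    assume Uq: "U (nv a) x q"
    have "rat (fn (G \<cdot> a \<cdot> x) n) \<le> q" for n
      using up[OF ax(2) Uq] Qn[OF ax, of n] unfolding Q_def by (meson linear)
    then have "val (G \<cdot> a \<cdot> x) \<le> const q"
      unfolding val_def by (intro lim_seq_le isr_cauchy isr ax) simp
    then show False using q by simp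
  qed
  have above: "U (nv a) x q" if ax: "a \<in> elts T0" "x \<in> elts T1" and q: "val (G \<cdot> a \<cdot> x) < const q" for a x q
  proof (rule ccontr)
    assume Uq: "\<not> U (nv a) x q"
    obtain n where n: "HP n < (const q - val (G \<cdot> a \<cdot> x)) / 2"
      using HP_archimedean[of "(const q - val (G \<cdot> a \<cdot> x)) / 2"] q by auto
    obtain c' where c': "U (nv a) x (rat c')" "rat c' \<le> rat (fn (G \<cdot> a \<cdot> x) n) + hp (n + 1)"
      using Qn[OF ax, of n] unfolding Q_def by blast
    have "\<not> rat c' \<le> q" using up[OF ax(2) c'(1)] Uq by blast
    then have "q < rat (fn (G \<cdot> a \<cdot> x) n) + hp (n + 1)" using c'(2) by linarith
    then have "const q < (const (rat (fn (G \<cdot> a \<cdot> x) n) + hp (n + 1)) :: rr)" by (simp only: const_less)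
    then have "const q < const (rat (fn (G \<cdot> a \<cdot> x) n)) + HP n / 2" by (simp add: HP_def hp_suc)
    moreover have "2 * HP n < const q - val (G \<cdot> a \<cdot> x)" using n by (simp add: field_simps)
    ultimately show False using val_approx(2)[OF isr[OF ax], of n] HP_pos[of n] by linarith
  qed
  show thesis by (rule that[OF G(1) isr below above])
qed

end

section \<open>Meaning of the principles in the model\<close>

text \<open>Bounds on the free variables are used in place of equations, because a bound passes
  through binders and connectives as a simplification rule.\<close>

lemma fv_form [simp]:
  "fv ((\<^bold>\<forall>x\<^bold>:\<sigma>. P x) d) \<subseteq> V \<longleftrightarrow> fv (P (Var d \<sigma>) (Suc d)) \<subseteq> insert (d, \<sigma>) V"
  "fv ((\<^bold>\<exists>x\<^bold>:\<sigma>. P x) d) \<subseteq> V \<longleftrightarrow> fv (P (Var d \<sigma>) (Suc d)) \<subseteq> insert (d, \<sigma>) V"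
  "fv ((F \<^bold>\<longrightarrow> G) d) \<subseteq> V \<longleftrightarrow> fv (F d) \<subseteq> V \<and> fv (G d) \<subseteq> V"
  "fv ((F \<^bold>\<and> G) d) \<subseteq> V \<longleftrightarrow> fv (F d) \<subseteq> V \<and> fv (G d) \<subseteq> V"
  "fv ((F \<^bold>\<or> G) d) \<subseteq> V \<longleftrightarrow> fv (F d) \<subseteq> V \<and> fv (G d) \<subseteq> V"
  "fv ((F \<^bold>\<longleftrightarrow> G) d) \<subseteq> V \<longleftrightarrow> fv (F d) \<subseteq> V \<and> fv (G d) \<subseteq> V"
  "fv ((\<^bold>\<not> F) d) \<subseteq> V \<longleftrightarrow> fv (F d) \<subseteq> V"
  "fv ((t \<^bold>= u) d) \<subseteq> V \<longleftrightarrow> fv_tm t \<subseteq> V \<and> fv_tm u \<subseteq> V"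
  "fv ((t \<^bold>< u) d) \<subseteq> V \<longleftrightarrow> fv_tm t \<subseteq> V \<and> fv_tm u \<subseteq> V"
  "fv ((t \<^bold>\<le> u) d) \<subseteq> V \<longleftrightarrow> fv_tm t \<subseteq> V \<and> fv_tm u \<subseteq> V"
  by (auto simp: All_f_def Ex_f_def Imp_f_def And_f_def Or_f_def Iff_f_def Not_f_def Eq_f_def Less_f_def
      Le_f_def FNot_def)

lemmas real_form_defs = is_real_def real_eq_def real_less_def near_def with_rat_def pair_code_def
  rat_abs_less_def rat_abs_le_def eps_def eps2_def pow2_def

lemma fv_real_forms [simp]:
  "fv_tm x \<subseteq> V \<Longrightarrow> fv (is_real x d) \<subseteq> V"
  "fv_tm x \<subseteq> V \<Longrightarrow> fv_tm y \<subseteq> V \<Longrightarrow> fv ((x \<^bold>=\<^sub>R y) d) \<subseteq> V"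
  "fv_tm x \<subseteq> V \<Longrightarrow> fv_tm y \<subseteq> V \<Longrightarrow> fv ((x \<^bold><\<^sub>R y) d) \<subseteq> V"
  "fv_tm k \<subseteq> V \<Longrightarrow> fv_tm x \<subseteq> V \<Longrightarrow> fv_tm y \<subseteq> V \<Longrightarrow> fv (near k x y d) \<subseteq> V"
  by (simp_all add: real_form_defs subset_insertI2)

lemma wf_real_forms [simp]:
  "typed x T1 \<Longrightarrow> wf_fm (is_real x d)"
  "typed x T1 \<Longrightarrow> typed y T1 \<Longrightarrow> wf_fm ((x \<^bold>=\<^sub>R y) d)"
  "typed x T1 \<Longrightarrow> typed y T1 \<Longrightarrow> wf_fm ((x \<^bold><\<^sub>R y) d)"
  "typed k T0 \<Longrightarrow> typed x T1 \<Longrightarrow> typed y T1 \<Longrightarrow> wf_fm (near k x y d)"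
  by (simp_all add: real_form_defs)

lemma const_R [simp]:
  "typed \<^bold>0\<^sub>R \<tau> \<longleftrightarrow> \<tau> = T1" "typed \<^bold>1\<^sub>R \<tau> \<longleftrightarrow> \<tau> = T1" "below d \<^bold>0\<^sub>R" "below d \<^bold>1\<^sub>R"
  "fv_tm \<^bold>0\<^sub>R = {}" "fv_tm \<^bold>1\<^sub>R = {}" "eval e \<^bold>0\<^sub>R = \<^bold>0\<^sub>R" "eval e \<^bold>1\<^sub>R = \<^bold>1\<^sub>R"
  by (auto simp: zero_R_def one_R_def)

lemmas principle_defs = NIN_alt_def height_countable_def cont_point_principle_def finite_R_def unit_I_def
  real_le_def is_fun_def regulated_def left_lim_def right_lim_def cont_within_def cont_on_def Baire2_def Baire1_def
  Baire1_star_def pointwise_lim_def usc_def lsc_def limsup_le_def liminf_ge_def is_set_def mem_def closed_R_def open_R_def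

lemma goals_closed:
  assumes "Q \<in> {Baire2, Baire1_star, usc, lsc}"
  shows "wf_fm (sentence (NIN_alt \<^bold>\<longleftrightarrow> cont_point_principle Q))" "fv (sentence (NIN_alt \<^bold>\<longleftrightarrow> cont_point_principle Q)) = {}"
proof -
  show "wf_fm (sentence (NIN_alt \<^bold>\<longleftrightarrow> cont_point_principle Q))"
    using assms by (auto simp: sentence_def principle_defs)
  have "fv (sentence (NIN_alt \<^bold>\<longleftrightarrow> cont_point_principle Q)) \<subseteq> {}"
    using assms by (elim insertE emptyE) (simp_all only: sentence_def principle_defs fv_form, simp_all)
  then show "fv (sentence (NIN_alt \<^bold>\<longleftrightarrow> cont_point_principle Q)) = {}" by simp
qed

lemma FIN_wf: "wf_fm (sentence FIN1)" "wf_fm (sentence FIN2)"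
  by (simp_all add: sentence_def FIN1_def FIN2_def finite_R_def is_set_def mem_def)

context the_model
begin

text \<open>Fixes the hidden argument type in the typing of an application once the type of the
  function is known.\<close>

lemma typed_App [simp]:
  "typed f (\<sigma> \<rightarrow> \<tau>) \<Longrightarrow> (\<exists>\<rho>. typed f (\<rho> \<rightarrow> \<tau>') \<and> typed x \<rho>) \<longleftrightarrow> \<tau>' = \<tau> \<and> typed x \<sigma>"
  using typed_unique by (metis ty.inject)

section \<open>Semantic counterparts of the defined notions\<close>

definition unit :: "tm \<Rightarrow> bool" where
  "unit x \<longleftrightarrow> isr x \<and> \<not> rlt x \<^bold>0\<^sub>R \<and> \<not> rlt \<^bold>1\<^sub>R x"

lemma sat_unit_I [simp]: "typed x T1 \<Longrightarrow> below d x \<Longrightarrow> env e \<Longrightarrow> sat M e (unit_I x d) \<longleftrightarrow> unit (eval e x)"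
  by (simp add: unit_I_def unit_def real_le_def)

text \<open>This and the following notions copy the formulas quantifier by quantifier, with
  \<open>E\<close> and \<open>L\<close> in place of relations on \<open>nn\<close>, so that
  simplification alone proves their agreement with \<open>sat\<close>.\<close>

definition finr :: "(tm \<Rightarrow> bool) \<Rightarrow> bool" where
  "finr P \<longleftrightarrow> (\<exists>N\<in>elts T0. \<forall>w\<in>elts (T0 \<rightarrow> T1).
     (\<forall>i\<in>elts T0. L i N \<or> E i N \<longrightarrow> isr (w \<cdot> i)) \<and>
     (\<forall>i\<in>elts T0. \<forall>j\<in>elts T0. L i j \<and> (L j N \<or> E j N) \<longrightarrow> \<not> req (w \<cdot> i) (w \<cdot> j)) \<longrightarrow>
     (\<exists>i\<in>elts T0. (L i N \<or> E i N) \<and> \<not> P (w \<cdot> i)))"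

definition setr :: "tm \<Rightarrow> bool" where
  "setr X \<longleftrightarrow> (\<forall>x\<in>elts T1. isr x \<longrightarrow> E (X \<cdot> x) \<^bold>0 \<or> E (X \<cdot> x) \<^bold>1) \<and>
     (\<forall>x\<in>elts T1. \<forall>y\<in>elts T1. isr x \<and> isr y \<and> req x y \<longrightarrow> E (X \<cdot> x) (X \<cdot> y))"

definition resp :: "tm \<Rightarrow> bool" where
  "resp H \<longleftrightarrow> (\<forall>x\<in>elts T1. \<forall>y\<in>elts T1. isr x \<and> isr y \<and> req x y \<longrightarrow> E (H \<cdot> x) (H \<cdot> y))"

definition height :: "tm \<Rightarrow> bool" where
  "height H \<longleftrightarrow> resp H \<and> (\<forall>n\<in>elts T0. finr (\<lambda>x. unit x \<and> L (H \<cdot> x) n))"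

definition funr :: "tm \<Rightarrow> bool" where
  "funr f \<longleftrightarrow> (\<forall>x\<in>elts T1. unit x \<longrightarrow> isr (f \<cdot> x)) \<and>
     (\<forall>x\<in>elts T1. \<forall>y\<in>elts T1. unit x \<and> unit y \<and> req x y \<longrightarrow> req (f \<cdot> x) (f \<cdot> y))"

definition contr :: "(tm \<Rightarrow> bool) \<Rightarrow> tm \<Rightarrow> tm \<Rightarrow> bool" where
  "contr P f x \<longleftrightarrow> (\<forall>k\<in>elts T0. \<exists>N\<in>elts T0. \<forall>y\<in>elts T1.
     isr y \<and> P y \<and> nearr (nv N) x y \<longrightarrow> nearr (nv k) (f \<cdot> x) (f \<cdot> y))"

definition leftr :: "tm \<Rightarrow> tm \<Rightarrow> tm \<Rightarrow> bool" where
  "leftr f x l \<longleftrightarrow> (\<forall>k\<in>elts T0. \<exists>N\<in>elts T0. \<forall>y\<in>elts T1.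
     unit y \<and> rlt y x \<and> nearr (nv N) x y \<longrightarrow> nearr (nv k) (f \<cdot> y) l)"

definition rightr :: "tm \<Rightarrow> tm \<Rightarrow> tm \<Rightarrow> bool" where
  "rightr f x l \<longleftrightarrow> (\<forall>k\<in>elts T0. \<exists>N\<in>elts T0. \<forall>y\<in>elts T1.
     unit y \<and> rlt x y \<and> nearr (nv N) x y \<longrightarrow> nearr (nv k) (f \<cdot> y) l)"

definition regr :: "tm \<Rightarrow> bool" where
  "regr f \<longleftrightarrow> (\<forall>x\<in>elts T1. unit x \<longrightarrow>
     (rlt \<^bold>0\<^sub>R x \<longrightarrow> (\<exists>l\<in>elts T1. isr l \<and> leftr f x l)) \<and>
     (rlt x \<^bold>1\<^sub>R \<longrightarrow> (\<exists>l\<in>elts T1. isr l \<and> rightr f x l)))"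

definition limr :: "tm \<Rightarrow> tm \<Rightarrow> bool" where
  "limr F f \<longleftrightarrow> (\<forall>x\<in>elts T1. unit x \<longrightarrow> (\<forall>k\<in>elts T0. \<exists>N\<in>elts T0. \<forall>n\<in>elts T0.
     L N n \<or> E N n \<longrightarrow> nearr (nv k) (F \<cdot> n \<cdot> x) (f \<cdot> x)))"

definition baire1r :: "tm \<Rightarrow> bool" where
  "baire1r f \<longleftrightarrow> (\<exists>F\<in>elts (T0 \<rightarrow> T1 \<rightarrow> T1).
     (\<forall>n\<in>elts T0. funr (F \<cdot> n) \<and> (\<forall>x\<in>elts T1. isr x \<and> unit x \<longrightarrow> contr unit (F \<cdot> n) x)) \<and> limr F f)"

definition baire2r :: "tm \<Rightarrow> bool" where
  "baire2r f \<longleftrightarrow> (\<exists>F\<in>elts (T0 \<rightarrow> T1 \<rightarrow> T1). (\<forall>n\<in>elts T0. funr (F \<cdot> n) \<and> baire1r (F \<cdot> n)) \<and> limr F f)"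

definition baire1starr :: "tm \<Rightarrow> bool" where
  "baire1starr f \<longleftrightarrow> (\<exists>C\<in>elts (T0 \<rightarrow> T2).
     (\<forall>n\<in>elts T0. setr (C \<cdot> n) \<and> (\<forall>x\<in>elts T1. isr x \<and> \<not> E (C \<cdot> n \<cdot> x) \<^bold>1 \<longrightarrow>
        (\<exists>k\<in>elts T0. \<forall>y\<in>elts T1. isr y \<and> nearr (nv k) x y \<longrightarrow> \<not> E (C \<cdot> n \<cdot> y) \<^bold>1))) \<and>
     (\<forall>x\<in>elts T1. isr x \<longrightarrow> (unit x \<longleftrightarrow> (\<exists>n\<in>elts T0. E (C \<cdot> n \<cdot> x) \<^bold>1))) \<and>
     (\<forall>m\<in>elts T0. \<forall>x\<in>elts T1. isr x \<and> E (C \<cdot> m \<cdot> x) \<^bold>1 \<longrightarrow> contr (\<lambda>y. E (C \<cdot> m \<cdot> y) \<^bold>1) f x))"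

definition uscr :: "tm \<Rightarrow> bool" where
  "uscr f \<longleftrightarrow> (\<forall>x\<in>elts T1. unit x \<longrightarrow> (\<forall>z\<in>elts T1. isr z \<and> rlt (f \<cdot> x) z \<longrightarrow>
     (\<exists>N\<in>elts T0. \<forall>y\<in>elts T1. unit y \<and> \<not> req y x \<and> nearr (nv N) x y \<longrightarrow> rlt (f \<cdot> y) z)))"

definition lscr :: "tm \<Rightarrow> bool" where
  "lscr f \<longleftrightarrow> (\<forall>x\<in>elts T1. unit x \<longrightarrow> (\<forall>z\<in>elts T1. isr z \<and> rlt z (f \<cdot> x) \<longrightarrow>
     (\<exists>N\<in>elts T0. \<forall>y\<in>elts T1. unit y \<and> \<not> req y x \<and> nearr (nv N) x y \<longrightarrow> rlt z (f \<cdot> y))))"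

lemma sat_NIN: "env e \<Longrightarrow> sat M e (NIN_alt 0) \<longleftrightarrow> \<not> (\<exists>H\<in>elts T2. height H)"
  by (simp add: NIN_alt_def height_countable_def finite_R_def height_def resp_def finr_def)

lemma sat_fun [simp]:
  "typed f (T1 \<rightarrow> T1) \<Longrightarrow> below d f \<Longrightarrow> env e \<Longrightarrow> sat M e (is_fun f d) \<longleftrightarrow> funr (eval e f)"
  by (simp add: is_fun_def funr_def)

lemma sat_cont_unit [simp]:
  "typed f (T1 \<rightarrow> T1) \<Longrightarrow> below d f \<Longrightarrow> typed x T1 \<Longrightarrow> below d x \<Longrightarrow> env e \<Longrightarrow>
    sat M e (cont_within unit_I f x d) \<longleftrightarrow> contr unit (eval e f) (eval e x)"
  by (simp add: cont_within_def contr_def)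

lemma sat_regulated [simp]:
  "typed f (T1 \<rightarrow> T1) \<Longrightarrow> below d f \<Longrightarrow> env e \<Longrightarrow> sat M e (regulated f d) \<longleftrightarrow> regr (eval e f)"
  by (simp add: regulated_def regr_def left_lim_def right_lim_def leftr_def rightr_def)

lemma sat_pointwise_lim [simp]:
  "typed F (T0 \<rightarrow> T1 \<rightarrow> T1) \<Longrightarrow> below d F \<Longrightarrow> typed f (T1 \<rightarrow> T1) \<Longrightarrow> below d f \<Longrightarrow> env e \<Longrightarrow>
    sat M e (pointwise_lim F f d) \<longleftrightarrow> limr (eval e F) (eval e f)"
  by (simp add: pointwise_lim_def limr_def)

lemma sat_Baire1 [simp]:
  "typed f (T1 \<rightarrow> T1) \<Longrightarrow> below d f \<Longrightarrow> env e \<Longrightarrow> sat M e (Baire1 f d) \<longleftrightarrow> baire1r (eval e f)"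
  by (simp add: Baire1_def baire1r_def cont_on_def)

lemma sat_Baire2 [simp]:
  "typed f (T1 \<rightarrow> T1) \<Longrightarrow> below d f \<Longrightarrow> env e \<Longrightarrow> sat M e (Baire2 f d) \<longleftrightarrow> baire2r (eval e f)"
  by (simp add: Baire2_def baire2r_def)

lemma sat_is_set [simp]:
  "typed X T2 \<Longrightarrow> below d X \<Longrightarrow> env e \<Longrightarrow> sat M e (is_set X d) \<longleftrightarrow> setr (eval e X)"
  by (simp add: is_set_def setr_def)

lemma sat_Baire1_star [simp]:
  "typed f (T1 \<rightarrow> T1) \<Longrightarrow> below d f \<Longrightarrow> env e \<Longrightarrow> sat M e (Baire1_star f d) \<longleftrightarrow> baire1starr (eval e f)"
  by (simp add: Baire1_star_def baire1starr_def cont_on_def cont_within_def closed_R_def open_R_def mem_def contr_def)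

lemma sat_usc [simp]:
  "typed f (T1 \<rightarrow> T1) \<Longrightarrow> below d f \<Longrightarrow> env e \<Longrightarrow> sat M e (usc f d) \<longleftrightarrow> uscr (eval e f)"
  by (simp add: usc_def uscr_def limsup_le_def)

lemma sat_lsc [simp]:
  "typed f (T1 \<rightarrow> T1) \<Longrightarrow> below d f \<Longrightarrow> env e \<Longrightarrow> sat M e (lsc f d) \<longleftrightarrow> lscr (eval e f)"
  by (simp add: lsc_def lscr_def liminf_ge_def)

definition principle :: "(tm \<Rightarrow> bool) \<Rightarrow> bool" where
  "principle Q \<longleftrightarrow> (\<forall>f\<in>elts (T1 \<rightarrow> T1). funr f \<and> regr f \<and> Q f \<longrightarrow> (\<exists>x\<in>elts T1. unit x \<and> contr unit f x))"

lemma sat_principle: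
  assumes "\<And>f d e. typed f (T1 \<rightarrow> T1) \<Longrightarrow> below d f \<Longrightarrow> env e \<Longrightarrow> sat M e (Q f d) \<longleftrightarrow> R (eval e f)" "env e"
  shows "sat M e (cont_point_principle Q 0) \<longleftrightarrow> principle R"
  using assms(2) by (simp add: cont_point_principle_def principle_def assms(1))

lemma FIN1r:
  assumes "X \<in> elts (T0 \<rightarrow> T2)" "k \<in> elts T0" "\<And>n. n \<in> elts T0 \<Longrightarrow> setr (X \<cdot> n) \<and> finr (\<lambda>x. E (X \<cdot> n \<cdot> x) \<^bold>1)"
  shows "finr (\<lambda>x. \<exists>n\<in>elts T0. (L n k \<or> E n k) \<and> E (X \<cdot> n \<cdot> x) \<^bold>1)"
proof -
  have "sat M e0 (sentence FIN1)" by (rule axiom_sat) (auto simp: FIN_def FIN_wf)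
  then have "\<forall>X\<in>elts (T0 \<rightarrow> T2). \<forall>k\<in>elts T0. (\<forall>n\<in>elts T0. setr (X \<cdot> n) \<and> finr (\<lambda>x. E (X \<cdot> n \<cdot> x) \<^bold>1)) \<longrightarrow>
     finr (\<lambda>x. \<exists>n\<in>elts T0. (L n k \<or> E n k) \<and> E (X \<cdot> n \<cdot> x) \<^bold>1)"
    by (simp add: sentence_def FIN1_def finite_R_def mem_def finr_def)
  then show ?thesis using assms by blast
qed

lemma FIN2r:
  assumes "X \<in> elts T2" "setr X" "finr (\<lambda>x. E (X \<cdot> x) \<^bold>1)"
  shows "\<exists>k\<in>elts T0. \<exists>w\<in>elts (T0 \<rightarrow> T1). (\<forall>i\<in>elts T0. L i k \<longrightarrow> isr (w \<cdot> i)) \<and>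
    (\<forall>x\<in>elts T1. isr x \<and> E (X \<cdot> x) \<^bold>1 \<longrightarrow> (\<exists>i\<in>elts T0. L i k \<and> req x (w \<cdot> i)))"
proof -
  have "sat M e0 (sentence FIN2)" by (rule axiom_sat) (auto simp: FIN_def FIN_wf)
  then have "\<forall>X\<in>elts T2. setr X \<and> finr (\<lambda>x. E (X \<cdot> x) \<^bold>1) \<longrightarrow>
    (\<exists>k\<in>elts T0. \<exists>w\<in>elts (T0 \<rightarrow> T1). (\<forall>i\<in>elts T0. L i k \<longrightarrow> isr (w \<cdot> i)) \<and>
    (\<forall>x\<in>elts T1. isr x \<and> E (X \<cdot> x) \<^bold>1 \<longrightarrow> (\<exists>i\<in>elts T0. L i k \<and> req x (w \<cdot> i))))"
    by (simp add: sentence_def FIN2_def finite_R_def mem_def finr_def)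
  then show ?thesis using assms by blast
qed

end

text \<open>An underivable equivalence gives a model in which it fails, so the choice defining
  \<open>M\<close> succeeds. What \<open>M\<close> refutes may be another of the four goals;
  therefore all of them have to hold in \<open>M\<close>.\<close>

lemma derivable_if_true:
  assumes "\<And>e A. the_model \<Longrightarrow> env e \<Longrightarrow> A \<in> goals \<Longrightarrow> sat M e A"
    and Q: "Q \<in> {Baire2, Baire1_star, usc, lsc}"
  shows "deriv base_theory {} (sentence (NIN_alt \<^bold>\<longleftrightarrow> cont_point_principle Q))"
proof (rule ccontr)
  let ?A = "sentence (NIN_alt \<^bold>\<longleftrightarrow> cont_point_principle Q)"
  assume "\<not> deriv base_theory {} ?A"
  from henkin_model[OF goals_closed[OF Q] this] obtain S where
    S: "\<forall>B\<in>base_theory. wf_fm B \<longrightarrow> (\<forall>e. env e \<longrightarrow> sat S e B)" "\<forall>e. env e \<longrightarrow> \<not> sat S e ?A" by blast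
  have "env (\<lambda>(i, \<sigma>). Var 1 \<sigma>)" by (auto simp: env_def elts_def)
  then have "\<not> sat S (\<lambda>(i, \<sigma>). Var 1 \<sigma>) ?A" using S(2) by blast
  moreover have "?A \<in> goals" using Q by (auto simp: goals_def)
  ultimately have "is_model S \<and> \<not> (\<forall>e. env e \<longrightarrow> (\<forall>A\<in>goals. sat S e A))"
    using S(1) \<open>env (\<lambda>(i, \<sigma>). Var 1 \<sigma>)\<close> unfolding is_model_def by blast
  then have M: "is_model M \<and> \<not> (\<forall>e. env e \<longrightarrow> (\<forall>A\<in>goals. sat M e A))" unfolding M_def by (rule someI)
  then have "the_model" by (simp add: the_model_def model_def)
  then show False using M assms(1) by blast
qed

context the_model
begin

section \<open>Finite sets and comprehension\<close>

lemma le_iff: "a \<in> elts T0 \<Longrightarrow> b \<in> elts T0 \<Longrightarrow> L a b \<or> E a b \<longleftrightarrow> nv a \<le> nv b"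
  using nv_less nv_eq by (metis order_le_less)

lemma real_numerals [simp]: "\<^bold>0\<^sub>R \<in> elts T1" "\<^bold>1\<^sub>R \<in> elts T1" "isr \<^bold>0\<^sub>R" "isr \<^bold>1\<^sub>R" "val \<^bold>0\<^sub>R = 0" "val \<^bold>1\<^sub>R = 1"
  using qc[OF elts_consts(1)] qc[OF elts_consts(2)] by (simp_all add: zero_R_qc one_R_qc)

lemma unit_isr: "unit x \<Longrightarrow> isr x"
  by (simp add: unit_def)

lemma unit_iff: "isr x \<Longrightarrow> unit x \<longleftrightarrow> 0 \<le> val x \<and> val x \<le> 1"
  by (auto simp: unit_def rlt_iff not_less)

lemma unit_bounds: "unit x \<Longrightarrow> 0 \<le> val x" "unit x \<Longrightarrow> val x \<le> 1"
  using unit_iff unit_isr by blast+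

lemma val_cong: "fn x = fn y \<Longrightarrow> val x = val y" "fn x = fn y \<Longrightarrow> isr x \<longleftrightarrow> isr y"
  by (simp_all add: val_def isr_def)

lemma unit_cong: "isr x \<Longrightarrow> isr y \<Longrightarrow> val x = val y \<Longrightarrow> unit x \<longleftrightarrow> unit y"
  by (simp add: unit_iff)

lemma unit_qc: "c \<in> elts T0 \<Longrightarrow> 0 \<le> val (qc c) \<Longrightarrow> val (qc c) \<le> 1 \<Longrightarrow> unit (qc c)"
  using unit_iff qc(3) by blast

lemma ar_unit: "definable T1 F \<Longrightarrow> ar (\<lambda>e. unit (F e))"
  unfolding unit_def by (intro ar_conj ar_isr ar_not ar_rlt definable_const real_numerals)

text \<open>On the left are arithmetical conditions on the sequence \<open>x\<close>, on the right
  inequalities in the completion: cuts and least numbers use the former, estimates the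
  latter.\<close>

lemma const_less_val_iff:
  assumes "isr x"
  shows "(\<exists>n. q + 2 * hp n < rat (fn x n)) \<longleftrightarrow> const q < val x" "(\<exists>n. rat (fn x n) + 2 * hp n < q) \<longleftrightarrow> val x < const q"
proof -
  obtain n where n: "rat n = q" using rat_surj by blast
  note c = qc[OF rp_elts, of n]
  show "(\<exists>n. q + 2 * hp n < rat (fn x n)) \<longleftrightarrow> const q < val x"
    using rlt_iff[OF c(3) assms] by (simp add: rlt_def c(2,4) n)
  show "(\<exists>n. rat (fn x n) + 2 * hp n < q) \<longleftrightarrow> val x < const q"
    using rlt_iff[OF assms c(3)] by (simp add: rlt_def c(2,4) n)
qed

lemma finr_mono:
  assumes "finr P" "\<And>x. x \<in> elts T1 \<Longrightarrow> isr x \<Longrightarrow> P' x \<Longrightarrow> P x" shows "finr P'"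
proof -
  obtain N where N: "N \<in> elts T0" "\<And>w. w \<in> elts (T0 \<rightarrow> T1) \<Longrightarrow>
     (\<forall>i\<in>elts T0. L i N \<or> E i N \<longrightarrow> isr (w \<cdot> i)) \<and>
     (\<forall>i\<in>elts T0. \<forall>j\<in>elts T0. L i j \<and> (L j N \<or> E j N) \<longrightarrow> \<not> req (w \<cdot> i) (w \<cdot> j)) \<Longrightarrow>
     \<exists>i\<in>elts T0. (L i N \<or> E i N) \<and> \<not> P (w \<cdot> i)"
    using assms(1) unfolding finr_def by blast
  show ?thesis unfolding finr_def
  proof (rule bexI[OF _ N(1)], intro ballI impI)
    fix w assume w: "w \<in> elts (T0 \<rightarrow> T1)" and H: "(\<forall>i\<in>elts T0. L i N \<or> E i N \<longrightarrow> isr (w \<cdot> i)) \<and>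
     (\<forall>i\<in>elts T0. \<forall>j\<in>elts T0. L i j \<and> (L j N \<or> E j N) \<longrightarrow> \<not> req (w \<cdot> i) (w \<cdot> j))"
    obtain i where i: "i \<in> elts T0" "L i N \<or> E i N" "\<not> P (w \<cdot> i)" using N(2)[OF w H] by blast
    moreover have "\<not> P' (w \<cdot> i)" using assms(2)[OF elts_App[OF w i(1)]] i H by blast
    ultimately show "\<exists>i\<in>elts T0. (L i N \<or> E i N) \<and> \<not> P' (w \<cdot> i)" by blast
  qed
qed

lemma finr_subsingleton:
  assumes "\<And>x y. x \<in> elts T1 \<Longrightarrow> y \<in> elts T1 \<Longrightarrow> isr x \<Longrightarrow> isr y \<Longrightarrow> P x \<Longrightarrow> P y \<Longrightarrow> val x = val y"
  shows "finr P"
  unfolding finr_def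
proof (rule bexI[of _ "\<^bold>1"], intro ballI impI)
  fix w assume w: "w \<in> elts (T0 \<rightarrow> T1)" and H: "(\<forall>i\<in>elts T0. L i \<^bold>1 \<or> E i \<^bold>1 \<longrightarrow> isr (w \<cdot> i)) \<and>
     (\<forall>i\<in>elts T0. \<forall>j\<in>elts T0. L i j \<and> (L j \<^bold>1 \<or> E j \<^bold>1) \<longrightarrow> \<not> req (w \<cdot> i) (w \<cdot> j))"
  have le: "L \<^bold>0 \<^bold>1" "E \<^bold>1 \<^bold>1" using nv_less[OF elts_consts(1,2)] E_refl[OF elts_consts(2)] by simp_all
  have isr: "isr (w \<cdot> \<^bold>0)" "isr (w \<cdot> \<^bold>1)" using H le elts_consts(1,2) by blast+
  have "\<not> req (w \<cdot> \<^bold>0) (w \<cdot> \<^bold>1)" using H le elts_consts(1,2) by blast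
  then have "val (w \<cdot> \<^bold>0) \<noteq> val (w \<cdot> \<^bold>1)" using req_iff isr by blast
  then have "\<not> P (w \<cdot> \<^bold>0) \<or> \<not> P (w \<cdot> \<^bold>1)"
    using assms[OF elts_App[OF w elts_consts(1)] elts_App[OF w elts_consts(2)] isr] by blast
  then show "\<exists>i\<in>elts T0. (L i \<^bold>1 \<or> E i \<^bold>1) \<and> \<not> P (w \<cdot> i)" using le elts_consts(1,2) by blast
qed (rule elts_consts)

text \<open>Yields a sequence of sets because \<open>FIN1\<close> takes one; a single set is
  obtained as one of its terms.\<close>

lemma comprehension:
  assumes R: "ar (\<lambda>e. R (e (0, T0)) (e (1, T1)))"
    and ext: "\<And>n x y. n \<in> elts T0 \<Longrightarrow> x \<in> elts T1 \<Longrightarrow> y \<in> elts T1 \<Longrightarrow> isr x \<Longrightarrow> isr y \<Longrightarrow> val x = val y \<Longrightarrow> R n x \<Longrightarrow> R n y"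
  obtains X where "X \<in> elts (T0 \<rightarrow> T2)" "\<And>n. n \<in> elts T0 \<Longrightarrow> setr (X \<cdot> n)"
    "\<And>n x. n \<in> elts T0 \<Longrightarrow> x \<in> elts T1 \<Longrightarrow> E (X \<cdot> n \<cdot> x) \<^bold>1 \<longleftrightarrow> R n x"
proof -
  \<comment> \<open>Truth is 0 for \<open>ar\<close>, while membership is 1: hence the negation of
    \<open>R\<close>.\<close>
  obtain G where G: "definable T0 G" "\<And>e. env e \<Longrightarrow> E (G e) (if \<not> R (e (0, T0)) (e (1, T1)) then \<^bold>0 else \<^bold>1)"
    by (rule arE[OF ar_not[OF R]]) blast
  obtain X where X: "X \<in> elts (T0 \<rightarrow> T2)"
    "\<And>n x. n \<in> elts T0 \<Longrightarrow> x \<in> elts T1 \<Longrightarrow> eqv T0 (X \<cdot> n \<cdot> x) (G (e0((0, T0) := n, (1, T1) := x)))"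
    by (rule lam2[OF G(1), of T0 T1]) blast
  have el: "X \<cdot> n \<cdot> x \<in> elts T0" if "n \<in> elts T0" "x \<in> elts T1" for n x
    using elts_App[OF elts_App[OF X(1) that(1)] that(2)] .
  have v: "nv (X \<cdot> n \<cdot> x) = (if R n x then 1 else 0)" if nx: "n \<in> elts T0" "x \<in> elts T1" for n x
  proof -
    let ?e = "e0((0, T0) := n, (1, T1) := x)"
    have e: "env ?e" using nx by simp
    have "nv (X \<cdot> n \<cdot> x) = nv (G ?e)" using X(2)[OF nx] nv_eq[OF el[OF nx] definable_elts[OF G(1) e]] by simp
    also have "\<dots> = nv (if \<not> R n x then \<^bold>0 else \<^bold>1)"
      using G(2)[OF e] nv_eq[OF definable_elts[OF G(1) e], of "if \<not> R n x then \<^bold>0 else \<^bold>1"] elts_consts(1,2) by simp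
    finally show ?thesis by simp
  qed
  have mem: "E (X \<cdot> n \<cdot> x) \<^bold>1 \<longleftrightarrow> R n x" if nx: "n \<in> elts T0" "x \<in> elts T1" for n x
    using nv_eq[OF el[OF nx] elts_consts(2)] v[OF nx] by (cases "R n x") simp_all
  show thesis
  proof (rule that[OF X(1) _ mem])
    show "setr (X \<cdot> n)" if n: "n \<in> elts T0" for n
      unfolding setr_def
    proof (intro conjI ballI impI)
      fix x assume x: "x \<in> elts T1"
      show "E (X \<cdot> n \<cdot> x) \<^bold>0 \<or> E (X \<cdot> n \<cdot> x) \<^bold>1"
        using nv_eq[OF el[OF n x] elts_consts(1)] nv_eq[OF el[OF n x] elts_consts(2)] v[OF n x] by (simp split: if_splits)
      fix y assume y: "y \<in> elts T1" and xy: "isr x \<and> isr y \<and> req x y"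
      then have "val x = val y" using req_iff by blast
      then have "R n x \<longleftrightarrow> R n y" using ext[OF n x y] ext[OF n y x] xy by metis
      then show "E (X \<cdot> n \<cdot> x) (X \<cdot> n \<cdot> y)" using nv_eq[OF el[OF n x] el[OF n y]] v[OF n x] v[OF n y] by simp
    qed
  qed
qed

end

section \<open>A nowhere continuous regulated function gives a height\<close>

locale nowhere_continuous = the_model +
  fixes f assumes f: "f \<in> elts (T1 \<rightarrow> T1)" and resp: "funr f" and reg: "regr f"
    and disc: "\<And>x. x \<in> elts T1 \<Longrightarrow> unit x \<Longrightarrow> \<not> contr unit f x"
begin

lemma f_isr: "x \<in> elts T1 \<Longrightarrow> unit x \<Longrightarrow> isr (f \<cdot> x)"
  using resp unfolding funr_def by blast

lemma f_cong:
  assumes "x \<in> elts T1" "y \<in> elts T1" "unit x" "unit y" "val x = val y" shows "val (f \<cdot> x) = val (f \<cdot> y)"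
proof -
  have "req x y" using assms req_iff unit_isr by blast
  then have "req (f \<cdot> x) (f \<cdot> y)" using resp assms unfolding funr_def by blast
  then show ?thesis using req_iff f_isr assms by blast
qed

text \<open>The oscillation of \<open>f\<close> at \<open>x\<close> is at least \<open>2\<^sup>-\<^sup>n\<close>; restricting to rational points keeps this
  arithmetical, and loses only a factor of two by the one-sided limits.\<close>

definition jump :: "tm \<Rightarrow> nn \<Rightarrow> bool" where
  "jump x n \<longleftrightarrow> (\<forall>N. \<exists>c\<in>elts T0. unit (qc c) \<and> \<not> req x (qc c) \<and> nearr N x (qc c) \<and> \<not> nearr n (f \<cdot> x) (f \<cdot> qc c))"

lemma ar_jump:
  assumes "definable T1 F" "dnn K" shows "ar (\<lambda>e. jump (F e) (K e))"
proof -
  obtain G where G: "definable T0 G" "\<And>e. env e \<Longrightarrow> K e = nv (G e)" using assms(2) unfolding dnn_def by blast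
  have "ar (\<lambda>e. jump (e (0, T1)) (nv (e (1, T0))))"
    unfolding jump_def
    by (intro ar_nn_all[of _ 2] ar_ex[of _ 3] ar_conj ar_not ar_unit ar_req ar_nearr definable_qc
        definable_app[OF definable_const[OF f]] definable_var dnn_nv) simp_all
  then have "ar (\<lambda>e. jump (F e) (nv (G e)))"
    by (rule ar_rel2[of "\<lambda>x a. jump x (nv a)", OF _ assms(1) G(1)])
  then show ?thesis by (rule ar_ext) (simp add: G(2))
qed

lemma jump_iff:
  assumes "x \<in> elts T1" "unit x"
  shows "jump x n \<longleftrightarrow> (\<forall>N. \<exists>c\<in>elts T0. unit (qc c) \<and> val x \<noteq> val (qc c) \<and> \<bar>val x - val (qc c)\<bar> < HP N \<and>
    HP n \<le> \<bar>val (f \<cdot> x) - val (f \<cdot> qc c)\<bar>)"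
proof -
  have "req x (qc c) \<longleftrightarrow> val x = val (qc c)" "nearr N x (qc c) \<longleftrightarrow> \<bar>val x - val (qc c)\<bar> < HP N"
    "unit (qc c) \<Longrightarrow> nearr n (f \<cdot> x) (f \<cdot> qc c) \<longleftrightarrow> \<bar>val (f \<cdot> x) - val (f \<cdot> qc c)\<bar> < HP n" if "c \<in> elts T0" for c N
    using req_iff nearr_iff unit_isr assms qc(1,3)[OF that] f_isr by blast+
  then show ?thesis unfolding jump_def by (simp add: not_less cong: conj_cong)
qed

lemma jump_mono: "x \<in> elts T1 \<Longrightarrow> unit x \<Longrightarrow> jump x m \<Longrightarrow> m \<le> n \<Longrightarrow> jump x n"
  unfolding jump_iff using HP_mono[of m n] order_trans by blast

lemma jump_cong:
  assumes "x \<in> elts T1" "y \<in> elts T1" "unit x" "unit y" "val x = val y" shows "jump x n \<longleftrightarrow> jump y n"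
  unfolding jump_iff[OF assms(1,3)] jump_iff[OF assms(2,4)] using assms(5) f_cong[OF assms] by simp

text \<open>At an end of the interval no points lie on the missing side, and any value serves as the
  limit there.\<close>

lemma one_sided_limits:
  assumes x: "x \<in> elts T1" "unit x"
  shows "\<exists>N v w. \<forall>y\<in>elts T1. unit y \<and> \<bar>val x - val y\<bar> < HP N \<longrightarrow>
    (val y < val x \<longrightarrow> \<bar>val (f \<cdot> y) - v\<bar> < HP k) \<and> (val x < val y \<longrightarrow> \<bar>val (f \<cdot> y) - w\<bar> < HP k)"
proof -
  have ix: "isr x" using x(2) unit_isr by blast
  have left: "\<exists>N v. \<forall>y\<in>elts T1. unit y \<and> \<bar>val x - val y\<bar> < HP N \<and> val y < val x \<longrightarrow> \<bar>val (f \<cdot> y) - v\<bar> < HP k"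
  proof (cases "0 < val x")
    case False
    then have "\<not> val y < val x" if "unit y" for y using unit_bounds(1)[OF that] by linarith
    then show ?thesis by blast
  next
    case True
    then have "rlt \<^bold>0\<^sub>R x" using rlt_iff ix by simp
    then obtain l where l: "l \<in> elts T1" "isr l" "leftr f x l" using reg x unfolding regr_def by blast
    obtain N where N: "\<And>y. y \<in> elts T1 \<Longrightarrow> unit y \<and> rlt y x \<and> nearr (nv N) x y \<Longrightarrow> nearr (nv (rp k)) (f \<cdot> y) l"
      using l(3) rp_elts[of k] unfolding leftr_def by blast
    have "\<bar>val (f \<cdot> y) - val l\<bar> < HP k" if "y \<in> elts T1" "unit y" "\<bar>val x - val y\<bar> < HP (nv N)" "val y < val x" for y
      using N[OF that(1)] that(2-4) rlt_iff nearr_iff unit_isr ix l(2) f_isr[OF that(1,2)] by (metis nv_rp)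
    then show ?thesis by blast
  qed
  have right: "\<exists>N v. \<forall>y\<in>elts T1. unit y \<and> \<bar>val x - val y\<bar> < HP N \<and> val x < val y \<longrightarrow> \<bar>val (f \<cdot> y) - v\<bar> < HP k"
  proof (cases "val x < 1")
    case False
    then have "\<not> val x < val y" if "unit y" for y using unit_bounds(2)[OF that] by linarith
    then show ?thesis by blast
  next
    case True
    then have "rlt x \<^bold>1\<^sub>R" using rlt_iff ix by simp
    then obtain l where l: "l \<in> elts T1" "isr l" "rightr f x l" using reg x unfolding regr_def by blast
    obtain N where N: "\<And>y. y \<in> elts T1 \<Longrightarrow> unit y \<and> rlt x y \<and> nearr (nv N) x y \<Longrightarrow> nearr (nv (rp k)) (f \<cdot> y) l"
      using l(3) rp_elts[of k] unfolding rightr_def by blast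
    have "\<bar>val (f \<cdot> y) - val l\<bar> < HP k" if "y \<in> elts T1" "unit y" "\<bar>val x - val y\<bar> < HP (nv N)" "val x < val y" for y
      using N[OF that(1)] that(2-4) rlt_iff nearr_iff unit_isr ix l(2) f_isr[OF that(1,2)] by (metis nv_rp)
    then show ?thesis by blast
  qed
  obtain N v where N: "\<forall>y\<in>elts T1. unit y \<and> \<bar>val x - val y\<bar> < HP N \<and> val y < val x \<longrightarrow> \<bar>val (f \<cdot> y) - v\<bar> < HP k"
    using left by blast
  obtain N' w where N': "\<forall>y\<in>elts T1. unit y \<and> \<bar>val x - val y\<bar> < HP N' \<and> val x < val y \<longrightarrow> \<bar>val (f \<cdot> y) - w\<bar> < HP k"
    using right by blast
  have "HP (max N N') \<le> HP N" "HP (max N N') \<le> HP N'" by (simp_all add: HP_mono)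
  then have "\<forall>y\<in>elts T1. unit y \<and> \<bar>val x - val y\<bar> < HP (max N N') \<longrightarrow>
    (val y < val x \<longrightarrow> \<bar>val (f \<cdot> y) - v\<bar> < HP k) \<and> (val x < val y \<longrightarrow> \<bar>val (f \<cdot> y) - w\<bar> < HP k)"
    using N N' less_le_trans by blast
  then show ?thesis by blast
qed

text \<open>Passes from rational points to all points. Between \<open>x\<close> and \<open>y\<close>
  lies a rational \<open>c\<close>, where \<open>f\<close> differs from its value at
  \<open>x\<close> by less than \<open>2^-(k + 1)\<close>; the values at \<open>c\<close> and at
  \<open>y\<close> are both within \<open>2^-(k + 2)\<close> of the same one-sided limit. The three
  errors add up to \<open>2^-k\<close>.\<close>

lemma continuous_if_no_jump:
  assumes x: "x \<in> elts T1" "unit x" and no: "\<not> jump x (k + 1)"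
  obtains N where "\<And>y. y \<in> elts T1 \<Longrightarrow> unit y \<Longrightarrow> \<bar>val x - val y\<bar> < HP N \<Longrightarrow> \<bar>val (f \<cdot> x) - val (f \<cdot> y)\<bar> < HP k"
proof -
  have HPk: "HP (k + 1) = HP k / 2" "HP (k + 1 + 1) = HP k / 4" by (simp_all add: HP_suc)
  obtain N where N: "\<And>c. c \<in> elts T0 \<Longrightarrow> unit (qc c) \<Longrightarrow> val x \<noteq> val (qc c) \<Longrightarrow> \<bar>val x - val (qc c)\<bar> < HP N \<Longrightarrow>
      \<bar>val (f \<cdot> x) - val (f \<cdot> qc c)\<bar> < HP (k + 1)"
    using no unfolding jump_iff[OF x] not_le[symmetric] by blast
  obtain N' v w where lim: "\<forall>y\<in>elts T1. unit y \<and> \<bar>val x - val y\<bar> < HP N' \<longrightarrow>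
    (val y < val x \<longrightarrow> \<bar>val (f \<cdot> y) - v\<bar> < HP (k + 1 + 1)) \<and> (val x < val y \<longrightarrow> \<bar>val (f \<cdot> y) - w\<bar> < HP (k + 1 + 1))"
    using one_sided_limits[OF x, of "k + 1 + 1"] by (elim exE)
  have N': "\<bar>val (f \<cdot> y) - v\<bar> < HP (k + 1 + 1)" if "y \<in> elts T1" "unit y" "\<bar>val x - val y\<bar> < HP N'" "val y < val x" for y
    using lim that by blast
  have N'': "\<bar>val (f \<cdot> y) - w\<bar> < HP (k + 1 + 1)" if "y \<in> elts T1" "unit y" "\<bar>val x - val y\<bar> < HP N'" "val x < val y" for y
    using lim that by blast
  have le: "HP (max N N') \<le> HP N" "HP (max N N') \<le> HP N'" by (simp_all add: HP_mono)
  show thesis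
  proof (rule that[of "max N N'"])
    fix y assume y: "y \<in> elts T1" "unit y" "\<bar>val x - val y\<bar> < HP (max N N')"
    note b = unit_bounds[OF x(2)] unit_bounds[OF y(2)]
    consider "val y = val x" | "val y < val x" | "val x < val y" by linarith
    then show "\<bar>val (f \<cdot> x) - val (f \<cdot> y)\<bar> < HP k"
    proof cases
      case 1
      then show ?thesis using f_cong[OF y(1) x(1) y(2) x(2)] by simp
    next
      case 2
      then obtain c where c: "c \<in> elts T0" "val y < val (qc c)" "val (qc c) < val x" by (rule rational_between)
      have u: "unit (qc c)" using c b by (intro unit_qc) linarith+
      have n: "\<bar>val x - val (qc c)\<bar> < HP N" "\<bar>val x - val (qc c)\<bar> < HP N'" "\<bar>val x - val y\<bar> < HP N'"
        using c y(3) le by linarith+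
      have "\<bar>val (f \<cdot> x) - val (f \<cdot> qc c)\<bar> < HP (k + 1)" using N[OF c(1) u _ n(1)] c(3) by auto
      moreover have "\<bar>val (f \<cdot> qc c) - v\<bar> < HP (k + 1 + 1)" using N'[OF qc(1)[OF c(1)] u n(2) c(3)] .
      moreover have "\<bar>val (f \<cdot> y) - v\<bar> < HP (k + 1 + 1)" using N'[OF y(1,2) n(3) 2] .
      ultimately show ?thesis using HPk by linarith
    next
      case 3
      then obtain c where c: "c \<in> elts T0" "val x < val (qc c)" "val (qc c) < val y" by (rule rational_between)
      have u: "unit (qc c)" using c b by (intro unit_qc) linarith+
      have n: "\<bar>val x - val (qc c)\<bar> < HP N" "\<bar>val x - val (qc c)\<bar> < HP N'" "\<bar>val x - val y\<bar> < HP N'"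
        using c y(3) le by linarith+
      have "\<bar>val (f \<cdot> x) - val (f \<cdot> qc c)\<bar> < HP (k + 1)" using N[OF c(1) u _ n(1)] c(2) by auto
      moreover have "\<bar>val (f \<cdot> qc c) - w\<bar> < HP (k + 1 + 1)" using N''[OF qc(1)[OF c(1)] u n(2) c(2)] .
      moreover have "\<bar>val (f \<cdot> y) - w\<bar> < HP (k + 1 + 1)" using N''[OF y(1,2) n(3) 3] .
      ultimately show ?thesis using HPk by linarith
    qed
  qed
qed

lemma ex_jump:
  assumes x: "x \<in> elts T1" "unit x" shows "\<exists>n. jump x n"
proof (rule ccontr)
  assume no: "\<nexists>n. jump x n"
  have "contr unit f x"
    unfolding contr_def
  proof (intro ballI)
    fix k assume k: "k \<in> elts T0"
    have "\<not> jump x (nv k + 1)" using no by blast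
    then obtain N where N: "\<And>y. y \<in> elts T1 \<Longrightarrow> unit y \<Longrightarrow> \<bar>val x - val y\<bar> < HP N \<Longrightarrow> \<bar>val (f \<cdot> x) - val (f \<cdot> y)\<bar> < HP (nv k)"
      by (rule continuous_if_no_jump[OF x]) blast
    have "nearr (nv k) (f \<cdot> x) (f \<cdot> y)" if "y \<in> elts T1" "isr y \<and> unit y \<and> nearr N x y" for y
      using N[OF that(1)] that(2) nearr_iff unit_isr[OF x(2)] f_isr[OF x] f_isr[OF that(1)] by blast
    then show "\<exists>N\<in>elts T0. \<forall>y\<in>elts T1. isr y \<and> unit y \<and> nearr (nv N) x y \<longrightarrow> nearr (nv k) (f \<cdot> x) (f \<cdot> y)"
      by (intro bexI[of _ "rp N"]) simp_all
  qed
  then show False using disc[OF x] by blast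
qed

text \<open>If no two jump points are closer than \<open>2\<^sup>-\<^sup>j\<close>, then they are separated by a finite grid.\<close>

lemma close_jumps:
  assumes inf: "\<not> finr (\<lambda>x. unit x \<and> jump x k)"
  shows "\<exists>x\<in>elts T1. \<exists>y\<in>elts T1. unit x \<and> unit y \<and> jump x k \<and> jump y k \<and> val x \<noteq> val y \<and> \<bar>val x - val y\<bar> < HP j"
proof (rule ccontr)
  assume no: "\<not> ?thesis"
  have ex: "\<exists>n. rat n = ofn m * hp (j + 1)" for m using rat_surj by blast
  have "ar (\<lambda>e. rat (nv (e (1, T0))) = ofn (nv (e (0, T0))) * hp (j + 1))"
    by (intro ar_qq_eq dqq_intros dnn_intros)
  then obtain g where g: "g \<in> elts T1" "\<And>m. rat (fn g m) = ofn m * hp (j + 1)"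
    using choice_T1[of "\<lambda>m n. rat n = ofn m * hp (j + 1)", OF _ ex] by blast
  have grid: "val (qc (g \<cdot> i)) = const (ofn (nv i) * hp (j + 1))" "isr (qc (g \<cdot> i))" if "i \<in> elts T0" for i
    using qc(3,4)[OF elts_T1[OF g(1) that]] nv_app[OF g(1) that] g(2) by simp_all
  \<comment> \<open>Two points within \<open>2^-(j + 1)\<close> of the same grid point are closer
    than \<open>2^-j\<close>, so by assumption each grid point collects at most one jump
    point.\<close>
  define R where "R i x \<longleftrightarrow> unit x \<and> jump x k \<and> nearr (j + 1) x (qc (g \<cdot> i))" for i x
  have "ar (\<lambda>e. R (e (0, T0)) (e (1, T1)))"
    unfolding R_def by (intro ar_conj ar_unit ar_jump ar_nearr definable_qc definable_app[OF definable_const[OF g(1)]]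
        dnn_const definable_var)
  moreover have "R n y" if "n \<in> elts T0" "x \<in> elts T1" "y \<in> elts T1" "isr x" "isr y" "val x = val y" "R n x" for n x y
  proof -
    have "unit y" using that unit_cong R_def by blast
    then show ?thesis using that jump_cong nearr_iff grid(2) unfolding R_def by metis
  qed
  ultimately obtain X where X: "X \<in> elts (T0 \<rightarrow> T2)" "\<And>n. n \<in> elts T0 \<Longrightarrow> setr (X \<cdot> n)"
    "\<And>n x. n \<in> elts T0 \<Longrightarrow> x \<in> elts T1 \<Longrightarrow> E (X \<cdot> n \<cdot> x) \<^bold>1 \<longleftrightarrow> R n x"
    by (rule comprehension[of R]) blast+
  have "finr (\<lambda>x. E (X \<cdot> n \<cdot> x) \<^bold>1)" if n: "n \<in> elts T0" for n
  proof (rule finr_subsingleton)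
    fix x y assume xy: "x \<in> elts T1" "y \<in> elts T1" "isr x" "isr y" "E (X \<cdot> n \<cdot> x) \<^bold>1" "E (X \<cdot> n \<cdot> y) \<^bold>1"
    then have R: "R n x" "R n y" using X(3)[OF n] by blast+
    have "\<bar>val x - val (qc (g \<cdot> n))\<bar> < HP (j + 1)" "\<bar>val y - val (qc (g \<cdot> n))\<bar> < HP (j + 1)"
      using R nearr_iff xy grid(2)[OF n] unfolding R_def by blast+
    then have "\<bar>val x - val y\<bar> < HP j" using HP_suc[of j] by linarith
    then show "val x = val y" using no R xy unfolding R_def by blast
  qed
  \<comment> \<open>The grid points with index up to \<open>2^(j + 1)\<close> reach across the unit
    interval, and \<open>FIN1\<close> unites the sets belonging to them.\<close>
  then have "finr (\<lambda>x. \<exists>n\<in>elts T0. (L n (rp (p2 (j + 1))) \<or> E n (rp (p2 (j + 1)))) \<and> E (X \<cdot> n \<cdot> x) \<^bold>1)"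
    using X(2) by (intro FIN1r[OF X(1)]) simp_all
  then have "finr (\<lambda>x. unit x \<and> jump x k)"
  proof (rule finr_mono)
    fix x assume x: "x \<in> elts T1" "isr x" "unit x \<and> jump x k"
    \<comment> \<open>Arithmetical form of \<open>x\<close> lying below the grid point with index
      \<open>a\<close>. The predecessor \<open>b\<close> of the least such \<open>a\<close> plays
      the part of a floor, which has to be found inside the model.\<close>
    define P where "P a \<longleftrightarrow> (\<exists>n. rat (fn x n) + 2 * hp n < ofn a * hp (j + 1))" for a
    have P: "P a \<longleftrightarrow> val x < const (ofn a * hp (j + 1))" for a
      unfolding P_def by (rule const_less_val_iff(2)[OF x(2)])
    have "(1::qq) < ofn (p2 (j + 1) + 1) * hp (j + 1)"
      using p2_pos[of "j + 1"] unfolding hp_def ofn_pos[symmetric] by (simp add: field_simps)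
    then have "const 1 < (const (ofn (p2 (j + 1) + 1) * hp (j + 1)) :: rr)" by (simp only: const_less)
    moreover have "val x \<le> const 1" using unit_bounds(2) x(3) by simp
    ultimately have large: "P (p2 (j + 1) + 1)" unfolding P by (meson le_less_trans)
    have "ar (\<lambda>e. P (nv (e (0, T0))))"
      unfolding P_def by (intro ar_nn_ex[of _ 1] ar_qq_less dqq_intros dnn_intros x(1)) simp_all
    then obtain a where a: "P a" "\<And>b. b < a \<Longrightarrow> \<not> P b" using nn_least[of P, OF _ large] by blast
    have "a \<noteq> 0" using a(1) P unit_bounds(1) x(3) by (auto simp: not_less[symmetric])
    then obtain b where b: "a = b + 1" using nn_zero_or_suc by blast
    have "\<not> P b" using a(2) b nn_less_suc by blast
    then have "const (ofn b * hp (j + 1)) \<le> val x" unfolding P by simp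
    moreover have "val x < const (ofn b * hp (j + 1)) + HP (j + 1)"
    proof -
      have "ofn a * hp (j + 1) = ofn b * hp (j + 1) + hp (j + 1)" using b by (simp add: algebra_simps)
      then show ?thesis using a(1) P HP_def by simp
    qed
    ultimately have "\<bar>val x - val (qc (g \<cdot> rp b))\<bar> < HP (j + 1)" using grid(1)[OF rp_elts, of b] by simp
    then have "R (rp b) x" using x nearr_iff grid(2)[OF rp_elts] unfolding R_def by blast
    then have "E (X \<cdot> rp b \<cdot> x) \<^bold>1" using X(3)[OF rp_elts x(1)] by blast
    moreover have "b \<le> p2 (j + 1)"
      using a(2)[of "p2 (j + 1) + 1"] large b by (metis add_le_cancel_right not_less)
    then have "L (rp b) (rp (p2 (j + 1))) \<or> E (rp b) (rp (p2 (j + 1)))" using le_iff by simp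
    ultimately show "\<exists>n\<in>elts T0. (L n (rp (p2 (j + 1))) \<or> E n (rp (p2 (j + 1)))) \<and> E (X \<cdot> n \<cdot> x) \<^bold>1"
      using rp_elts by blast
  qed
  then show False using inf by blast
qed

end

context the_model
begin

text \<open>\<open>QF_AC T0 T1\<close> selects a single object of type 1, so two reals are packed
  into one by Cantor pairing of their values. Unpacking returns them up to \<open>fn\<close>, which
  is all that \<open>val\<close> sees.\<close>

lemma coded_pairs:
  obtains fst' snd' where "fst' \<in> elts (T1 \<rightarrow> T1)" "snd' \<in> elts (T1 \<rightarrow> T1)"
    "\<And>x y. x \<in> elts T1 \<Longrightarrow> y \<in> elts T1 \<Longrightarrow> \<exists>p\<in>elts T1. fn (fst' \<cdot> p) = fn x \<and> fn (snd' \<cdot> p) = fn y"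
proof -
  \<comment> \<open>A total arithmetical relation between numbers lifts to a functional that applies
    it to every value of a sequence; both projections are instances.\<close>
  have dec: "\<exists>h\<in>elts (T1 \<rightarrow> T1). \<forall>p\<in>elts T1. \<forall>n. D (fn p n) (fn (h \<cdot> p) n)"
    if ar: "ar (\<lambda>e. D (fn (e (0, T1)) (nv (e (1, T0)))) (nv (e (2, T0))))" and ex: "\<And>m. \<exists>a. D m a" for D
  proof -
    obtain X where X: "dnn X" "\<And>e. env e \<Longrightarrow> D (fn (e (0, T1)) (nv (e (1, T0)))) (X e)"
      using nn_choice[of "\<lambda>e. D (fn (e (0, T1)) (nv (e (1, T0))))" 2, OF ar] ex by auto
    obtain F where F: "definable T0 F" "\<And>e. env e \<Longrightarrow> X e = nv (F e)" using X(1) unfolding dnn_def by blast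
    obtain h where h: "h \<in> elts (T1 \<rightarrow> T1)"
      "\<And>p n. p \<in> elts T1 \<Longrightarrow> n \<in> elts T0 \<Longrightarrow> eqv T0 (h \<cdot> p \<cdot> n) (F (e0((0, T1) := p, (1, T0) := n)))"
      by (rule lam2[OF F(1), of T1 T0]) blast
    have "D (fn p n) (fn (h \<cdot> p) n)" if p: "p \<in> elts T1" for p n
    proof -
      let ?e = "e0((0, T1) := p, (1, T0) := rp n)"
      have e: "env ?e" using p by simp
      have "fn (h \<cdot> p) n = nv (F ?e)"
        using h(2)[OF p rp_elts, of n] nv_eq[OF elts_App[OF elts_App[OF h(1) p] rp_elts] definable_elts[OF F(1) e]]
        by (simp add: fn_def)
      then show ?thesis using X(2)[OF e] F(2)[OF e] by simp
    qed
    then show ?thesis using h(1) by blast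
  qed
  have "\<exists>h\<in>elts (T1 \<rightarrow> T1). \<forall>p\<in>elts T1. \<forall>n. \<exists>b. pairs (fn (h \<cdot> p) n) b (fn p n)"
    by (rule dec[of "\<lambda>m a. \<exists>b. pairs a b m"], unfold pairs_def, intro ar_nn_ex[of _ 3] ar_nn_eq dnn_intros)
      (simp_all, use pairs_surj in \<open>auto simp: pairs_def\<close>)
  then obtain h where h: "h \<in> elts (T1 \<rightarrow> T1)" "\<And>p n. p \<in> elts T1 \<Longrightarrow> \<exists>b. pairs (fn (h \<cdot> p) n) b (fn p n)" by blast
  have "\<exists>h\<in>elts (T1 \<rightarrow> T1). \<forall>p\<in>elts T1. \<forall>n. \<exists>a. pairs a (fn (h \<cdot> p) n) (fn p n)"
    by (rule dec[of "\<lambda>m b. \<exists>a. pairs a b m"], unfold pairs_def, intro ar_nn_ex[of _ 3] ar_nn_eq dnn_intros)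
      (simp_all, metis pairs_surj pairs_def)
  then obtain h' where h': "h' \<in> elts (T1 \<rightarrow> T1)" "\<And>p n. p \<in> elts T1 \<Longrightarrow> \<exists>a. pairs a (fn (h' \<cdot> p) n) (fn p n)" by blast
  show thesis
  proof (rule that[OF h(1) h'(1)])
    fix x y assume xy: "x \<in> elts T1" "y \<in> elts T1"
    have "ar (\<lambda>e. pairs (fn x (nv (e (0, T0)))) (fn y (nv (e (0, T0)))) (nv (e (1, T0))))"
      unfolding pairs_def by (intro ar_nn_eq dnn_intros xy)
    then obtain p where p: "p \<in> elts T1" "\<And>n. pairs (fn x n) (fn y n) (fn p n)"
      using choice_T1[of "\<lambda>m n. pairs (fn x m) (fn y m) n", OF _ pairs_total] by blast
    have "fn (h \<cdot> p) n = fn x n" "fn (h' \<cdot> p) n = fn y n" for n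
      using h(2)[OF p(1), of n] h'(2)[OF p(1), of n] p(2)[of n] pairs_unique by blast+
    then show "\<exists>p\<in>elts T1. fn (h \<cdot> p) = fn x \<and> fn (h' \<cdot> p) = fn y" using p(1) by blast
  qed
qed

end

context nowhere_continuous
begin

text \<open>\<open>z\<close> is the upper limit of the first components of the selected pairs. A
  first component near \<open>z\<close> may equal \<open>z\<close>; then the second one, also near
  \<open>z\<close> by the choice of the pair, does not.\<close>

lemma jump_limit_point:
  assumes inf: "\<not> finr (\<lambda>x. unit x \<and> jump x k)"
  obtains z where "z \<in> elts T1" "isr z"
    "\<And>N. \<exists>u\<in>elts T1. unit u \<and> jump u k \<and> val u \<noteq> val z \<and> \<bar>val u - val z\<bar> < HP N"
proof -
  obtain p q where pq: "p \<in> elts (T1 \<rightarrow> T1)" "q \<in> elts (T1 \<rightarrow> T1)"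
    "\<And>x y. x \<in> elts T1 \<Longrightarrow> y \<in> elts T1 \<Longrightarrow> \<exists>c\<in>elts T1. fn (p \<cdot> c) = fn x \<and> fn (q \<cdot> c) = fn y"
    by (rule coded_pairs) blast
  define R where "R j c \<longleftrightarrow> unit (p \<cdot> c) \<and> unit (q \<cdot> c) \<and> jump (p \<cdot> c) k \<and> jump (q \<cdot> c) k \<and>
    \<not> req (p \<cdot> c) (q \<cdot> c) \<and> nearr (nv j) (p \<cdot> c) (q \<cdot> c)" for j c
  have "ar (\<lambda>e. R (e (0, T0)) (e (1, T1)))"
    unfolding R_def by (intro ar_conj ar_unit ar_jump ar_not ar_req ar_nearr definable_app[OF definable_const[OF pq(1)]]
        definable_app[OF definable_const[OF pq(2)]] dnn_const dnn_nv definable_var)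
  then obtain Y where Y: "Y \<in> elts (T0 \<rightarrow> T1 \<rightarrow> T0)" "\<And>j c. j \<in> elts T0 \<Longrightarrow> c \<in> elts T1 \<Longrightarrow> E (Y \<cdot> j \<cdot> c) \<^bold>0 \<longleftrightarrow> R j c"
    by (rule rel_fun2[of R]) blast
  have "\<exists>c\<in>elts T1. E (Y \<cdot> j \<cdot> c) \<^bold>0" if j: "j \<in> elts T0" for j
  proof -
    obtain x y where xy: "x \<in> elts T1" "y \<in> elts T1" "unit x" "unit y" "jump x k" "jump y k" "val x \<noteq> val y" "\<bar>val x - val y\<bar> < HP (nv j)"
      using close_jumps[OF inf, of "nv j"] by blast
    obtain c where c: "c \<in> elts T1" "fn (p \<cdot> c) = fn x" "fn (q \<cdot> c) = fn y" using pq(3)[OF xy(1,2)] by blast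
    have el: "p \<cdot> c \<in> elts T1" "q \<cdot> c \<in> elts T1" using elts_App pq(1,2) c(1) by blast+
    have isr: "isr (p \<cdot> c)" "isr (q \<cdot> c)" "isr x" "isr y" using val_cong(2) c unit_isr xy by blast+
    have val: "val (p \<cdot> c) = val x" "val (q \<cdot> c) = val y" using val_cong(1) c by blast+
    have unit: "unit (p \<cdot> c)" "unit (q \<cdot> c)" using unit_cong isr val xy by blast+
    have "R j c" unfolding R_def
      using unit jump_cong[OF el(1) xy(1) unit(1) xy(3) val(1)] jump_cong[OF el(2) xy(2) unit(2) xy(4) val(2)] xy(5-8)
        req_iff[OF isr(1,2)] nearr_iff[OF isr(1,2)] val by simp
    then show ?thesis using Y(2)[OF j c(1)] c(1) by blast
  qed
  then have "\<exists>Z\<in>elts (T0 \<rightarrow> T1). \<forall>j\<in>elts T0. E (Y \<cdot> j \<cdot> (Z \<cdot> j)) \<^bold>0"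
    by (rule choice_basic[OF base_subsets(5) Y(1)]) (assumption, erule bexI[rotated], simp)
  then obtain Z where Z: "Z \<in> elts (T0 \<rightarrow> T1)" "\<And>j. j \<in> elts T0 \<Longrightarrow> E (Y \<cdot> j \<cdot> (Z \<cdot> j)) \<^bold>0" by blast
  define xs where "xs j = p \<cdot> (Z \<cdot> j)" for j
  define ys where "ys j = q \<cdot> (Z \<cdot> j)" for j
  have els: "xs j \<in> elts T1" "ys j \<in> elts T1" if "j \<in> elts T0" for j
    unfolding xs_def ys_def using elts_App pq(1,2) elts_App[OF Z(1) that] by blast+
  have R: "unit (xs j)" "unit (ys j)" "jump (xs j) k" "jump (ys j) k" "\<not> req (xs j) (ys j)" "nearr (nv j) (xs j) (ys j)" if j: "j \<in> elts T0" for j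
    using Y(2)[OF j elts_App[OF Z(1) j]] Z(2)[OF j] unfolding R_def xs_def ys_def by blast+
  have xs: "isr (xs j)" "0 \<le> val (xs j)" "val (xs j) \<le> 1" "val (xs j) \<noteq> val (ys j)" "\<bar>val (xs j) - val (ys j)\<bar> < HP (nv j)"
    if j: "j \<in> elts T0" for j
  proof -
    have isr: "isr (xs j)" "isr (ys j)" using unit_isr[OF R(1)[OF j]] unit_isr[OF R(2)[OF j]] .
    show "isr (xs j)" "0 \<le> val (xs j)" "val (xs j) \<le> 1" using isr(1) unit_bounds[OF R(1)[OF j]] .
    show "val (xs j) \<noteq> val (ys j)" using R(5)[OF j] unfolding req_iff[OF isr] .
    show "\<bar>val (xs j) - val (ys j)\<bar> < HP (nv j)" using R(6)[OF j] unfolding nearr_iff[OF isr] .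
  qed
  \<comment> \<open>The first components are eventually at most \<open>r\<close>; the comparison
    with \<open>r\<close> is written through approximations to stay arithmetical.\<close>
  define U where "U r \<longleftrightarrow> (\<exists>N. \<forall>j\<in>elts T0. N \<le> nv j \<longrightarrow> \<not> (\<exists>n. r + 2 * hp n < rat (fn (xs j) n)))" for r
  have U: "U r \<longleftrightarrow> (\<exists>N. \<forall>j\<in>elts T0. N \<le> nv j \<longrightarrow> val (xs j) \<le> const r)" for r
    unfolding U_def using const_less_val_iff(1)[OF xs(1)] by (simp add: not_less[symmetric])
  have arU: "ar (\<lambda>e. U (rat (nv (e (2, T0)))))"
    unfolding U_def xs_def
    by (intro ar_nn_ex[of _ 3] ar_all[of _ 4] ar_imp ar_nn_le ar_not ar_nn_ex[of _ 5] ar_qq_less dqq_intros dnn_intros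
        definable_app[OF definable_const[OF pq(1)]] definable_app[OF definable_const[OF Z(1)]]) simp_all
  have low: "\<not> U (- 1)"
  proof
    assume "U (- 1)"
    then obtain N where "\<And>j. j \<in> elts T0 \<Longrightarrow> N \<le> nv j \<Longrightarrow> val (xs j) \<le> const (- 1)" unfolding U by blast
    from this[OF rp_elts, of N] have "val (xs (rp N)) \<le> - 1" by simp
    then show False using xs(2)[OF rp_elts, of N] by linarith
  qed
  have high: "U 2"
  proof -
    have "val (xs j) \<le> const 2" if "j \<in> elts T0" for j using xs(3)[OF that] by simp
    then show ?thesis unfolding U by blast
  qed
  have up: "U s" if "U r" "r \<le> s" for r s
  proof -
    have "const r \<le> (const s :: rr)" using that(2) by simp
    then show ?thesis using that(1) order_trans unfolding U by blast
  qed
  obtain G where G: "G \<in> elts (T0 \<rightarrow> T1 \<rightarrow> T1)" "\<And>a x. a \<in> elts T0 \<Longrightarrow> x \<in> elts T1 \<Longrightarrow> isr (G \<cdot> a \<cdot> x)"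
    "\<And>a x q. a \<in> elts T0 \<Longrightarrow> x \<in> elts T1 \<Longrightarrow> const q < val (G \<cdot> a \<cdot> x) \<Longrightarrow> \<not> U q"
    "\<And>a x q. a \<in> elts T0 \<Longrightarrow> x \<in> elts T1 \<Longrightarrow> val (G \<cdot> a \<cdot> x) < const q \<Longrightarrow> U q"
    by (rule cut_real[of "\<lambda>m x q. U q", OF arU]) (use low high up in blast)+
  \<comment> \<open>\<open>cut_real\<close> gives a family of reals with two parameters; the cut is
    the same for all of them, and its real is read off at 0.\<close>
  note a = elts_consts(1) real_numerals(1)
  define z where "z = G \<cdot> \<^bold>0 \<cdot> \<^bold>0\<^sub>R"
  show thesis
  proof (rule that[of z])
    show "z \<in> elts T1" unfolding z_def using elts_App[OF elts_App[OF G(1) a(1)] a(2)] .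
    show "isr z" unfolding z_def using G(2)[OF a] .
    fix N
    \<comment> \<open>Since \<open>s\<close> is in the cut and \<open>r\<close> is not, some late
      first component lies between \<open>r\<close> and \<open>s\<close>, hence within
      \<open>2^-(N + 1)\<close> of \<open>z\<close>; its partner then lies within
      \<open>2^-N\<close>.\<close>
    have "val z - HP (N + 1) < val z" "val z < val z + HP (N + 1)" by simp_all
    then obtain r s where rs: "val z - HP (N + 1) < const r" "const r < val z" "val z < const s" "const s < val z + HP (N + 1)"
      using const_dense by metis
    have "U s" "\<not> U r" using G(4)[OF a, of s] G(3)[OF a, of r] rs unfolding z_def by blast+
    then obtain N' where N': "\<And>j. j \<in> elts T0 \<Longrightarrow> N' \<le> nv j \<Longrightarrow> val (xs j) \<le> const s" unfolding U by blast
    obtain j where j: "j \<in> elts T0" "max N' (N + 1) \<le> nv j" "const r < val (xs j)"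
      using \<open>\<not> U r\<close> unfolding U by (meson not_le)
    have "val (xs j) \<le> const s" using N'[OF j(1)] j(2) by simp
    moreover have "HP (nv j) \<le> HP (N + 1)" using j(2) by (intro HP_mono) simp
    ultimately have "\<bar>val (xs j) - val z\<bar> < HP (N + 1)" "\<bar>val (ys j) - val z\<bar> < HP N"
      using rs j(3) xs(5)[OF j(1)] HP_suc[of N] by linarith+
    moreover have "HP (N + 1) \<le> HP N" using HP_suc[of N] HP_pos[of N] by linarith
    ultimately have "\<bar>val (xs j) - val z\<bar> < HP N" "\<bar>val (ys j) - val z\<bar> < HP N" by linarith+
    then show "\<exists>u\<in>elts T1. unit u \<and> jump u k \<and> val u \<noteq> val z \<and> \<bar>val u - val z\<bar> < HP N"
      using xs(4)[OF j(1)] els[OF j(1)] R(1-4)[OF j(1)] by metis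
  qed
qed

text \<open>Where \<open>f\<close> stays within \<open>2^-(k + 1)\<close> of one value, any two of
  its values differ by less than \<open>2^-k\<close>.\<close>

lemma small_jumps:
  assumes u: "u \<in> elts T1" "unit u" "jump u k" "a < val u" "val u < b"
    and osc: "\<And>y. y \<in> elts T1 \<Longrightarrow> unit y \<Longrightarrow> a < val y \<Longrightarrow> val y < b \<Longrightarrow> \<bar>val (f \<cdot> y) - v\<bar> < HP (k + 1)"
  shows False
proof -
  obtain N where N: "HP N < min (val u - a) (b - val u)" using HP_archimedean[of "min (val u - a) (b - val u)"] u(4,5) by auto
  obtain c where c: "c \<in> elts T0" "unit (qc c)" "\<bar>val u - val (qc c)\<bar> < HP N" "HP k \<le> \<bar>val (f \<cdot> u) - val (f \<cdot> qc c)\<bar>"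
    using u(3) unfolding jump_iff[OF u(1,2)] by blast
  have "\<bar>val (f \<cdot> qc c) - v\<bar> < HP (k + 1)" using c N by (intro osc qc) auto
  moreover have "\<bar>val (f \<cdot> u) - v\<bar> < HP (k + 1)" using u by (intro osc)
  ultimately show False using c(4) HP_suc[of k] by linarith
qed

lemma finite_jumps: "finr (\<lambda>x. unit x \<and> jump x k)"
proof (rule ccontr)
  assume "\<not> ?thesis"
  then obtain z where z: "z \<in> elts T1" "isr z"
    "\<And>N. \<exists>u\<in>elts T1. unit u \<and> jump u k \<and> val u \<noteq> val z \<and> \<bar>val u - val z\<bar> < HP N"
    by (rule jump_limit_point) blast
  \<comment> \<open>The cut places \<open>z\<close> only between \<open>- 1\<close> and
    \<open>2\<close>; it belongs to the unit interval as a limit of points of it.\<close>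
  have "0 \<le> val z"
  proof (rule ccontr)
    assume "\<not> 0 \<le> val z"
    then obtain N where "HP N < - val z" using HP_archimedean[of "- val z"] by auto
    moreover obtain u where "unit u" "\<bar>val u - val z\<bar> < HP N" using z(3)[of N] by blast
    ultimately show False using unit_bounds(1)[of u] by linarith
  qed
  moreover have "val z \<le> 1"
  proof (rule ccontr)
    assume "\<not> val z \<le> 1"
    then obtain N where "HP N < val z - 1" using HP_archimedean[of "val z - 1"] by auto
    moreover obtain u where "unit u" "\<bar>val u - val z\<bar> < HP N" using z(3)[of N] by blast
    ultimately show False using unit_bounds(2)[of u] by linarith
  qed
  ultimately have "unit z" using unit_iff z(2) by blast
  obtain N v w where lim: "\<forall>y\<in>elts T1. unit y \<and> \<bar>val z - val y\<bar> < HP N \<longrightarrow>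
    (val y < val z \<longrightarrow> \<bar>val (f \<cdot> y) - v\<bar> < HP (k + 1)) \<and> (val z < val y \<longrightarrow> \<bar>val (f \<cdot> y) - w\<bar> < HP (k + 1))"
    using one_sided_limits[OF z(1) \<open>unit z\<close>, of "k + 1"] by (elim exE)
  obtain u where u: "u \<in> elts T1" "unit u" "jump u k" "val u \<noteq> val z" "\<bar>val u - val z\<bar> < HP N" using z(3) by blast
  show False
  proof (cases "val u < val z")
    case True
    show False
      by (rule small_jumps[OF u(1-3), of "val z - HP N" "val z" v]) (use True u(5) lim in auto)
  next
    case False
    show False
      by (rule small_jumps[OF u(1-3), of "val z" "val z + HP N" w]) (use False u(4,5) lim in auto)
  qed
qed

lemma height_exists: "\<exists>H\<in>elts T2. height H"
proof -
  \<comment> \<open>The least level of a jump; the value 0 outside the unit interval makes a value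
    exist for every \<open>x\<close>.\<close>
  define Q where "Q x n \<longleftrightarrow> (unit x \<longrightarrow> jump x n \<and> (\<forall>k. k < n \<longrightarrow> \<not> jump x k)) \<and> (\<not> unit x \<longrightarrow> n = 0)" for x n
  have "ar (\<lambda>e. Q (e (0, T1)) (nv (e (1, T0))))"
    unfolding Q_def by (intro ar_imp ar_conj ar_unit ar_jump ar_nn_all[of _ 2] ar_not ar_nn_less ar_nn_eq dnn_const dnn_nv definable_var) simp_all
  then obtain X where X: "dnn X" "\<And>e. env e \<Longrightarrow> \<exists>n. Q (e (0, T1)) n \<Longrightarrow> Q (e (0, T1)) (X e)"
    using nn_choice[of "\<lambda>e. Q (e (0, T1))" 1] by auto
  obtain F where F: "definable T0 F" "\<And>e. env e \<Longrightarrow> X e = nv (F e)" using X(1) unfolding dnn_def by blast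
  obtain H where H: "H \<in> elts T2" "\<And>x. x \<in> elts T1 \<Longrightarrow> eqv T0 (H \<cdot> x) (F (e0((0, T1) := x)))"
    by (rule lam1[OF F(1), of T1]) blast
  have Q: "Q x (nv (H \<cdot> x))" if x: "x \<in> elts T1" for x
  proof -
    have e: "env (e0((0, T1) := x))" using x by simp
    have "nv (H \<cdot> x) = nv (F (e0((0, T1) := x)))"
      using nv_eq[OF elts_App[OF H(1) x] definable_elts[OF F(1) e]] H(2)[OF x] by simp
    moreover have "\<exists>n. Q x n"
    proof (cases "unit x")
      case True
      obtain n where "jump x n" using ex_jump[OF x True] by blast
      moreover have "ar (\<lambda>e. jump x (nv (e (0, T0))))" by (intro ar_jump definable_const x dnn_nv definable_var)
      ultimately show ?thesis unfolding Q_def using nn_least[of "jump x"] by blast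
    qed (simp add: Q_def)
    ultimately show ?thesis using X(2)[OF e] F(2)[OF e] by simp
  qed
  show ?thesis
  proof (rule bexI[OF _ H(1)])
    have el: "H \<cdot> x \<in> elts T0" if "x \<in> elts T1" for x using elts_App[OF H(1) that] .
    have "resp H"
      unfolding resp_def
    proof (intro ballI impI)
      fix x y assume xy: "x \<in> elts T1" "y \<in> elts T1" "isr x \<and> isr y \<and> req x y"
      then have val: "val x = val y" using req_iff by blast
      have u: "unit x \<longleftrightarrow> unit y" using unit_cong xy(3) val by blast
      have "nv (H \<cdot> x) = nv (H \<cdot> y)"
      proof (cases "unit x")
        case True
        then have "jump x n \<longleftrightarrow> jump y n" for n using jump_cong[OF xy(1,2) _ _ val] u by blast
        then show ?thesis using Q[OF xy(1)] Q[OF xy(2)] True u unfolding Q_def by (metis linorder_neqE)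
      next
        case False
        then show ?thesis using Q[OF xy(1)] Q[OF xy(2)] u unfolding Q_def by simp
      qed
      then show "E (H \<cdot> x) (H \<cdot> y)" using nv_eq[OF el[OF xy(1)] el[OF xy(2)]] by blast
    qed
    moreover have "finr (\<lambda>x. unit x \<and> L (H \<cdot> x) n)" if n: "n \<in> elts T0" for n
    \<comment> \<open>Jumps persist at higher levels, so a height below \<open>n\<close> implies a
      jump at level \<open>n\<close>.\<close>
    proof (rule finr_mono[OF finite_jumps[of "nv n"]])
      fix x assume x: "x \<in> elts T1" "unit x \<and> L (H \<cdot> x) n"
      then have less: "nv (H \<cdot> x) < nv n" and u: "unit x" using nv_less[OF el[OF x(1)] n] by simp_all
      have "jump x (nv (H \<cdot> x))" using Q[OF x(1)] u unfolding Q_def by simp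
      then have "jump x (nv n)" using jump_mono[OF x(1) u _ less_imp_le[OF less]] by simp
      then show "unit x \<and> jump x (nv n)" using u by simp
    qed
    ultimately show "height H" unfolding height_def by blast
  qed
qed

end

section \<open>A height gives a nowhere continuous function\<close>

context the_model
begin

lemma HP_less: "m < n \<Longrightarrow> HP n < HP m"
proof -
  assume "m < n"
  then have "HP n \<le> HP (m + 1)" by (metis HP_mono nn_less_suc not_less)
  then show ?thesis using HP_suc[of m] HP_pos[of m] by linarith
qed

lemma ar_less_abs_diff:
  assumes "dqq A" "dqq D" "dqq B" shows "ar (\<lambda>e. A e < \<bar>D e\<bar> - B e)"
  by (rule ar_ext[OF ar_not[OF ar_abs_le[OF assms(2) dqq_add[OF assms(1,3)]]]]) auto

text \<open>The counterpart of \<open>nearr\<close> for lower bounds on a distance. The bound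
  \<open>s\<close> may be negative, as it is in \<open>finite_support_Baire1\<close> when
  \<open>q\<close> exceeds a value \<open>v i\<close>.\<close>

lemma far_iff:
  assumes "isr x" "isr y"
  shows "(\<exists>l. s < \<bar>rat (fn x l) - rat (fn y l)\<bar> - 2 * hp l) \<longleftrightarrow> const s < \<bar>val x - val y\<bar>"
proof
  assume "\<exists>l. s < \<bar>rat (fn x l) - rat (fn y l)\<bar> - 2 * hp l"
  then obtain l where "s < \<bar>rat (fn x l) - rat (fn y l)\<bar> - 2 * hp l" by blast
  then have "const s < (const (\<bar>rat (fn x l) - rat (fn y l)\<bar> - 2 * hp l) :: rr)" by (simp only: const_less)
  then have "const s < \<bar>const (rat (fn x l)) - const (rat (fn y l))\<bar> - 2 * HP l" by (simp add: HP_def)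
  then show "const s < \<bar>val x - val y\<bar>" using val_approx[OF assms(1), of l] val_approx[OF assms(2), of l] by linarith
next
  assume s: "const s < \<bar>val x - val y\<bar>"
  then obtain l where "HP l < (\<bar>val x - val y\<bar> - const s) / 4"
    using HP_archimedean[of "(\<bar>val x - val y\<bar> - const s) / 4"] by auto
  then have "4 * HP l < \<bar>val x - val y\<bar> - const s" by (simp add: field_simps)
  then have "const s < \<bar>const (rat (fn x l)) - const (rat (fn y l))\<bar> - 2 * HP l"
    using val_approx[OF assms(1), of l] val_approx[OF assms(2), of l] by linarith
  then have "const s < (const (\<bar>rat (fn x l) - rat (fn y l)\<bar> - 2 * hp l) :: rr)" by (simp add: HP_def)
  then show "\<exists>l. s < \<bar>rat (fn x l) - rat (fn y l)\<bar> - 2 * hp l" unfolding const_less by blast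
qed

text \<open>The least of the positive distances from \<open>x\<close> to the listed points.
  \<open>K\<close> may be nonstandard, so the points are added one by one in an induction inside the
  model.\<close>

lemma finite_distance:
  assumes w: "w \<in> elts (T0 \<rightarrow> T1)" and x: "x \<in> elts T1" "isr x"
  shows "\<exists>N. \<forall>i\<in>elts T0. nv i < K \<longrightarrow> isr (w \<cdot> i) \<longrightarrow> val x \<noteq> val (w \<cdot> i) \<longrightarrow> HP N \<le> \<bar>val x - val (w \<cdot> i)\<bar>"
proof -
  \<comment> \<open>Stated with \<open>req\<close> and \<open>nearr\<close>, as the induction needs
    an arithmetical predicate.\<close>
  define P where "P k N \<longleftrightarrow> (\<forall>i\<in>elts T0. nv i < k \<longrightarrow> isr (w \<cdot> i) \<longrightarrow> \<not> req x (w \<cdot> i) \<longrightarrow> \<not> nearr N x (w \<cdot> i))" for k N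
  have P: "P k N \<longleftrightarrow> (\<forall>i\<in>elts T0. nv i < k \<longrightarrow> isr (w \<cdot> i) \<longrightarrow> val x \<noteq> val (w \<cdot> i) \<longrightarrow> HP N \<le> \<bar>val x - val (w \<cdot> i)\<bar>)" for k N
    unfolding P_def by (intro ball_cong imp_cong refl) (simp_all add: req_iff[OF x(2)] nearr_iff[OF x(2)] not_less)
  have "\<exists>N. P K N"
  proof (rule nn_induct[of "\<lambda>k. \<exists>N. P k N"])
    show "ar (\<lambda>e. \<exists>N. P (nv (e (0, T0))) N)"
      unfolding P_def by (intro ar_nn_ex[of _ 1] ar_all[of _ 2] ar_imp ar_nn_less ar_isr ar_not ar_req ar_nearr dnn_nv
          definable_app[OF definable_const[OF w]] definable_const x(1) definable_var) simp_all
    show "\<exists>N. P 0 N" unfolding P_def using nn_nonneg not_less by blast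
  next
    fix k assume "\<exists>N. P k N"
    then obtain N where N: "P k N" by blast
    obtain N' where N': "val x \<noteq> val (w \<cdot> rp k) \<Longrightarrow> HP N' \<le> \<bar>val x - val (w \<cdot> rp k)\<bar>"
    proof (cases "val x = val (w \<cdot> rp k)")
      case False
      then have "0 < \<bar>val x - val (w \<cdot> rp k)\<bar>" by simp
      then obtain M where "HP M < \<bar>val x - val (w \<cdot> rp k)\<bar>" by (rule HP_archimedean)
      then show thesis by (intro that[of M]) simp
    qed blast
    have le: "HP (max N N') \<le> HP N" "HP (max N N') \<le> HP N'" by (simp_all add: HP_mono)
    have "P (k + 1) (max N N')"
      unfolding P
    proof (intro ballI impI)
      fix i assume i: "i \<in> elts T0" "nv i < k + 1" "isr (w \<cdot> i)" "val x \<noteq> val (w \<cdot> i)"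
      show "HP (max N N') \<le> \<bar>val x - val (w \<cdot> i)\<bar>"
      proof (cases "nv i = k")
        case True
        \<comment> \<open>Indices of equal value may still be different terms, so extensionality is
          needed to move from \<open>i\<close> to \<open>rp k\<close>.\<close>
        have "fn (w \<cdot> i) = fn (w \<cdot> rp k)"
          using nv_arg[OF w i(1)] True eqv_T1[OF elts_App[OF w i(1)] elts_App[OF w rp_elts]] by blast
        then have "val (w \<cdot> i) = val (w \<cdot> rp k)" by (rule val_cong)
        then show ?thesis using N' i(4) le by force
      next
        case False
        then have "nv i < k" using i(2) nn_less_suc by (metis order_le_less)
        then show ?thesis using N i le unfolding P by force
      qed
    qed
    then show "\<exists>N. P (k + 1) N" by blast
  qed
  then show ?thesis unfolding P .
qed

text \<open>A rational slightly to the right of \<open>x\<close> will do, or one to its left if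
  \<open>x\<close> is the right end.\<close>

lemma other_point:
  assumes "unit x" shows "\<exists>y\<in>elts T1. unit y \<and> val y \<noteq> val x \<and> \<bar>val x - val y\<bar> < HP N"
proof -
  note b = unit_bounds[OF assms]
  have "\<exists>c\<in>elts T0. unit (qc c) \<and> val (qc c) \<noteq> val x \<and> \<bar>val x - val (qc c)\<bar> < HP N"
  proof (cases "val x < 1")
    case True
    then have "val x < min 1 (val x + HP N)" by simp
    then obtain c where c: "c \<in> elts T0" "val x < val (qc c)" "val (qc c) < min 1 (val x + HP N)" by (rule rational_between)
    have "unit (qc c)" using c b by (intro unit_qc) auto
    then show ?thesis using c by (intro bexI[OF _ c(1)]) auto
  next
    case False
    then have "max 0 (val x - HP N) < val x" using HP_pos[of N] by simp
    then obtain c where c: "c \<in> elts T0" "max 0 (val x - HP N) < val (qc c)" "val (qc c) < val x" by (rule rational_between)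
    have "unit (qc c)" using c b by (intro unit_qc) auto
    then show ?thesis using c by (intro bexI[OF _ c(1)]) auto
  qed
  then show ?thesis using qc(1) by blast
qed

text \<open>A function vanishing off a finite set is the limit of the Lipschitz functions
  \<open>x \<mapsto> max\<^sub>i (g w\<^sub>i - 2\<^sup>m \<bar>x - w\<^sub>i\<bar>)\<close>, cut off at zero. The maximum of finitely many reals is
  obtained as a cut.\<close>

lemma finite_support_Baire1:
  assumes g: "g \<in> elts (T1 \<rightarrow> T1)" "funr g" and w: "w \<in> elts (T0 \<rightarrow> T1)" "\<And>i. i \<in> elts T0 \<Longrightarrow> nv i < K \<Longrightarrow> isr (w \<cdot> i)"
    and rational: "\<And>x. x \<in> elts T1 \<Longrightarrow> unit x \<Longrightarrow> val (g \<cdot> x) = const (rat (fn (g \<cdot> x) 0))"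
    and bounds: "\<And>x. x \<in> elts T1 \<Longrightarrow> unit x \<Longrightarrow> 0 \<le> rat (fn (g \<cdot> x) 0) \<and> rat (fn (g \<cdot> x) 0) \<le> 1"
    and zero: "\<And>x. x \<in> elts T1 \<Longrightarrow> unit x \<Longrightarrow> \<forall>i\<in>elts T0. nv i < K \<longrightarrow> val x \<noteq> val (w \<cdot> i) \<Longrightarrow> val (g \<cdot> x) = 0"
  shows "baire1r g"
proof -
  \<comment> \<open>By \<open>rational\<close> the first entry of the sequence is the exact value,
    which makes \<open>v\<close> arithmetical.\<close>
  define v where "v i = rat (fn (g \<cdot> (w \<cdot> i)) 0)" for i
  \<comment> \<open>The rationals above the function to be built at \<open>x\<close>:
    \<open>q\<close> is positive and exceeds each \<open>v i - 2^m * d\<close>, where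
    \<open>d\<close> is the distance from \<open>x\<close> to the point with index \<open>i\<close>.
    Multiplying by \<open>2^-m\<close> leaves a comparison of a rational with a distance, as in
    \<open>far_iff\<close>.\<close>
  define U where "U m x q \<longleftrightarrow> 0 < q \<and> (\<forall>i\<in>elts T0. nv i < K \<longrightarrow> unit (w \<cdot> i) \<longrightarrow>
    (\<exists>l. (v i - q) * hp m < \<bar>rat (fn x l) - rat (fn (w \<cdot> i) l)\<bar> - 2 * hp l))" for m x q
  have wel: "w \<cdot> i \<in> elts T1" if "i \<in> elts T0" for i using elts_App[OF w(1) that] .
  have v01: "0 \<le> v i" "v i \<le> 1" if "i \<in> elts T0" "unit (w \<cdot> i)" for i
    using bounds[OF wel[OF that(1)] that(2)] unfolding v_def by blast+
  have arU: "ar (\<lambda>e. U (nv (e (0, T0))) (e (1, T1)) (rat (nv (e (2, T0)))))"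
    unfolding U_def v_def by (intro ar_conj ar_less_abs_diff ar_qq_less ar_all[of _ 3] ar_imp ar_nn_less ar_unit ar_nn_ex[of _ 4] dqq_intros dnn_intros
        definable_app[OF definable_const[OF g(1)]] definable_app[OF definable_const[OF w(1)]]) simp_all
  have low: "\<not> U m x (- 1)" for m x unfolding U_def by simp
  have high: "U m x 2" for m x
    unfolding U_def
  proof (intro conjI ballI impI)
    fix i assume i: "i \<in> elts T0" "nv i < K" "unit (w \<cdot> i)"
    have "(v i - 2) * hp m \<le> (- 1) * hp m" using v01[OF i(1,3)] by (intro mult_right_mono) (simp_all add: less_imp_le)
    \<comment> \<open>At precision \<open>m + 2\<close> the error term \<open>2 * 2^-(m + 2)\<close>
      is half of \<open>2^-m\<close>, while the left side of the inequality is at most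
      \<open>- 2^-m\<close>.\<close>
    moreover have "hp (m + 1 + 1) = hp m / 4" by (simp add: hp_suc)
    ultimately have "(v i - 2) * hp m < - 2 * hp (m + 1 + 1)" using hp_pos[of m] by linarith
    then have "(v i - 2) * hp m < \<bar>rat (fn x (m + 1 + 1)) - rat (fn (w \<cdot> i) (m + 1 + 1))\<bar> - 2 * hp (m + 1 + 1)" by linarith
    then show "\<exists>l. (v i - 2) * hp m < \<bar>rat (fn x l) - rat (fn (w \<cdot> i) l)\<bar> - 2 * hp l" by blast
  qed simp
  have up: "U m x r" if "U m x q" "q \<le> r" for m x q r
  proof -
    have "(v i - r) * hp m \<le> (v i - q) * hp m" for i using that(2) by (intro mult_right_mono) (simp_all add: less_imp_le)
    then show ?thesis using that unfolding U_def by (meson le_less_trans less_le_trans)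
  qed
  obtain G where G: "G \<in> elts (T0 \<rightarrow> T1 \<rightarrow> T1)" "\<And>a x. a \<in> elts T0 \<Longrightarrow> x \<in> elts T1 \<Longrightarrow> isr (G \<cdot> a \<cdot> x)"
    "\<And>a x q. a \<in> elts T0 \<Longrightarrow> x \<in> elts T1 \<Longrightarrow> const q < val (G \<cdot> a \<cdot> x) \<Longrightarrow> \<not> U (nv a) x q"
    "\<And>a x q. a \<in> elts T0 \<Longrightarrow> x \<in> elts T1 \<Longrightarrow> val (G \<cdot> a \<cdot> x) < const q \<Longrightarrow> U (nv a) x q"
    by (rule cut_real[of U, OF arU]) (use low high up in blast)+
  have U: "U m x q \<longleftrightarrow> (0::rr) < const q \<and> (\<forall>i\<in>elts T0. nv i < K \<longrightarrow> unit (w \<cdot> i) \<longrightarrow>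
    (const (v i) - const q) * HP m < \<bar>val x - val (w \<cdot> i)\<bar>)" if "isr x" for m x q
  proof -
    have "(\<exists>l. (v i - q) * hp m < \<bar>rat (fn x l) - rat (fn (w \<cdot> i) l)\<bar> - 2 * hp l) \<longleftrightarrow>
      (const (v i) - const q) * HP m < \<bar>val x - val (w \<cdot> i)\<bar>" if "unit (w \<cdot> i)" for i
      unfolding far_iff[OF \<open>isr x\<close> unit_isr[OF that]] by (simp add: HP_def)
    moreover have "(const 0 :: rr) < const q \<longleftrightarrow> 0 < q" by (rule const_less)
    then have "0 < q \<longleftrightarrow> (0::rr) < const q" by simp
    ultimately show ?thesis unfolding U_def by (simp cong: imp_cong)
  qed
  \<comment> \<open>One direction of a Lipschitz bound with constant \<open>2^m\<close>, where
    \<open>m\<close> is the value of \<open>a\<close>. If it failed, a rational \<open>q\<close>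
    above the value at \<open>x\<close>, raised by \<open>?d\<close>, would leave room for some
    \<open>r\<close> below the value at \<open>y\<close>; but the triangle inequality puts
    \<open>r\<close> into the cut at \<open>y\<close>.\<close>
  have half: "\<not> \<bar>val x - val y\<bar> < (val (G \<cdot> a \<cdot> y) - val (G \<cdot> a \<cdot> x)) * HP (nv a)"
    if a: "a \<in> elts T0" and xy: "x \<in> elts T1" "y \<in> elts T1" "isr x" "isr y" for a x y
  proof
    let ?d = "\<bar>val x - val y\<bar> / HP (nv a)"
    assume "\<bar>val x - val y\<bar> < (val (G \<cdot> a \<cdot> y) - val (G \<cdot> a \<cdot> x)) * HP (nv a)"
    then have "?d < val (G \<cdot> a \<cdot> y) - val (G \<cdot> a \<cdot> x)" by (simp add: pos_divide_less_eq)
    then have "val (G \<cdot> a \<cdot> x) < val (G \<cdot> a \<cdot> y) - ?d" by linarith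
    then obtain q where q: "val (G \<cdot> a \<cdot> x) < const q" "const q < val (G \<cdot> a \<cdot> y) - ?d" using const_dense by blast
    then have "const q + ?d < val (G \<cdot> a \<cdot> y)" by linarith
    then obtain r where r: "const q + ?d < const r" "const r < val (G \<cdot> a \<cdot> y)" using const_dense by blast
    have Uq: "U (nv a) x q" using G(4)[OF a xy(1) q(1)] .
    have "HP (nv a) \<noteq> 0" using HP_pos[of "nv a"] by (metis less_irrefl)
    then have d: "?d * HP (nv a) = \<bar>val x - val y\<bar>" by simp
    have "0 \<le> ?d" by (simp add: less_imp_le)
    then have "(0::rr) < const r" using Uq r(1) unfolding U[OF xy(3)] by linarith
    moreover have "(const (v i) - const r) * HP (nv a) < \<bar>val y - val (w \<cdot> i)\<bar>" if i: "i \<in> elts T0" "nv i < K" "unit (w \<cdot> i)" for i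
    proof -
      have "(const (v i) - const r) * HP (nv a) \<le> (const (v i) - const q - ?d) * HP (nv a)"
        using r(1) by (intro mult_right_mono) (simp_all add: less_imp_le)
      also have "\<dots> = (const (v i) - const q) * HP (nv a) - ?d * HP (nv a)" by (simp only: left_diff_distrib)
      finally have "(const (v i) - const r) * HP (nv a) \<le> (const (v i) - const q) * HP (nv a) - \<bar>val x - val y\<bar>" unfolding d .
      moreover have "(const (v i) - const q) * HP (nv a) < \<bar>val x - val (w \<cdot> i)\<bar>" using Uq i unfolding U[OF xy(3)] by blast
      ultimately show ?thesis by linarith
    qed
    ultimately have "U (nv a) y r" unfolding U[OF xy(4)] by blast
    then show False using G(3)[OF a xy(2) r(2)] by blast
  qed
  have lipschitz: "\<bar>val (G \<cdot> a \<cdot> x) - val (G \<cdot> a \<cdot> y)\<bar> * HP (nv a) \<le> \<bar>val x - val y\<bar>"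
    if a: "a \<in> elts T0" and xy: "x \<in> elts T1" "y \<in> elts T1" "isr x" "isr y" for a x y
  proof (cases "val (G \<cdot> a \<cdot> x) \<le> val (G \<cdot> a \<cdot> y)")
    case True
    then have "\<bar>val (G \<cdot> a \<cdot> x) - val (G \<cdot> a \<cdot> y)\<bar> = val (G \<cdot> a \<cdot> y) - val (G \<cdot> a \<cdot> x)" by simp
    then show ?thesis using half[OF a xy] unfolding not_less by simp
  next
    case False
    then have "\<bar>val (G \<cdot> a \<cdot> x) - val (G \<cdot> a \<cdot> y)\<bar> = val (G \<cdot> a \<cdot> x) - val (G \<cdot> a \<cdot> y)" by simp
    then show ?thesis using half[OF a xy(2,1,4,3)] unfolding not_less abs_minus_commute[of "val y"] by simp
  qed
  have "funr (G \<cdot> a)" if a: "a \<in> elts T0" for a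
    unfolding funr_def
  proof (intro conjI ballI impI)
    fix x assume x: "x \<in> elts T1"
    show "isr (G \<cdot> a \<cdot> x)" using G(2)[OF a x] .
    fix y assume y: "y \<in> elts T1" and xy: "unit x \<and> unit y \<and> req x y"
    then have "val x = val y" "isr x" "isr y" using req_iff unit_isr by blast+
    then have "\<bar>val (G \<cdot> a \<cdot> x) - val (G \<cdot> a \<cdot> y)\<bar> * HP (nv a) \<le> 0" using lipschitz[OF a x y] by simp
    then have "val (G \<cdot> a \<cdot> x) = val (G \<cdot> a \<cdot> y)" using HP_pos[of "nv a"] by (simp add: mult_le_0_iff not_le)
    then show "req (G \<cdot> a \<cdot> x) (G \<cdot> a \<cdot> y)" using req_iff G(2)[OF a x] G(2)[OF a y] by blast
  qed
  moreover have "contr unit (G \<cdot> a) x" if a: "a \<in> elts T0" and x: "x \<in> elts T1" "isr x" for a x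
    unfolding contr_def
  proof (intro ballI)
    fix k
    have pos: "0 < HP (nv k) * HP (nv a)" by simp
    obtain N where N: "HP N < HP (nv k) * HP (nv a)" using HP_archimedean[OF pos] by blast
    have "nearr (nv k) (G \<cdot> a \<cdot> x) (G \<cdot> a \<cdot> y)" if y: "y \<in> elts T1" "isr y" "nearr N x y" for y
    proof -
      have "\<bar>val x - val y\<bar> < HP N" using nearr_iff[OF x(2) y(2)] y(3) by blast
      then have "\<bar>val (G \<cdot> a \<cdot> x) - val (G \<cdot> a \<cdot> y)\<bar> * HP (nv a) < HP (nv k) * HP (nv a)"
        using lipschitz[OF a x(1) y(1) x(2) y(2)] N by linarith
      then have "\<bar>val (G \<cdot> a \<cdot> x) - val (G \<cdot> a \<cdot> y)\<bar> < HP (nv k)" by (rule mult_right_less_imp_less[OF _ less_imp_le[OF HP_pos]])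
      then show ?thesis using nearr_iff G(2)[OF a x(1)] G(2)[OF a y(1)] by blast
    qed
    then show "\<exists>N\<in>elts T0. \<forall>y\<in>elts T1. isr y \<and> unit y \<and> nearr (nv N) x y \<longrightarrow> nearr (nv k) (G \<cdot> a \<cdot> x) (G \<cdot> a \<cdot> y)"
      by (intro bexI[of _ "rp N"]) simp_all
  qed
  moreover have "limr G g"
    unfolding limr_def
  proof (intro ballI impI)
    fix x k assume x: "x \<in> elts T1" "unit x"
    have ix: "isr x" using unit_isr[OF x(2)] .
    have vg: "const (v i) = val (g \<cdot> x)" if i: "i \<in> elts T0" "isr (w \<cdot> i)" "val x = val (w \<cdot> i)" for i
    proof -
      have u: "unit (w \<cdot> i)" using unit_cong[OF ix i(2,3)] x(2) by blast
      have "req x (w \<cdot> i)" using req_iff[OF ix i(2)] i(3) by blast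
      then have "req (g \<cdot> x) (g \<cdot> (w \<cdot> i))" "isr (g \<cdot> x)" "isr (g \<cdot> (w \<cdot> i))"
        using g(2) x u wel[OF i(1)] unfolding funr_def by blast+
      then have "val (g \<cdot> x) = val (g \<cdot> (w \<cdot> i))" using req_iff by blast
      then show ?thesis using rational[OF wel[OF i(1)] u] by (simp add: v_def)
    qed
    obtain N where N: "\<And>i. i \<in> elts T0 \<Longrightarrow> nv i < K \<Longrightarrow> val x \<noteq> val (w \<cdot> i) \<Longrightarrow> HP N \<le> \<bar>val x - val (w \<cdot> i)\<bar>"
      using finite_distance[OF w(1) x(1) ix, of K] w(2) by blast
    have "(const 0 :: rr) \<le> const (rat (fn (g \<cdot> x) 0))" unfolding const_le using bounds[OF x] by blast
    then have g0: "0 \<le> val (g \<cdot> x)" unfolding rational[OF x] const_simps .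
    \<comment> \<open>From index \<open>N\<close> on, the peaks at other points have dropped to zero
      or below at \<open>x\<close>: they are at most 1 high and at distance at least
      \<open>2^-N\<close>. So the sequence is eventually constant at each \<open>x\<close>.\<close>
    have "val (G \<cdot> a \<cdot> x) = val (g \<cdot> x)" if a: "a \<in> elts T0" "N \<le> nv a" for a
    proof (rule antisym)
      show "val (G \<cdot> a \<cdot> x) \<le> val (g \<cdot> x)"
      proof (rule ccontr)
        assume "\<not> ?thesis"
        then obtain q where q: "val (g \<cdot> x) < const q" "const q < val (G \<cdot> a \<cdot> x)" using const_dense not_le by blast
        have "(const (v i) - const q) * HP (nv a) < \<bar>val x - val (w \<cdot> i)\<bar>" if i: "i \<in> elts T0" "nv i < K" "unit (w \<cdot> i)" for i
        proof (cases "val x = val (w \<cdot> i)")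
          case True
          have "const (v i) - const q < (0::rr)" unfolding vg[OF i(1) w(2)[OF i(1,2)] True] using q(1) by simp
          then have "(const (v i) - const q) * HP (nv a) < 0" using HP_pos[of "nv a"] by (rule mult_neg_pos)
          then show ?thesis using abs_ge_zero[of "val x - val (w \<cdot> i)"] by linarith
        next
          case False
          have "const (v i) \<le> (const 1 :: rr)" using v01(2)[OF i(1,3)] by (simp only: const_le)
          then have "const (v i) \<le> (1::rr)" unfolding const_simps .
          then have "const (v i) - const q < (1::rr)" using q(1) g0 by linarith
          then have "(const (v i) - const q) * HP (nv a) < 1 * HP (nv a)" by (intro mult_strict_right_mono) simp_all
          moreover have "HP (nv a) \<le> HP N" using a(2) by (rule HP_mono)
          ultimately show ?thesis using N[OF i(1,2) False] by linarith
        qed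
        then have "U (nv a) x q" unfolding U[OF ix] using q(1) g0 by fastforce
        then show False using G(3)[OF a(1) x(1) q(2)] by blast
      qed
      show "val (g \<cdot> x) \<le> val (G \<cdot> a \<cdot> x)"
      proof (rule ccontr)
        assume "\<not> ?thesis"
        then obtain q where q: "val (G \<cdot> a \<cdot> x) < const q" "const q < val (g \<cdot> x)" using const_dense not_le by blast
        have Uq: "U (nv a) x q" using G(4)[OF a(1) x(1) q(1)] .
        then have "(0::rr) < const q" unfolding U[OF ix] by blast
        then have "val (g \<cdot> x) \<noteq> 0" using q(2) by force
        then obtain i where i: "i \<in> elts T0" "nv i < K" "val x = val (w \<cdot> i)" using zero[OF x] by blast
        have "unit (w \<cdot> i)" using unit_cong[OF ix w(2)[OF i(1,2)] i(3)] x(2) by blast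
        then have "(const (v i) - const q) * HP (nv a) < 0" using Uq i unfolding U[OF ix] by fastforce
        moreover have "0 < (const (v i) - const q) * HP (nv a)" unfolding vg[OF i(1) w(2)[OF i(1,2)] i(3)] using q(2) by simp
        ultimately show False by linarith
      qed
    qed
    then have "nearr (nv k) (G \<cdot> a \<cdot> x) (g \<cdot> x)" if "a \<in> elts T0" "N \<le> nv a" for a
    proof -
      have "isr (g \<cdot> x)" using g(2) x unfolding funr_def by blast
      then show ?thesis using nearr_iff[OF G(2)[OF that(1) x(1)]] \<open>\<And>a. a \<in> elts T0 \<Longrightarrow> N \<le> nv a \<Longrightarrow> _\<close> that by simp
    qed
    then show "\<exists>N\<in>elts T0. \<forall>n\<in>elts T0. L N n \<or> E N n \<longrightarrow> nearr (nv k) (G \<cdot> n \<cdot> x) (g \<cdot> x)"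
      by (intro bexI[of _ "rp N"]) (simp_all add: le_iff)
  qed
  ultimately show ?thesis unfolding baire1r_def using G(1) by blast
qed

end

section \<open>The function \<open>2^-h\<close> of a height \<open>h\<close>\<close>

locale with_height = the_model +
  fixes H assumes H: "H \<in> elts T2" and height: "height H"
begin

abbreviation h :: "tm \<Rightarrow> nn" where "h x \<equiv> nv (H \<cdot> x)"

lemma definable_H: "definable T1 F \<Longrightarrow> definable T0 (\<lambda>e. H \<cdot> F e)"
  by (rule definable_app[OF definable_const[OF H]])

lemma H_elts: "x \<in> elts T1 \<Longrightarrow> H \<cdot> x \<in> elts T0"
  by (rule elts_App[OF H])

lemma h_cong: "x \<in> elts T1 \<Longrightarrow> y \<in> elts T1 \<Longrightarrow> isr x \<Longrightarrow> isr y \<Longrightarrow> val x = val y \<Longrightarrow> h x = h y"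
  using height req_iff nv_eq H_elts unfolding height_def resp_def by blast

lemma low_points:
  obtains K w where "w \<in> elts (T0 \<rightarrow> T1)" "\<And>i. i \<in> elts T0 \<Longrightarrow> nv i < K \<Longrightarrow> isr (w \<cdot> i)"
    "\<And>x. x \<in> elts T1 \<Longrightarrow> unit x \<Longrightarrow> h x \<le> k \<Longrightarrow> \<exists>i\<in>elts T0. nv i < K \<and> val x = val (w \<cdot> i)"
proof -
  define R where "R n x \<longleftrightarrow> unit x \<and> L (H \<cdot> x) n" for n x
  have "ar (\<lambda>e. R (e (0, T0)) (e (1, T1)))"
    unfolding R_def by (intro ar_conj ar_unit ar_L definable_H definable_var)
  moreover have "R n y" if "n \<in> elts T0" "x \<in> elts T1" "y \<in> elts T1" "isr x" "isr y" "val x = val y" "R n x" for n x y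
    using that unit_cong h_cong nv_less H_elts unfolding R_def by metis
  ultimately obtain X where X: "X \<in> elts (T0 \<rightarrow> T2)" "\<And>n. n \<in> elts T0 \<Longrightarrow> setr (X \<cdot> n)"
    "\<And>n x. n \<in> elts T0 \<Longrightarrow> x \<in> elts T1 \<Longrightarrow> E (X \<cdot> n \<cdot> x) \<^bold>1 \<longleftrightarrow> R n x"
    by (rule comprehension[of R]) blast+
  \<comment> \<open>\<open>height\<close> speaks of a strict bound, so points with
    \<open>h x \<le> k\<close> are obtained from the bound \<open>k + 1\<close>.\<close>
  have "finr (\<lambda>x. unit x \<and> L (H \<cdot> x) (rp (k + 1)))" using height rp_elts unfolding height_def by blast
  then have "finr (\<lambda>x. E (X \<cdot> rp (k + 1) \<cdot> x) \<^bold>1)"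
    by (rule finr_mono) (use X(3)[OF rp_elts] R_def in blast)
  then obtain K w where Kw: "K \<in> elts T0" "w \<in> elts (T0 \<rightarrow> T1)" "\<forall>i\<in>elts T0. L i K \<longrightarrow> isr (w \<cdot> i)"
    "\<forall>x\<in>elts T1. isr x \<and> E (X \<cdot> rp (k + 1) \<cdot> x) \<^bold>1 \<longrightarrow> (\<exists>i\<in>elts T0. L i K \<and> req x (w \<cdot> i))"
    using FIN2r[OF elts_App[OF X(1) rp_elts] X(2)[OF rp_elts], of "k + 1"] by blast
  show thesis
  proof (rule that[OF Kw(2)])
    show isr: "isr (w \<cdot> i)" if "i \<in> elts T0" "nv i < nv K" for i
      using Kw(3) nv_less[OF that(1) Kw(1)] that by blast
    fix x assume x: "x \<in> elts T1" "unit x" "h x \<le> k"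
    then have "L (H \<cdot> x) (rp (k + 1))" using nv_less[OF H_elts rp_elts] nn_less_suc by simp
    then have "E (X \<cdot> rp (k + 1) \<cdot> x) \<^bold>1" using X(3)[OF rp_elts x(1)] x(2) R_def by blast
    then obtain i where i: "i \<in> elts T0" "L i K" "req x (w \<cdot> i)" using Kw(4) x(1) unit_isr[OF x(2)] by blast
    have "nv i < nv K" using nv_less[OF i(1) Kw(1)] i(2) by blast
    then show "\<exists>i\<in>elts T0. nv i < nv K \<and> val x = val (w \<cdot> i)"
      using req_iff[OF unit_isr[OF x(2)] isr[OF i(1)]] i by blast
  qed
qed

text \<open>A listed low point different from \<open>x\<close> keeps the distance given by
  \<open>finite_distance\<close>. \<open>x\<close> may lie outside the unit interval, which the
  closedness in \<open>Baire1_star\<close> needs.\<close>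

lemma isolated:
  assumes x: "x \<in> elts T1" "isr x"
  shows "\<exists>N. \<forall>y\<in>elts T1. unit y \<longrightarrow> \<bar>val x - val y\<bar> < HP N \<longrightarrow> val y \<noteq> val x \<longrightarrow> k < h y"
proof -
  obtain K w where Kw: "w \<in> elts (T0 \<rightarrow> T1)" "\<And>i. i \<in> elts T0 \<Longrightarrow> nv i < K \<Longrightarrow> isr (w \<cdot> i)"
    "\<And>x. x \<in> elts T1 \<Longrightarrow> unit x \<Longrightarrow> h x \<le> k \<Longrightarrow> \<exists>i\<in>elts T0. nv i < K \<and> val x = val (w \<cdot> i)"
    by (rule low_points[of k]) blast
  obtain N where N: "\<And>i. i \<in> elts T0 \<Longrightarrow> nv i < K \<Longrightarrow> val x \<noteq> val (w \<cdot> i) \<Longrightarrow> HP N \<le> \<bar>val x - val (w \<cdot> i)\<bar>"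
    using finite_distance[OF Kw(1) x, of K] Kw(2) by blast
  have "k < h y" if y: "y \<in> elts T1" "unit y" "\<bar>val x - val y\<bar> < HP N" "val y \<noteq> val x" for y
  proof (rule ccontr)
    assume "\<not> k < h y"
    then have "h y \<le> k" by simp
    then obtain i where i: "i \<in> elts T0" "nv i < K" "val y = val (w \<cdot> i)" using Kw(3)[OF y(1,2)] by blast
    then have "HP N \<le> \<bar>val x - val (w \<cdot> i)\<bar>" using N y(4) by metis
    then show False using i(3) y(3) by simp
  qed
  then show ?thesis by blast
qed

text \<open>Codes of the values \<open>s m\<close> are chosen first and composed with
  \<open>H\<close>; a constant sequence then turns each code into a real.\<close>

lemma coded_function:
  assumes "ar (\<lambda>e. rat (nv (e (1, T0))) = s (nv (e (0, T0))))"
  obtains f where "f \<in> elts (T1 \<rightarrow> T1)" "\<And>x. x \<in> elts T1 \<Longrightarrow> isr (f \<cdot> x) \<and> val (f \<cdot> x) = const (s (h x))"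
proof -
  have "\<exists>n. rat n = s m" for m using rat_surj by blast
  then obtain c where c: "c \<in> elts T1" "\<And>m. rat (fn c m) = s m"
    using choice_T1[of "\<lambda>m n. rat n = s m", OF assms] by blast
  have "definable T1 (\<lambda>e. qc (c \<cdot> (H \<cdot> e (0, T1))))"
    by (intro definable_qc definable_app[OF definable_const[OF c(1)]] definable_H definable_var)
  then obtain f where f: "f \<in> elts (T1 \<rightarrow> T1)" "\<And>x. x \<in> elts T1 \<Longrightarrow> eqv T1 (f \<cdot> x) (qc (c \<cdot> (H \<cdot> (e0((0, T1) := x)) (0, T1))))"
    by (rule lam1[of _ _ T1]) blast
  have "isr (f \<cdot> x) \<and> val (f \<cdot> x) = const (s (h x))" if x: "x \<in> elts T1" for x
  proof -
    have el: "c \<cdot> (H \<cdot> x) \<in> elts T0" using elts_T1[OF c(1) H_elts[OF x]] .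
    have "fn (f \<cdot> x) = fn (qc (c \<cdot> (H \<cdot> x)))" using f(2)[OF x] eqv_T1[OF elts_App[OF f(1) x] qc(1)[OF el]] by simp
    from val_cong[OF this] qc(3,4)[OF el] show ?thesis using nv_app[OF c(1) H_elts[OF x]] c(2) by simp
  qed
  with f(1) show thesis using that by blast
qed

end

text \<open>The sign of \<open>s\<close> is left open: \<open>hp\<close> gives the upper
  semi-continuous function, its negative the lower semi-continuous one.\<close>

locale height_function = with_height +
  fixes f s assumes f: "f \<in> elts (T1 \<rightarrow> T1)" "\<And>x. x \<in> elts T1 \<Longrightarrow> isr (f \<cdot> x)" "\<And>x. x \<in> elts T1 \<Longrightarrow> val (f \<cdot> x) = const (s (h x))"
    and s: "\<And>n. s n \<noteq> 0" "\<And>n. \<bar>s n\<bar> = hp n"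
begin

lemma near_zero:
  assumes x: "x \<in> elts T1" "isr x"
  obtains N where "\<And>y. y \<in> elts T1 \<Longrightarrow> unit y \<Longrightarrow> \<bar>val x - val y\<bar> < HP N \<Longrightarrow> val y \<noteq> val x \<Longrightarrow> \<bar>val (f \<cdot> y)\<bar> < HP k"
proof -
  obtain N where N: "\<forall>y\<in>elts T1. unit y \<longrightarrow> \<bar>val x - val y\<bar> < HP N \<longrightarrow> val y \<noteq> val x \<longrightarrow> k < h y"
    using isolated[OF x] by blast
  have "\<bar>val (f \<cdot> y)\<bar> = HP (h y)" if "y \<in> elts T1" for y
  proof -
    have "\<bar>val (f \<cdot> y)\<bar> = const \<bar>s (h y)\<bar>" using f(3)[OF that] by simp
    then show ?thesis unfolding s(2) HP_def .
  qed
  then show thesis using that[of N] N HP_less by simp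
qed

lemma funr_f: "funr f"
  unfolding funr_def
proof (intro conjI ballI impI)
  fix x assume x: "x \<in> elts T1" show "isr (f \<cdot> x)" using f(2)[OF x] .
  fix y assume y: "y \<in> elts T1" and xy: "unit x \<and> unit y \<and> req x y"
  then have "h x = h y" using h_cong[OF x y] unit_isr req_iff by blast
  then show "req (f \<cdot> x) (f \<cdot> y)" using req_iff f(2,3) x y by metis
qed

lemma regr_f: "regr f"
proof -
  have "leftr f x \<^bold>0\<^sub>R \<and> rightr f x \<^bold>0\<^sub>R" if x: "x \<in> elts T1" "unit x" for x
  proof -
    have ix: "isr x" using unit_isr[OF x(2)] .
    have "\<exists>N\<in>elts T0. \<forall>y\<in>elts T1. unit y \<and> (rlt y x \<or> rlt x y) \<and> nearr (nv N) x y \<longrightarrow> nearr (nv k) (f \<cdot> y) \<^bold>0\<^sub>R" for k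
    proof -
      obtain N where N: "\<And>y. y \<in> elts T1 \<Longrightarrow> unit y \<Longrightarrow> \<bar>val x - val y\<bar> < HP N \<Longrightarrow> val y \<noteq> val x \<Longrightarrow> \<bar>val (f \<cdot> y)\<bar> < HP (nv k)"
        by (rule near_zero[OF x(1) ix, of "nv k"]) blast
      have "nearr (nv k) (f \<cdot> y) \<^bold>0\<^sub>R" if y: "y \<in> elts T1" "unit y \<and> (rlt y x \<or> rlt x y) \<and> nearr N x y" for y
      proof -
        have iy: "isr y" using unit_isr y(2) by blast
        have "\<bar>val (f \<cdot> y)\<bar> < HP (nv k)"
          using N[OF y(1)] y(2) rlt_iff[OF ix iy] rlt_iff[OF iy ix] nearr_iff[OF ix iy] by auto
        then show ?thesis using nearr_iff[OF f(2)[OF y(1)] real_numerals(3)] by simp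
      qed
      then show ?thesis by (intro bexI[of _ "rp N"]) simp_all
    qed
    then show ?thesis unfolding leftr_def rightr_def by blast
  qed
  then show ?thesis unfolding regr_def using real_numerals(1,3) by blast
qed

lemma discontinuous:
  assumes x: "x \<in> elts T1" "unit x" shows "\<not> contr unit f x"
proof
  assume c: "contr unit f x"
  have ix: "isr x" using unit_isr[OF x(2)] .
  have "const (s (h x)) \<noteq> (0::rr)" using s(1) const_eq[of "s (h x)" 0] by simp
  \<comment> \<open>If \<open>f\<close> were continuous at \<open>x\<close>, some nearby
    \<open>y\<close> would have a value smaller than \<open>2^-k\<close> in size and yet within
    \<open>2^-k\<close> of the value at \<open>x\<close>; taking \<open>2^-k\<close> below half of
    the latter excludes this.\<close>
  then have "0 < \<bar>val (f \<cdot> x)\<bar> / 2" using f(3)[OF x(1)] by simp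
  then obtain k where k: "HP k < \<bar>val (f \<cdot> x)\<bar> / 2" by (rule HP_archimedean)
  obtain N where N: "\<And>y. y \<in> elts T1 \<Longrightarrow> unit y \<Longrightarrow> \<bar>val x - val y\<bar> < HP N \<Longrightarrow> val y \<noteq> val x \<Longrightarrow> \<bar>val (f \<cdot> y)\<bar> < HP k"
    by (rule near_zero[OF x(1) ix, of k]) blast
  obtain N' where N': "N' \<in> elts T0" "\<And>y. y \<in> elts T1 \<Longrightarrow> isr y \<and> unit y \<and> nearr (nv N') x y \<Longrightarrow> nearr (nv (rp k)) (f \<cdot> x) (f \<cdot> y)"
    using c rp_elts[of k] unfolding contr_def by blast
  obtain y where y: "y \<in> elts T1" "unit y" "val y \<noteq> val x" "\<bar>val x - val y\<bar> < HP (max N (nv N'))"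
    using other_point[OF x(2)] by blast
  have "HP (max N (nv N')) \<le> HP N" "HP (max N (nv N')) \<le> HP (nv N')" by (simp_all add: HP_mono)
  then have near: "\<bar>val x - val y\<bar> < HP N" "\<bar>val x - val y\<bar> < HP (nv N')" using y(4) by linarith+
  have iy: "isr y" using unit_isr[OF y(2)] .
  have "nearr k (f \<cdot> x) (f \<cdot> y)" using N'(2)[OF y(1)] iy y(2) near(2) nearr_iff[OF ix iy] by simp
  then have "\<bar>val (f \<cdot> x) - val (f \<cdot> y)\<bar> < HP k" using nearr_iff f(2) x(1) y(1) by blast
  moreover have "\<bar>val (f \<cdot> y)\<bar> < HP k" using N[OF y(1,2) near(1) y(3)] .
  ultimately show False using k by (simp add: field_simps)
qed

lemma refutes: "Q f \<Longrightarrow> \<not> principle Q"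
  unfolding principle_def using f(1) funr_f regr_f discontinuous by blast

text \<open>At every point \<open>f\<close> tends to 0, which lies below all its values.\<close>

lemma usc_if_pos: "(\<And>n. 0 < s n) \<Longrightarrow> uscr f"
  unfolding uscr_def
proof (intro ballI impI)
  fix x z assume pos: "\<And>n. 0 < s n" and x: "x \<in> elts T1" "unit x" and z: "z \<in> elts T1" "isr z \<and> rlt (f \<cdot> x) z"
  have ix: "isr x" using unit_isr[OF x(2)] .
  have "(0::rr) < const (s (h x))" unfolding const_simps(1)[symmetric] const_less by (rule pos)
  moreover have "const (s (h x)) < val z" using rlt_iff[OF f(2)[OF x(1)], of z] z(2) unfolding f(3)[OF x(1)] by blast
  ultimately have "0 < val z" by (rule less_trans)
  then obtain k where k: "HP k < val z" by (rule HP_archimedean)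
  obtain N where N: "\<And>y. y \<in> elts T1 \<Longrightarrow> unit y \<Longrightarrow> \<bar>val x - val y\<bar> < HP N \<Longrightarrow> val y \<noteq> val x \<Longrightarrow> \<bar>val (f \<cdot> y)\<bar> < HP k"
    by (rule near_zero[OF x(1) ix, of k]) blast
  have "rlt (f \<cdot> y) z" if y: "y \<in> elts T1" "unit y \<and> \<not> req y x \<and> nearr N x y" for y
  proof -
    have iy: "isr y" using unit_isr y(2) by blast
    have "\<bar>val (f \<cdot> y)\<bar> < HP k" using N[OF y(1)] y(2) req_iff[OF iy ix] nearr_iff[OF ix iy] by blast
    then show ?thesis using rlt_iff[OF f(2)[OF y(1)]] z(2) k by simp
  qed
  then show "\<exists>N\<in>elts T0. \<forall>y\<in>elts T1. unit y \<and> \<not> req y x \<and> nearr (nv N) x y \<longrightarrow> rlt (f \<cdot> y) z"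
    by (intro bexI[of _ "rp N"]) simp_all
qed

lemma lsc_if_neg: "(\<And>n. s n < 0) \<Longrightarrow> lscr f"
  unfolding lscr_def
proof (intro ballI impI)
  fix x z assume neg: "\<And>n. s n < 0" and x: "x \<in> elts T1" "unit x" and z: "z \<in> elts T1" "isr z \<and> rlt z (f \<cdot> x)"
  have ix: "isr x" using unit_isr[OF x(2)] .
  have "const (s (h x)) < (0::rr)" unfolding const_simps(1)[symmetric] const_less by (rule neg)
  moreover have "val z < const (s (h x))" using rlt_iff[OF _ f(2)[OF x(1)], of z] z(2) unfolding f(3)[OF x(1)] by blast
  ultimately have "0 < - val z" by linarith
  then obtain k where k: "HP k < - val z" by (rule HP_archimedean)
  obtain N where N: "\<And>y. y \<in> elts T1 \<Longrightarrow> unit y \<Longrightarrow> \<bar>val x - val y\<bar> < HP N \<Longrightarrow> val y \<noteq> val x \<Longrightarrow> \<bar>val (f \<cdot> y)\<bar> < HP k"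
    by (rule near_zero[OF x(1) ix, of k]) blast
  have "rlt z (f \<cdot> y)" if y: "y \<in> elts T1" "unit y \<and> \<not> req y x \<and> nearr N x y" for y
  proof -
    have iy: "isr y" using unit_isr y(2) by blast
    have "\<bar>val (f \<cdot> y)\<bar> < HP k" using N[OF y(1)] y(2) req_iff[OF iy ix] nearr_iff[OF ix iy] by blast
    then show ?thesis using rlt_iff[OF _ f(2)[OF y(1)]] z(2) k by simp
  qed
  then show "\<exists>N\<in>elts T0. \<forall>y\<in>elts T1. unit y \<and> \<not> req y x \<and> nearr (nv N) x y \<longrightarrow> rlt z (f \<cdot> y)"
    by (intro bexI[of _ "rp N"]) simp_all
qed

text \<open>By \<open>isolated\<close>, near any real the set given by \<open>h x \<le> n\<close>
  contains at most that real itself. This yields closedness at points outside the set, and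
  continuity of the restriction because \<open>x\<close> is its only nearby point.\<close>

lemma Baire1_star: "baire1starr f"
proof -
  define R where "R n x \<longleftrightarrow> unit x \<and> h x \<le> nv n" for n x
  have "ar (\<lambda>e. R (e (0, T0)) (e (1, T1)))"
    unfolding R_def by (intro ar_conj ar_unit ar_nn_le dnn_nv definable_H definable_var)
  moreover have R_cong: "R n y" if "x \<in> elts T1" "y \<in> elts T1" "isr x" "isr y" "val x = val y" "R n x" for n x y
    using that unit_cong h_cong unfolding R_def by metis
  ultimately obtain C where C: "C \<in> elts (T0 \<rightarrow> T2)" "\<And>n. n \<in> elts T0 \<Longrightarrow> setr (C \<cdot> n)"
    "\<And>n x. n \<in> elts T0 \<Longrightarrow> x \<in> elts T1 \<Longrightarrow> E (C \<cdot> n \<cdot> x) \<^bold>1 \<longleftrightarrow> R n x"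
    by (rule comprehension[of R]) blast+
  have closed: "\<exists>k\<in>elts T0. \<forall>y\<in>elts T1. isr y \<and> nearr (nv k) x y \<longrightarrow> \<not> R n y"
    if x: "x \<in> elts T1" "isr x" and no: "\<not> R n x" for n x
  proof -
    obtain N where N: "\<forall>y\<in>elts T1. unit y \<longrightarrow> \<bar>val x - val y\<bar> < HP N \<longrightarrow> val y \<noteq> val x \<longrightarrow> nv n < h y"
      using isolated[OF x] by blast
    have "\<not> R n y" if y: "y \<in> elts T1" "isr y \<and> nearr N x y" for y
    proof
      assume R: "R n y"
      have "val y \<noteq> val x" using R_cong[OF y(1) x(1)] y(2) x(2) R no by blast
      then have "nv n < h y" using N y R nearr_iff[OF x(2)] unfolding R_def by blast
      then show False using R not_le unfolding R_def by blast
    qed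
    then show ?thesis by (intro bexI[of _ "rp N"]) simp_all
  qed
  have cont: "contr (\<lambda>y. E (C \<cdot> n \<cdot> y) \<^bold>1) f x" if n: "n \<in> elts T0" and x: "x \<in> elts T1" "isr x" for n x
    unfolding contr_def
  proof (intro ballI)
    fix k
    obtain N where N: "\<forall>y\<in>elts T1. unit y \<longrightarrow> \<bar>val x - val y\<bar> < HP N \<longrightarrow> val y \<noteq> val x \<longrightarrow> nv n < h y"
      using isolated[OF x] by blast
    have "nearr (nv k) (f \<cdot> x) (f \<cdot> y)" if y: "y \<in> elts T1" "isr y \<and> E (C \<cdot> n \<cdot> y) \<^bold>1 \<and> nearr N x y" for y
    proof -
      have R: "unit y" "h y \<le> nv n" using C(3)[OF n y(1)] y(2) R_def by blast+
      have "\<bar>val x - val y\<bar> < HP N" using y(2) nearr_iff[OF x(2)] by blast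
      then have "val y = val x" using N y(1) R by fastforce
      then have "h x = h y" using h_cong x y by metis
      then show ?thesis using nearr_iff f(2,3) x(1) y(1) by simp
    qed
    then show "\<exists>N\<in>elts T0. \<forall>y\<in>elts T1. isr y \<and> E (C \<cdot> n \<cdot> y) \<^bold>1 \<and> nearr (nv N) x y \<longrightarrow> nearr (nv k) (f \<cdot> x) (f \<cdot> y)"
      by (intro bexI[of _ "rp N"]) simp_all
  qed
  have cover: "unit x \<longleftrightarrow> (\<exists>n\<in>elts T0. E (C \<cdot> n \<cdot> x) \<^bold>1)" if x: "x \<in> elts T1" for x
  proof -
    have "(\<exists>n\<in>elts T0. E (C \<cdot> n \<cdot> x) \<^bold>1) \<longleftrightarrow> (\<exists>n\<in>elts T0. R n x)" using C(3)[OF _ x] by blast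
    also have "\<dots> \<longleftrightarrow> unit x" unfolding R_def using H_elts[OF x] by blast
    finally show ?thesis by blast
  qed
  show ?thesis
    unfolding baire1starr_def
  proof (intro bexI[OF _ C(1)] conjI ballI impI)
    fix n assume n: "n \<in> elts T0"
    show "setr (C \<cdot> n)" using C(2)[OF n] .
    fix x assume x: "x \<in> elts T1"
    show "\<exists>k\<in>elts T0. \<forall>y\<in>elts T1. isr y \<and> nearr (nv k) x y \<longrightarrow> \<not> E (C \<cdot> n \<cdot> y) \<^bold>1" if "isr x \<and> \<not> E (C \<cdot> n \<cdot> x) \<^bold>1"
    proof -
      have "\<not> R n x" "isr x" using that C(3)[OF n x] by blast+
      then obtain k where "k \<in> elts T0" "\<forall>y\<in>elts T1. isr y \<and> nearr (nv k) x y \<longrightarrow> \<not> R n y" using closed[OF x] by blast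
      then show ?thesis using C(3)[OF n] by blast
    qed
    show "contr (\<lambda>y. E (C \<cdot> n \<cdot> y) \<^bold>1) f x" if "isr x \<and> E (C \<cdot> n \<cdot> x) \<^bold>1"
      using cont[OF n x] that by blast
  next
    fix x assume "x \<in> elts T1" "isr x"
    then show "unit x \<longleftrightarrow> (\<exists>n\<in>elts T0. E (C \<cdot> n \<cdot> x) \<^bold>1)" using cover by blast
  qed
qed

end

context with_height
begin

lemma Baire2:
  assumes f: "f \<in> elts (T1 \<rightarrow> T1)" "\<And>x. x \<in> elts T1 \<Longrightarrow> isr (f \<cdot> x)" "\<And>x. x \<in> elts T1 \<Longrightarrow> val (f \<cdot> x) = HP (h x)"
  shows "baire2r f"
proof -
  \<comment> \<open>\<open>a\<close> codes the value at \<open>x\<close> of the function cut off at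
    height \<open>k\<close>. The values become constant sequences of codes, as
    \<open>finite_support_Baire1\<close> reads them off from the first entry.\<close>
  define Q where "Q x k a \<longleftrightarrow> (h x \<le> k \<longrightarrow> rat a = hp (h x)) \<and> (\<not> h x \<le> k \<longrightarrow> rat a = 0)" for x k a
  have "ar (\<lambda>e. Q (e (1, T1)) (nv (e (0, T0))) (nv (e (2, T0))))"
    unfolding Q_def by (intro ar_conj ar_imp ar_not ar_nn_le ar_qq_eq dqq_intros dnn_nv definable_H definable_var)
  moreover have "\<exists>a. Q x k a" for x k
    unfolding Q_def using rat_surj[of "hp (h x)"] rat_surj[of 0] by (cases "h x \<le> k") auto
  ultimately obtain X where X: "dnn X" "\<And>e. env e \<Longrightarrow> Q (e (1, T1)) (nv (e (0, T0))) (X e)"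
    using nn_choice[of "\<lambda>e. Q (e (1, T1)) (nv (e (0, T0)))" 2] by auto
  obtain D where D: "definable T0 D" "\<And>e. env e \<Longrightarrow> X e = nv (D e)" using X(1) unfolding dnn_def by blast
  obtain F where F: "F \<in> elts (T0 \<rightarrow> T1 \<rightarrow> T1)"
    "\<And>a x. a \<in> elts T0 \<Longrightarrow> x \<in> elts T1 \<Longrightarrow> eqv T1 (F \<cdot> a \<cdot> x) (qc (D (e0((0, T0) := a, (1, T1) := x))))"
    by (rule lam2[OF definable_qc[OF D(1)], of T0 T1]) blast
  have Fel: "F \<cdot> a \<cdot> x \<in> elts T1" if "a \<in> elts T0" "x \<in> elts T1" for a x
    using elts_App[OF elts_App[OF F(1) that(1)] that(2)] .
  have code: "isr (F \<cdot> a \<cdot> x) \<and> val (F \<cdot> a \<cdot> x) = const (rat (fn (F \<cdot> a \<cdot> x) 0)) \<and> Q x (nv a) (fn (F \<cdot> a \<cdot> x) 0)"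
    if ax: "a \<in> elts T0" "x \<in> elts T1" for a x
  proof -
    let ?e = "e0((0, T0) := a, (1, T1) := x)"
    have e: "env ?e" using ax by simp
    have el: "D ?e \<in> elts T0" using definable_elts[OF D(1) e] .
    have fn: "fn (F \<cdot> a \<cdot> x) = fn (qc (D ?e))" using F(2)[OF ax] eqv_T1[OF Fel[OF ax] qc(1)[OF el]] by blast
    have "Q x (nv a) (nv (D ?e))" using X(2)[OF e] D(2)[OF e] by simp
    then show ?thesis using val_cong[OF fn] qc(2-4)[OF el] fn by simp
  qed
  have val: "val (F \<cdot> a \<cdot> x) = (if h x \<le> nv a then HP (h x) else 0)" if "a \<in> elts T0" "x \<in> elts T1" for a x
    using code[OF that] by (auto simp: Q_def HP_def)
  have isr: "isr (F \<cdot> a \<cdot> x)" if "a \<in> elts T0" "x \<in> elts T1" for a x using code[OF that] by blast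
  have funr_F: "funr (F \<cdot> a)" if a: "a \<in> elts T0" for a
    unfolding funr_def
  proof (intro conjI ballI impI)
    fix x assume x: "x \<in> elts T1"
    show "isr (F \<cdot> a \<cdot> x)" using isr[OF a x] .
    fix y assume y: "y \<in> elts T1" and xy: "unit x \<and> unit y \<and> req x y"
    then have "h x = h y" using h_cong[OF x y] unit_isr req_iff by blast
    then have "val (F \<cdot> a \<cdot> x) = val (F \<cdot> a \<cdot> y)" using val[OF a x] val[OF a y] by simp
    then show "req (F \<cdot> a \<cdot> x) (F \<cdot> a \<cdot> y)" using req_iff isr[OF a] x y by blast
  qed
  have "baire1r (F \<cdot> a)" if a: "a \<in> elts T0" for a
  proof -
    obtain K w where Kw: "w \<in> elts (T0 \<rightarrow> T1)" "\<And>i. i \<in> elts T0 \<Longrightarrow> nv i < K \<Longrightarrow> isr (w \<cdot> i)"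
      "\<And>x. x \<in> elts T1 \<Longrightarrow> unit x \<Longrightarrow> h x \<le> nv a \<Longrightarrow> \<exists>i\<in>elts T0. nv i < K \<and> val x = val (w \<cdot> i)"
      by (rule low_points[of "nv a"]) blast
    show ?thesis
    proof (rule finite_support_Baire1[OF elts_App[OF F(1) a] funr_F[OF a] Kw(1,2)])
      fix x assume x: "x \<in> elts T1" "unit x"
      show "val (F \<cdot> a \<cdot> x) = const (rat (fn (F \<cdot> a \<cdot> x) 0))" using code[OF a x(1)] by blast
      have "hp (h x) \<le> hp 0" by (rule hp_mono) simp
      then show "0 \<le> rat (fn (F \<cdot> a \<cdot> x) 0) \<and> rat (fn (F \<cdot> a \<cdot> x) 0) \<le> 1"
        using code[OF a x(1)] hp_pos[of "h x"] unfolding Q_def by (cases "h x \<le> nv a") (auto simp: less_imp_le)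
      show "val (F \<cdot> a \<cdot> x) = 0" if "\<forall>i\<in>elts T0. nv i < K \<longrightarrow> val x \<noteq> val (w \<cdot> i)"
        using that Kw(3)[OF x] val[OF a x(1)] by auto
    qed
  qed
  moreover have "limr F f"
    unfolding limr_def
  proof (intro ballI impI)
    fix x k assume x: "x \<in> elts T1"
    \<comment> \<open>The truncations agree with \<open>f\<close> at \<open>x\<close> from index
      \<open>h x\<close> on, so the term for the height of \<open>x\<close> is itself the required
      index.\<close>
    have "nearr (nv k) (F \<cdot> a \<cdot> x) (f \<cdot> x)" if "a \<in> elts T0" "L (H \<cdot> x) a \<or> E (H \<cdot> x) a" for a
    proof -
      have "h x \<le> nv a" using le_iff[OF H_elts[OF x] that(1)] that(2) by blast
      then show ?thesis using nearr_iff[OF isr[OF that(1) x] f(2)[OF x]] val[OF that(1) x] f(3)[OF x] by simp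
    qed
    then show "\<exists>N\<in>elts T0. \<forall>n\<in>elts T0. L N n \<or> E N n \<longrightarrow> nearr (nv k) (F \<cdot> n \<cdot> x) (f \<cdot> x)"
      using H_elts[OF x] by blast
  qed
  ultimately show ?thesis unfolding baire2r_def using F(1) funr_F by blast
qed

text \<open>The positive function refutes three of the principles, its negative the one for lower
  semi-continuity.\<close>

lemma principles_fail: "\<not> principle uscr" "\<not> principle lscr" "\<not> principle baire1starr" "\<not> principle baire2r"
proof -
  have "ar (\<lambda>e. rat (nv (e (1, T0))) = hp (nv (e (0, T0))))" by (intro ar_qq_eq dqq_intros dnn_nv definable_var)
  then obtain f where f: "f \<in> elts (T1 \<rightarrow> T1)" "\<And>x. x \<in> elts T1 \<Longrightarrow> isr (f \<cdot> x) \<and> val (f \<cdot> x) = const (hp (h x))"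
    by (rule coded_function) blast
  interpret f: height_function H f hp
    by unfold_locales (use f less_imp_neq[OF hp_pos] in \<open>auto simp: less_imp_le\<close>)
  show "\<not> principle uscr" by (rule f.refutes, rule f.usc_if_pos) simp
  show "\<not> principle baire1starr" by (rule f.refutes, rule f.Baire1_star)
  have "baire2r f" by (rule Baire2[OF f(1)]) (use f(2) in \<open>simp_all add: HP_def\<close>)
  then show "\<not> principle baire2r" by (rule f.refutes)
  have "ar (\<lambda>e. rat (nv (e (1, T0))) = - hp (nv (e (0, T0))))" by (intro ar_qq_eq dqq_intros dnn_nv definable_var)
  then obtain g where g: "g \<in> elts (T1 \<rightarrow> T1)" "\<And>x. x \<in> elts T1 \<Longrightarrow> isr (g \<cdot> x) \<and> val (g \<cdot> x) = const (- hp (h x))"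
    by (rule coded_function[of "\<lambda>n. - hp n"]) blast
  interpret g: height_function H g "\<lambda>n. - hp n"
    by unfold_locales (use g less_imp_neq[OF hp_pos] in \<open>auto simp: less_imp_le\<close>)
  show "\<not> principle lscr" by (rule g.refutes, rule g.lsc_if_neg) simp
qed

end

section \<open>The four equivalences\<close>

context the_model
begin

text \<open>Contrapositive: a counterexample of whatever kind is a regulated function without points
  of continuity, and so provides a height.\<close>

lemma principle_if_no_height:
  assumes "\<not> (\<exists>H\<in>elts T2. height H)" shows "principle R"
  unfolding principle_def
proof (intro ballI impI, rule ccontr)
  fix f assume "f \<in> elts (T1 \<rightarrow> T1)" "funr f \<and> regr f \<and> R f" "\<not> (\<exists>x\<in>elts T1. unit x \<and> contr unit f x)"
  then interpret nowhere_continuous f by unfold_locales blast+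
  show False using height_exists assms by blast
qed

lemma goals_hold:
  assumes e: "env e" and A: "A \<in> goals" shows "sat M e A"
proof -
  have NIN: "sat M e (NIN_alt 0) \<longleftrightarrow> principle R" if "R \<in> {baire2r, baire1starr, uscr, lscr}" for R
  \<comment> \<open>Either both sides fail because of a height, or both hold for want of
    one.\<close>
  proof (cases "\<exists>H\<in>elts T2. height H")
    case True
    then obtain H where "H \<in> elts T2" "height H" by blast
    then interpret with_height H by unfold_locales
    show ?thesis using True sat_NIN[OF e] principles_fail that by blast
  next
    case False
    then show ?thesis using sat_NIN[OF e] principle_if_no_height by blast
  qed
  have sat: "sat M e (cont_point_principle Baire2 0) \<longleftrightarrow> principle baire2r"
    "sat M e (cont_point_principle Baire1_star 0) \<longleftrightarrow> principle baire1starr"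
    "sat M e (cont_point_principle usc 0) \<longleftrightarrow> principle uscr"
    "sat M e (cont_point_principle lsc 0) \<longleftrightarrow> principle lscr"
    by (rule sat_principle[OF sat_Baire2 e] sat_principle[OF sat_Baire1_star e] sat_principle[OF sat_usc e] sat_principle[OF sat_lsc e];
        assumption)+
  show ?thesis
    using A NIN[of baire2r] NIN[of baire1starr] NIN[of uscr] NIN[of lscr] sat e unfolding goals_def
    by (elim imageE insertE emptyE) (simp_all add: sentence_def)
qed

end

theorem theorem3p8:
  shows "equivalent_over (ACA0\<omega> \<union> QF_AC T0 T1 \<union> FIN) NIN_alt (cont_point_principle Baire2) \<and>
    equivalent_over (ACA0\<omega> \<union> QF_AC T0 T1 \<union> FIN) NIN_alt (cont_point_principle Baire1_star) \<and>
    equivalent_over (ACA0\<omega> \<union> QF_AC T0 T1 \<union> FIN) NIN_alt (cont_point_principle usc) \<and>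
    equivalent_over (ACA0\<omega> \<union> QF_AC T0 T1 \<union> FIN) NIN_alt (cont_point_principle lsc)"
  unfolding equivalent_over_def
  by (intro conjI derivable_if_true the_model.goals_hold) auto

end
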